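(* Let $n>0$, $x>0$, $\delta\in\mathbb R$, scale the parameters by writing $x=\xi\sqrt n$, $\delta=\sigma\sqrt n$, and assume that $x/n$ and $\delta/n$ are bounded. Put $$y=\frac{x^2}{n+x^2}=\frac{\xi^2}{1+\xi^2},\qquad z=y\sigma^2,\qquad \phi(t)=zt+\ln t-\ln(t-1),$$ and consider $P_n(x;\delta)$ written in the form $$P_n(x;\delta)=\tfrac12\,\frac{\sqrt y\,e^{-\frac12n\phi(1/y)}}{2\pi i}\int_0^{(1+)}e^{\frac12n\phi(t)}\,\frac{dt}{(1-yt)\sqrt t},$$ where the contour starts at the origin, encircles $t=1$ anti-clockwise, cutting the positive real axis between $1$ and $1/y$, and returns to the origin (multivalued factors have their principal values, with $t-1$ positive for $t>1$). Let $t_0$ be the positive saddle point that follows from $$\phi'(t)=\frac{zt^2-zt-1}{t(t-1)}\quad\Longrightarrow\quad t_0=\frac{z+\sqrt{z(z+4)}}{2z},$$ and let the real number $\eta$ be defined by $$\phi(1/y)-\phi(t_0)=\eta^2,\qquad \operatorname{sign}(\eta)=\operatorname{sign}(1/y-t_0).$$ Then, as $n\to\infty$ and $z>0$, $$P_n(x;\delta)\sim\tfrac14\operatorname{erfc}\left(\eta\sqrt{n/2}\right)+\tfrac12\,\frac{e^{-\frac12n\eta^2}}{\sqrt{2\pi n}}\sum_{k=0}^\infty\frac{c_k}{n^k}.$$ With $\rho=1/y$ and $t_1=\dfrac{\sqrt2\,t_0(t_0-1)}{\sqrt{2t_0-1}}$, the first two coefficients are $$c_0=\sqrt{\frac{\rho}{t_0}}\,\frac{t_1}{\rho-t_0}-\frac1\eta,\qquad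 c_1=-\left(\sqrt{\frac{\rho}{t_0}}\,\frac{t_1^3\left(a_0+a_1t_0+a_2t_0^2+a_3t_0^3+a_4t_0^4+a_5t_0^5\right)}{24\,t_0^2(t_0-1)^2(2t_0-1)^2(\rho-t_0)^3}-\frac1{\eta^3}\right),$$ where $a_0=-\rho^2$, $a_1=2\rho(7+3\rho)$, $a_2=-3\rho^2-84\rho+11$, $a_3=186\rho-66$, $a_4=-216\rho+129$, $a_5=96\rho-72$ (the coefficients remain bounded as $\eta\to0$ and are taken by their limits there).
   Context: Notation. $\operatorname{erfc}(w)=\frac{2}{\sqrt\pi}\int_w^\infty e^{-t^2}dt$. $I_y(a,b)=\frac{1}{B(a,b)}\int_0^y t^{a-1}(1-t)^{b-1}dt$ is the normalized incomplete beta function, with $B(a,b)=\Gamma(a)\Gamma(b)/\Gamma(a+b)$. For $x\ge 0$, $\delta\in\mathbb R$, $n>0$ (not necessarily an integer), with $y=x^2/(n+x^2)$, define $$P_n(x;\delta)=\tfrac12 e^{-\frac12\delta^2}\sum_{j=0}^\infty \frac{(\frac12\delta^2)^j}{j!}\, I_y\left(j+\tfrac12,\tfrac12 n\right).$$ The saddle point satisfies $t_0>1$. *)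

theory Defs
  imports "HOL-Complex_Analysis.Complex_Analysis"
begin

definition erfc :: "real \<Rightarrow> real" where
  "erfc w = 2 / sqrt pi * integral {w..} (\<lambda>t. exp (- t\<^sup>2))"

definition incomplete_beta :: "real \<Rightarrow> real \<Rightarrow> real \<Rightarrow> real" where
  "incomplete_beta y a b =
     integral {0..y} (\<lambda>t. t powr (a - 1) * (1 - t) powr (b - 1)) / Beta a b"

definition nct_P :: "real \<Rightarrow> real \<Rightarrow> real \<Rightarrow> real" where
  "nct_P n x \<delta> = 1 / 2 * exp (- \<delta>\<^sup>2 / 2) *
     (\<Sum>j. (\<delta>\<^sup>2 / 2) ^ j / fact j * incomplete_beta (x\<^sup>2 / (n + x\<^sup>2)) (real j + 1 / 2) (n / 2))"

text \<open>The scaled variables are \<open>\<xi> = x / sqrt n\<close> and \<open>\<sigma> = \<delta> / sqrt n\<close>; then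
  \<open>x\<^sup>2 / (n + x\<^sup>2) = y_par \<xi>\<close>.\<close>

definition y_par :: "real \<Rightarrow> real" where
  "y_par \<xi> = \<xi>\<^sup>2 / (1 + \<xi>\<^sup>2)"

definition z_par :: "real \<Rightarrow> real \<Rightarrow> real" where
  "z_par \<xi> \<sigma> = y_par \<xi> * \<sigma>\<^sup>2"

text \<open>One definition serves both the real phase on \<open>t > 1\<close> and its complex continuation, where
  both logarithms are principal; the latter is holomorphic off the half-line \<open>t \<le> 1\<close>.\<close>

definition phase :: "real \<Rightarrow> 'a::{real_normed_field,ln} \<Rightarrow> 'a" where
  "phase z t = of_real z * t + ln t - ln (t - 1)"

definition saddle :: "real \<Rightarrow> real" where
  "saddle z = (z + sqrt (z * (z + 4))) / (2 * z)"

definition eta :: "real \<Rightarrow> real \<Rightarrow> real" where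
  "eta \<xi> \<sigma> = (let \<rho> = 1 / y_par \<xi>; z = z_par \<xi> \<sigma> in
     sgn (\<rho> - saddle z) * sqrt (phase z \<rho> - phase z (saddle z)))"

text \<open>A contour of type \<open>(1+)\<close> based at the origin. Between its end points it stays off the cut
  \<open>t \<le> 1\<close> of the principal values, and it can meet the real axis only in the open interval
  from \<open>1\<close> to \<open>\<rho>\<close>. Winding number 1 makes it leave the origin below the cut and return above.\<close>

definition loop_contour :: "real \<Rightarrow> (real \<Rightarrow> complex) \<Rightarrow> bool" where
  "loop_contour \<rho> \<gamma> \<longleftrightarrow>
     valid_path \<gamma> \<and> pathstart \<gamma> = 0 \<and> pathfinish \<gamma> = 0 \<and>
     (\<forall>s\<in>{0<..<1}. \<gamma> s \<notin> complex_of_real ` ({..1} \<union> {\<rho>..})) \<and>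
     winding_number \<gamma> 1 = 1"

text \<open>The explicit formulas for the first two coefficients, meaningful for \<open>eta \<xi> \<sigma> \<noteq> 0\<close>.\<close>

definition t1_coeff :: "real \<Rightarrow> real" where
  "t1_coeff t0 = sqrt 2 * t0 * (t0 - 1) / sqrt (2 * t0 - 1)"

definition c0_formula :: "real \<Rightarrow> real \<Rightarrow> real" where
  "c0_formula \<xi> \<sigma> = (let \<rho> = 1 / y_par \<xi>; t0 = saddle (z_par \<xi> \<sigma>); t1 = t1_coeff t0 in
     sqrt (\<rho> / t0) * (t1 / (\<rho> - t0)) - 1 / eta \<xi> \<sigma>)"

definition c1_formula :: "real \<Rightarrow> real \<Rightarrow> real" where
  "c1_formula \<xi> \<sigma> =
    (let \<rho> = 1 / y_par \<xi>; t0 = saddle (z_par \<xi> \<sigma>); t1 = t1_coeff t0;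
         a0 = - \<rho>\<^sup>2;
         a1 = 2 * \<rho> * (7 + 3 * \<rho>);
         a2 = - 3 * \<rho>\<^sup>2 - 84 * \<rho> + 11;
         a3 = 186 * \<rho> - 66;
         a4 = - 216 * \<rho> + 129;
         a5 = 96 * \<rho> - 72
     in - (sqrt (\<rho> / t0) *
            (t1 ^ 3 * (a0 + a1 * t0 + a2 * t0 ^ 2 + a3 * t0 ^ 3 + a4 * t0 ^ 4 + a5 * t0 ^ 5) /
             (24 * t0 ^ 2 * (t0 - 1) ^ 2 * (2 * t0 - 1) ^ 2 * (\<rho> - t0) ^ 3))
           - 1 / eta \<xi> \<sigma> ^ 3))"

end

theory Submission
  imports Defs "HOL-Probability.Distributions" "HOL-Real_Asymp.Real_Asymp"
begin

text \<open>The contour integral is evaluated on one convenient loop: a contour of the required type leaves the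
  origin in the lower and returns in the upper half plane, so the integral only depends on the boundary
  values of a primitive. Expanding the exponential and the geometric factor produces the beta series.

  For the expansion put \<open>\<rho> = 1/y\<close>, \<open>\<kappa> = 1 - 1/t\<^sub>0\<close> and \<open>u = (\<rho> - 1)/(t\<^sub>0 - 1)\<close>. Then \<open>z = (1 - \<kappa>)\<^sup>2/\<kappa>\<close>,
  \<open>\<rho>/t\<^sub>0 = 1 - \<kappa> + \<kappa> u\<close>, and \<open>\<eta>\<^sup>2\<close> is the function \<open>\<Psi>(u) = (1 - \<kappa>)(u - 1) - ln u + ln (1 - \<kappa> + \<kappa> u)\<close>.
  For fixed \<open>z\<close> the derivative of \<open>P\<^sub>n\<close> with respect to \<open>u\<close> is \<open>exp (- n \<Psi> / 2)\<close> times an algebraic function of \<open>u\<close>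
  that depends on \<open>n\<close> only through a factor and a ratio of two Kummer functions. The ratio satisfies a Riccati
  equation, which yields its expansion in powers of \<open>1/n\<close>. The coefficients \<open>c\<^sub>k\<close> are chosen so that the ansatz
  has the same derivative up to \<open>O(n\<^sup>-\<^sup>K)\<close>; both sides have the same limits for \<open>u \<rightarrow> 0\<close> and \<open>u \<rightarrow> \<infinity>\<close>, so
  integrating the error from either end gives the bound, and matching at \<open>u = 1\<close> fixes the factor.\<close>

section \<open>The incomplete beta function\<close>

text \<open>The contour plays no part in the asymptotics: no path is moved to a saddle point, and
  everything rests on a first order equation in \<open>u\<close>. What shapes the proof is
  uniformity. The error must be a fixed multiple of
  \<open>exp (- n * eta^2 / 2) / sqrt n / n ^ K\<close> for all \<open>u > 0\<close> and all
  \<kappa> in (0, \<kappa>1], where \<kappa>1 < 1 encodes the lower bound on z; no constant may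
  deteriorate as \<kappa> tends to 0 or as \<open>u\<close> tends to 0, 1 or infinity. Near
  \<open>u = 1\<close> each coefficient is a difference of two terms with poles there, so it is
  continued to a complex disc, where Cauchy's estimate and the maximum principle carry bounds
  inwards from a circle on which the poles are harmless. Away from 1 the coefficients are controlled
  by a class of rational functions that is closed under differentiation and bounded independently of
  \<kappa>. For large n the Riccati equation has two equilibrium branches; comparing power series
  coefficients shows which one is followed. The normalizing factor is never evaluated: its expansion
  is forced by regularity of the coefficients at \<open>u = 1\<close>.\<close>

definition ibeta_kernel :: "real \<Rightarrow> real \<Rightarrow> real \<Rightarrow> real" where
  "ibeta_kernel a b t = t powr (a - 1) * (1 - t) powr (b - 1)"

lemma incomplete_beta_kernel:
  "incomplete_beta y a b = integral {0..y} (ibeta_kernel a b) / Beta a b"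
  by (simp add: incomplete_beta_def ibeta_kernel_def[abs_def])

lemma Beta_pos_real:
  fixes a b :: real assumes "a > 0" "b > 0" shows "Beta a b > 0"
  using assms by (simp add: Beta_def Gamma_real_pos)

lemma ibeta_kernel_has_integral:
  assumes "a > 0" "b > 0" shows "(ibeta_kernel a b has_integral Beta a b) {0..1}"
  using has_integral_Beta_real[OF assms] by (simp add: ibeta_kernel_def[abs_def])

lemma ibeta_kernel_integrable:
  assumes "a > 0" "b > 0" "0 \<le> x" "y \<le> 1" shows "ibeta_kernel a b integrable_on {x..y}"
  by (rule integrable_on_subinterval[where S="{0..1}"])
     (use assms ibeta_kernel_has_integral in auto)

lemma ibeta_kernel_nonneg: "0 \<le> ibeta_kernel a b t"
  by (simp add: ibeta_kernel_def)

lemma incomplete_beta_0 [simp]: "incomplete_beta 0 a b = 0"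
  by (simp add: incomplete_beta_kernel)

lemma incomplete_beta_1:
  assumes "a > 0" "b > 0" shows "incomplete_beta 1 a b = 1"
  using integral_unique[OF ibeta_kernel_has_integral[OF assms]] Beta_pos_real[OF assms]
  by (simp add: incomplete_beta_kernel)

lemma incomplete_beta_nonneg:
  assumes "a > 0" "b > 0" "y \<le> 1" shows "0 \<le> incomplete_beta y a b"
  unfolding incomplete_beta_kernel
  by (intro divide_nonneg_pos integral_nonneg ibeta_kernel_integrable Beta_pos_real)
     (use assms ibeta_kernel_nonneg in auto)

lemma incomplete_beta_le_1:
  assumes "a > 0" "b > 0" "0 \<le> y" "y \<le> 1" shows "incomplete_beta y a b \<le> 1"
proof -
  have "integral {0..y} (ibeta_kernel a b) \<le> integral {0..1} (ibeta_kernel a b)"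
    by (rule integral_subset_le) (use assms ibeta_kernel_integrable ibeta_kernel_nonneg in auto)
  also have "\<dots> = Beta a b" using integral_unique[OF ibeta_kernel_has_integral[OF assms(1,2)]] .
  finally show ?thesis using Beta_pos_real[OF assms(1,2)] by (simp add: incomplete_beta_kernel)
qed

lemma continuous_on_incomplete_beta:
  assumes "a > 0" "b > 0" shows "continuous_on {0..1} (\<lambda>y. incomplete_beta y a b)"
  unfolding incomplete_beta_kernel
  by (intro continuous_on_divide indefinite_integral_continuous_1 ibeta_kernel_integrable continuous_on_const)
     (use assms Beta_pos_real[of a b] in auto)

lemma incomplete_beta_has_derivative:
  assumes "a > 0" "b > 0" "0 < y" "y < 1"
  shows "((\<lambda>y. incomplete_beta y a b) has_real_derivative y powr (a - 1) * (1 - y) powr (b - 1) / Beta a b) (at y)"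
proof -
  have "continuous (at y within {0..1}) (ibeta_kernel a b)"
    unfolding ibeta_kernel_def[abs_def] by (intro continuous_intros) (use assms in auto)
  then have "((\<lambda>u. integral {0..u} (ibeta_kernel a b)) has_vector_derivative ibeta_kernel a b y) (at y within {0..1})"
    by (intro integral_has_vector_derivative_continuous_at[where S="{}", simplified])
       (use assms ibeta_kernel_integrable in auto)
  then have "((\<lambda>u. integral {0..u} (ibeta_kernel a b)) has_real_derivative ibeta_kernel a b y) (at y)"
    using assms by (simp add: has_real_derivative_iff_has_vector_derivative at_within_Icc_at)
  then show ?thesis
    unfolding incomplete_beta_kernel using Beta_pos_real[of a b] assms
    by (auto intro!: derivative_eq_intros simp: ibeta_kernel_def)
qed

lemma Beta_plus1_real:
  fixes a b :: real assumes "a > 0" "b > 0"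
  shows "Beta (a + 1) b = a / (a + b) * Beta a b"
proof -
  have "a \<notin> \<int>\<^sub>\<le>\<^sub>0" using assms by (auto elim!: nonpos_Ints_cases)
  from Beta_plus1_left[OF this, of b] show ?thesis using assms by (simp add: field_simps)
qed

text \<open>Integrates the derivative of \<open>t powr a * (1 - t) powr b\<close>, which is
  \<open>a\<close> times the kernel for \<open>(a, b)\<close> minus \<open>a + b\<close> times the
  kernel for \<open>(a + 1, b)\<close>. The ratio \<open>a / (a + b)\<close> of the two beta values
  normalizes both integrals at once.\<close>

lemma incomplete_beta_plus1:
  assumes "a > 0" "b > 0" "0 \<le> y" "y \<le> 1"
  shows "incomplete_beta (y) (a + 1) b = incomplete_beta y a b - y powr a * (1 - y) powr b / (a * Beta a b)"
proof -
  have "((\<lambda>t. a * ibeta_kernel a b t - (a + b) * ibeta_kernel (a+1) b t) has_integral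
      (y powr a * (1 - y) powr b - 0 powr a * (1 - 0) powr b)) {0..y}"
  proof (rule fundamental_theorem_of_calculus_interior)
    show "continuous_on {0..y} (\<lambda>t. t powr a * (1 - t) powr b)"
      by (intro continuous_intros continuous_on_powr') (use assms in auto)
    fix t assume t: "t \<in> {0<..<y}"
    then have "t > 0" "t < 1" using assms by auto
    have e: "t powr a = t * t powr (a - 1)" "(1-t) powr b = (1 - t) * (1-t) powr (b-1)"
      using \<open>t>0\<close> \<open>t<1\<close> by (simp_all add: powr_mult_base)
    show "((\<lambda>t. t powr a * (1 - t) powr b) has_vector_derivative
       a * ibeta_kernel a b t - (a + b) * ibeta_kernel (a+1) b t) (at t)"
      unfolding has_real_derivative_iff_has_vector_derivative[symmetric]
    proof (rule DERIV_cong)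
      show "((\<lambda>t. t powr a * (1 - t) powr b) has_real_derivative
          a * t powr (a - 1) * (1 - t) powr b + (b * (1 - t) powr (b - 1) * (- 1)) * t powr a) (at t)"
        by (intro DERIV_mult has_real_derivative_powr DERIV_chain2[where f="\<lambda>x. x powr b"])
           (use \<open>t>0\<close> \<open>t<1\<close> in \<open>auto intro!: derivative_eq_intros\<close>)
      show "a * t powr (a - 1) * (1 - t) powr b + (b * (1 - t) powr (b - 1) * (- 1)) * t powr a
          = a * ibeta_kernel a b t - (a + b) * ibeta_kernel (a+1) b t"
        unfolding ibeta_kernel_def by (simp only: add_diff_cancel_right' e) algebra
    qed
  qed (use assms in auto)
  then have "y powr a * (1 - y) powr b = integral {0..y} (\<lambda>t. a * ibeta_kernel a b t - (a + b) * ibeta_kernel (a+1) b t)"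
    using assms by (simp add: integral_unique)
  also have "\<dots> = a * integral {0..y} (ibeta_kernel a b) - (a + b) * integral {0..y} (ibeta_kernel (a+1) b)"
    using assms by (subst integral_diff) (auto intro!: integrable_on_cmult_left ibeta_kernel_integrable)
  finally show ?thesis
    unfolding incomplete_beta_kernel Beta_plus1_real[OF assms(1,2)]
    using assms Beta_pos_real[OF assms(1,2)] by (simp add: field_simps)
qed

section \<open>Telescoping over half-integer parameters\<close>

text \<open>The drop of the incomplete beta function when its first parameter moves from
  \<open>k + 1/2\<close> to \<open>k + 3/2\<close>.\<close>

definition ibeta_term :: "real \<Rightarrow> real \<Rightarrow> nat \<Rightarrow> real" where
  "ibeta_term y b k = y powr (real k + 1/2) * (1 - y) powr b / ((real k + 1/2) * Beta (real k + 1/2) b)"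

lemma ibeta_term_nonneg: "b > 0 \<Longrightarrow> 0 \<le> ibeta_term y b k"
  using Beta_pos_real[of "real k + 1/2" b] by (simp add: ibeta_term_def)

lemma incomplete_beta_half_plus:
  assumes "b > 0" "0 \<le> y" "y \<le> 1"
  shows "incomplete_beta y (real (j + k) + 1/2) b
     = incomplete_beta y (real j + 1/2) b - (\<Sum>i<k. ibeta_term y b (j + i))"
proof (induction k)
  case (Suc k)
  have "incomplete_beta y (real (j + k) + 1/2 + 1) b
     = incomplete_beta y (real (j + k) + 1/2) b - ibeta_term y b (j + k)"
    using incomplete_beta_plus1[of "real (j + k) + 1/2" b y] assms by (simp add: ibeta_term_def)
  then show ?case using Suc by (simp add: add_ac)
qed simp

lemma incomplete_beta_half_antimono:
  assumes "b > 0" "0 \<le> y" "y \<le> 1" "j \<le> k"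
  shows "incomplete_beta y (real k + 1/2) b \<le> incomplete_beta y (real j + 1/2) b"
  using incomplete_beta_half_plus[OF assms(1-3), of j "k - j"] assms(4)
    sum_nonneg[of "{..<k - j}" "\<lambda>i. ibeta_term y b (j + i)"] ibeta_term_nonneg[OF assms(1)]
  by simp

text \<open>The numerator carries a factor at most \<open>y ^ k\<close>, since
  \<open>t \<le> y\<close> there, whereas the normalizing beta value keeps a multiple of
  \<open>w ^ k\<close> from the part of the unit interval beyond a point \<open>w > y\<close>. The
  quotient therefore decays geometrically.\<close>

lemma incomplete_beta_half_tendsto_0:
  assumes "b > 0" "0 \<le> y" "y < 1"
  shows "(\<lambda>k. incomplete_beta y (real k + 1/2) b) \<longlonglongrightarrow> 0"
proof -
  define w where "w = (1 + y) / 2"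
  have w: "0 < w" "w < 1" "y < w" using assms by (auto simp: w_def)
  define c where "c = integral {w..1} (ibeta_kernel (1/2) b)"
  have kern: "ibeta_kernel (real k + 1/2) b t = t ^ k * ibeta_kernel (1/2) b t" if "t \<ge> 0" for t k
  proof (cases "t = 0")
    case False
    have "t powr (real k + 1/2 - 1) = t powr (real k + (1/2 - 1))" by (simp add: algebra_simps)
    also have "\<dots> = t ^ k * t powr (1/2 - 1)" using that False by (subst powr_add) (simp add: powr_realpow)
    finally show ?thesis by (simp add: ibeta_kernel_def)
  qed (simp add: ibeta_kernel_def)
  have "c > 0"
  proof -
    \<comment> \<open>The kernel may be singular at 1, so positivity of its integral is read off a
      minorant with an elementary primitive.\<close>
    have "0 < integral {w..1} (\<lambda>t. (1 - t) powr b)"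
    proof -
      have deriv: "((\<lambda>t. - ((1 - t) powr (b + 1)) / (b + 1)) has_vector_derivative (1 - t) powr b) (at t)" if "t < 1" for t
      proof -
        have "((\<lambda>t. 1 - t) has_real_derivative - 1) (at t)" by (auto intro!: derivative_eq_intros)
        then have "((\<lambda>t. (1 - t) powr (b + 1)) has_real_derivative ((b + 1) * (1 - t) powr (b + 1 - 1)) * (- 1)) (at t)"
          using that by (intro DERIV_chain2[OF has_real_derivative_powr]) auto
        from DERIV_cdivide[OF DERIV_minus[OF this], of "b + 1"]
        have "((\<lambda>t. - ((1 - t) powr (b + 1)) / (b + 1)) has_real_derivative (1 - t) powr b) (at t)"
          by (rule DERIV_cong) (use assms in simp)
        then show ?thesis by (simp only: has_real_derivative_iff_has_vector_derivative)
      qed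
      have "((\<lambda>t. (1 - t) powr b) has_integral (- ((1 - 1) powr (b+1)) / (b+1) - (- ((1 - w) powr (b+1)) / (b+1)))) {w..1}"
        apply (rule fundamental_theorem_of_calculus_interior)
        subgoal using w by simp
        subgoal using assms
          by (intro continuous_on_divide continuous_on_minus continuous_on_powr' continuous_on_diff
              continuous_on_const continuous_on_id ballI) auto
        subgoal for t using deriv[of t] by simp
        done
      note integral_unique[OF this]
      also have "- ((1 - 1) powr (b+1)) / (b+1) - (- ((1 - w) powr (b+1)) / (b+1)) = (1 - w) powr (b+1) / (b+1)"
        by simp
      finally have "integral {w..1} (\<lambda>t. (1 - t) powr b) = (1 - w) powr (b+1) / (b+1)" .
      then show ?thesis using w assms by simp
    qed
    also have "\<dots> \<le> c" unfolding c_def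
    proof (rule integral_le)
      show "(\<lambda>t. (1 - t) powr b) integrable_on {w..1}"
        by (intro integrable_continuous_interval continuous_intros continuous_on_powr') (use assms in auto)
      show "ibeta_kernel (1/2) b integrable_on {w..1}" using assms w ibeta_kernel_integrable by auto
      fix t assume t: "t \<in> {w..1}"
      have "t powr (1/2) \<le> 1 powr (1/2)" using t w by (intro powr_mono2) auto
      then have "1 \<le> t powr (1/2 - 1)" using t w by (simp add: powr_minus divide_simps)
      moreover have "(1 - t) powr b \<le> (1 - t) powr (b - 1)"
        using t w by (intro powr_mono') auto
      ultimately show "(1 - t) powr b \<le> ibeta_kernel (1/2) b t"
        using mult_mono[of 1 "t powr (1/2 - 1)" "(1 - t) powr b" "(1 - t) powr (b - 1)"]
        unfolding ibeta_kernel_def by simp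
    qed
    finally show ?thesis .
  qed
  have bound: "incomplete_beta y (real k + 1/2) b \<le> (y / w) ^ k * (Beta (1/2) b / c)" for k
  proof -
    have "integral {0..y} (ibeta_kernel (real k + 1/2) b) \<le> integral {0..y} (\<lambda>t. y ^ k * ibeta_kernel (1/2) b t)"
    proof (rule integral_le)
      show "ibeta_kernel (real k + 1/2) b t \<le> y ^ k * ibeta_kernel (1/2) b t" if "t \<in> {0..y}" for t
        using that by (simp add: kern mult_right_mono power_mono ibeta_kernel_nonneg)
    qed (use assms in \<open>auto intro!: integrable_on_mult_right ibeta_kernel_integrable\<close>)
    also have "\<dots> = y ^ k * integral {0..y} (ibeta_kernel (1/2) b)" by simp
    also have "\<dots> \<le> y ^ k * Beta (1/2) b"
      using incomplete_beta_le_1[of "1/2" b y] Beta_pos_real[of "1/2" b] assms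
      by (intro mult_left_mono) (auto simp: incomplete_beta_kernel)
    finally have 1: "integral {0..y} (ibeta_kernel (real k + 1/2) b) \<le> y ^ k * Beta (1/2) b" .
    have "w ^ k * c = integral {w..1} (\<lambda>t. w ^ k * ibeta_kernel (1/2) b t)" by (simp add: c_def)
    also have "\<dots> \<le> integral {w..1} (ibeta_kernel (real k + 1/2) b)"
    proof (rule integral_le)
      show "w ^ k * ibeta_kernel (1/2) b t \<le> ibeta_kernel (real k + 1/2) b t" if "t \<in> {w..1}" for t
        using that w by (simp add: kern mult_right_mono power_mono ibeta_kernel_nonneg)
    qed (use assms w in \<open>auto intro!: integrable_on_mult_right ibeta_kernel_integrable\<close>)
    also have "\<dots> \<le> integral {0..1} (ibeta_kernel (real k + 1/2) b)"
      by (rule integral_subset_le) (use assms w ibeta_kernel_integrable ibeta_kernel_nonneg in auto)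
    also have "\<dots> = Beta (real k + 1/2) b"
      by (rule integral_unique, rule ibeta_kernel_has_integral) (use assms in auto)
    finally have 2: "w ^ k * c \<le> Beta (real k + 1/2) b" .
    have "incomplete_beta y (real k + 1/2) b \<le> (y ^ k * Beta (1/2) b) / (w ^ k * c)"
      unfolding incomplete_beta_kernel
      by (rule frac_le[OF _ 1 _ 2]) (use assms w \<open>c > 0\<close> Beta_pos_real[of "1/2" b] in auto)
    then show ?thesis by (simp add: power_divide)
  qed
  have "(\<lambda>k. (y / w) ^ k * (Beta (1/2) b / c)) \<longlonglongrightarrow> 0 * (Beta (1/2) b / c)"
    by (intro tendsto_mult LIMSEQ_power_zero tendsto_const) (use assms w in auto)
  then have lim: "(\<lambda>k. (y / w) ^ k * (Beta (1/2) b / c)) \<longlonglongrightarrow> 0" by simp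
  show ?thesis
    by (rule tendsto_sandwich[OF _ _ tendsto_const lim])
       (use assms bound incomplete_beta_nonneg in \<open>auto intro!: always_eventually\<close>)
qed

lemma ibeta_term_sums:
  assumes "b > 0" "0 \<le> y" "y < 1"
  shows "(\<lambda>i. ibeta_term y b i) sums incomplete_beta y (1/2) b"
proof -
  have "(\<Sum>i<k. ibeta_term y b i) = incomplete_beta y (1/2) b - incomplete_beta y (real k + 1/2) b" for k
    using incomplete_beta_half_plus[of b y 0 k] assms by simp
  moreover have "(\<lambda>k. incomplete_beta y (1/2) b - incomplete_beta y (real k + 1/2) b) \<longlonglongrightarrow> incomplete_beta y (1/2) b - 0"
    by (intro tendsto_intros incomplete_beta_half_tendsto_0 assms)
  ultimately show ?thesis by (simp add: sums_def)
qed

section \<open>The Poisson mixture as a rearranged double series\<close>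

definition poisson_ibeta :: "real \<Rightarrow> real \<Rightarrow> real \<Rightarrow> real" where
  "poisson_ibeta b \<mu> y = (\<Sum>j. \<mu> ^ j / fact j * incomplete_beta y (real j + 1/2) b)"

lemma nct_P_poisson_ibeta:
  "nct_P n x \<delta> = 1/2 * exp (- \<delta>\<^sup>2/2) * poisson_ibeta (n/2) (\<delta>\<^sup>2/2) (x\<^sup>2/(n + x\<^sup>2))"
  by (simp add: nct_P_def poisson_ibeta_def)

lemma poisson_ibeta_summable:
  assumes "b > 0" "0 \<le> y" "y \<le> 1"
  shows "summable (\<lambda>j. \<mu> ^ j / fact j * incomplete_beta y (real j + 1/2) b)"
proof (rule summable_comparison_test[OF _ summable_exp[of "\<bar>\<mu>\<bar>"]], intro exI allI impI)
  fix j :: nat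
  have "\<bar>incomplete_beta y (real j + 1/2) b\<bar> \<le> 1"
    using incomplete_beta_le_1[of "real j + 1/2" b y] incomplete_beta_nonneg[of "real j + 1/2" b y] assms by auto
  then have "\<bar>\<mu>\<bar> ^ j / fact j * \<bar>incomplete_beta y (real j + 1/2) b\<bar> \<le> \<bar>\<mu>\<bar> ^ j / fact j * 1"
    by (intro mult_left_mono) auto
  then show "norm (\<mu> ^ j / fact j * incomplete_beta y (real j + 1/2) b) \<le> inverse (fact j) * \<bar>\<mu>\<bar> ^ j"
    by (simp add: abs_mult power_abs field_simps)
qed

text \<open>Summation by parts: each beta value is the tail sum of its drops, so the exponential
  weights accumulate into partial sums of the exponential series. These partial sums are what the
  contour integral produces as Taylor coefficients.\<close>

lemma poisson_ibeta_sums_ibeta_term: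
  assumes "b > 0" "0 \<le> y" "y < 1"
  shows "(\<lambda>i. ibeta_term y b i * (\<Sum>j\<le>i. \<mu> ^ j / fact j)) sums poisson_ibeta b \<mu> y"
proof -
  let ?I = "\<lambda>j. incomplete_beta y (real j + 1/2) b"
  let ?e = "\<lambda>j. \<mu> ^ j / fact j"
  have part: "(\<Sum>i<N. ibeta_term y b i * (\<Sum>j\<le>i. ?e j)) = (\<Sum>j<N. ?e j * ?I j) - ?I N * (\<Sum>j<N. ?e j)" for N
  proof (induction N)
    case (Suc N)
    have t: "ibeta_term y b N = ?I N - ?I (Suc N)"
      using incomplete_beta_half_plus[of b y N 1] assms by simp
    have "(\<Sum>i<Suc N. ibeta_term y b i * (\<Sum>j\<le>i. ?e j))
        = (\<Sum>i<N. ibeta_term y b i * (\<Sum>j\<le>i. ?e j)) + ibeta_term y b N * ((\<Sum>j<N. ?e j) + ?e N)"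
      by (simp add: lessThan_Suc_atMost[symmetric])
    also have "\<dots> = (\<Sum>j<Suc N. ?e j * ?I j) - ?I (Suc N) * (\<Sum>j<Suc N. ?e j)"
      by (simp only: Suc.IH t sum.lessThan_Suc) (simp only: algebra_simps)
    finally show ?case .
  qed simp
  have s: "summable ?e" using summable_exp[of \<mu>] by (simp add: field_simps)
  \<comment> \<open>The boundary term disappears because the beta value tends to 0 while the partial
    exponential sums converge.\<close>
  have "(\<lambda>N. (\<Sum>j<N. ?e j * ?I j) - ?I N * (\<Sum>j<N. ?e j)) \<longlonglongrightarrow> poisson_ibeta b \<mu> y - 0 * suminf ?e"
    unfolding poisson_ibeta_def
    by (intro tendsto_intros summable_LIMSEQ poisson_ibeta_summable s incomplete_beta_half_tendsto_0)
       (use assms in auto)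
  then show ?thesis by (simp add: sums_def part)
qed

section \<open>Contour integrals over loops based at the origin\<close>

text \<open>The plane cut along the real points outside \<open>J\<close>. The choice of
  \<open>J\<close> records where a loop may cross the real axis, and hence which logarithms are
  single valued along it.\<close>

definition slit :: "real set \<Rightarrow> complex set" where
  "slit J = {t. Im t = 0 \<longrightarrow> Re t \<in> J}"

lemma open_slit: assumes "open J" shows "open (slit J)"
proof -
  have "slit J = {t. Im t \<noteq> 0} \<union> (Re -` J)" by (auto simp: slit_def)
  moreover have "open {t. Im t \<noteq> 0}"
    by (intro open_Collect_neq continuous_intros)
  moreover have "open (Re -` J)" using assms by (intro open_vimage continuous_intros)
  ultimately show ?thesis by auto
qed

text \<open>A segment from a real point of \<open>J\<close> to a non-real point meets the axis only
  at its start; real end points are covered by convexity. Starlikeness is what yields primitives on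
  the cut plane.\<close>

lemma starlike_slit: assumes "convex J" "J \<noteq> {}" shows "starlike (slit J)"
proof -
  obtain a where a: "a \<in> J" using assms by auto
  have "closed_segment (of_real a) t \<subseteq> slit J" if "t \<in> slit J" for t
  proof
    fix x assume "x \<in> closed_segment (of_real a) t"
    then obtain u where u: "0 \<le> u" "u \<le> 1" "x = (1 - u) *\<^sub>R of_real a + u *\<^sub>R t"
      by (auto simp: closed_segment_def)
    show "x \<in> slit J"
      unfolding slit_def
    proof safe
      assume "Im x = 0"
      then have "u * Im t = 0" using u by simp
      then consider "u = 0" | "Im t = 0" by auto
      then show "Re x \<in> J"
      proof cases
        case 2
        then have "Re t \<in> J" using that by (auto simp: slit_def)
        then have "(1 - u) *\<^sub>R a + u *\<^sub>R Re t \<in> J"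
          using convexD[OF assms(1) a, of "Re t" "1 - u" u] u by auto
        then show ?thesis using u by simp
      qed (use u a in auto)
    qed
  qed
  moreover have "of_real a \<in> slit J" using a by (auto simp: slit_def)
  ultimately show ?thesis unfolding starlike_def by blast
qed

text \<open>The winding number is replaced by the sides on which the path leaves and reaches the
  origin. Together with a primitive on \<open>D\<close> these sides determine the integral, which
  makes it the same for all such loops.\<close>

definition origin_loop :: "complex set \<Rightarrow> (real \<Rightarrow> complex) \<Rightarrow> bool" where
  "origin_loop D \<gamma> \<longleftrightarrow> valid_path \<gamma> \<and> \<gamma> 0 = 0 \<and> \<gamma> 1 = 0 \<and> (\<forall>s\<in>{0<..<1}. \<gamma> s \<in> D) \<and>
     (\<forall>\<^sub>F s in at_right 0. Im (\<gamma> s) < 0) \<and> (\<forall>\<^sub>F s in at_left 1. Im (\<gamma> s) > 0)"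

lemma origin_loop_mono: "origin_loop D \<gamma> \<Longrightarrow> D \<subseteq> E \<Longrightarrow> origin_loop E \<gamma>"
  by (auto simp: origin_loop_def)

text \<open>The primitive need not exist at the end points of the path. Composing it with the path
  and filling in the two limits gives a function continuous on the whole interval and differentiable
  off a finite set, to which the fundamental theorem applies.\<close>

lemma has_contour_integral_primitive_limits:
  assumes \<gamma>: "valid_path \<gamma>" "\<And>s. s \<in> {0<..<1} \<Longrightarrow> \<gamma> s \<in> D"
    and F: "\<And>t. t \<in> D \<Longrightarrow> (F has_field_derivative f t) (at t)"
    and l: "((\<lambda>s. F (\<gamma> s)) \<longlongrightarrow> l0) (at_right 0)" "((\<lambda>s. F (\<gamma> s)) \<longlongrightarrow> l1) (at_left 1)"
  shows "(f has_contour_integral (l1 - l0)) \<gamma>"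
proof -
  obtain S where S: "finite S" "\<gamma> C1_differentiable_on {0..1} - S" "continuous_on {0..1} \<gamma>"
    using \<gamma>(1) by (auto simp: valid_path_def piecewise_C1_differentiable_on_def)
  define g where "g s = (if s = 0 then l0 else if s = 1 then l1 else F (\<gamma> s))" for s :: real
  have d\<gamma>: "(\<gamma> has_vector_derivative vector_derivative \<gamma> (at s)) (at s)" if "s \<in> {0<..<1} - S" for s
    using S(2) that unfolding C1_differentiable_on_eq
    by (auto simp: vector_derivative_works)
  have cont: "continuous (at s) (\<lambda>s. F (\<gamma> s))" if "s \<in> {0<..<1}" for s
  proof -
    have "continuous (at s) \<gamma>"
      using S(3) that continuous_on_interior[of "{0..1}" \<gamma> s] by auto
    moreover have "continuous (at (\<gamma> s)) F" using F[OF \<gamma>(2)[OF that]] DERIV_isCont by auto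
    ultimately show ?thesis by (rule continuous_at_compose[unfolded o_def])
  qed
  have "((\<lambda>x. f (\<gamma> x) * vector_derivative \<gamma> (at x within {0..1})) has_integral (g 1 - g 0)) {0..1}"
  proof (rule fundamental_theorem_of_calculus_interior_strong[OF S(1)])
    fix x assume x: "x \<in> {0<..<1} - S"
    then have D: "\<gamma> x \<in> D" using \<gamma>(2) by auto
    have "((F \<circ> \<gamma>) has_vector_derivative vector_derivative \<gamma> (at x) * f (\<gamma> x)) (at x)"
      by (rule field_vector_diff_chain_at[OF d\<gamma>[OF x] F[OF D]])
    then have "((F \<circ> \<gamma>) has_vector_derivative f (\<gamma> x) * vector_derivative \<gamma> (at x within {0..1})) (at x)"
      using x by (simp add: at_within_Icc_at mult.commute)
    then show "(g has_vector_derivative f (\<gamma> x) * vector_derivative \<gamma> (at x within {0..1})) (at x)"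
      by (rule has_vector_derivative_transform_within_open[where S="{0<..<1}"])
         (use x in \<open>auto simp: g_def\<close>)
  next
    show "continuous_on {0..1} g"
    proof (rule continuous_on_IccI)
      have "(g \<longlongrightarrow> l0) (at_right 0)"
        by (rule Lim_transform_eventually[OF l(1)])
          (auto simp: eventually_at_right_field g_def intro!: exI[of _ 1])
      then show "(g \<longlongrightarrow> g 0) (at_right 0)" by (simp add: g_def)
      have "(g \<longlongrightarrow> l1) (at_left 1)"
        by (rule Lim_transform_eventually[OF l(2)])
          (auto simp: eventually_at_left_field g_def intro!: exI[of _ 0])
      then show "(g \<longlongrightarrow> g 1) (at_left 1)" by (simp add: g_def)
      fix x :: real assume x: "0 < x" "x < 1"
      have "((\<lambda>s. F (\<gamma> s)) \<longlongrightarrow> g x) (at x)"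
        using cont[of x] x by (auto simp: continuous_at g_def)
      moreover have "eventually (\<lambda>s. s \<in> {0<..<1}) (at x)"
        using x by (intro eventually_at_in_open') auto
      ultimately show "(g \<longlongrightarrow> g x) (at x)"
        by (elim Lim_transform_eventually) (auto elim!: eventually_mono simp: g_def)
    qed auto
  qed auto
  then show ?thesis by (simp add: has_contour_integral_def g_def)
qed

text \<open>Trades \<open>Ln (t - 1)\<close>, whose cut passes through the origin, for
  \<open>Ln (1 - t)\<close>, which is holomorphic in the unit disc; only a constant depending on the
  half plane remains.\<close>

lemma Ln_minus1_upper: assumes "Im t > 0" shows "Ln (t - 1) = Ln (1 - t) + \<i> * pi"
proof -
  have "1 - t \<noteq> 0" using assms by (auto simp: complex_eq_iff)
  from Ln_minus[OF this] show ?thesis using assms by simp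
qed

lemma Ln_minus1_lower: assumes "Im t < 0" shows "Ln (t - 1) = Ln (1 - t) - \<i> * pi"
proof -
  have "1 - t \<noteq> 0" using assms by (auto simp: complex_eq_iff)
  from Ln_minus[OF this] show ?thesis using assms by simp
qed

lemma exp_Ln_tendsto_0:
  assumes "s > 0" shows "((\<lambda>t. exp (complex_of_real s * Ln t)) \<longlongrightarrow> 0) (at 0 within H)"
proof (rule tendsto_norm_zero_cancel)
  have ev: "\<forall>\<^sub>F t in at 0 within H. norm t powr s = norm (exp (complex_of_real s * Ln t))"
    by (auto simp: eventually_at_filter powr_def intro!: always_eventually)
  have "((\<lambda>t::complex. norm t powr s) \<longlongrightarrow> 0 powr s) (at 0 within H)"
    by (intro tendsto_powr' tendsto_norm_zero tendsto_ident_at tendsto_const) (use assms in auto)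
  then show "((\<lambda>t. norm (exp (complex_of_real s * Ln t))) \<longlongrightarrow> 0) (at 0 within H)"
    using Lim_transform_eventually[OF _ ev, of 0] assms by simp
qed

text \<open>Subtracting \<open>t powr s * g\<^sub>1 t / s\<close> from a primitive leaves a function with bounded
  derivative, so the weak singularity at the origin does no harm.\<close>

lemma primitive_limit_at_0:
  assumes s: "s > 0" and g: "g1 holomorphic_on ball 0 1" "g2 holomorphic_on ball 0 1"
    and H: "convex H" "0 \<in> closure (H \<inter> ball 0 (1/2))" "H \<inter> \<real>\<^sub>\<le>\<^sub>0 = {}"
    and F: "\<And>t. t \<in> H \<Longrightarrow> norm t < 1 \<Longrightarrow>
        (F has_field_derivative exp (of_real (s - 1) * Ln t) * g1 t + g2 t) (at t)"
  shows "\<exists>l. (F \<longlongrightarrow> l) (at 0 within H)"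
proof -
  let ?X = "H \<inter> ball 0 (1/2)"
  define K where "K t = F t - exp (of_real s * Ln t) * g1 t / of_real s" for t
  have K: "(K has_field_derivative (g2 t - exp (of_real s * Ln t) * deriv g1 t / of_real s)) (at t)" if t: "t \<in> ?X" for t
  proof -
    have [simp]: "t \<noteq> 0" "t \<notin> \<real>\<^sub>\<le>\<^sub>0" using that H by auto
    have g1: "(g1 has_field_derivative deriv g1 t) (at t)"
      using holomorphic_derivI[OF g(1), of t] that by auto
    have e: "exp (of_real s * Ln t) = t * exp (of_real (s - 1) * Ln t)"
      by (simp add: algebra_simps exp_add exp_diff)
    have "(K has_field_derivative (exp (of_real (s - 1) * Ln t) * g1 t + g2 t)
       - ((of_real s * (1/t)) * exp (of_real s * Ln t) * g1 t + exp (of_real s * Ln t) * deriv g1 t) / of_real s) (at t)"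
      unfolding K_def using that F[of t] g1 s
      by (auto intro!: derivative_eq_intros simp: field_simps)
    then show ?thesis by (rule DERIV_cong) (use s in \<open>auto simp: e field_simps\<close>)
  qed
  have "continuous_on (cball 0 (1/2)) (deriv g1)" "continuous_on (cball 0 (1/2)) g2"
    using g by (auto intro!: holomorphic_on_imp_continuous_on[OF holomorphic_on_subset[of _ "ball 0 1"]] holomorphic_deriv)
  then have "compact (deriv g1 ` cball 0 (1/2))" "compact (g2 ` cball 0 (1/2))"
    by (auto intro!: compact_continuous_image)
  then obtain B1 B2 where B: "\<And>t. t \<in> cball 0 (1/2) \<Longrightarrow> norm (deriv g1 t) \<le> B1"
      "\<And>t. t \<in> cball 0 (1/2) \<Longrightarrow> norm (g2 t) \<le> B2"
    using compact_imp_bounded bounded_iff by (metis image_eqI)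
  have bd: "norm (g2 t - exp (of_real s * Ln t) * deriv g1 t / of_real s) \<le> B2 + B1 / s" if t: "t \<in> ?X" for t
  proof -
    have "t \<noteq> 0" using that H by auto
    have "norm (exp (of_real s * Ln t)) = norm t powr s" using \<open>t \<noteq> 0\<close> by (simp add: powr_def)
    also have "\<dots> \<le> 1 powr s" using that s by (intro powr_mono2) auto
    finally have "norm (exp (of_real s * Ln t)) * norm (deriv g1 t) \<le> 1 * B1"
      using B(1)[of t] that by (intro mult_mono) auto
    then have "norm (exp (of_real s * Ln t) * deriv g1 t / of_real s) \<le> B1 / s"
      using s by (simp add: norm_mult norm_divide divide_right_mono)
    moreover have "norm (g2 t) \<le> B2" using B(2)[of t] that by auto
    ultimately show ?thesis using norm_triangle_ineq4[of "g2 t"] by (meson add_mono order_trans)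
  qed
  \<comment> \<open>A bounded derivative on a convex set gives a Lipschitz bound, so
    \<open>K\<close> is uniformly continuous and extends to the boundary point 0.\<close>
  have "(B2 + B1 / s)-lipschitz_on ?X K"
  proof (rule lipschitz_onI)
    show "dist (K x) (K y) \<le> (B2 + B1/s) * dist x y" if "x \<in> ?X" "y \<in> ?X" for x y
      unfolding dist_norm
      by (rule field_differentiable_bound[of ?X K, OF _ has_field_derivative_at_within[OF K] bd])
         (use that H in \<open>auto intro: convex_Int\<close>)
    have "norm (g2 0) \<le> B2" "norm (deriv g1 0) \<le> B1" using B by auto
    then show "0 \<le> B2 + B1 / s"
      by (intro add_nonneg_nonneg divide_nonneg_pos s) (auto intro: order_trans[OF norm_ge_zero])
  qed
  then have "uniformly_continuous_on ?X K" by (rule lipschitz_on_uniformly_continuous)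
  then obtain l where l: "(K \<longlongrightarrow> l) (at 0 within ?X)"
    using uniformly_continuous_on_extension_at_closure[OF _ H(2)] by metis
  have "at 0 within ?X = at 0 within H"
    by (rule at_within_nhd[where S="ball 0 (1/2)"]) auto
  with l have l: "(K \<longlongrightarrow> l) (at 0 within H)" by simp
  have "isCont g1 0"
    using field_differentiable_imp_continuous_at[OF holomorphic_on_imp_differentiable_at[OF g(1)], of 0] by simp
  then have "(g1 \<longlongrightarrow> g1 0) (at 0 within H)"
    by (metis isCont_def tendsto_within_subset subset_UNIV)
  then have "((\<lambda>t. K t + exp (of_real s * Ln t) * g1 t / of_real s) \<longlongrightarrow> l + 0 * g1 0 / of_real s) (at 0 within H)"
    by (intro tendsto_intros l exp_Ln_tendsto_0 s) (use s in auto)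
  then show ?thesis by (auto simp: K_def)
qed

section \<open>The weight of the contour integral and its primitives\<close>

text \<open>The factor \<open>(t / (t - 1)) ^ b / sqrt t\<close> with principal values. It collects
  the branch points of the integrand; what is left is an exponential and a simple pole.\<close>

definition loop_weight :: "real \<Rightarrow> complex \<Rightarrow> complex" where
  "loop_weight b t = exp (of_real b * (Ln t - Ln (t - 1))) / csqrt t"

lemma loop_weight_eq: "t \<noteq> 0 \<Longrightarrow> loop_weight b t = exp (of_real (b - 1/2) * Ln t - of_real b * Ln (t - 1))"
  by (simp add: loop_weight_def csqrt_exp_Ln exp_diff[symmetric] algebra_simps)

lemma loop_weight_holomorphic: "loop_weight b holomorphic_on slit {1<..}"
proof -
  have "(\<lambda>t. exp (of_real (b - 1/2) * Ln t - of_real b * Ln (t - 1))) holomorphic_on slit {1<..}"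
    by (intro holomorphic_intros) (auto simp: slit_def complex_nonpos_Reals_iff)
  then show ?thesis
    by (rule holomorphic_transform) (subst loop_weight_eq, auto simp: slit_def)
qed

lemma origin_loop_limits:
  assumes "origin_loop D \<gamma>"
  shows "filterlim \<gamma> (at 0 within {t. Im t < 0}) (at_right 0)"
    "filterlim \<gamma> (at 0 within {t. Im t > 0}) (at_left 1)"
proof -
  have c: "continuous_on {0..1} \<gamma>" using assms by (auto simp: origin_loop_def valid_path_def piecewise_C1_differentiable_on_def)
  have 0: "(\<gamma> \<longlongrightarrow> 0) (at_right 0)" "(\<gamma> \<longlongrightarrow> 0) (at_left 1)"
    using continuous_on_Icc_at_rightD[OF c] continuous_on_Icc_at_leftD[OF c] assms by (auto simp: origin_loop_def)
  show "filterlim \<gamma> (at 0 within {t. Im t < 0}) (at_right 0)"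
    unfolding filterlim_at using 0 assms by (auto simp: origin_loop_def elim!: eventually_mono)
  show "filterlim \<gamma> (at 0 within {t. Im t > 0}) (at_left 1)"
    unfolding filterlim_at using 0 assms by (auto simp: origin_loop_def elim!: eventually_mono)
qed

lemma half_plane_facts:
  "convex {t::complex. Im t > 0}" "convex {t::complex. Im t < 0}"
  "0 \<in> closure ({t. Im t > 0} \<inter> ball 0 (1/2))" "0 \<in> closure ({t. Im t < 0} \<inter> ball 0 (1/2))"
  "{t. Im t > 0} \<inter> \<real>\<^sub>\<le>\<^sub>0 = {}" "{t. Im t < 0} \<inter> \<real>\<^sub>\<le>\<^sub>0 = {}"
proof -
  show "convex {t::complex. Im t > 0}" "convex {t::complex. Im t < 0}"
    by (rule convex_halfspace_Im_gt convex_halfspace_Im_lt)+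
  show "{t. Im t > 0} \<inter> \<real>\<^sub>\<le>\<^sub>0 = {}" "{t. Im t < 0} \<inter> \<real>\<^sub>\<le>\<^sub>0 = {}"
    by (auto simp: complex_nonpos_Reals_iff)
  show "0 \<in> closure ({t. Im t > 0} \<inter> ball 0 (1/2))"
    unfolding closure_approachable
  proof safe
    fix e :: real assume "e > 0"
    then show "\<exists>y\<in>{t. Im t > 0} \<inter> ball 0 (1/2). dist y 0 < e"
      by (intro bexI[of _ "Complex 0 (min e (1/2) / 2)"]) (auto simp: dist_norm norm_complex_def)
  qed
  show "0 \<in> closure ({t. Im t < 0} \<inter> ball 0 (1/2))"
    unfolding closure_approachable
  proof safe
    fix e :: real assume "e > 0"
    then show "\<exists>y\<in>{t. Im t < 0} \<inter> ball 0 (1/2). dist y 0 < e"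
      by (intro bexI[of _ "Complex 0 (- (min e (1/2) / 2))"]) (auto simp: dist_norm norm_complex_def)
  qed
qed

text \<open>At the origin the weight behaves like \<open>t powr (b - 1/2)\<close> with exponent
  above -1, so a primitive of \<open>f\<close> has a limit from each half plane. Every loop runs
  from the lower limit to the upper one, whence a single value \<open>I\<close> for all of them. The
  summand \<open>g2\<close> allows for integrands from which a pole term has been
  subtracted.\<close>

lemma loop_integral_exists:
  assumes "open D" "starlike D" "f holomorphic_on D" "b > 0"
    and g: "g1 holomorphic_on ball 0 1" "g2 holomorphic_on ball 0 1"
    and f: "\<And>t. norm t < 1 \<Longrightarrow> Im t \<noteq> 0 \<Longrightarrow> t \<in> D \<and> f t = loop_weight b t * g1 t + g2 t"
  shows "\<exists>I. \<forall>\<gamma>. origin_loop D \<gamma> \<longrightarrow> (f has_contour_integral I) \<gamma>"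
proof -
  obtain F where F: "\<And>t. t \<in> D \<Longrightarrow> (F has_field_derivative f t) (at t)"
    using holomorphic_starlike_primitive[of D f "{}"] assms
    by (metis Diff_empty finite.emptyI holomorphic_on_imp_continuous_on holomorphic_on_imp_differentiable_at)
  \<comment> \<open>The holomorphic part of the weight near 0; the constant \<open>c\<close> is
    \<open>\<i> * pi\<close> above and its negative below the axis.\<close>
  define h where "h c t = exp (- (of_real b * (Ln (1 - t) + c))) * g1 t" for c t
  have h: "h c holomorphic_on ball 0 1" for c
    unfolding h_def using g
    by (intro holomorphic_intros)
      (auto simp: complex_nonpos_Reals_iff dest: order.strict_trans1[OF complex_Re_le_cmod])
  have w: "loop_weight b t * g1 t = exp (of_real (b + 1/2 - 1) * Ln t) * h c t"
    if "t \<noteq> 0" "Ln (t - 1) = Ln (1 - t) + c" for t c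
  proof -
    have "exp (of_real (b - 1/2) * Ln t - of_real b * Ln (t - 1))
        = exp (of_real (b + 1/2 - 1) * Ln t) * exp (- (of_real b * (Ln (1 - t) + c)))"
      unfolding that(2) by (simp add: exp_add[symmetric] algebra_simps)
    then show ?thesis using that by (simp add: loop_weight_eq h_def)
  qed
  have "\<exists>l. (F \<longlongrightarrow> l) (at 0 within {t. Im t > 0})"
  proof (rule primitive_limit_at_0[of "b + 1/2" "h (\<i> * pi)" g2])
    fix t assume "t \<in> {t. Im t > 0}" "norm t < 1"
    then have *: "t \<in> D" "f t = loop_weight b t * g1 t + g2 t" "t \<noteq> 0" "Im t > 0" using f[of t] by auto
    from F[OF *(1)] show "(F has_field_derivative exp (of_real (b + 1/2 - 1) * Ln t) * h (\<i> * pi) t + g2 t) (at t)"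
      using w[of t "\<i> * pi"] * Ln_minus1_upper by simp
  qed (use \<open>b > 0\<close> h g half_plane_facts in auto)
  then obtain l1 where l1: "(F \<longlongrightarrow> l1) (at 0 within {t. Im t > 0})" ..
  have "\<exists>l. (F \<longlongrightarrow> l) (at 0 within {t. Im t < 0})"
  proof (rule primitive_limit_at_0[of "b + 1/2" "h (- (\<i> * pi))" g2])
    fix t assume "t \<in> {t. Im t < 0}" "norm t < 1"
    then have *: "t \<in> D" "f t = loop_weight b t * g1 t + g2 t" "t \<noteq> 0" "Im t < 0" using f[of t] by auto
    from F[OF *(1)] show "(F has_field_derivative exp (of_real (b + 1/2 - 1) * Ln t) * h (- (\<i> * pi)) t + g2 t) (at t)"
      using w[of t "- (\<i> * pi)"] * Ln_minus1_lower by simp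
  qed (use \<open>b > 0\<close> h g half_plane_facts in auto)
  then obtain l0 where l0: "(F \<longlongrightarrow> l0) (at 0 within {t. Im t < 0})" ..
  have "(f has_contour_integral (l1 - l0)) \<gamma>" if \<gamma>: "origin_loop D \<gamma>" for \<gamma>
    by (rule has_contour_integral_primitive_limits[where D=D and F=F])
       (use \<gamma> F filterlim_compose[OF l0 origin_loop_limits(1)[OF \<gamma>]]
         filterlim_compose[OF l1 origin_loop_limits(2)[OF \<gamma>]] in \<open>auto simp: origin_loop_def\<close>)
  then show ?thesis by blast
qed

section \<open>Circles through the origin\<close>

text \<open>The angle \<pi> starts the circle at the origin; it is run through once anti-clockwise
  and crosses the real axis again only at \<open>2 * R\<close>.\<close>

definition origin_circle :: "real \<Rightarrow> real \<Rightarrow> complex" where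
  "origin_circle R = part_circlepath (of_real R) R pi (3 * pi)"

lemma origin_circle_eq: "origin_circle R s = of_real R * (1 - cis (2 * pi * s))"
proof -
  have "\<i> * complex_of_real (linepath pi (3 * pi) s) = \<i> * of_real pi + \<i> * of_real (2 * pi * s)"
    by (simp add: linepath_def algebra_simps)
  then show ?thesis
    by (simp add: origin_circle_def part_circlepath_def exp_add cis_conv_exp algebra_simps)
qed

text \<open>Up to \<open>pi / 3\<close> the derivative of the sine is at least 1/2. Beyond that the
  sine is at least \<open>sqrt 3 / 2\<close>, which exceeds \<open>pi / 4\<close> and hence
  \<open>x / 2\<close>.\<close>

lemma sin_ge_half: assumes "0 \<le> x" "x \<le> pi / 2" shows "x / 2 \<le> sin (x::real)"
proof (cases "x \<le> pi / 3")
  case True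
  have "sin 0 - 0 / 2 \<le> sin x - x / 2"
  proof (rule DERIV_nonneg_imp_nondecreasing[OF assms(1)])
    fix t assume t: "0 \<le> t" "t \<le> x"
    have "cos (pi/3) \<le> cos t" using t True by (intro cos_monotone_0_pi_le) auto
    then show "\<exists>y. ((\<lambda>x. sin x - x / 2) has_real_derivative y) (at t) \<and> 0 \<le> y"
      by (intro exI[of _ "cos t - 1/2"]) (auto intro!: derivative_eq_intros simp: cos_60)
  qed
  then show ?thesis by simp
next
  case False
  have "x / 2 \<le> pi / 4" using assms by simp
  also have "\<dots> \<le> sqrt 3 / 2"
  proof -
    have "(1.65::real) \<le> sqrt 3" by (rule real_le_rsqrt) (simp add: power2_eq_square)
    then show ?thesis using pi_approx by simp
  qed
  also have "\<dots> = sin (pi/3)" by (simp add: sin_60)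
  also have "\<dots> \<le> sin x" using assms False by (intro sin_monotone_2pi_le) auto
  finally show ?thesis .
qed

lemma origin_circle_norm:
  assumes "R > 0" "0 \<le> s" "s \<le> 1"
  shows "norm (origin_circle R s) = 2 * R * sin (pi * s)"
proof -
  have "norm (1 - cis (2 * pi * s)) ^ 2 = (2 * sin (pi * s)) ^ 2"
  proof -
    have "norm (1 - cis (2 * pi * s)) ^ 2 = (1 - cos (2 * pi * s))\<^sup>2 + (sin (2 * pi * s))\<^sup>2"
      by (simp add: cmod_power2)
    also have "\<dots> = 2 - 2 * cos (2 * (pi * s))"
      using sin_cos_squared_add[of "2 * pi * s"] by (simp add: power2_eq_square algebra_simps)
    finally show ?thesis by (simp only: cos_double_sin) (simp add: power2_eq_square algebra_simps)
  qed
  moreover have "sin (pi * s) \<ge> 0" using assms by (intro sin_ge_zero) auto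
  ultimately have "norm (1 - cis (2 * pi * s)) = 2 * sin (pi * s)"
    by (metis norm_ge_zero power2_eq_imp_eq mult_nonneg_nonneg zero_le_numeral)
  then show ?thesis using assms by (simp add: origin_circle_eq norm_mult)
qed

text \<open>A linear lower bound at both ends; it keeps negative powers of the modulus with exponent
  above -1 integrable along the circle.\<close>

lemma origin_circle_norm_ge:
  assumes "R > 0" "0 \<le> s" "s \<le> 1"
  shows "2 * R * min s (1 - s) \<le> norm (origin_circle R s)"
proof -
  have "min s (1 - s) \<le> sin (pi * s)"
  proof (cases "s \<le> 1/2")
    case True
    then have "s \<le> pi * s / 2" using mult_right_mono[OF pi_ge_two assms(2)] by simp
    also have "\<dots> \<le> sin (pi * s)" using True assms by (intro sin_ge_half) auto
    finally show ?thesis by simp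
  next
    case False
    then have "1 - s \<le> pi * (1 - s) / 2" using mult_right_mono[OF pi_ge_two, of "1 - s"] assms by simp
    also have "\<dots> \<le> sin (pi * (1 - s))" using False assms by (intro sin_ge_half) auto
    also have "\<dots> = sin (pi * s)" by (simp add: algebra_simps sin_diff)
    finally show ?thesis by simp
  qed
  then show ?thesis using assms by (simp add: origin_circle_norm)
qed

lemma origin_loop_circle:
  assumes "R > 0" "2 * R \<in> J"
  shows "origin_loop (slit J) (origin_circle R)"
  unfolding origin_loop_def
proof (intro conjI ballI)
  show "valid_path (origin_circle R)" by (simp add: origin_circle_def)
  show "origin_circle R 0 = 0" "origin_circle R 1 = 0"
    by (simp_all add: origin_circle_eq complex_eq_iff)
  fix s :: real assume s: "s \<in> {0<..<1}"
  show "origin_circle R s \<in> slit J" unfolding slit_def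
  proof safe
    assume "Im (origin_circle R s) = 0"
    then have 0: "sin (2 * pi * s) = 0" using assms by (simp add: origin_circle_eq)
    have *: "2 * pi * s = pi"
    proof (rule ccontr)
      assume "2 * pi * s \<noteq> pi"
      then consider "2 * pi * s < pi" | "2 * pi * s > pi" by linarith
      then show False
      proof cases
        case 1 then show ?thesis using sin_gt_zero[of "2 * pi * s"] s 0 by simp
      next
        case 2 then show ?thesis using sin_lt_zero[of "2 * pi * s"] s 0 by simp
      qed
    qed
    then show "Re (origin_circle R s) \<in> J" unfolding origin_circle_eq * using assms by (simp add: mult.commute)
  qed
next
  have "Im (origin_circle R s) < 0" if "0 < s" "s < 1/2" for s
  proof -
    have "sin (2 * pi * s) > 0" using that by (intro sin_gt_zero) auto
    then show ?thesis using assms by (simp add: origin_circle_eq)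
  qed
  then show "\<forall>\<^sub>F s in at_right 0. Im (origin_circle R s) < 0"
    unfolding eventually_at_right_field by (intro exI[of _ "1/2"]) auto
  have "Im (origin_circle R s) > 0" if "1/2 < s" "s < 1" for s
  proof -
    have "sin (2 * pi * s) < 0" using that by (intro sin_lt_zero) auto
    then show ?thesis using assms by (simp add: origin_circle_eq mult_pos_neg)
  qed
  then show "\<forall>\<^sub>F s in at_left 1. 0 < Im (origin_circle R s)"
    unfolding eventually_at_left_field by (intro exI[of _ "1/2"]) auto
qed

lemma norm_loop_weight:
  assumes "t \<noteq> 0" "t \<noteq> 1" shows "norm (loop_weight b t) = norm t powr (b - 1/2) * norm (t - 1) powr (- b)"
proof -
  have "norm (loop_weight b t) = exp ((b - 1/2) * ln (norm t) + (- b) * ln (norm (t - 1)))"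
    using assms by (simp add: loop_weight_eq)
  then show ?thesis using assms by (simp only: exp_add) (simp add: powr_def)
qed

lemma loop_weight_circle_dominated:
  assumes "b > 0" "R > 1/2"
  obtains h where "h integrable_on {0..1}"
    "\<And>s. s \<in> {0..1} \<Longrightarrow> norm (loop_weight b (origin_circle R s) * vector_derivative (origin_circle R) (at s within {0..1})) \<le> h s"
proof -
  \<comment> \<open>A lower bound for the distance of the point 1 from the circle, positive
    precisely because \<open>R > 1/2\<close>.\<close>
  define d where "d = R - \<bar>R - 1\<bar>"
  have d: "d > 0" using assms by (auto simp: d_def)
  \<comment> \<open>The summand 1 covers \<open>b \<ge> 1/2\<close>, where the power of the modulus
    is bounded; the two end point powers cover \<open>b < 1/2\<close>.\<close>
  define h where "h s = (2 * R) powr (b - 1/2) * (1 + s powr (b - 1/2) + (1 - s) powr (b - 1/2)) * d powr (- b) * (2 * pi * R)" for s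
  have "(\<lambda>s. s powr (b - 1/2)) integrable_on {0..1}"
    using has_integral_powr_from_0[of "b - 1/2" 1] assms by auto
  moreover from this have "(\<lambda>s. (1 - s) powr (b - 1/2)) integrable_on {0..1}"
  proof -
    have im: "(\<lambda>x::real. 1 - x) ` {0..1} = {0..1}" using image_diff_atLeastAtMost[of "1::real" 0 1] by simp
    assume "(\<lambda>s. s powr (b - 1/2)) integrable_on {0..1}"
    then show ?thesis
      using integrable_affinity[of "\<lambda>s. s powr (b - 1/2)" 0 1 "-1" 1] by (simp add: im)
  qed
  ultimately have 1: "h integrable_on {0..1}"
    unfolding h_def[abs_def]
    by (intro integrable_on_mult_left integrable_on_mult_right integrable_add) auto
  have 2: "norm (loop_weight b (origin_circle R s) * vector_derivative (origin_circle R) (at s within {0..1})) \<le> h s"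
    if s: "s \<in> {0..1}" for s
  proof -
    let ?t = "origin_circle R s"
    have v: "norm (vector_derivative (origin_circle R) (at s within {0..1})) = 2 * pi * R"
      using s assms by (simp add: origin_circle_def vector_derivative_part_circlepath01 norm_mult)
    have "norm (loop_weight b ?t) \<le> (2 * R) powr (b - 1/2) * (1 + s powr (b - 1/2) + (1 - s) powr (b - 1/2)) * d powr (- b)"
    proof (cases "s = 0 \<or> s = 1")
      case True
      then have "?t = 0" by (auto simp: origin_circle_eq complex_eq_iff)
      then show ?thesis by (simp add: loop_weight_def)
    next
      case False
      then have s': "0 < s" "s < 1" using s by auto
      have lo: "2 * R * min s (1 - s) \<le> norm ?t" using origin_circle_norm_ge[of R s] s assms by auto
      have hi: "norm ?t \<le> 2 * R" using origin_circle_norm[of R s] s assms by simp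
      have pos: "0 < 2 * R * min s (1 - s)" using s' assms by simp
      have "d \<le> norm (?t - 1)"
      proof -
        have "R = norm (?t - of_real R)" using assms by (simp add: origin_circle_eq algebra_simps norm_mult)
        also have "\<dots> \<le> norm (?t - 1) + norm (1 - complex_of_real R)"
          using norm_triangle_ineq[of "?t - 1" "1 - complex_of_real R"] by simp
        also have "norm (1 - complex_of_real R) = \<bar>1 - R\<bar>"
          by (metis norm_of_real of_real_1 of_real_diff)
        finally show ?thesis by (simp add: d_def abs_minus_commute)
      qed
      then have b2: "norm (?t - 1) powr (- b) \<le> d powr (- b)" using d assms by (intro powr_mono2') auto
      have b1: "norm ?t powr (b - 1/2) \<le> (2 * R) powr (b - 1/2) * (1 + s powr (b - 1/2) + (1 - s) powr (b - 1/2))"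
      proof (cases "b \<ge> 1/2")
        case True
        then have "norm ?t powr (b - 1/2) \<le> (2 * R) powr (b - 1/2) * 1" using hi by (simp add: powr_mono2)
        also have "\<dots> \<le> (2 * R) powr (b - 1/2) * (1 + s powr (b - 1/2) + (1 - s) powr (b - 1/2))"
          by (intro mult_left_mono) auto
        finally show ?thesis .
      next
        case False
        have "norm ?t powr (b - 1/2) \<le> (2 * R * min s (1 - s)) powr (b - 1/2)"
          using False lo pos by (intro powr_mono2') auto
        also have "\<dots> = (2 * R) powr (b - 1/2) * (min s (1 - s)) powr (b - 1/2)"
          by (rule powr_mult)
        also have "\<dots> \<le> (2 * R) powr (b - 1/2) * (1 + s powr (b - 1/2) + (1 - s) powr (b - 1/2))"
          by (intro mult_left_mono) (auto simp: min_def)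
        finally show ?thesis .
      qed
      have "?t \<noteq> 0" "?t \<noteq> 1" using lo pos d \<open>d \<le> norm (?t - 1)\<close> by fastforce+
      then show ?thesis using b1 b2 unfolding norm_loop_weight[OF \<open>?t \<noteq> 0\<close> \<open>?t \<noteq> 1\<close>]
        by (intro mult_mono) auto
    qed
    then show ?thesis unfolding norm_mult v h_def using assms by (intro mult_right_mono) auto
  qed
  from that[OF 1 2] show ?thesis .
qed

text \<open>Dominated convergence: on the circle the modulus is at most \<open>2 * R\<close>, so the
  partial sums of the power series are bounded by one constant, and the weight has an integrable
  majorant.\<close>

lemma loop_integral_series:
  assumes "b > 0" "R > 1/2" "summable (\<lambda>k. norm (u k) * (2 * R) ^ k)"
    and L: "\<And>k. ((\<lambda>t. loop_weight b t * t ^ k) has_contour_integral L k) (origin_circle R)"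
    and I: "((\<lambda>t. loop_weight b t * (\<Sum>k. u k * t ^ k)) has_contour_integral I) (origin_circle R)"
  shows "(\<lambda>k. u k * L k) sums I"
proof -
  let ?\<gamma> = "origin_circle R" and ?v = "\<lambda>s. vector_derivative (origin_circle R) (at s within {0..1})"
  obtain h where h: "h integrable_on {0..1}" "\<And>s. s \<in> {0..1} \<Longrightarrow> norm (loop_weight b (?\<gamma> s) * ?v s) \<le> h s"
    using loop_weight_circle_dominated[OF assms(1,2)] by blast
  define M where "M = (\<Sum>k. norm (u k) * (2 * R) ^ k)"
  define f where "f N s = loop_weight b (?\<gamma> s) * (\<Sum>k<N. u k * ?\<gamma> s ^ k) * ?v s" for N s
  have f: "(f N has_integral (\<Sum>k<N. u k * L k)) {0..1}" for N
  proof -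
    have "((\<lambda>t. \<Sum>k<N. u k * (loop_weight b t * t ^ k)) has_contour_integral (\<Sum>k<N. u k * L k)) ?\<gamma>"
      by (intro has_contour_integral_sum has_contour_integral_lmul L) auto
    then show ?thesis
      by (simp add: has_contour_integral_def f_def[abs_def] sum_distrib_left sum_distrib_right mult_ac)
  qed
  have tb: "norm (u k * ?\<gamma> s ^ k) \<le> norm (u k) * (2 * R) ^ k" if "s \<in> {0..1}" for s k
  proof -
    have "norm (?\<gamma> s) \<le> 2 * R" using origin_circle_norm[of R s] that assms by simp
    then show ?thesis unfolding norm_mult norm_power by (intro mult_left_mono power_mono) auto
  qed
  have conv: "(\<lambda>N. f N s) \<longlonglongrightarrow> loop_weight b (?\<gamma> s) * (\<Sum>k. u k * ?\<gamma> s ^ k) * ?v s" if "s \<in> {0..1}" for s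
    unfolding f_def
    by (intro tendsto_intros summable_LIMSEQ summable_comparison_test[OF _ assms(3)] exI[of _ 0] allI impI tb that)
  have "(\<lambda>N. integral {0..1} (f N)) \<longlonglongrightarrow> integral {0..1} (\<lambda>s. loop_weight b (?\<gamma> s) * (\<Sum>k. u k * ?\<gamma> s ^ k) * ?v s)"
  proof (rule dominated_convergence)
    show "f N integrable_on {0..1}" for N using f by blast
    show "(\<lambda>s. h s * M) integrable_on {0..1}" using h by (intro integrable_on_mult_left)
    fix N s assume s: "s \<in> {0..1::real}"
    have "norm (\<Sum>k<N. u k * ?\<gamma> s ^ k) \<le> (\<Sum>k<N. norm (u k) * (2 * R) ^ k)"
      by (rule sum_norm_le) (use tb[OF s] in auto)
    also have "\<dots> \<le> M" unfolding M_def by (rule sum_le_suminf[OF assms(3)]) (use assms in auto)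
    finally have "norm (loop_weight b (?\<gamma> s) * ?v s) * norm (\<Sum>k<N. u k * ?\<gamma> s ^ k) \<le> h s * M"
      using h(2)[OF s] by (intro mult_mono) (auto intro: order_trans[OF norm_ge_zero])
    then show "norm (f N s) \<le> h s * M" by (simp add: f_def norm_mult mult_ac)
  qed (use conv in auto)
  moreover have "integral {0..1} (f N) = (\<Sum>k<N. u k * L k)" for N using f by (rule integral_unique)
  moreover have "integral {0..1} (\<lambda>s. loop_weight b (?\<gamma> s) * (\<Sum>k. u k * ?\<gamma> s ^ k) * ?v s) = I"
    using I unfolding has_contour_integral_def by (rule integral_unique)
  ultimately show ?thesis by (simp add: sums_def)
qed

section \<open>Moments of the loop weight\<close>

text \<open>The coefficients of \<open>ibeta_term\<close> as a power series in \<open>y\<close>.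
  They turn out to be, up to the factor \<open>2 * pi * \<i>\<close>, the moments of the loop
  weight.\<close>

definition ibeta_coeff :: "real \<Rightarrow> nat \<Rightarrow> real" where
  "ibeta_coeff b k = 1 / ((real k + 1/2) * Beta (real k + 1/2) b)"

lemma ibeta_coeff_pos: "b > 0 \<Longrightarrow> ibeta_coeff b k > 0"
  using Beta_pos_real[of "real k + 1/2" b] by (simp add: ibeta_coeff_def)

lemma ibeta_coeff_Suc:
  assumes "b > 0" shows "(real k + 3/2) * ibeta_coeff b (Suc k) = (real k + 1/2 + b) * ibeta_coeff b k"
proof -
  have B: "Beta (real (Suc k) + 1/2) b = (real k + 1/2) / (real k + 1/2 + b) * Beta (real k + 1/2) b"
    using Beta_plus1_real[of "real k + 1/2" b] assms by (simp add: add_ac)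
  define c where "c = Beta (real k + 1/2) b"
  have "c > 0" using Beta_pos_real[of "real k + 1/2" b] assms by (simp add: c_def)
  have pos: "real k + 1/2 > 0" "real k + 3/2 > 0" "real k + 1/2 + b > 0" using assms by auto
  have "(real k + 3/2) * (1 / ((real k + 3/2) * (p / q * c))) = q * (1 / (p * c))" if "p > 0" "q > 0" for p q :: real
    using that \<open>c > 0\<close> pos by (simp add: divide_simps)
  from this[OF pos(1,3)] show ?thesis unfolding ibeta_coeff_def B c_def by (simp add: add_ac)
qed

lemma ibeta_term_coeff:
  assumes "y > 0" shows "ibeta_term y b k = sqrt y * (1 - y) powr b * (ibeta_coeff b k * y ^ k)"
  using assms by (simp add: ibeta_term_def ibeta_coeff_def powr_add powr_realpow powr_half_sqrt)

text \<open>The integrand is the derivative of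
  \<open>t powr (k + 1/2 + b) * (t - 1) powr (1 - b)\<close>, which vanishes at both ends of the
  loop. This is the recurrence of \<open>ibeta_coeff_Suc\<close> for the moments.\<close>

lemma loop_integral_recurrence:
  assumes "b > 0" "origin_loop (slit {1<..}) \<gamma>"
  shows "((\<lambda>t. of_real (real k + 3/2) * (loop_weight b t * t ^ Suc k) - of_real (real k + 1/2 + b) * (loop_weight b t * t ^ k))
     has_contour_integral 0) \<gamma>"
proof -
  define U where "U t = exp (of_real (real k + 1/2 + b) * Ln t) * exp (of_real (1 - b) * Ln (t - 1))" for t
  have lim: "(U \<longlongrightarrow> 0) (at 0 within {t. Im t > 0})" "(U \<longlongrightarrow> 0) (at 0 within {t. Im t < 0})"
  proof -
    have c: "((\<lambda>t. exp (of_real (1 - b) * (Ln (1 - t) + c))) \<longlongrightarrow> exp (of_real (1 - b) * (Ln (1 - 0) + c))) (at 0 within H)" for c H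
      by (intro tendsto_intros) auto
    have e: "((\<lambda>t. exp (of_real (real k + 1/2 + b) * Ln t) * exp (of_real (1 - b) * (Ln (1 - t) + c))) \<longlongrightarrow> 0) (at 0 within H)" for c H
      using tendsto_mult[OF exp_Ln_tendsto_0[of "real k + 1/2 + b" H] c] assms by simp
    show "(U \<longlongrightarrow> 0) (at 0 within {t. Im t > 0})"
      by (rule Lim_transform_eventually[OF e[of "\<i> * pi"]])
         (auto simp: eventually_at_filter U_def Ln_minus1_upper intro!: always_eventually)
    show "(U \<longlongrightarrow> 0) (at 0 within {t. Im t < 0})"
      by (rule Lim_transform_eventually[OF e[of "- (\<i> * pi)"]])
         (auto simp: eventually_at_filter U_def Ln_minus1_lower intro!: always_eventually)
  qed
  have der: "(U has_field_derivative (of_real (real k + 3/2) * (loop_weight b t * t ^ Suc k) - of_real (real k + 1/2 + b) * (loop_weight b t * t ^ k))) (at t)"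
    if "t \<in> slit {1<..}" for t
  proof -
    have t: "t \<notin> \<real>\<^sub>\<le>\<^sub>0" "t - 1 \<notin> \<real>\<^sub>\<le>\<^sub>0" "t \<noteq> 0" "t - 1 \<noteq> 0"
      using that by (auto simp: slit_def complex_nonpos_Reals_iff complex_eq_iff)
    have w: "U t = loop_weight b t * t ^ k * (t * (t - 1))"
    proof -
      have "U t = exp (of_real (b - 1/2) * Ln t - of_real b * Ln (t - 1) + of_nat k * Ln t + (Ln t + Ln (t - 1)))"
        unfolding U_def by (simp add: exp_add[symmetric] algebra_simps)
      also have "\<dots> = exp (of_real (b - 1/2) * Ln t - of_real b * Ln (t - 1)) * t ^ k * (t * (t - 1))"
        using t by (simp add: exp_add exp_of_nat_mult)
      finally show ?thesis using t by (simp add: loop_weight_eq)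
    qed
    have "(U has_field_derivative (of_real (real k + 1/2 + b) / t + of_real (1 - b) / (t - 1)) * U t) (at t)"
      unfolding U_def using t by (auto intro!: derivative_eq_intros simp: field_simps)
    then show ?thesis
      by (rule DERIV_cong) (use t in \<open>simp add: w field_simps\<close>)
  qed
  from has_contour_integral_primitive_limits[where D="slit {1<..}" and F=U and ?l0.0=0 and ?l1.0=0, OF _ _ der]
  show ?thesis using assms filterlim_compose[OF lim(2) origin_loop_limits(1)[OF assms(2)]]
     filterlim_compose[OF lim(1) origin_loop_limits(2)[OF assms(2)]]
    by (auto simp: origin_loop_def)
qed

text \<open>The moments obey the same two-term recurrence as \<open>ibeta_coeff\<close>, so they are
  proportional to it; the factor \<open>C\<close> is the only unknown left.\<close>

lemma loop_weight_power_integral_ex: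
  assumes "b > 0"
  obtains C where "\<And>k \<gamma>. origin_loop (slit {1<..}) \<gamma> \<Longrightarrow>
     ((\<lambda>t. loop_weight b t * t ^ k) has_contour_integral (C * of_real (ibeta_coeff b k))) \<gamma>"
proof -
  have ex: "\<exists>I. \<forall>\<gamma>. origin_loop (slit {1<..}) \<gamma> \<longrightarrow> ((\<lambda>t. loop_weight b t * t ^ k) has_contour_integral I) \<gamma>" for k
  proof (rule loop_integral_exists[OF _ _ _ assms, where ?g1.0="\<lambda>t. t ^ k" and ?g2.0="\<lambda>_. 0"])
    show "open (slit {1<..})" by (rule open_slit) simp
    show "starlike (slit {1<..})" by (rule starlike_slit) auto
    show "(\<lambda>t. loop_weight b t * t ^ k) holomorphic_on slit {1<..}"
      by (intro holomorphic_intros loop_weight_holomorphic)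
    show "(\<lambda>t. t ^ k) holomorphic_on ball 0 1" "(\<lambda>_. 0) holomorphic_on ball 0 1"
      by (intro holomorphic_intros)+
    show "t \<in> slit {1<..} \<and> loop_weight b t * t ^ k = loop_weight b t * t ^ k + 0" if "Im t \<noteq> 0" for t
      using that by (simp add: slit_def)
  qed
  define I where "I k = (SOME I. \<forall>\<gamma>. origin_loop (slit {1<..}) \<gamma> \<longrightarrow> ((\<lambda>t. loop_weight b t * t ^ k) has_contour_integral I) \<gamma>)" for k
  have I: "\<forall>\<gamma>. origin_loop (slit {1<..}) \<gamma> \<longrightarrow> ((\<lambda>t. loop_weight b t * t ^ k) has_contour_integral I k) \<gamma>" for k
    unfolding I_def by (rule someI_ex[OF ex])
  define C where "C = I 0 / of_real (ibeta_coeff b 0)"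
  have loop: "origin_loop (slit {1<..}) (origin_circle 1)" by (rule origin_loop_circle) auto
  have "I k = C * of_real (ibeta_coeff b k)" for k
  proof (induction k)
    case 0
    then show ?case using ibeta_coeff_pos[OF assms, of 0] by (simp add: C_def)
  next
    case (Suc k)
    have "((\<lambda>t. of_real (real k + 3/2) * (loop_weight b t * t ^ Suc k) - of_real (real k + 1/2 + b) * (loop_weight b t * t ^ k))
       has_contour_integral (of_real (real k + 3/2) * I (Suc k) - of_real (real k + 1/2 + b) * I k)) (origin_circle 1)"
      by (rule has_contour_integral_diff; rule has_contour_integral_lmul; rule I[rule_format, OF loop])
    from has_contour_integral_unique[OF this loop_integral_recurrence[OF assms loop, of k]]
    have "of_real (real k + 3/2) * I (Suc k) = of_real (real k + 1/2 + b) * I k"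
      by (rule eq_iff_diff_eq_0[THEN iffD2])
    also have "\<dots> = C * of_real ((real k + 1/2 + b) * ibeta_coeff b k)"
      unfolding Suc.IH of_real_mult by (simp only: mult_ac)
    also have "\<dots> = of_real (real k + 3/2) * (C * of_real (ibeta_coeff b (Suc k)))"
      unfolding ibeta_coeff_Suc[OF assms, symmetric] of_real_mult by (simp only: mult_ac)
    finally have eq: "of_real (real k + 3/2) * I (Suc k) = of_real (real k + 3/2) * (C * of_real (ibeta_coeff b (Suc k)))" .
    have "complex_of_real (real k + 3/2) \<noteq> 0" by (simp only: of_real_eq_0_iff)
    then show ?case using eq by (metis mult_left_cancel)
  qed
  with I show ?thesis by (intro that[of C]) simp
qed

text \<open>A loop that crosses the axis only beyond \<rho> encloses the pole:
  \<open>Ln (t - \<rho>)\<close> is single valued along it and its boundary values at the origin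
  differ by \<open>2 * pi * \<i>\<close>.\<close>

lemma contour_integral_simple_pole_inside:
  assumes "origin_loop (slit {\<rho><..}) \<gamma>" "\<rho> > 0"
  shows "((\<lambda>t. 1 / (t - of_real \<rho>)) has_contour_integral (2 * of_real pi * \<i>)) \<gamma>"
proof -
  have F: "((\<lambda>t. Ln (t - of_real \<rho>)) has_field_derivative 1 / (t - of_real \<rho>)) (at t)" if "t \<in> slit {\<rho><..}" for t
  proof -
    have "t - of_real \<rho> \<notin> \<real>\<^sub>\<le>\<^sub>0" using that by (auto simp: slit_def complex_nonpos_Reals_iff)
    then show ?thesis by (auto intro!: derivative_eq_intros simp: inverse_eq_divide)
  qed
  have r: "complex_of_real \<rho> - t \<noteq> 0" if "Im t \<noteq> 0" for t using that by (auto simp: complex_eq_iff)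
  have Lu: "Ln (t - of_real \<rho>) = Ln (of_real \<rho> - t) + \<i> * pi" if "Im t > 0" for t
    using Ln_minus[OF r, of t] that by simp
  have Ll: "Ln (t - of_real \<rho>) = Ln (of_real \<rho> - t) - \<i> * pi" if "Im t < 0" for t
    using Ln_minus[OF r, of t] that by simp
  have c: "((\<lambda>t. Ln (of_real \<rho> - t) + c) \<longlongrightarrow> Ln (of_real \<rho> - 0) + c) (at 0 within H)" for c H
    by (intro tendsto_intros) (use assms in \<open>auto simp: complex_nonpos_Reals_iff\<close>)
  have "((\<lambda>t. Ln (t - of_real \<rho>)) \<longlongrightarrow> Ln (of_real \<rho>) + \<i> * pi) (at 0 within {t. Im t > 0})"
    by (rule Lim_transform_eventually[OF c[of "\<i> * pi", simplified]])
       (auto simp: eventually_at_filter Lu intro!: always_eventually)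
  moreover have "((\<lambda>t. Ln (t - of_real \<rho>)) \<longlongrightarrow> Ln (of_real \<rho> - 0) + - (\<i> * pi)) (at 0 within {t. Im t < 0})"
    by (rule Lim_transform_eventually[OF c[of "- (\<i> * pi)"]])
       (auto simp: eventually_at_filter Ll intro!: always_eventually)
  ultimately have "((\<lambda>t. 1 / (t - of_real \<rho>)) has_contour_integral
      ((Ln (of_real \<rho>) + \<i> * pi) - (Ln (of_real \<rho> - 0) + - (\<i> * pi)))) \<gamma>"
    using assms(1)
    by (intro has_contour_integral_primitive_limits[where D="slit {\<rho><..}" and F="\<lambda>t. Ln (t - of_real \<rho>)"] F
        filterlim_compose[OF _ origin_loop_limits(1)[OF assms(1)]]
        filterlim_compose[OF _ origin_loop_limits(2)[OF assms(1)]]) (auto simp: origin_loop_def)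
  then show ?thesis by (simp add: algebra_simps)
qed

text \<open>When the crossing lies to the left of \<rho>, the function
  \<open>Ln (\<rho> - t)\<close> is a primitive that is continuous at the origin, so nothing
  accumulates.\<close>

lemma contour_integral_simple_pole_outside:
  assumes "origin_loop (slit {..<\<rho>}) \<gamma>" "\<rho> > 0"
  shows "((\<lambda>t. 1 / (t - of_real \<rho>)) has_contour_integral 0) \<gamma>"
proof -
  have F: "((\<lambda>t. Ln (of_real \<rho> - t)) has_field_derivative 1 / (t - of_real \<rho>)) (at t)" if "t \<in> slit {..<\<rho>}" for t
  proof -
    have *: "of_real \<rho> - t \<notin> \<real>\<^sub>\<le>\<^sub>0" using that by (auto simp: slit_def complex_nonpos_Reals_iff)
    then have "t \<noteq> of_real \<rho>" by auto
    have "((\<lambda>t. Ln (of_real \<rho> - t)) has_field_derivative - 1 / (of_real \<rho> - t)) (at t)"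
      using * by (auto intro!: derivative_eq_intros simp: field_simps)
    also have "- 1 / (of_real \<rho> - t) = 1 / (t - of_real \<rho>)"
      by (metis minus_diff_eq divide_minus_left divide_minus_right minus_minus)
    finally show ?thesis .
  qed
  have c: "((\<lambda>t. Ln (of_real \<rho> - t)) \<longlongrightarrow> Ln (of_real \<rho> - 0)) (at 0 within H)" for H
    by (intro tendsto_intros) (use assms in \<open>auto simp: complex_nonpos_Reals_iff\<close>)
  have "((\<lambda>t. 1 / (t - of_real \<rho>)) has_contour_integral
      (Ln (of_real \<rho> - 0) - Ln (of_real \<rho> - 0))) \<gamma>"
    using assms(1)
    by (intro has_contour_integral_primitive_limits[where D="slit {..<\<rho>}" and F="\<lambda>t. Ln (of_real \<rho> - t)"] F
        filterlim_compose[OF c origin_loop_limits(1)[OF assms(1)]]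
        filterlim_compose[OF c origin_loop_limits(2)[OF assms(1)]]) (auto simp: origin_loop_def)
  then show ?thesis by simp
qed

text \<open>Removing the pole leaves a function \<open>e\<close> holomorphic across \<rho>, whose
  integral is common to both loops; the pole part contributes 0 to one loop and the residue to the
  other. A residue theorem for closed paths would not apply directly, since the weight is not
  holomorphic at the base point.\<close>

lemma loop_weight_residue:
  assumes "b > 0" "\<rho> > 1"
    and s: "origin_loop (slit {1<..<\<rho>}) \<gamma>" and l: "origin_loop (slit {\<rho><..}) \<gamma>'"
  obtains I where "((\<lambda>t. loop_weight b t / (t - of_real \<rho>)) has_contour_integral I) \<gamma>"
    "((\<lambda>t. loop_weight b t / (t - of_real \<rho>)) has_contour_integral (I + 2 * of_real pi * \<i> * loop_weight b \<rho>)) \<gamma>'"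
proof -
  define e where "e t = (if t = of_real \<rho> then deriv (loop_weight b) \<rho>
      else (loop_weight b t - loop_weight b \<rho>) / (t - of_real \<rho>))" for t
  have op: "open (slit {1<..})" by (rule open_slit) simp
  have s1: "origin_loop (slit {1<..}) \<gamma>" "origin_loop (slit {..<\<rho>}) \<gamma>"
    using s by (auto elim!: origin_loop_mono simp: slit_def)
  have l1: "origin_loop (slit {1<..}) \<gamma>'"
    using l assms(2) by (auto elim!: origin_loop_mono simp: slit_def)
  have "\<exists>I. \<forall>\<gamma>. origin_loop (slit {1<..}) \<gamma> \<longrightarrow> (e has_contour_integral I) \<gamma>"
  proof (rule loop_integral_exists[OF op _ _ assms(1)])
    show "starlike (slit {1<..})" by (rule starlike_slit) auto
    show "e holomorphic_on slit {1<..}" unfolding e_def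
      by (intro pole_lemma_open loop_weight_holomorphic op)
    have ne: "t - of_real \<rho> \<noteq> 0" if "norm t < 1" for t :: complex using that assms(2) by auto
    show "(\<lambda>t. 1 / (t - of_real \<rho>)) holomorphic_on ball 0 1"
      by (intro holomorphic_intros ne) auto
    show "(\<lambda>t. - loop_weight b \<rho> / (t - of_real \<rho>)) holomorphic_on ball 0 1"
      by (intro holomorphic_intros ne) auto
    show "t \<in> slit {1<..} \<and> e t = loop_weight b t * (1 / (t - of_real \<rho>)) + - loop_weight b \<rho> / (t - of_real \<rho>)"
      if "norm t < 1" "Im t \<noteq> 0" for t
      using ne[OF that(1)] that(2) by (auto simp: slit_def e_def diff_divide_distrib)
  qed
  then obtain I where I: "(e has_contour_integral I) \<gamma>" "(e has_contour_integral I) \<gamma>'"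
    using s1 l1 by blast
  \<comment> \<open>Replacing the integrand is legitimate because the path avoids \<rho>: inside the
    interval it stays in \<open>D\<close>, and both ends are 0.\<close>
  have cong: "((\<lambda>t. loop_weight b t / (t - of_real \<rho>)) has_contour_integral J) \<gamma>"
    if "((\<lambda>t. e t + loop_weight b \<rho> * (1 / (t - of_real \<rho>))) has_contour_integral J) \<gamma>"
      "origin_loop D \<gamma>" "of_real \<rho> \<notin> D" for \<gamma> J D
  proof (rule has_contour_integral_eq[OF that(1)])
    fix t assume "t \<in> path_image \<gamma>"
    then obtain u where u: "u \<in> {0..1}" "t = \<gamma> u" by (auto simp: path_image_def)
    have "t \<noteq> of_real \<rho>"
    proof (cases "u = 0 \<or> u = 1")
      case True
      then have "t = 0" using u that(2) by (auto simp: origin_loop_def)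
      then show ?thesis using assms(2) by auto
    next
      case False
      then have "t \<in> D" using u that(2) by (auto simp: origin_loop_def)
      then show ?thesis using that(3) by auto
    qed
    then show "e t + loop_weight b \<rho> * (1 / (t - of_real \<rho>)) = loop_weight b t / (t - of_real \<rho>)"
      by (simp add: e_def diff_divide_distrib)
  qed
  have "((\<lambda>t. loop_weight b t / (t - of_real \<rho>)) has_contour_integral (I + loop_weight b \<rho> * 0)) \<gamma>"
    by (rule cong[OF _ s], intro has_contour_integral_add has_contour_integral_lmul I
        contour_integral_simple_pole_outside s1) (use assms in \<open>auto simp: slit_def\<close>)
  moreover have "((\<lambda>t. loop_weight b t / (t - of_real \<rho>)) has_contour_integral (I + loop_weight b \<rho> * (2 * of_real pi * \<i>))) \<gamma>'"
    by (rule cong[OF _ l], intro has_contour_integral_add has_contour_integral_lmul I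
        contour_integral_simple_pole_inside l) (use assms in \<open>auto simp: slit_def\<close>)
  ultimately show ?thesis using that[of I] by (simp add: mult_ac)
qed

lemma loop_weight_of_real:
  assumes "\<rho> > 1" shows "loop_weight b (of_real \<rho>) = of_real (\<rho> powr (b - 1/2) * (\<rho> - 1) powr (- b))"
proof -
  have "Ln (of_real \<rho> - 1) = of_real (ln (\<rho> - 1))"
    using Ln_of_real[of "\<rho> - 1"] assms by simp
  then show ?thesis using assms
    by (subst loop_weight_eq) (auto simp: Ln_of_real powr_def exp_add[symmetric] exp_of_real[symmetric] algebra_simps)
qed

text \<open>The constant is found by letting the pole \<open>\<rho> = 1/y\<close> approach \<open>1\<close>: the incomplete beta function
  tends to \<open>1\<close>, while moving the contour across the pole leaves only the residue.\<close>

lemma loop_weight_power_integral: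
  assumes "b > 0" "origin_loop (slit {1<..}) \<gamma>"
  shows "((\<lambda>t. loop_weight b t * t ^ k) has_contour_integral (2 * of_real pi * \<i> * of_real (ibeta_coeff b k))) \<gamma>"
proof -
  obtain C where C: "\<And>k \<gamma>. origin_loop (slit {1<..}) \<gamma> \<Longrightarrow>
     ((\<lambda>t. loop_weight b t * t ^ k) has_contour_integral (C * of_real (ibeta_coeff b k))) \<gamma>"
    using loop_weight_power_integral_ex[OF assms(1)] by blast
  obtain h where h: "h integrable_on {0..1}"
    "\<And>s. s \<in> {0..1} \<Longrightarrow> norm (loop_weight b (origin_circle 2 s) * vector_derivative (origin_circle 2) (at s within {0..1})) \<le> h s"
    using loop_weight_circle_dominated[OF assms(1), of 2] by auto
  define B where "B = integral {0..1} h"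
  \<comment> \<open>The difference will be the prefactor, which contains
    \<open>(1 - y) powr b\<close>, times an integral over a fixed large circle that stays bounded as
    \<open>y\<close> tends to 1.\<close>
  have bound: "norm (C * of_real (incomplete_beta y (1/2) b) - 2 * of_real pi * \<i>) \<le> 2 * (1 - y) powr b * B"
    if y: "1/2 < y" "y < 1" for y
  proof -
    define \<rho> where "\<rho> = 1 / y"
    have \<rho>: "1 < \<rho>" "\<rho> < 2" using y by (auto simp: \<rho>_def field_simps)
    \<comment> \<open>This puts the crossing point \<open>2 * R\<close> midway between the branch
      point 1 and the pole \<rho>.\<close>
    define R where "R = (1 + \<rho>) / 4"
    have R: "R > 1/2" "1 < 2 * R" "2 * R < \<rho>" "R > 0" using \<rho> by (auto simp: R_def)
    have small: "origin_loop (slit {1<..<\<rho>}) (origin_circle R)" using R by (intro origin_loop_circle) auto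
    have large: "origin_loop (slit {\<rho><..}) (origin_circle 2)" using \<rho> by (intro origin_loop_circle) auto
    obtain I where I: "((\<lambda>t. loop_weight b t / (t - of_real \<rho>)) has_contour_integral I) (origin_circle R)"
      "((\<lambda>t. loop_weight b t / (t - of_real \<rho>)) has_contour_integral (I + 2 * of_real pi * \<i> * loop_weight b \<rho>)) (origin_circle 2)"
      using loop_weight_residue[OF assms(1) \<rho>(1) small large] by blast
    have yR: "y * (2 * R) < 1" using R y by (simp add: \<rho>_def field_simps)
    have ser: "(\<Sum>k. of_real y ^ k * t ^ k) = (- of_real \<rho>) * (1 / (t - of_real \<rho>))" if "norm t \<le> 2 * R" for t :: complex
    proof -
      have "norm (of_real y * t) \<le> y * (2 * R)" using that y by (simp add: norm_mult)
      with yR have n: "norm (of_real y * t) < 1" by simp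
      then have "of_real y * t \<noteq> 1" by auto
      moreover from this have "t \<noteq> of_real \<rho>" using y by (auto simp: \<rho>_def)
      moreover have "complex_of_real y * of_real \<rho> = 1" using y by (simp add: \<rho>_def)
      ultimately have "1 / (1 - of_real y * t) = (- of_real \<rho>) * (1 / (t - of_real \<rho>))"
        by (simp add: divide_simps) (simp add: algebra_simps)
      then show ?thesis using suminf_geometric[OF n] by (simp add: power_mult_distrib)
    qed
    have "(\<lambda>k. of_real y ^ k * (C * of_real (ibeta_coeff b k))) sums ((- of_real \<rho>) * I)"
    proof (rule loop_integral_series[OF assms(1) R(1)])
      show "summable (\<lambda>k. norm (complex_of_real y ^ k) * (2 * R) ^ k)"
        using summable_geometric[of "y * (2 * R)"] yR R y by (simp add: norm_power power_mult_distrib)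
      show "((\<lambda>t. loop_weight b t * t ^ k) has_contour_integral (C * of_real (ibeta_coeff b k))) (origin_circle R)" for k
        by (rule C[OF origin_loop_mono[OF small]]) (auto simp: slit_def)
      show "((\<lambda>t. loop_weight b t * (\<Sum>k. of_real y ^ k * t ^ k)) has_contour_integral - of_real \<rho> * I) (origin_circle R)"
      proof (rule has_contour_integral_eq[OF has_contour_integral_lmul[OF I(1), of "- of_real \<rho>"]])
        fix t assume "t \<in> path_image (origin_circle R)"
        then obtain u where "u \<in> {0..1}" "t = origin_circle R u" by (auto simp: path_image_def)
        then have "norm t \<le> 2 * R" using origin_circle_norm[of R u] R by simp
        from ser[OF this] show "- of_real \<rho> * (loop_weight b t / (t - of_real \<rho>)) = loop_weight b t * (\<Sum>k. of_real y ^ k * t ^ k)"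
          by simp
      qed
    qed
    moreover define P where "P = sqrt y * (1 - y) powr b"
    ultimately have s1: "(\<lambda>k. of_real P * (of_real y ^ k * (C * of_real (ibeta_coeff b k)))) sums (of_real P * ((- of_real \<rho>) * I))"
      by (intro sums_mult)
    have "(\<lambda>k. C * of_real (ibeta_term y b k)) sums (C * of_real (incomplete_beta y (1/2) b))"
      using ibeta_term_sums[OF assms(1), of y] y by (intro sums_mult) (simp add: sums_of_real_iff)
    then have "(\<lambda>k. of_real P * (of_real y ^ k * (C * of_real (ibeta_coeff b k)))) sums (C * of_real (incomplete_beta y (1/2) b))"
      using y by (simp add: ibeta_term_coeff P_def mult_ac)
    with s1 have eq: "C * of_real (incomplete_beta y (1/2) b) = of_real P * ((- of_real \<rho>) * I)"
      by (rule sums_unique2[symmetric])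
    define I2 where "I2 = I + 2 * of_real pi * \<i> * loop_weight b \<rho>"
    \<comment> \<open>The residue and the prefactor of the beta series are reciprocal, so crossing
      the pole contributes exactly \<open>2 * pi * \<i>\<close> whatever \<open>y\<close>
      is.\<close>
    have "P * \<rho> * (\<rho> powr (b - 1/2) * (\<rho> - 1) powr (- b)) = 1"
    proof -
      have "1 - y = (\<rho> - 1) / \<rho>" "sqrt y = \<rho> powr (- (1/2))"
        using y by (simp_all add: \<rho>_def field_simps powr_minus powr_half_sqrt real_sqrt_divide)
      then have "P * \<rho> = \<rho> powr (- (1/2)) * ((\<rho> - 1) powr b / \<rho> powr b) * \<rho> powr 1"
        using \<rho> by (simp add: P_def powr_divide)
      moreover have "\<rho> powr (- (1/2)) * \<rho> powr 1 * \<rho> powr (b - 1/2) = \<rho> powr b"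
        by (simp only: powr_add[symmetric]) simp
      ultimately show ?thesis using \<rho> by (simp add: powr_minus field_simps)
    qed
    then have "of_real P * of_real \<rho> * loop_weight b \<rho> = (1::complex)"
      unfolding loop_weight_of_real[OF \<rho>(1)] by (metis of_real_1 of_real_mult)
    then have eq2: "C * of_real (incomplete_beta y (1/2) b) - 2 * of_real pi * \<i>
       = - (of_real P * of_real \<rho> * I2)"
      unfolding eq I2_def by (simp add: algebra_simps)
    have I2B: "norm I2 \<le> B"
    proof -
      let ?f = "\<lambda>s. loop_weight b (origin_circle 2 s) / (origin_circle 2 s - of_real \<rho>)
            * vector_derivative (origin_circle 2) (at s within {0..1})"
      have f: "(?f has_integral I2) {0..1}" using I(2) unfolding has_contour_integral_def I2_def .
      have "norm (integral {0..1} ?f) \<le> B" unfolding B_def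
      proof (rule integral_norm_bound_integral[OF _ h(1)])
        fix s :: real assume s: "s \<in> {0..1}"
        \<comment> \<open>The circle has centre 2 and radius 2 while \<rho> lies between 1 and 2, so
          its distance from \<rho> is at least \<rho>, hence at least 1.\<close>
        have "2 = norm (origin_circle 2 s - 2)" by (simp add: origin_circle_eq norm_mult)
        also have "\<dots> \<le> norm (origin_circle 2 s - of_real \<rho>) + norm (2 - complex_of_real \<rho>)"
          using norm_triangle_ineq4[of "origin_circle 2 s - of_real \<rho>" "2 - complex_of_real \<rho>"] by simp
        also have "norm (2 - complex_of_real \<rho>) = 2 - \<rho>"
          using \<rho> norm_of_real[where ?'a=complex, of "2 - \<rho>"] by simp
        finally have "1 \<le> norm (origin_circle 2 s - of_real \<rho>)" using \<rho> by simp
        then have "norm (loop_weight b (origin_circle 2 s) * vector_derivative (origin_circle 2) (at s within {0..1})) / norm (origin_circle 2 s - of_real \<rho>)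
          \<le> norm (loop_weight b (origin_circle 2 s) * vector_derivative (origin_circle 2) (at s within {0..1})) / 1"
          by (intro frac_le) auto
        then have "norm (?f s) \<le> norm (loop_weight b (origin_circle 2 s) * vector_derivative (origin_circle 2) (at s within {0..1}))"
          by (simp add: norm_mult norm_divide)
        then show "norm (?f s) \<le> h s" using h(2)[OF s] by simp
      qed (use f in blast)
      then show ?thesis using integral_unique[OF f] by simp
    qed
    have "norm (- (of_real P * of_real \<rho> * I2)) = P * \<rho> * norm I2" using y \<rho> by (simp add: norm_mult P_def)
    also have "\<dots> \<le> P * \<rho> * B"
    proof -
      show ?thesis using I2B y \<rho> by (intro mult_left_mono) (auto simp: P_def)
    qed
    also have "P * \<rho> * B \<le> 2 * (1 - y) powr b * B"
    proof -
      have "sqrt y * \<rho> \<le> 1 * 2" using y \<rho> by (intro mult_mono) auto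
      moreover have "B \<ge> 0" using I2B by (rule order_trans[OF norm_ge_zero])
      ultimately have "sqrt y * \<rho> * ((1 - y) powr b * B) \<le> 2 * ((1 - y) powr b * B)"
        by (intro mult_right_mono) auto
      then show ?thesis by (simp add: P_def mult_ac)
    qed
    finally show ?thesis unfolding eq2 .
  qed
  have ev: "\<forall>\<^sub>F y in at_left 1. (1/2::real) < y \<and> y < 1"
    by (auto simp: eventually_at_left_field intro!: exI[of _ "1/2"])
  have "((\<lambda>y. incomplete_beta y (1/2) b) \<longlongrightarrow> incomplete_beta 1 (1/2) b) (at_left 1)"
    using continuous_on_Icc_at_leftD[OF continuous_on_incomplete_beta[of "1/2" b]] assms(1) by simp
  then have "((\<lambda>y. norm (C * of_real (incomplete_beta y (1/2) b) - 2 * of_real pi * \<i>)) \<longlongrightarrow>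
      norm (C * of_real 1 - 2 * of_real pi * \<i>)) (at_left 1)"
    using assms(1) by (intro tendsto_intros) (simp add: incomplete_beta_1)
  moreover have "((\<lambda>y. 2 * (1 - y) powr b * B) \<longlongrightarrow> 2 * (1 - 1) powr b * B) (at_left 1)"
    by (intro tendsto_intros tendsto_powr') (use assms(1) in \<open>auto simp: eventually_at_left_field intro!: exI[of _ 0]\<close>)
  ultimately have "norm (C * of_real 1 - 2 * of_real pi * \<i>) \<le> 2 * (1 - 1) powr b * B"
    by (intro tendsto_le[of "at_left (1::real)"]) (use bound ev in \<open>auto elim!: eventually_mono\<close>)
  then have "C = 2 * of_real pi * \<i>" by simp
  with C[OF assms(2), of k] show ?thesis by simp
qed

section \<open>From winding numbers to sides of the cut, and the contour representation\<close>

lemma continuous_nonzero_Im_sign: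
  assumes "continuous_on S \<gamma>" "connected S" "\<And>s. s \<in> S \<Longrightarrow> Im (\<gamma> s) \<noteq> 0"
  shows "(\<forall>s\<in>S. Im (\<gamma> s) < 0) \<or> (\<forall>s\<in>S. Im (\<gamma> s) > 0)"
proof (rule ccontr)
  assume "\<not> ?thesis"
  then obtain a b where ab: "a \<in> S" "b \<in> S" "Im (\<gamma> a) \<ge> 0" "Im (\<gamma> b) \<le> 0" by (auto simp: not_less)
  have "connected ((\<lambda>s. Im (\<gamma> s)) ` S)"
    by (intro connected_continuous_image continuous_intros assms)
  from connectedD_interval[OF this, of "Im (\<gamma> b)" "Im (\<gamma> a)" 0] ab assms(3) show False by fastforce
qed

text \<open>Along the path the logarithm \<open>Ln (t - 1)\<close> changes by \<open>2 * pi * \<i>\<close>, which forces its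
  boundary values at the two ends to be \<open>- pi * \<i>\<close> and \<open>pi * \<i>\<close>.\<close>

lemma loop_contour_origin_loop:
  assumes "\<rho> > 1" "loop_contour \<rho> \<gamma>"
  shows "origin_loop (slit {1<..<\<rho>}) \<gamma>"
proof -
  have vp: "valid_path \<gamma>" and g0: "\<gamma> 0 = 0" and g1: "\<gamma> 1 = 0"
    and av: "\<And>s. s \<in> {0<..<1} \<Longrightarrow> \<gamma> s \<notin> complex_of_real ` ({..1} \<union> {\<rho>..})" and wn: "winding_number \<gamma> 1 = 1"
    using assms(2) by (auto simp: loop_contour_def pathstart_def pathfinish_def)
  have D: "\<gamma> s \<in> slit {1<..<\<rho>}" if "s \<in> {0<..<1}" for s
    unfolding slit_def
  proof safe
    assume "Im (\<gamma> s) = 0"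
    then have eq: "\<gamma> s = of_real (Re (\<gamma> s))" by (simp add: complex_eq_iff)
    show "Re (\<gamma> s) \<in> {1<..<\<rho>}"
    proof (rule ccontr)
      assume "Re (\<gamma> s) \<notin> {1<..<\<rho>}"
      then have "Re (\<gamma> s) \<in> {..1} \<union> {\<rho>..}" by auto
      with eq have "\<gamma> s \<in> complex_of_real ` ({..1} \<union> {\<rho>..})" by (rule image_eqI)
      with av[OF that] show False by simp
    qed
  qed
  have c: "continuous_on {0..1} \<gamma>" using vp by (auto simp: valid_path_def piecewise_C1_differentiable_on_def)
  have t0: "(\<gamma> \<longlongrightarrow> 0) (at_right 0)" and t1: "(\<gamma> \<longlongrightarrow> 0) (at_left 1)"
    using continuous_on_Icc_at_rightD[OF c] continuous_on_Icc_at_leftD[OF c] g0 g1 by auto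
  have nz: "Im (\<gamma> s) \<noteq> 0" if "s \<in> {0<..<1}" "norm (\<gamma> s) < 1" for s
    using D[OF that(1)] that(2) complex_Re_le_cmod[of "\<gamma> s"] by (auto simp: slit_def)
  have s0: "(\<forall>\<^sub>F s in at_right 0. Im (\<gamma> s) < 0) \<or> (\<forall>\<^sub>F s in at_right 0. Im (\<gamma> s) > 0)"
  proof -
    have "\<forall>\<^sub>F s in at_right 0. norm (\<gamma> s) < 1"
      using tendsto_norm[OF t0] by (rule order_tendstoD) simp
    then obtain d where d: "d > 0" "\<And>s. 0 < s \<Longrightarrow> s < d \<Longrightarrow> norm (\<gamma> s) < 1"
      by (auto simp: eventually_at_right_field)
    have "(\<forall>s\<in>{0<..<min d 1}. Im (\<gamma> s) < 0) \<or> (\<forall>s\<in>{0<..<min d 1}. Im (\<gamma> s) > 0)"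
      by (rule continuous_nonzero_Im_sign) (use d nz in \<open>auto intro: continuous_on_subset[OF c]\<close>)
    then show ?thesis
      using d(1) by (auto simp: eventually_at_right_field intro!: exI[of _ "min d 1"])
  qed
  have s1: "(\<forall>\<^sub>F s in at_left 1. Im (\<gamma> s) < 0) \<or> (\<forall>\<^sub>F s in at_left 1. Im (\<gamma> s) > 0)"
  proof -
    have "\<forall>\<^sub>F s in at_left 1. norm (\<gamma> s) < 1"
      using tendsto_norm[OF t1] by (rule order_tendstoD) simp
    then obtain d where d: "d < 1" "\<And>s. d < s \<Longrightarrow> s < 1 \<Longrightarrow> norm (\<gamma> s) < 1"
      by (auto simp: eventually_at_left_field)
    have "(\<forall>s\<in>{max d 0<..<1}. Im (\<gamma> s) < 0) \<or> (\<forall>s\<in>{max d 0<..<1}. Im (\<gamma> s) > 0)"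
      by (rule continuous_nonzero_Im_sign) (use d nz in \<open>auto intro: continuous_on_subset[OF c]\<close>)
    then show ?thesis
      using d(1) by (auto simp: eventually_at_left_field intro!: exI[of _ "max d 0"])
  qed
  have up: "((\<lambda>s. Ln (\<gamma> s - 1)) \<longlongrightarrow> \<i> * pi) F" if "(\<gamma> \<longlongrightarrow> 0) F" "\<forall>\<^sub>F s in F. Im (\<gamma> s) > 0" for F :: "real filter"
  proof (rule Lim_transform_eventually)
    have "((\<lambda>s. Ln (1 - \<gamma> s) + \<i> * pi) \<longlongrightarrow> Ln (1 - 0) + \<i> * pi) F"
      by (intro tendsto_intros that) auto
    then show "((\<lambda>s. Ln (1 - \<gamma> s) + \<i> * pi) \<longlongrightarrow> \<i> * pi) F" by simp
    show "\<forall>\<^sub>F s in F. Ln (1 - \<gamma> s) + \<i> * pi = Ln (\<gamma> s - 1)"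
      using that(2) by eventually_elim (simp add: Ln_minus1_upper)
  qed
  have lo: "((\<lambda>s. Ln (\<gamma> s - 1)) \<longlongrightarrow> - (\<i> * pi)) F" if "(\<gamma> \<longlongrightarrow> 0) F" "\<forall>\<^sub>F s in F. Im (\<gamma> s) < 0" for F :: "real filter"
  proof (rule Lim_transform_eventually)
    have "((\<lambda>s. Ln (1 - \<gamma> s) - \<i> * pi) \<longlongrightarrow> Ln (1 - 0) - \<i> * pi) F"
      by (intro tendsto_intros that) auto
    then show "((\<lambda>s. Ln (1 - \<gamma> s) - \<i> * pi) \<longlongrightarrow> - (\<i> * pi)) F" by simp
    show "\<forall>\<^sub>F s in F. Ln (1 - \<gamma> s) - \<i> * pi = Ln (\<gamma> s - 1)"
      using that(2) by eventually_elim (simp add: Ln_minus1_lower)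
  qed
  have "1 \<notin> path_image \<gamma>"
  proof
    assume "1 \<in> path_image \<gamma>"
    then obtain u where u: "u \<in> {0..1}" "1 = \<gamma> u" by (auto simp: path_image_def)
    then have "u \<in> {0<..<1}" using g0 g1 by (cases "u = 0"; cases "u = 1") auto
    with D[of u] u show False by (auto simp: slit_def)
  qed
  from winding_number_valid_path[OF vp this] wn
  have ci: "contour_integral \<gamma> (\<lambda>w. 1 / (w - 1)) = 2 * pi * \<i>" by (simp add: field_simps)
  have int: "b - a = 2 * pi * \<i>"
    if "((\<lambda>s. Ln (\<gamma> s - 1)) \<longlongrightarrow> a) (at_right 0)" "((\<lambda>s. Ln (\<gamma> s - 1)) \<longlongrightarrow> b) (at_left 1)" for a b
  proof -
    have "((\<lambda>w. 1 / (w - 1)) has_contour_integral (b - a)) \<gamma>"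
    proof (rule has_contour_integral_primitive_limits[OF vp D _ that])
      fix t assume "t \<in> slit {1<..<\<rho>}"
      then have "t - 1 \<notin> \<real>\<^sub>\<le>\<^sub>0" by (auto simp: slit_def complex_nonpos_Reals_iff)
      then show "((\<lambda>t. Ln (t - 1)) has_field_derivative 1 / (t - 1)) (at t)"
        by (auto intro!: derivative_eq_intros simp: inverse_eq_divide)
    qed
    then show ?thesis using ci by (simp add: contour_integral_unique)
  qed
  have "(\<forall>\<^sub>F s in at_right 0. Im (\<gamma> s) < 0) \<and> (\<forall>\<^sub>F s in at_left 1. Im (\<gamma> s) > 0)"
    \<comment> \<open>Equal sides at both ends would give increment 0, upper to lower would give
      \<open>- 2 * pi * \<i>\<close>; only lower to upper agrees with winding number 1.\<close>
    using s0 s1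
  proof (elim disjE)
    assume "\<forall>\<^sub>F s in at_right 0. Im (\<gamma> s) < 0" "\<forall>\<^sub>F s in at_left 1. Im (\<gamma> s) < 0"
    from int[OF lo[OF t0 this(1)] lo[OF t1 this(2)]] show ?thesis by simp
  next
    assume "\<forall>\<^sub>F s in at_right 0. Im (\<gamma> s) > 0" "\<forall>\<^sub>F s in at_left 1. Im (\<gamma> s) < 0"
    from int[OF up[OF t0 this(1)] lo[OF t1 this(2)]] show ?thesis by (simp add: complex_eq_iff)
  next
    assume "\<forall>\<^sub>F s in at_right 0. Im (\<gamma> s) > 0" "\<forall>\<^sub>F s in at_left 1. Im (\<gamma> s) > 0"
    from int[OF up[OF t0 this(1)] up[OF t1 this(2)]] show ?thesis by simp
  qed auto
  then show ?thesis using vp g0 g1 D by (simp add: origin_loop_def)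
qed

text \<open>The Cauchy product of the exponential and the geometric series. The absolute version is
  what termwise integration over the circle requires.\<close>

lemma exp_geometric_series:
  fixes m y t :: "'a::{banach,real_normed_field}"
  assumes "norm (y * t) < 1"
  shows "summable (\<lambda>k. norm (\<Sum>j\<le>k. m ^ j / fact j * y ^ (k - j)) * norm t ^ k)" (is ?A)
    and "(\<lambda>k. (\<Sum>j\<le>k. m ^ j / fact j * y ^ (k - j)) * t ^ k) sums (exp (m * t) / (1 - y * t))" (is ?B)
proof -
  have 1: "summable (\<lambda>j. norm ((m * t) ^ j / fact j))"
    using summable_norm_exp[of "m * t"] by (simp add: divide_inverse mult_ac scaleR_conv_of_real)
  have 2: "summable (\<lambda>j. norm ((y * t) ^ j))"
    using assms by (simp add: norm_power)
  have e: "(\<Sum>j\<le>k. (m * t) ^ j / fact j * (y * t) ^ (k - j)) = (\<Sum>j\<le>k. m ^ j / fact j * y ^ (k - j)) * t ^ k" for k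
    unfolding sum_distrib_right
    by (rule sum.cong) (auto simp: power_mult_distrib field_simps power_add[symmetric])
  have ex: "(\<Sum>j. (m * t) ^ j / fact j) = exp (m * t)"
    by (simp add: exp_def divide_inverse mult_ac scaleR_conv_of_real)
  from Cauchy_product_sums[OF 1 2] show ?B
    unfolding e ex suminf_geometric[OF assms] by simp
  have 3: "summable (\<lambda>k. \<Sum>j\<le>k. norm ((m * t) ^ j / fact j) * norm ((y * t) ^ (k - j)))"
    using summable_Cauchy_product[of "\<lambda>j. norm ((m * t) ^ j / fact j)" "\<lambda>j. norm ((y * t) ^ j)"] 1 2 by simp
  show ?A
  proof (rule summable_comparison_test'[OF 3])
    fix k
    have "norm (\<Sum>j\<le>k. m ^ j / fact j * y ^ (k - j)) * norm t ^ k = norm (\<Sum>j\<le>k. (m * t) ^ j / fact j * (y * t) ^ (k - j))"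
      by (simp only: e norm_mult norm_power)
    also have "\<dots> \<le> (\<Sum>j\<le>k. norm ((m * t) ^ j / fact j) * norm ((y * t) ^ (k - j)))"
      by (rule sum_norm_le) (rule norm_mult_ineq)
    finally show "norm (norm (\<Sum>j\<le>k. m ^ j / fact j * y ^ (k - j)) * norm t ^ k)
        \<le> (\<Sum>j\<le>k. norm ((m * t) ^ j / fact j) * norm ((y * t) ^ (k - j)))" by simp
  qed
qed

text \<open>With exponential rate \<open>\<mu> * y\<close> and pole at \<open>1 / y\<close>, the
  k-th Taylor coefficient of the remaining factor is \<open>y ^ k\<close> times a partial sum of the
  exponential series. Multiplied by the moments, this is the rearranged Poisson mixture.\<close>

lemma poisson_ibeta_loop_integral:
  assumes "b > 0" "0 < y" "y < 1" "\<mu> \<ge> 0" and \<gamma>: "origin_loop (slit {1<..<1/y}) \<gamma>"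
  shows "\<exists>I. ((\<lambda>t. loop_weight b t * (exp (of_real (\<mu> * y) * t) / (1 - of_real y * t))) has_contour_integral I) \<gamma> \<and>
    complex_of_real (poisson_ibeta b \<mu> y) = of_real (sqrt y * (1 - y) powr b) * I / (2 * of_real pi * \<i>)"
proof -
  define \<rho> where "\<rho> = 1 / y"
  define g where "g t = exp (of_real (\<mu> * y) * t) / (1 - of_real y * t)" for t :: complex
  have \<rho>: "1 < \<rho>" using assms by (auto simp: \<rho>_def field_simps)
  have ny: "1 - of_real y * t \<noteq> 0" if "t \<noteq> of_real \<rho>" for t :: complex
    using that assms(2) by (auto simp: \<rho>_def field_simps)
  have "\<exists>I. \<forall>\<gamma>. origin_loop (slit {1<..<\<rho>}) \<gamma> \<longrightarrow> ((\<lambda>t. loop_weight b t * g t) has_contour_integral I) \<gamma>"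
  proof (rule loop_integral_exists[OF open_slit starlike_slit _ assms(1)])
    show "(\<lambda>t. loop_weight b t * g t) holomorphic_on slit {1<..<\<rho>}" unfolding g_def
      by (intro holomorphic_intros holomorphic_on_subset[OF loop_weight_holomorphic] ny) (auto simp: slit_def)
    show "g holomorphic_on ball 0 1" unfolding g_def
      by (intro holomorphic_intros ny) (use \<rho> in auto)
    show "(\<lambda>_. 0) holomorphic_on ball 0 1" by (intro holomorphic_intros)
    show "t \<in> slit {1<..<\<rho>} \<and> loop_weight b t * g t = loop_weight b t * g t + 0" if "Im t \<noteq> 0" for t
      using that by (simp add: slit_def)
  qed (use \<rho> in auto)
  then obtain I where I: "\<And>\<gamma>. origin_loop (slit {1<..<\<rho>}) \<gamma> \<Longrightarrow> ((\<lambda>t. loop_weight b t * g t) has_contour_integral I) \<gamma>"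
    by blast
  \<comment> \<open>The series is integrated over a circle crossing midway between 1 and \<rho>,
    inside its disc of convergence; the value is then transferred to the given loop.\<close>
  define R where "R = (1 + \<rho>) / 4"
  have R: "R > 1/2" "1 < 2 * R" "2 * R < \<rho>" "R > 0" using \<rho> by (auto simp: R_def)
  have loop: "origin_loop (slit {1<..<\<rho>}) (origin_circle R)" using R by (intro origin_loop_circle) auto
  have yR: "y * (2 * R) < 1" using R assms by (simp add: \<rho>_def field_simps)
  define u where "u k = (\<Sum>j\<le>k. complex_of_real (\<mu> * y) ^ j / fact j * of_real y ^ (k - j))" for k
  have "(\<lambda>k. u k * (2 * of_real pi * \<i> * of_real (ibeta_coeff b k))) sums I"
  proof (rule loop_integral_series[OF assms(1) R(1)])
    show "summable (\<lambda>k. norm (u k) * (2 * R) ^ k)"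
      using exp_geometric_series(1)[of "complex_of_real y" "of_real (2 * R)" "of_real (\<mu> * y)"] yR R assms
      by (simp add: u_def norm_mult)
    show "((\<lambda>t. loop_weight b t * t ^ k) has_contour_integral (2 * of_real pi * \<i> * of_real (ibeta_coeff b k))) (origin_circle R)" for k
      by (rule loop_weight_power_integral[OF assms(1) origin_loop_mono[OF loop]]) (auto simp: slit_def)
    show "((\<lambda>t. loop_weight b t * (\<Sum>k. u k * t ^ k)) has_contour_integral I) (origin_circle R)"
    proof (rule has_contour_integral_eq[OF I[OF loop]])
      fix t assume "t \<in> path_image (origin_circle R)"
      then obtain s where "s \<in> {0..1}" "t = origin_circle R s" by (auto simp: path_image_def)
      then have "norm t \<le> 2 * R" using origin_circle_norm[of R s] R by simp
      then have "y * norm t \<le> y * (2 * R)" using assms by (intro mult_left_mono) auto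
      also note yR
      finally have "norm (of_real y * t) < 1" using assms by (simp add: norm_mult)
      from exp_geometric_series(2)[OF this, of "of_real (\<mu> * y)"]
      show "loop_weight b t * g t = loop_weight b t * (\<Sum>k. u k * t ^ k)"
        by (simp add: sums_iff u_def g_def)
    qed
  qed
  moreover define K where "K = 2 * complex_of_real pi * \<i>"
  ultimately have "(\<lambda>k. u k * (K * of_real (ibeta_coeff b k)) / K) sums (I / K)"
    by (intro sums_divide) simp
  moreover have "K \<noteq> 0" by (simp add: K_def)
  ultimately have s1: "(\<lambda>k. u k * of_real (ibeta_coeff b k)) sums (I / (2 * of_real pi * \<i>))"
    by (simp add: K_def[symmetric])
  have u: "u k = of_real (y ^ k * (\<Sum>j\<le>k. \<mu> ^ j / fact j))" for k
  proof -
    have "u k = (\<Sum>j\<le>k. of_real (y ^ k * (\<mu> ^ j / fact j)))"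
      unfolding u_def
    proof (rule sum.cong)
      fix j assume "j \<in> {..k}"
      then have "y ^ k = y ^ j * y ^ (k - j)" by (simp add: power_add[symmetric])
      then show "complex_of_real (\<mu> * y) ^ j / fact j * of_real y ^ (k - j) = of_real (y ^ k * (\<mu> ^ j / fact j))"
        by (simp add: power_mult_distrib)
    qed simp
    then show ?thesis by (simp add: sum_distrib_left)
  qed
  define P where "P = sqrt y * (1 - y) powr b"
  have "(\<lambda>k. complex_of_real (P * ((y ^ k * (\<Sum>j\<le>k. \<mu> ^ j / fact j)) * ibeta_coeff b k))) sums (of_real P * (I / (2 * of_real pi * \<i>)))"
    using sums_mult[OF s1, of "of_real P"] by (simp add: u)
  moreover have "(\<lambda>k. complex_of_real (P * ((y ^ k * (\<Sum>j\<le>k. \<mu> ^ j / fact j)) * ibeta_coeff b k))) sums of_real (poisson_ibeta b \<mu> y)"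
    unfolding sums_of_real_iff using poisson_ibeta_sums_ibeta_term[OF assms(1), of y \<mu>] assms
    by (simp add: ibeta_term_coeff P_def mult_ac)
  ultimately have "complex_of_real (poisson_ibeta b \<mu> y) = of_real P * (I / (2 * of_real pi * \<i>))"
    using sums_unique2 by blast
  with I[OF \<gamma>[folded \<rho>_def]] show ?thesis by (intro exI[of _ I]) (simp add: P_def g_def)
qed

theorem nct_P_contour_integral:
  fixes n x \<delta> :: real
  assumes "0 < n" "0 < x"
  defines "y \<equiv> y_par (x / sqrt n)" and "z \<equiv> z_par (x / sqrt n) (\<delta> / sqrt n)"
  assumes "loop_contour (1 / y) \<gamma>"
  shows "\<exists>I. ((\<lambda>t. exp (of_real (n / 2) * phase z t) / ((1 - of_real y * t) * csqrt t)) has_contour_integral I) \<gamma> \<and>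
       complex_of_real (nct_P n x \<delta>) =
         1 / 2 * (of_real (sqrt y * exp (- (n / 2) * phase z (1 / y))) / (2 * of_real pi * \<i>)) * I"
proof -
  have y: "y = x\<^sup>2 / (n + x\<^sup>2)"
    using assms(1,2) by (simp add: y_def y_par_def power_divide field_simps)
  have "0 < n + x\<^sup>2" using assms(1) by (simp add: add_pos_nonneg)
  then have y01: "0 < y" "y < 1" using assms(1,2) by (auto simp: y)
  define \<mu> where "\<mu> = \<delta>\<^sup>2 / 2"
  have z: "n / 2 * z = \<mu> * y"
    using assms(1) by (simp add: z_def z_par_def y_def[symmetric] \<mu>_def power_divide)
  have loop: "origin_loop (slit {1<..<1/y}) \<gamma>"
    by (rule loop_contour_origin_loop[OF _ assms(5)]) (use y01 in simp)
  obtain I where I: "((\<lambda>t. loop_weight (n/2) t * (exp (of_real (\<mu> * y) * t) / (1 - of_real y * t))) has_contour_integral I) \<gamma>"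
    "complex_of_real (poisson_ibeta (n/2) \<mu> y) = of_real (sqrt y * (1 - y) powr (n/2)) * I / (2 * of_real pi * \<i>)"
    using poisson_ibeta_loop_integral[OF _ y01 _ loop, of "n/2" \<mu>] assms(1) by (auto simp: \<mu>_def)
  have "loop_weight (n/2) t * (exp (of_real (\<mu> * y) * t) / (1 - of_real y * t))
      = exp (of_real (n / 2) * phase z t) / ((1 - of_real y * t) * csqrt t)" for t
  proof -
    have "of_real (n/2) * phase z t = of_real (n/2) * (Ln t - Ln (t - 1)) + of_real (n/2 * z) * t"
      by (simp add: phase_def algebra_simps)
    then have "exp (of_real (n/2) * phase z t) = exp (of_real (n/2) * (Ln t - Ln (t - 1))) * exp (of_real (\<mu> * y) * t)"
      unfolding z by (simp only: exp_add)
    then show ?thesis by (simp add: loop_weight_def field_simps)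
  qed
  with I(1) have 1: "((\<lambda>t. exp (of_real (n / 2) * phase z t) / ((1 - of_real y * t) * csqrt t)) has_contour_integral I) \<gamma>"
    by simp
  \<comment> \<open>At \<open>1 / y\<close> the linear term of the phase gives the Poisson
    normalization and the logarithms give \<open>(1 - y) powr (n/2)\<close>.\<close>
  have "exp (- (n / 2) * phase z (1 / y)) = exp (- \<delta>\<^sup>2 / 2) * (1 - y) powr (n/2)"
  proof -
    have "1 / y - 1 = (1 - y) / y" using y01 by (simp add: field_simps)
    then have l: "ln (1 / y - 1) = ln (1 - y) + ln (1 / y)" using y01 by (simp add: ln_div)
    have "- (n/2) * phase z (1 / y) = - (n/2 * z / y) + (n/2) * ln (1 - y)"
      unfolding phase_def l by (simp add: algebra_simps)
    also have "n/2 * z / y = \<delta>\<^sup>2 / 2" unfolding z using y01 by (simp add: \<mu>_def)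
    finally show ?thesis using y01 by (simp add: exp_add[symmetric] powr_def)
  qed
  then have "complex_of_real (nct_P n x \<delta>) =
         1 / 2 * (of_real (sqrt y * exp (- (n / 2) * phase z (1 / y))) / (2 * of_real pi * \<i>)) * I"
    using I(2) by (simp add: nct_P_poisson_ibeta \<mu>_def y[symmetric])
  with 1 show ?thesis by blast
qed

section \<open>The distribution function along a ray of constant z\<close>

text \<open>By \<open>ibeta_coeff_Suc\<close> the case \<open>i = 0\<close> is a constant multiple
  of the confluent hypergeometric function M(b + 1/2, 3/2, m); \<open>i\<close> counts derivatives
  in \<open>m\<close>.\<close>

definition kummer_series :: "real \<Rightarrow> nat \<Rightarrow> real \<Rightarrow> real" where
  "kummer_series b i m = (\<Sum>k. ibeta_coeff b (k + i) / fact k * m ^ k)"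

lemma Suc_mult_div_fact: "real (Suc k) * (a / fact (Suc k)) = a / (fact k :: real)"
proof -
  have "real (Suc k) * a / (real (Suc k) * fact k) = a / fact k"
    by (rule nonzero_mult_divide_mult_cancel_left) simp
  then show ?thesis by simp
qed

lemma ibeta_coeff_growth:
  assumes "b > 0" shows "ibeta_coeff b k \<le> ibeta_coeff b 0 * (1 + b) ^ k"
proof (induction k)
  case (Suc k)
  have "0 \<le> b * real k" using assms by simp
  moreover have "(1 + b) * (real k + 3/2) = real k + 3/2 + b * real k + 3/2 * b" by (simp add: algebra_simps)
  ultimately have "real k + 1/2 + b \<le> (1 + b) * (real k + 3/2)" using assms by linarith
  then have "(real k + 1/2 + b) * ibeta_coeff b k \<le> ((1 + b) * (real k + 3/2)) * ibeta_coeff b k"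
    using ibeta_coeff_pos[OF assms, of k] by (intro mult_right_mono) auto
  then have "(real k + 3/2) * ibeta_coeff b (Suc k) \<le> (real k + 3/2) * ((1 + b) * ibeta_coeff b k)"
    using ibeta_coeff_Suc[OF assms, of k] by (simp add: mult_ac)
  then have "ibeta_coeff b (Suc k) \<le> (1 + b) * ibeta_coeff b k" by (rule mult_left_le_imp_le) simp
  also have "\<dots> \<le> (1 + b) * (ibeta_coeff b 0 * (1 + b) ^ k)" using Suc assms by (intro mult_left_mono) auto
  finally show ?case by (simp add: mult_ac)
qed simp

lemma kummer_series_summable:
  assumes "b > 0" shows "summable (\<lambda>k. ibeta_coeff b (k + i) / fact k * m ^ k)"
proof (rule summable_comparison_test)
  let ?c = "ibeta_coeff b 0 * (1 + b) ^ i"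
  show "summable (\<lambda>k. ?c * (inverse (fact k) * ((1 + b) * \<bar>m\<bar>) ^ k))"
    by (intro summable_mult summable_exp)
  have "norm (ibeta_coeff b (k + i) / fact k * m ^ k) \<le> ?c * (inverse (fact k) * ((1 + b) * \<bar>m\<bar>) ^ k)" for k
  proof -
    have "norm (ibeta_coeff b (k + i) / fact k * m ^ k) = ibeta_coeff b (k + i) * (inverse (fact k) * \<bar>m\<bar> ^ k)"
      using ibeta_coeff_pos[OF assms, of "k + i"] by (simp add: abs_mult power_abs field_simps)
    also have "\<dots> \<le> (ibeta_coeff b 0 * (1 + b) ^ (k + i)) * (inverse (fact k) * \<bar>m\<bar> ^ k)"
      by (intro mult_right_mono ibeta_coeff_growth assms) auto
    finally show ?thesis by (simp add: power_add power_mult_distrib mult_ac)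
  qed
  then show "\<exists>N. \<forall>k\<ge>N. norm (ibeta_coeff b (k + i) / fact k * m ^ k) \<le> ?c * (inverse (fact k) * ((1 + b) * \<bar>m\<bar>) ^ k)"
    by blast
qed

lemma kummer_series_sums:
  assumes "b > 0" shows "(\<lambda>k. ibeta_coeff b (k + i) / fact k * m ^ k) sums kummer_series b i m"
  using kummer_series_summable[OF assms] by (simp add: kummer_series_def summable_sums)

lemma kummer_series_has_derivative:
  assumes "b > 0" shows "(kummer_series b i has_real_derivative kummer_series b (Suc i) m) (at m)"
proof -
  have "((\<lambda>m. \<Sum>k. ibeta_coeff b (k + i) / fact k * m ^ k) has_real_derivative
     (\<Sum>k. diffs (\<lambda>k. ibeta_coeff b (k + i) / fact k) k * m ^ k)) (at m)"
    by (rule termdiffs_strong_converges_everywhere) (rule kummer_series_summable[OF assms])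
  moreover have "diffs (\<lambda>k. ibeta_coeff b (k + i) / fact k) = (\<lambda>k. ibeta_coeff b (k + Suc i) / fact k)"
    by (rule ext) (simp only: diffs_def Suc_mult_div_fact add_Suc add_Suc_right)
  ultimately show ?thesis by (simp add: kummer_series_def[abs_def])
qed

lemma kummer_series_pos: assumes "b > 0" "m \<ge> 0" shows "kummer_series b i m > 0"
proof -
  have "0 < ibeta_coeff b (0 + i) / fact 0 * m ^ 0" using ibeta_coeff_pos[OF assms(1)] by simp
  also have "\<dots> = (\<Sum>k\<in>{0}. ibeta_coeff b (k + i) / fact k * m ^ k)" by simp
  also have "\<dots> \<le> kummer_series b i m"
    unfolding kummer_series_def
  proof (rule sum_le_suminf[OF kummer_series_summable[OF assms(1)]])
    show "0 \<le> ibeta_coeff b (k + i) / fact k * m ^ k" for k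
      using ibeta_coeff_pos[OF assms(1), of "k + i"] assms(2) by simp
  qed simp
  finally show ?thesis .
qed

lemma kummer_series_mult_sums:
  assumes "b > 0"
  shows "(\<lambda>k. real k * (ibeta_coeff b (k + i) / fact k * m ^ k)) sums (m * kummer_series b (Suc i) m)"
proof -
  have "(\<lambda>k. real (Suc k) * (ibeta_coeff b (Suc k + i) / fact (Suc k) * m ^ Suc k)) sums (m * kummer_series b (Suc i) m)"
  proof -
    have "m * (ibeta_coeff b (k + Suc i) / fact k * m ^ k) = real (Suc k) * (ibeta_coeff b (Suc k + i) / fact (Suc k) * m ^ Suc k)" for k
      unfolding mult.assoc[symmetric] Suc_mult_div_fact by simp
    with sums_mult[OF kummer_series_sums[OF assms, of "Suc i" m], of m] show ?thesis by (simp only:)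
  qed
  from sums_Suc[of "\<lambda>k. real k * (ibeta_coeff b (k + i) / fact k * m ^ k)", OF this] show ?thesis by simp
qed

text \<open>Kummer's equation for parameters \<open>b + 1/2\<close> and \<open>3/2\<close>, read off
  coefficientwise from the two-term recurrence.\<close>

lemma kummer_series_ode:
  assumes "b > 0"
  shows "m * kummer_series b 2 m + 3/2 * kummer_series b 1 m = m * kummer_series b 1 m + (1/2 + b) * kummer_series b 0 m"
proof -
  have "(\<lambda>k. real k * (ibeta_coeff b (k + 1) / fact k * m ^ k) + 3/2 * (ibeta_coeff b (k + 1) / fact k * m ^ k))
     sums (m * kummer_series b (Suc 1) m + 3/2 * kummer_series b 1 m)"
    by (intro sums_add sums_mult kummer_series_sums kummer_series_mult_sums assms)
  moreover have "(\<lambda>k. real k * (ibeta_coeff b (k + 0) / fact k * m ^ k) + (1/2 + b) * (ibeta_coeff b (k + 0) / fact k * m ^ k))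
     sums (m * kummer_series b (Suc 0) m + (1/2 + b) * kummer_series b 0 m)"
    by (intro sums_add sums_mult kummer_series_sums kummer_series_mult_sums assms)
  moreover have "real k * (ibeta_coeff b (k + 1) / fact k * m ^ k) + 3/2 * (ibeta_coeff b (k + 1) / fact k * m ^ k)
     = real k * (ibeta_coeff b (k + 0) / fact k * m ^ k) + (1/2 + b) * (ibeta_coeff b (k + 0) / fact k * m ^ k)" for k
  proof -
    have "real k * (ibeta_coeff b (k + 1) / fact k * m ^ k) + 3/2 * (ibeta_coeff b (k + 1) / fact k * m ^ k)
       = ((real k + 3/2) * ibeta_coeff b (Suc k)) / fact k * m ^ k" by (simp add: field_simps)
    also have "\<dots> = ((real k + 1/2 + b) * ibeta_coeff b k) / fact k * m ^ k" by (simp only: ibeta_coeff_Suc[OF assms])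
    finally show ?thesis by (simp add: field_simps)
  qed
  ultimately show ?thesis using sums_unique2 by (simp add: numeral_2_eq_2)
qed

text \<open>\<open>kummer_A\<close> and \<open>kummer_B\<close> are the two combinations that arise
  when the distribution function is differentiated along the ray. \<open>kummer_B\<close> weights
  the k-th term of the series by \<open>k + 1/2\<close>.\<close>

definition kummer_A :: "real \<Rightarrow> real \<Rightarrow> real" where "kummer_A b m = m * kummer_series b 0 m"
definition kummer_B :: "real \<Rightarrow> real \<Rightarrow> real" where
  "kummer_B b m = m * kummer_series b 1 m + 1/2 * kummer_series b 0 m"

lemma kummer_A_pos: "b > 0 \<Longrightarrow> m > 0 \<Longrightarrow> kummer_A b m > 0"
  using kummer_series_pos[of b m 0] by (simp add: kummer_A_def)

lemma kummer_B_sums: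
  assumes "b > 0" shows "(\<lambda>k. (real k + 1/2) * (ibeta_coeff b k / fact k * m ^ k)) sums kummer_B b m"
  using sums_add[OF kummer_series_mult_sums[OF assms, of 0 m] sums_mult[OF kummer_series_sums[OF assms, of 0 m], of "1/2"]]
  by (simp only: kummer_B_def add_0_right distrib_right One_nat_def)

text \<open>The logarithmic derivative of \<open>sqrt m * kummer_series b 0 m\<close>.\<close>

definition kummer_q :: "real \<Rightarrow> real \<Rightarrow> real" where "kummer_q b m = kummer_B b m / kummer_A b m"

text \<open>Kummer's second order linear equation becomes a first order Riccati equation for the
  quotient of the two combinations.\<close>

lemma kummer_q_has_derivative:
  assumes "b > 0" "m > 0"
  shows "(kummer_q b has_real_derivative (kummer_q b m + b / m - (kummer_q b m)\<^sup>2 - kummer_q b m / (2 * m))) (at m)"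
proof -
  let ?g = "\<lambda>i. kummer_series b i m"
  have A: "(kummer_A b has_real_derivative (kummer_A b m / (2 * m) + kummer_B b m)) (at m)"
    unfolding kummer_A_def[abs_def] kummer_B_def
    using kummer_series_has_derivative[OF assms(1), of 0 m] assms(2)
    by (auto intro!: derivative_eq_intros simp: field_simps)
  have "(kummer_B b has_real_derivative (m * ?g 2 + 3/2 * ?g 1)) (at m)"
    unfolding kummer_B_def[abs_def]
    using kummer_series_has_derivative[OF assms(1), of 0 m] kummer_series_has_derivative[OF assms(1), of 1 m]
    by (auto intro!: derivative_eq_intros simp: numeral_2_eq_2)
  also have "m * ?g 2 + 3/2 * ?g 1 = kummer_B b m + b / m * kummer_A b m"
    unfolding kummer_series_ode[OF assms(1)] kummer_B_def kummer_A_def using assms(2) by (simp add: field_simps)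
  finally have B: "(kummer_B b has_real_derivative (kummer_B b m + b / m * kummer_A b m)) (at m)" .
  have pos: "kummer_A b m > 0" by (rule kummer_A_pos[OF assms])
  have "(kummer_q b has_real_derivative
      ((kummer_B b m + b / m * kummer_A b m) * kummer_A b m - kummer_B b m * (kummer_A b m / (2 * m) + kummer_B b m)) / (kummer_A b m * kummer_A b m)) (at m)"
    unfolding kummer_q_def[abs_def] by (rule DERIV_divide[OF B A]) (use pos in simp)
  then show ?thesis
    by (rule DERIV_cong) (use pos assms in \<open>simp add: kummer_q_def field_simps power2_eq_square\<close>)
qed

text \<open>After an index shift both combinations are power series in \<open>m\<close>, and the
  coefficients compare termwise: the recurrence reduces the claim to
  \<open>j + 1 \<le> j + 1/2 + b\<close>. This bound later keeps \<open>theta\<close> away from the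
  wrong equilibrium.\<close>

lemma kummer_q_ge_1:
  assumes "b \<ge> 1/2" "m > 0" shows "1 \<le> kummer_q b m"
proof -
  have b: "b > 0" using assms by simp
  have "kummer_A b m \<le> kummer_B b m"
  proof (rule sums_le)
    show "(\<lambda>k. (real k + 1/2) * (ibeta_coeff b k / fact k * m ^ k)) sums kummer_B b m" by (rule kummer_B_sums[OF b])
    have "(\<lambda>k. m * (ibeta_coeff b (k + 0) / fact k * m ^ k)) sums kummer_A b m"
      unfolding kummer_A_def by (intro sums_mult kummer_series_sums b)
    moreover have "m * (ibeta_coeff b (k + 0) / fact k * m ^ k) = real (Suc k) * (ibeta_coeff b (Suc k - 1) / fact (Suc k) * m ^ Suc k)" for k
      unfolding mult.assoc[symmetric] Suc_mult_div_fact by simp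
    ultimately have "(\<lambda>k. real (Suc k) * (ibeta_coeff b (Suc k - 1) / fact (Suc k) * m ^ Suc k)) sums kummer_A b m"
      by (simp only:)
    from sums_Suc[of "\<lambda>k. real k * (ibeta_coeff b (k - 1) / fact k * m ^ k)", OF this]
    have "(\<lambda>k. real k * (ibeta_coeff b (k - 1) / fact k * m ^ k)) sums kummer_A b m" by simp
    then show "(\<lambda>k. real k * (ibeta_coeff b (k - 1) / fact k * m ^ k)) sums kummer_A b m" .
    fix k
    have "real k * ibeta_coeff b (k - 1) \<le> (real k + 1/2) * ibeta_coeff b k"
    proof (cases k)
      case (Suc j)
      have "(real j + 1) * ibeta_coeff b j \<le> (real j + 1/2 + b) * ibeta_coeff b j"
        using assms ibeta_coeff_pos[OF b, of j] by (intro mult_right_mono) auto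
      then show ?thesis using ibeta_coeff_Suc[OF b, of j] by (simp add: Suc add_ac)
    qed (use ibeta_coeff_pos[OF b, of 0] in simp)
    then have "real k * ibeta_coeff b (k - 1) * (m ^ k / fact k) \<le> (real k + 1/2) * ibeta_coeff b k * (m ^ k / fact k)"
      using assms(2) by (intro mult_right_mono) auto
    then show "real k * (ibeta_coeff b (k - 1) / fact k * m ^ k) \<le> (real k + 1/2) * (ibeta_coeff b k / fact k * m ^ k)"
      by (simp add: mult_ac)
  qed
  then show ?thesis using kummer_A_pos[OF b assms(2)] by (simp add: kummer_q_def)
qed

text \<open>Again a termwise comparison of coefficients. The term
  \<open>2 * b * kummer_series b 0 m\<close> added to \<open>kummer_A\<close> is what produces
  \<open>2 * b / m\<close> after division.\<close>

lemma kummer_q_le: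
  assumes "b \<ge> 1/2" "m > 0" shows "kummer_q b m \<le> 1 + 2 * b / m"
proof -
  have b: "b > 0" using assms by simp
  have "kummer_B b m \<le> kummer_A b m + 2 * b * kummer_series b 0 m"
  proof (rule sums_le)
    show "(\<lambda>k. (real k + 1/2) * (ibeta_coeff b k / fact k * m ^ k)) sums kummer_B b m" by (rule kummer_B_sums[OF b])
    have "(\<lambda>k. m * (ibeta_coeff b (k + 0) / fact k * m ^ k)) sums kummer_A b m"
      unfolding kummer_A_def by (intro sums_mult kummer_series_sums b)
    moreover have "m * (ibeta_coeff b (k + 0) / fact k * m ^ k) = real (Suc k) * (ibeta_coeff b (Suc k - 1) / fact (Suc k) * m ^ Suc k)" for k
      unfolding mult.assoc[symmetric] Suc_mult_div_fact by simp
    ultimately have "(\<lambda>k. real (Suc k) * (ibeta_coeff b (Suc k - 1) / fact (Suc k) * m ^ Suc k)) sums kummer_A b m"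
      by (simp only:)
    from sums_Suc[of "\<lambda>k. real k * (ibeta_coeff b (k - 1) / fact k * m ^ k)", OF this]
    have "(\<lambda>k. real k * (ibeta_coeff b (k - 1) / fact k * m ^ k)) sums kummer_A b m" by simp
    then show "(\<lambda>k. real k * (ibeta_coeff b (k - 1) / fact k * m ^ k) + 2 * b * (ibeta_coeff b (k + 0) / fact k * m ^ k))
        sums (kummer_A b m + 2 * b * kummer_series b 0 m)"
      by (intro sums_add sums_mult kummer_series_sums b)
    fix k
    have "(real k + 1/2) * ibeta_coeff b k \<le> real k * ibeta_coeff b (k - 1) + 2 * b * ibeta_coeff b k"
    proof (cases k)
      case (Suc j)
      \<comment> \<open>Scaling by \<open>real j + 3/2\<close> makes two neighbouring coefficients
        polynomial multiples of one positive number, so only a polynomial inequality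
        remains.\<close>
      define l where "l = ibeta_coeff b j / (real j + 3/2)"
      have l: "l > 0" using ibeta_coeff_pos[OF b, of j] by (simp add: l_def)
      have l1: "ibeta_coeff b j = (real j + 3/2) * l" by (simp add: l_def)
      have l2: "ibeta_coeff b (Suc j) = (real j + 1/2 + b) * l"
        using ibeta_coeff_Suc[OF b, of j] by (simp add: l_def field_simps)
      \<comment> \<open>The slack of the quadratic inequality is
        \<open>j / 2 + j * b + 2 * (b - 1/8)^2\<close> plus a positive constant.\<close>
      have "0 \<le> real j * b" "0 \<le> 2 * (b - 1/8)\<^sup>2" using assms by auto
      moreover have "2 * (b - 1/8)\<^sup>2 = 2 * (b * b) - b / 2 + 1/32" by (simp add: power2_eq_square algebra_simps)
      moreover have "(real j + 3/2 - 2 * b) * (real j + 1/2 + b) = real j * real j + 2 * real j - real j * b + 3/4 + b / 2 - 2 * (b * b)"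
        by (simp add: algebra_simps)
      moreover have "(real j + 1) * (real j + 3/2) = real j * real j + 5/2 * real j + 3/2" by (simp add: field_simps)
      ultimately have "(real j + 3/2 - 2 * b) * (real j + 1/2 + b) \<le> (real j + 1) * (real j + 3/2)" by linarith
      then have "(real j + 3/2 - 2 * b) * (real j + 1/2 + b) * l \<le> (real j + 1) * (real j + 3/2) * l"
        using l by (intro mult_right_mono) auto
      then show ?thesis unfolding Suc by (simp add: l1 l2 algebra_simps)
    qed (use assms ibeta_coeff_pos[OF b, of 0] in \<open>simp add: mult_right_mono\<close>)
    then have "(real k + 1/2) * ibeta_coeff b k * (m ^ k / fact k)
        \<le> (real k * ibeta_coeff b (k - 1) + 2 * b * ibeta_coeff b k) * (m ^ k / fact k)"
      using assms(2) by (intro mult_right_mono) auto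
    then show "(real k + 1/2) * (ibeta_coeff b k / fact k * m ^ k)
        \<le> real k * (ibeta_coeff b (k - 1) / fact k * m ^ k) + 2 * b * (ibeta_coeff b (k + 0) / fact k * m ^ k)"
      by (simp add: algebra_simps add_divide_distrib)
  qed
  also have "\<dots> = (1 + 2 * b / m) * kummer_A b m" using assms(2) by (simp add: kummer_A_def field_simps)
  finally show ?thesis using kummer_A_pos[OF b assms(2)] by (simp add: kummer_q_def divide_le_eq)
qed

section \<open>The Poisson mixture along the ray\<close>

text \<open>Weierstrass test with the exponential series, as beta values lie between 0 and 1. Joint
  continuity is required because both arguments move along the ray.\<close>

lemma continuous_on_poisson_ibeta:
  assumes "b > 0" shows "continuous_on ({0..M} \<times> {0..1}) (\<lambda>(\<mu>, y). poisson_ibeta b \<mu> y)"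
proof -
  let ?f = "\<lambda>j p. fst p ^ j / fact j * incomplete_beta (snd p) (real j + 1/2) b"
  have "uniform_limit ({0..M} \<times> {0..1}) (\<lambda>n p. \<Sum>j<n. ?f j p) (\<lambda>p. suminf (\<lambda>j. ?f j p)) sequentially"
  proof (rule Weierstrass_m_test)
    show "summable (\<lambda>j. inverse (fact j) * \<bar>M\<bar> ^ j)" by (rule summable_exp)
    fix j p assume p: "p \<in> {0..M} \<times> {0..1::real}"
    then have "\<bar>incomplete_beta (snd p) (real j + 1/2) b\<bar> \<le> 1"
      using incomplete_beta_le_1[of "real j + 1/2" b "snd p"] incomplete_beta_nonneg[of "real j + 1/2" b "snd p"] assms by auto
    moreover have "\<bar>fst p ^ j / fact j\<bar> \<le> inverse (fact j) * \<bar>M\<bar> ^ j"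
      using p by (auto simp: power_abs divide_inverse intro!: mult_mono power_mono)
    ultimately have "\<bar>fst p ^ j / fact j\<bar> * \<bar>incomplete_beta (snd p) (real j + 1/2) b\<bar> \<le> inverse (fact j) * \<bar>M\<bar> ^ j * 1"
      by (intro mult_mono) auto
    then show "norm (?f j p) \<le> inverse (fact j) * \<bar>M\<bar> ^ j" by (simp add: abs_mult)
  qed
  moreover have "continuous_on ({0..M} \<times> {0..1}) (?f j)" for j
    by (intro continuous_intros continuous_on_compose2[OF continuous_on_incomplete_beta[of "real j + 1/2" b]])
       (use assms in auto)
  then have "\<forall>\<^sub>F n in sequentially. continuous_on ({0..M} \<times> {0..1}) (\<lambda>p. \<Sum>j<n. ?f j p)"
    by (intro always_eventually allI continuous_on_sum)
  ultimately have "continuous_on ({0..M} \<times> {0..1}) (\<lambda>p. suminf (\<lambda>j. ?f j p))"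
    by (intro uniform_limit_theorem[of _ _ sequentially]) auto
  then show ?thesis by (simp add: poisson_ibeta_def case_prod_beta)
qed

lemma poisson_ibeta_at_1: assumes "b > 0" shows "poisson_ibeta b \<mu> 1 = exp \<mu>"
proof -
  have "incomplete_beta 1 (real j + 1/2) b = 1" for j by (rule incomplete_beta_1) (use assms in auto)
  then show ?thesis by (simp add: poisson_ibeta_def exp_def field_simps)
qed

lemma poisson_ibeta_nonneg:
  assumes "b > 0" "\<mu> \<ge> 0" "0 \<le> y" "y \<le> 1" shows "0 \<le> poisson_ibeta b \<mu> y"
  unfolding poisson_ibeta_def
  by (intro suminf_nonneg poisson_ibeta_summable mult_nonneg_nonneg incomplete_beta_nonneg) (use assms in auto)

lemma poisson_ibeta_le:
  assumes "b > 0" "\<mu> \<ge> 0" "0 \<le> y" "y \<le> 1"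
  shows "poisson_ibeta b \<mu> y \<le> exp \<mu> * incomplete_beta y (1/2) b"
proof -
  have "(\<lambda>j. \<mu> ^ j / fact j * incomplete_beta y (1/2) b) sums (exp \<mu> * incomplete_beta y (1/2) b)"
    using exp_converges[of \<mu>] by (intro sums_mult2) (simp add: field_simps)
  moreover have "(\<lambda>j. \<mu> ^ j / fact j * incomplete_beta y (real j + 1/2) b) sums poisson_ibeta b \<mu> y"
    unfolding poisson_ibeta_def by (intro summable_sums poisson_ibeta_summable) (use assms in auto)
  moreover have le: "\<mu> ^ j / fact j * incomplete_beta y (real j + 1/2) b \<le> \<mu> ^ j / fact j * incomplete_beta y (1/2) b" for j
    using incomplete_beta_half_antimono[of b y 0 j] assms by (intro mult_left_mono) auto
  ultimately show ?thesis by (intro sums_le[OF le])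
qed

text \<open>Half of the noncentral probability along the curve \<open>\<delta>\<^sup>2 / 2 = m * \<rho>\<close>, \<open>y = 1 / \<rho>\<close>,
  on which the parameter \<open>z\<close> is constant.\<close>

definition ray_prob :: "real \<Rightarrow> real \<Rightarrow> real \<Rightarrow> real" where
  "ray_prob b m \<rho> = 1/2 * exp (- (m * \<rho>)) * poisson_ibeta b (m * \<rho>) (1 / \<rho>)"

text \<open>Termwise differentiation. The derivative of the power factor shifts the index and
  reproduces the sum up to a Kummer term; that copy cancels against the derivative of the
  exponential. In the derivative of the beta factor the powers of \<rho> cancel, so the series left
  over depends on \<open>m\<close> alone.\<close>

lemma ray_prob_has_derivative:
  assumes "b > 0" "m > 0" "\<rho> > 1"
  shows "(ray_prob b m has_real_derivative
     - (1/2 * exp (- (m * \<rho>)) * (1 - 1/\<rho>) powr b / sqrt \<rho> * (kummer_A b m + kummer_B b m / (\<rho> - 1)))) (at \<rho>)"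
proof -
  define r1 r2 where "r1 = (1 + \<rho>) / 2" and "r2 = \<rho> + 1"
  have r: "1 < r1" "r1 < \<rho>" "\<rho> < r2" using assms by (auto simp: r1_def r2_def)
  let ?I = "\<lambda>j r. incomplete_beta (1 / r) (real j + 1/2) b"
  define f where "f j r = (m * r) ^ j / fact j * ?I j r" for j r
  define w where "w r = (1 / r) powr (3/2) * (1 - 1/r) powr (b - 1)" for r :: real
  define f1 where "f1 j r = (case j of 0 \<Rightarrow> 0 | Suc i \<Rightarrow> m * ((m * r) ^ i / fact i) * ?I j r)" for j r
  define f2 where "f2 j r = w r * ((real j + 1/2) * (ibeta_coeff b j / fact j * m ^ j))" for j r
  have df: "(f j has_real_derivative (f1 j r - f2 j r)) (at r)" if "r > 1" for j r
  proof -
    have y: "0 < 1 / r" "1 / r < 1" using that by auto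
    have i: "((\<lambda>r. 1 / r) has_real_derivative - (1 / r\<^sup>2)) (at r)"
      using that by (auto intro!: derivative_eq_intros simp: power2_eq_square field_simps)
    have dI: "(?I j has_real_derivative ((1/r) powr (real j + 1/2 - 1) * (1 - 1/r) powr (b - 1) / Beta (real j + 1/2) b) * (- (1 / r\<^sup>2))) (at r)"
      by (rule DERIV_chain2[OF incomplete_beta_has_derivative i]) (use y assms in auto)
    have dp: "((\<lambda>r. (m * r) ^ j / fact j) has_real_derivative (case j of 0 \<Rightarrow> 0 | Suc i \<Rightarrow> m * ((m * r) ^ i / fact i))) (at r)"
    proof (cases j)
      case (Suc i)
      have "((\<lambda>r. m * r) has_real_derivative m) (at r)" by (auto intro!: derivative_eq_intros)
      from DERIV_cdivide[OF DERIV_power[OF this, of "Suc i"], of "fact (Suc i)"]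
      show ?thesis unfolding Suc by (rule DERIV_cong) (simp add: field_simps del: of_nat_Suc)
    qed simp
    have e: "(1/r) powr (real j + 1/2 - 1) * (1 / r\<^sup>2) * (m * r) ^ j = (1/r) powr (3/2) * m ^ j"
    proof -
      have "(1/r) powr (real j + 1/2 - 1) * (1/r) powr 2 = (1/r) powr (real j) * (1/r) powr (3/2)"
        by (simp only: powr_add[symmetric]) (rule arg_cong[where f="\<lambda>x. (1/r) powr x"], simp)
      then have "(1/r) powr (real j + 1/2 - 1) * (1 / r\<^sup>2) = (1/r) ^ j * (1/r) powr (3/2)"
        using y that by (simp add: powr_realpow power_divide)
      then show ?thesis using that by (simp add: power_mult_distrib power_divide)
    qed
    have B: "1 / Beta (real j + 1/2) b = (real j + 1/2) * ibeta_coeff b j"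
      by (simp add: ibeta_coeff_def)
    have "((1/r) powr (real j + 1/2 - 1) * (1 - 1/r) powr (b - 1) / Beta (real j + 1/2) b) * (- (1 / r\<^sup>2)) * ((m * r) ^ j / fact j)
       = - (((1/r) powr (real j + 1/2 - 1) * (1 / r\<^sup>2) * (m * r) ^ j) * (1 - 1/r) powr (b - 1) * (1 / Beta (real j + 1/2) b) / fact j)"
      by (simp add: mult_ac)
    also have "\<dots> = - f2 j r" unfolding e B f2_def w_def by simp
    finally have e2: "((1/r) powr (real j + 1/2 - 1) * (1 - 1/r) powr (b - 1) / Beta (real j + 1/2) b) * (- (1 / r\<^sup>2)) * ((m * r) ^ j / fact j) = - f2 j r" .
    have "(f j has_real_derivative ((case j of 0 \<Rightarrow> 0 | Suc i \<Rightarrow> m * ((m * r) ^ i / fact i)) * ?I j r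
        + ((1/r) powr (real j + 1/2 - 1) * (1 - 1/r) powr (b - 1) / Beta (real j + 1/2) b) * (- (1 / r\<^sup>2)) * ((m * r) ^ j / fact j))) (at r)"
      unfolding f_def by (rule DERIV_mult[OF dp dI])
    then show ?thesis unfolding e2 f1_def by (rule DERIV_cong) (auto split: nat.splits)
  qed
  have I1: "\<bar>?I j r\<bar> \<le> 1" if "r > 1" for j r
    using incomplete_beta_le_1[of "real j + 1/2" b "1/r"] incomplete_beta_nonneg[of "real j + 1/2" b "1/r"] assms that by auto
  have "compact (w ` {r1..r2})"
    unfolding w_def using r by (intro compact_continuous_image continuous_intros) auto
  then obtain W where W: "\<And>r. r \<in> {r1..r2} \<Longrightarrow> \<bar>w r\<bar> \<le> W"
    using compact_imp_bounded bounded_real by (metis image_eqI)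
  have uc: "uniformly_convergent_on {r1<..<r2} (\<lambda>n r. \<Sum>j<n. f1 j r - f2 j r)"
  proof (rule Weierstrass_m_test'_ev[where M="\<lambda>j. (case j of 0 \<Rightarrow> 0 | Suc i \<Rightarrow> m * (inverse (fact i) * (m * r2) ^ i)) + W * ((real j + 1/2) * (ibeta_coeff b j / fact j * m ^ j))"])
    have "summable (\<lambda>i. m * (inverse (fact i) * (m * r2) ^ i))" by (intro summable_mult summable_exp)
    then have "summable (\<lambda>j. case j of 0 \<Rightarrow> 0 | Suc i \<Rightarrow> m * (inverse (fact i) * (m * r2) ^ i))"
      by (subst summable_Suc_iff[symmetric]) simp
    then show "summable (\<lambda>j. (case j of 0 \<Rightarrow> 0 | Suc i \<Rightarrow> m * (inverse (fact i) * (m * r2) ^ i)) + W * ((real j + 1/2) * (ibeta_coeff b j / fact j * m ^ j)))"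
      by (intro summable_add summable_mult sums_summable[OF kummer_B_sums[OF assms(1)]])
    have "norm (f1 j r - f2 j r) \<le> (case j of 0 \<Rightarrow> 0 | Suc i \<Rightarrow> m * (inverse (fact i) * (m * r2) ^ i)) + W * ((real j + 1/2) * (ibeta_coeff b j / fact j * m ^ j))"
      if rr: "r \<in> {r1<..<r2}" for j r
    proof -
      have "\<bar>f2 j r\<bar> \<le> W * ((real j + 1/2) * (ibeta_coeff b j / fact j * m ^ j))"
      proof -
        have "0 \<le> (real j + 1/2) * (ibeta_coeff b j / fact j * m ^ j)"
          using ibeta_coeff_pos[OF assms(1), of j] assms(2) by simp
        moreover have "\<bar>w r\<bar> \<le> W" using W[of r] rr by auto
        ultimately show ?thesis unfolding f2_def abs_mult[of "w r"]
          by (metis abs_of_nonneg mult_right_mono)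
      qed
      moreover have "\<bar>f1 j r\<bar> \<le> (case j of 0 \<Rightarrow> 0 | Suc i \<Rightarrow> m * (inverse (fact i) * (m * r2) ^ i))"
      proof (cases j)
        case (Suc i)
        have "(m * r) ^ i \<le> (m * r2) ^ i" using rr r assms by (intro power_mono mult_left_mono) auto
        then have "(m * r) ^ i / fact i \<le> inverse (fact i) * (m * r2) ^ i"
          by (simp add: divide_inverse mult.commute mult_left_mono)
        then have "m * ((m * r) ^ i / fact i) \<le> m * (inverse (fact i) * (m * r2) ^ i)"
          using assms(2) by (intro mult_left_mono) auto
        moreover have "0 \<le> m * ((m * r) ^ i / fact i)" using assms(2) rr r by auto
        moreover have "\<bar>?I j r\<bar> \<le> 1" using rr r by (intro I1) auto
        ultimately have "m * ((m * r) ^ i / fact i) * \<bar>?I j r\<bar> \<le> m * (inverse (fact i) * (m * r2) ^ i) * 1"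
          by (meson mult_mono abs_ge_zero order_trans)
        then show ?thesis using Suc rr r assms(2) by (simp add: f1_def abs_mult)
      qed (simp add: f1_def)
      ultimately show ?thesis by simp
    qed
    then show "\<forall>\<^sub>F n in sequentially. \<forall>x\<in>{r1<..<r2}. norm (f1 n x - f2 n x) \<le> (case n of 0 \<Rightarrow> 0 | Suc i \<Rightarrow> m * (inverse (fact i) * (m * r2) ^ i)) + W * ((real n + 1/2) * (ibeta_coeff b n / fact n * m ^ n))"
      by (intro always_eventually) auto
  qed
  have sf: "summable (\<lambda>j. f j \<rho>)"
    unfolding f_def by (rule poisson_ibeta_summable) (use assms in auto)
  have "((\<lambda>r. \<Sum>j. f j r) has_real_derivative (\<Sum>j. f1 j \<rho> - f2 j \<rho>)) (at \<rho>)"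
  proof (rule has_field_derivative_series'(2)[where S="{r1<..<r2}" and f=f and f'="\<lambda>j r. f1 j r - f2 j r" and ?x0.0=\<rho>])
    show "(f j has_real_derivative f1 j r - f2 j r) (at r within {r1<..<r2})" if "r \<in> {r1<..<r2}" for j r
      using df[of r j] that r by (auto intro: has_field_derivative_at_within)
    show "\<rho> \<in> interior {r1<..<r2}" using r by (simp add: interior_open)
  qed (use r uc sf in auto)
  moreover have "(\<Sum>j. f j r) = poisson_ibeta b (m * r) (1 / r)" for r by (simp add: f_def poisson_ibeta_def)
  ultimately have D: "((\<lambda>r. poisson_ibeta b (m * r) (1 / r)) has_real_derivative (\<Sum>j. f1 j \<rho> - f2 j \<rho>)) (at \<rho>)" by simp
  define S where "S = poisson_ibeta b (m * \<rho>) (1/\<rho>)"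
  define P where "P = (1 - 1/\<rho>) powr b / sqrt \<rho>"
  have s2: "(\<lambda>j. f2 j \<rho>) sums (w \<rho> * kummer_B b m)"
    unfolding f2_def by (intro sums_mult kummer_B_sums assms)
  have s1: "(\<lambda>j. f1 j \<rho>) sums (m * (S - P * kummer_series b 0 m))"
  proof -
    have "(\<lambda>j. (m * \<rho>) ^ j / fact j * ?I j \<rho> - P * (ibeta_coeff b (j + 0) / fact j * m ^ j)) sums (S - P * kummer_series b 0 m)"
      by (intro sums_diff sums_mult kummer_series_sums assms) (use summable_sums[OF sf] in \<open>simp add: f_def S_def poisson_ibeta_def\<close>)
    moreover have "(m * \<rho>) ^ j / fact j * ?I j \<rho> - P * (ibeta_coeff b (j + 0) / fact j * m ^ j) = (m * \<rho>) ^ j / fact j * ?I (Suc j) \<rho>" for j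
    proof -
      have 1: "?I (Suc j) \<rho> = ?I j \<rho> - ibeta_term (1/\<rho>) b j"
        using incomplete_beta_half_plus[of b "1/\<rho>" j 1] assms by simp
      have 2: "(m * \<rho>) ^ j * ibeta_term (1/\<rho>) b j = P * (ibeta_coeff b j * m ^ j)"
        using assms by (simp add: ibeta_term_coeff P_def power_mult_distrib power_divide real_sqrt_divide)
      have 3: "P * (ibeta_coeff b (j + 0) / fact j * m ^ j) = ((m * \<rho>) ^ j * ibeta_term (1/\<rho>) b j) / fact j"
        unfolding 2 by simp
      show ?thesis unfolding 1 3 by (simp add: right_diff_distrib)
    qed
    ultimately have "(\<lambda>j. m * ((m * \<rho>) ^ j / fact j * ?I (Suc j) \<rho>)) sums (m * (S - P * kummer_series b 0 m))"
      by (intro sums_mult) simp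
    then have "(\<lambda>j. f1 (Suc j) \<rho>) sums (m * (S - P * kummer_series b 0 m))" by (simp add: f1_def mult_ac)
    from sums_Suc[OF this] show ?thesis by (simp add: f1_def)
  qed
  have sum: "(\<Sum>j. f1 j \<rho> - f2 j \<rho>) = m * (S - P * kummer_series b 0 m) - w \<rho> * kummer_B b m"
    using sums_diff[OF s1 s2] by (simp add: sums_iff)
  have wP: "w \<rho> = P / (\<rho> - 1)"
  proof -
    have "(1/\<rho>) powr (3/2) = 1 / (sqrt \<rho> * \<rho>)"
    proof -
      have "(1/\<rho>) powr (1 + 1/2) = 1 / \<rho> * (1 / sqrt \<rho>)"
        using assms by (simp only: powr_add) (simp add: powr_half_sqrt real_sqrt_divide)
      then show ?thesis by simp
    qed
    then have w: "w \<rho> = (1 - 1/\<rho>) powr (b - 1) / sqrt \<rho> * (1 / \<rho>)" by (simp add: w_def)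
    have "(1 - 1/\<rho>) powr b = (1 - 1/\<rho>) powr (b - 1) * (1 - 1/\<rho>) powr 1"
      by (simp only: powr_add[symmetric]) simp
    then have "P / (\<rho> - 1) = (1 - 1/\<rho>) powr (b - 1) / sqrt \<rho> * ((1 - 1/\<rho>) / (\<rho> - 1))"
      using assms by (simp add: P_def)
    also have "(1 - 1/\<rho>) / (\<rho> - 1) = 1 / \<rho>" using assms by (simp add: field_simps)
    finally show ?thesis using w by simp
  qed
  have "((\<lambda>r. 1/2 * exp (- (m * r)) * poisson_ibeta b (m * r) (1 / r)) has_real_derivative
    (1/2 * (exp (- (m * \<rho>)) * (- m))) * S + (m * (S - P * kummer_series b 0 m) - w \<rho> * kummer_B b m) * (1/2 * exp (- (m * \<rho>)))) (at \<rho>)"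
    unfolding S_def
    by (rule DERIV_mult) (use D[unfolded sum S_def] in \<open>auto intro!: derivative_eq_intros\<close>)
  then show ?thesis
    unfolding ray_prob_def[abs_def]
    by (rule DERIV_cong) (simp add: wP P_def kummer_A_def algebra_simps add_divide_distrib)
qed

text \<open>The mixture is at most \<open>exp (m * \<rho>)\<close> times its first beta value, which
  tends to 0 as \<open>1 / \<rho>\<close> does; the growing Poisson parameter is compensated by the
  normalization.\<close>

lemma ray_prob_tendsto_0:
  assumes "b > 0" "m > 0" shows "(ray_prob b m \<longlongrightarrow> 0) at_top"
proof (rule tendsto_sandwich[OF _ _ tendsto_const])
  have "((\<lambda>\<rho>. incomplete_beta (1/\<rho>) (1/2) b) \<longlongrightarrow> incomplete_beta 0 (1/2) b) at_top"
  proof (rule filterlim_compose[of "\<lambda>y. incomplete_beta y (1/2) b" _ "at_right 0"])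
    show "((\<lambda>y. incomplete_beta y (1/2) b) \<longlongrightarrow> incomplete_beta 0 (1/2) b) (at_right 0)"
      using continuous_on_Icc_at_rightD[OF continuous_on_incomplete_beta[of "1/2" b]] assms by simp
    show "filterlim (\<lambda>\<rho>::real. 1 / \<rho>) (at_right 0) at_top"
      using filterlim_inverse_at_right_top by (simp add: inverse_eq_divide)
  qed
  then have "((\<lambda>\<rho>. 1/2 * incomplete_beta (1/\<rho>) (1/2) b) \<longlongrightarrow> 1/2 * incomplete_beta 0 (1/2) b) at_top"
    by (intro tendsto_intros)
  then show "((\<lambda>\<rho>. 1/2 * incomplete_beta (1/\<rho>) (1/2) b) \<longlongrightarrow> 0) at_top" by simp
  show "\<forall>\<^sub>F \<rho> in at_top. 0 \<le> ray_prob b m \<rho>"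
    using eventually_ge_at_top[of 1] by eventually_elim (use assms in \<open>auto simp: ray_prob_def intro!: mult_nonneg_nonneg poisson_ibeta_nonneg\<close>)
  show "\<forall>\<^sub>F \<rho> in at_top. ray_prob b m \<rho> \<le> 1/2 * incomplete_beta (1/\<rho>) (1/2) b"
    using eventually_ge_at_top[of 1]
  proof eventually_elim
    case (elim \<rho>)
    then have "exp (- (m * \<rho>)) * poisson_ibeta b (m * \<rho>) (1/\<rho>) \<le> exp (- (m * \<rho>)) * (exp (m * \<rho>) * incomplete_beta (1/\<rho>) (1/2) b)"
      using assms by (intro mult_left_mono poisson_ibeta_le) auto
    then show ?case by (simp add: ray_prob_def mult.assoc[symmetric] exp_add[symmetric])
  qed
qed

lemma ray_prob_tendsto_half:
  assumes "b > 0" "m > 0" shows "(ray_prob b m \<longlongrightarrow> 1/2) (at_right 1)"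
proof -
  have "continuous_on {1..2} (\<lambda>\<rho>. (\<lambda>(\<mu>, y). poisson_ibeta b \<mu> y) (m * \<rho>, 1/\<rho>))"
    by (rule continuous_on_compose2[OF continuous_on_poisson_ibeta[OF assms(1), of "m * 2"]])
       (use assms in \<open>auto intro!: continuous_intros\<close>)
  then have "continuous_on {1..2} (ray_prob b m)"
    unfolding ray_prob_def[abs_def] by (intro continuous_intros) auto
  from continuous_on_Icc_at_rightD[OF this] show ?thesis
    by (simp add: ray_prob_def poisson_ibeta_at_1[OF assms(1)] exp_minus)
qed

section \<open>The logarithmic derivative of the Kummer function\<close>

text \<open>At leading order the Riccati equation gives \<open>kummer_q = 1 / (1 - \<kappa>)\<close>
  at \<open>m = n * z / 2\<close>; \<open>theta\<close> is the relative deviation from that value, a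
  quantity of order \<open>1 / n\<close>.\<close>

definition theta :: "real \<Rightarrow> real \<Rightarrow> real" where
  "theta n \<kappa> = (1 - \<kappa>) * kummer_q (n/2) (n * (1 - \<kappa>)\<^sup>2 / (2 * \<kappa>)) - 1"

text \<open>The Riccati equation in the variable \<kappa>. The large factor multiplies a quadratic
  with roots 0 and \<open>- (1 + \<kappa>)\<close>, the two possible limiting branches.\<close>

lemma theta_has_derivative:
  assumes "n > 0" "0 < \<kappa>" "\<kappa> < 1"
  shows "(theta n has_real_derivative
    (n * (1 + \<kappa>) / (2 * \<kappa>\<^sup>2) * ((theta n \<kappa>)\<^sup>2 + (1 + \<kappa>) * theta n \<kappa>) + (1 + theta n \<kappa>) / (2 * \<kappa>))) (at \<kappa>)"
proof -
  define m where "m = n * (1 - \<kappa>)\<^sup>2 / (2 * \<kappa>)"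
  define q where "q = kummer_q (n/2) m"
  define c where "c = 1 - \<kappa>"
  have m: "m > 0" using assms by (simp add: m_def)
  have c: "c > 0" "\<kappa> = 1 - c" using assms by (auto simp: c_def)
  have dm: "((\<lambda>\<kappa>. n * (1 - \<kappa>)\<^sup>2 / (2 * \<kappa>)) has_real_derivative (- (n * c * (1 + \<kappa>) / (2 * \<kappa>\<^sup>2)))) (at \<kappa>)"
    using assms by (auto intro!: derivative_eq_intros simp: c_def field_simps power2_eq_square)
  have dq: "((\<lambda>\<kappa>. kummer_q (n/2) (n * (1 - \<kappa>)\<^sup>2 / (2 * \<kappa>))) has_real_derivative
      (q + n / 2 / m - q\<^sup>2 - q / (2 * m)) * (- (n * c * (1 + \<kappa>) / (2 * \<kappa>\<^sup>2)))) (at \<kappa>)"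
    using DERIV_chain2[OF kummer_q_has_derivative[of "n/2" m, unfolded m_def] dm] assms m
    by (simp add: q_def m_def)
  have "(theta n has_real_derivative (- q + (q + n / 2 / m - q\<^sup>2 - q / (2 * m)) * (- (n * c * (1 + \<kappa>) / (2 * \<kappa>\<^sup>2))) * c)) (at \<kappa>)"
    unfolding theta_def[abs_def] using dq by (auto intro!: derivative_eq_intros simp: q_def m_def c_def)
  moreover have "theta n \<kappa> = c * q - 1" by (simp add: theta_def q_def m_def c_def)
  moreover have "- q + (q + n / 2 / m - q\<^sup>2 - q / (2 * m)) * (- (n * c * (1 + \<kappa>) / (2 * \<kappa>\<^sup>2))) * c
     = n * (1 + \<kappa>) / (2 * \<kappa>\<^sup>2) * ((c * q - 1)\<^sup>2 + (1 + \<kappa>) * (c * q - 1)) + (1 + (c * q - 1)) / (2 * \<kappa>)"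
  proof -
    have m1: "n / 2 / m = \<kappa> / c\<^sup>2" "q / (2 * m) = q * \<kappa> / (n * c\<^sup>2)"
      using assms c by (simp_all add: m_def c_def[symmetric] field_simps)
    have "(q + n / 2 / m - q\<^sup>2 - q / (2 * m)) * (- (n * c * (1 + \<kappa>) / (2 * \<kappa>\<^sup>2))) * c
      = n * (1 + \<kappa>) / (2 * \<kappa>\<^sup>2) * ((c * q)\<^sup>2 - c * (c * q) - \<kappa>) + (1 + \<kappa>) * q / (2 * \<kappa>)"
      unfolding m1 using assms c(1) by (simp add: field_simps power2_eq_square)
    moreover have "(c * q)\<^sup>2 - c * (c * q) - \<kappa> = (c * q - 1)\<^sup>2 + (1 + \<kappa>) * (c * q - 1)"
      unfolding c(2) by (simp add: power2_eq_square algebra_simps)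
    moreover have "- q + (1 + \<kappa>) * q / (2 * \<kappa>) = (1 + (c * q - 1)) / (2 * \<kappa>)"
      using assms by (simp add: c_def field_simps)
    ultimately show ?thesis by simp
  qed
  ultimately show ?thesis by simp
qed

text \<open>The lower bound \<open>- \<kappa>\<close> stays at distance 1 from the root
  \<open>- (1 + \<kappa>)\<close>, which singles out the branch near 0. The upper bound only has to
  be finite for fixed \<kappa> < 1.\<close>

lemma theta_bounds:
  assumes "n \<ge> 1" "0 < \<kappa>" "\<kappa> < 1"
  shows "- \<kappa> \<le> theta n \<kappa>" "theta n \<kappa> \<le> 2 / (1 - \<kappa>)"
proof -
  define m where "m = n * (1 - \<kappa>)\<^sup>2 / (2 * \<kappa>)"
  have m: "m > 0" using assms by (simp add: m_def)
  have "(1 - \<kappa>) * 1 \<le> (1 - \<kappa>) * kummer_q (n/2) m"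
    using kummer_q_ge_1[of "n/2" m] assms m by (intro mult_left_mono) auto
  then show "- \<kappa> \<le> theta n \<kappa>" by (simp add: theta_def m_def)
  have "kummer_q (n/2) m \<le> 1 + n / m" using kummer_q_le[of "n/2" m] assms m by simp
  also have "n / m = 2 * \<kappa> / (1 - \<kappa>)\<^sup>2" using assms by (simp add: m_def)
  finally have "(1 - \<kappa>) * kummer_q (n/2) m \<le> (1 - \<kappa>) * (1 + 2 * \<kappa> / (1 - \<kappa>)\<^sup>2)"
    using assms by (intro mult_left_mono) auto
  also have "\<dots> = (1 - \<kappa>) + 2 * \<kappa> / (1 - \<kappa>)" using assms by (simp add: distrib_left power2_eq_square)
  also have "2 * \<kappa> / (1 - \<kappa>) \<le> 2 / (1 - \<kappa>)" using assms by (simp add: divide_right_mono)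
  finally show "theta n \<kappa> \<le> 2 / (1 - \<kappa>)" using assms by (simp add: theta_def m_def)
qed

text \<open>The coefficients of the expansion of \<open>theta\<close> are polynomials in \<open>1 / (1 + \<kappa>)\<close>.\<close>

fun theta_poly :: "nat \<Rightarrow> real poly" where
  "theta_poly k = (if k = 0 then 0 else
     [:0, 1:] * ([:1, -1:] * (- (if k = 1 then 1 else 0) - theta_poly (k - 1)
        - [:0, 2:] * [:1, -1:] * pderiv (theta_poly (k - 1)))
       - (\<Sum>i\<in>{1..<k}. theta_poly i * theta_poly (k - i))))"

declare theta_poly.simps [simp del]

lemma theta_poly_0 [simp]: "theta_poly 0 = 0" by (simp add: theta_poly.simps)

definition theta_coeff :: "nat \<Rightarrow> real \<Rightarrow> real" where
  "theta_coeff k \<kappa> = poly (theta_poly k) (1 / (1 + \<kappa>))"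

definition theta_coeff_deriv :: "nat \<Rightarrow> real \<Rightarrow> real" where
  "theta_coeff_deriv k \<kappa> = - (poly (pderiv (theta_poly k)) (1 / (1 + \<kappa>)) / (1 + \<kappa>)\<^sup>2)"

lemma theta_coeff_0 [simp]: "theta_coeff 0 \<kappa> = 0" by (simp add: theta_coeff_def)

lemma theta_coeff_1: assumes "\<kappa> > 0" shows "theta_coeff 1 \<kappa> = - \<kappa> / (1 + \<kappa>)\<^sup>2"
  using assms by (simp add: theta_coeff_def theta_poly.simps[of "Suc 0"] power2_eq_square field_simps)

lemma theta_coeff_has_derivative:
  assumes "\<kappa> > 0" shows "(theta_coeff k has_real_derivative theta_coeff_deriv k \<kappa>) (at \<kappa>)"
proof -
  have "((\<lambda>\<kappa>. 1 / (1 + \<kappa>)) has_real_derivative - (1 / (1 + \<kappa>)\<^sup>2)) (at \<kappa>)"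
    using assms by (auto intro!: derivative_eq_intros simp: power2_eq_square)
  from DERIV_chain2[OF poly_DERIV this] show ?thesis
    unfolding theta_coeff_def[abs_def] theta_coeff_deriv_def by simp
qed

text \<open>A polynomial is evaluated at a point of the compact unit interval, so the bound persists
  as \<kappa> tends to 0.\<close>

lemma theta_coeff_bounded:
  obtains T where "\<And>\<kappa>. 0 < \<kappa> \<Longrightarrow> \<kappa> < 1 \<Longrightarrow> \<bar>theta_coeff k \<kappa>\<bar> \<le> T"
    "\<And>\<kappa>. 0 < \<kappa> \<Longrightarrow> \<kappa> < 1 \<Longrightarrow> \<bar>theta_coeff_deriv k \<kappa>\<bar> \<le> T"
proof -
  have b: "\<exists>B. \<forall>s\<in>{0..1}. \<bar>poly p s\<bar> \<le> B" for p :: "real poly"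
  proof -
    have "compact (poly p ` {0..1})" by (intro compact_continuous_image continuous_intros) auto
    then show ?thesis using compact_imp_bounded bounded_real by (metis image_eqI)
  qed
  obtain B1 B2 where B: "\<forall>s\<in>{0..1}. \<bar>poly (theta_poly k) s\<bar> \<le> B1" "\<forall>s\<in>{0..1}. \<bar>poly (pderiv (theta_poly k)) s\<bar> \<le> B2"
    using b by meson
  show ?thesis
  proof (rule that[of "max B1 B2"])
    fix \<kappa> :: real assume k: "0 < \<kappa>" "\<kappa> < 1"
    then have s: "1 / (1 + \<kappa>) \<in> {0..1}" by auto
    show "\<bar>theta_coeff k \<kappa>\<bar> \<le> max B1 B2" using B(1) s by (fastforce simp: theta_coeff_def)
    have "\<bar>theta_coeff_deriv k \<kappa>\<bar> = \<bar>poly (pderiv (theta_poly k)) (1 / (1 + \<kappa>))\<bar> / (1 + \<kappa>)\<^sup>2"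
      by (simp add: theta_coeff_deriv_def)
    also have "\<dots> \<le> \<bar>poly (pderiv (theta_poly k)) (1 / (1 + \<kappa>))\<bar> / 1"
      using k by (intro frac_le) auto
    also have "\<dots> \<le> B2" using B(2) s by auto
    finally show "\<bar>theta_coeff_deriv k \<kappa>\<bar> \<le> max B1 B2" by simp
  qed
qed

text \<open>The equation of order \<open>Suc k\<close> for a formal power series solution of the
  Riccati equation. With \<open>s = 1 / (1 + \<kappa>)\<close> one has
  \<open>s * \<kappa> = 1 - s\<close>, which turns the polynomial recursion into this form.\<close>

lemma theta_coeff_Suc:
  assumes "\<kappa> > 0"
  shows "(\<Sum>i\<le>Suc k. theta_coeff i \<kappa> * theta_coeff (Suc k - i) \<kappa>) + (1 + \<kappa>) * theta_coeff (Suc k) \<kappa>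
    = - (\<kappa> / (1 + \<kappa>)) * ((if k = 0 then 1 else 0) + theta_coeff k \<kappa> - 2 * \<kappa> * theta_coeff_deriv k \<kappa>)"
proof -
  define s where "s = 1 / (1 + \<kappa>)"
  have s: "s * (1 + \<kappa>) = 1" "s > 0" using assms by (auto simp: s_def)
  have sk: "s * \<kappa> = 1 - s" using s by (simp add: algebra_simps)
  define P where "P = poly (pderiv (theta_poly k)) s"
  define S where "S = (\<Sum>i\<in>{1..<Suc k}. theta_coeff i \<kappa> * theta_coeff (Suc k - i) \<kappa>)"
  define X where "X = - (if k = 0 then 1 else 0) - theta_coeff k \<kappa> - 2 * s * (1 - s) * P"
  have 1: "(\<Sum>i\<le>Suc k. theta_coeff i \<kappa> * theta_coeff (Suc k - i) \<kappa>) = S"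
    unfolding S_def by (rule sum.mono_neutral_right) (auto simp: not_less_eq_eq le_Suc_eq)
  have 2: "theta_coeff (Suc k) \<kappa> = s * ((1 - s) * X - S)"
    unfolding theta_coeff_def s_def[symmetric] X_def S_def P_def
    by (subst theta_poly.simps) (auto simp: poly_sum algebra_simps)
  have 3: "2 * \<kappa> * theta_coeff_deriv k \<kappa> = - (2 * s * (1 - s) * P)"
  proof -
    have "theta_coeff_deriv k \<kappa> = - (s * s * P)"
      by (simp add: theta_coeff_deriv_def s_def P_def power2_eq_square)
    then have "2 * \<kappa> * theta_coeff_deriv k \<kappa> = - (2 * s * (s * \<kappa>) * P)" by simp
    then show ?thesis unfolding sk by simp
  qed
  have "(1 + \<kappa>) * theta_coeff (Suc k) \<kappa> = (s * (1 + \<kappa>)) * ((1 - s) * X - S)" unfolding 2 by simp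
  then have 4: "(1 + \<kappa>) * theta_coeff (Suc k) \<kappa> = (1 - s) * X - S" unfolding s(1) by simp
  have 5: "\<kappa> / (1 + \<kappa>) = 1 - s" using sk by (simp add: s_def)
  show ?thesis unfolding 1 3 4 5 by (simp add: X_def algebra_simps)
qed

section \<open>Residual of the truncated Riccati series\<close>

text \<open>The product of two truncated series and the truncated Cauchy product differ by the index
  pairs with \<open>i + j \<ge> K\<close>, each of which carries a power of \<open>x\<close> at most
  \<open>x ^ K\<close>.\<close>

lemma truncated_series_mult:
  fixes a b :: "nat \<Rightarrow> real"
  assumes "0 \<le> x" "x \<le> 1"
  shows "\<bar>(\<Sum>i<K. a i * x ^ i) * (\<Sum>j<K. b j * x ^ j) - (\<Sum>k<K. (\<Sum>i\<le>k. a i * b (k - i)) * x ^ k)\<bar>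
    \<le> (\<Sum>i<K. \<bar>a i\<bar>) * (\<Sum>j<K. \<bar>b j\<bar>) * x ^ K"
proof -
  let ?T = "{(i, j). i < K \<and> j < K \<and> i + j < K}" and ?U = "{..<K} \<times> {..<K}"
  let ?g = "\<lambda>(i, j). a i * b j * x ^ (i + j)"
  have fin: "finite ?U" and sub: "?T \<subseteq> ?U" by auto
  have 1: "(\<Sum>i<K. a i * x ^ i) * (\<Sum>j<K. b j * x ^ j) = sum ?g ?U"
    by (simp add: sum_product sum.cartesian_product power_add mult_ac)
  have 2: "(\<Sum>k<K. (\<Sum>i\<le>k. a i * b (k - i)) * x ^ k) = sum ?g ?T"
  proof -
    have "(\<Sum>k<K. (\<Sum>i\<le>k. a i * b (k - i)) * x ^ k) = (\<Sum>(k, i)\<in>(SIGMA k:{..<K}. {..k}). a i * b (k - i) * x ^ k)"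
      by (simp add: sum.Sigma sum_distrib_right)
    also have "\<dots> = sum ?g ?T"
      by (rule sum.reindex_bij_witness[of _ "\<lambda>(i, j). (i + j, i)" "\<lambda>(k, i). (i, k - i)"]) auto
    finally show ?thesis .
  qed
  have d: "sum ?g ?U - sum ?g ?T = sum ?g (?U - ?T)" using sum_diff[OF fin sub, of ?g] by simp
  have "\<bar>sum ?g ?U - sum ?g ?T\<bar> \<le> (\<Sum>p\<in>?U - ?T. \<bar>?g p\<bar>)"
    unfolding d by (rule sum_abs)
  also have "\<dots> \<le> (\<Sum>p\<in>?U - ?T. \<bar>a (fst p)\<bar> * \<bar>b (snd p)\<bar> * x ^ K)"
  proof (rule sum_mono)
    fix p assume p: "p \<in> ?U - ?T"
    then have "x ^ (fst p + snd p) \<le> x ^ K" using assms by (intro power_decreasing) auto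
    then show "\<bar>?g p\<bar> \<le> \<bar>a (fst p)\<bar> * \<bar>b (snd p)\<bar> * x ^ K"
      using assms by (auto simp: case_prod_beta abs_mult intro!: mult_left_mono)
  qed
  also have "\<dots> \<le> (\<Sum>p\<in>?U. \<bar>a (fst p)\<bar> * \<bar>b (snd p)\<bar> * x ^ K)"
    by (rule sum_mono2) (use assms in auto)
  also have "\<dots> = (\<Sum>i<K. \<bar>a i\<bar>) * (\<Sum>j<K. \<bar>b j\<bar>) * x ^ K"
  proof -
    have "(\<Sum>i<K. \<bar>a i\<bar>) * (\<Sum>j<K. \<bar>b j\<bar>) = (\<Sum>p\<in>?U. \<bar>a (fst p)\<bar> * \<bar>b (snd p)\<bar>)"
      by (simp add: sum_product sum.cartesian_product case_prod_beta)
    then show ?thesis by (simp only: sum_distrib_right)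
  qed
  finally show ?thesis unfolding 1 2 .
qed

definition theta_sum :: "nat \<Rightarrow> real \<Rightarrow> real \<Rightarrow> real" where
  "theta_sum K x \<kappa> = (\<Sum>k<K. theta_coeff k \<kappa> * x ^ k)"

definition theta_sum_deriv :: "nat \<Rightarrow> real \<Rightarrow> real \<Rightarrow> real" where
  "theta_sum_deriv K x \<kappa> = (\<Sum>k<K. theta_coeff_deriv k \<kappa> * x ^ k)"

lemma theta_sum_has_derivative:
  "\<kappa> > 0 \<Longrightarrow> (theta_sum K x has_real_derivative theta_sum_deriv K x \<kappa>) (at \<kappa>)"
  unfolding theta_sum_def[abs_def] theta_sum_deriv_def
  by (auto intro!: derivative_eq_intros DERIV_sum theta_coeff_has_derivative simp: mult.commute)

text \<open>The Riccati equation multiplied by \<open>2 * \<kappa>^2 * x / (1 + \<kappa>)\<close>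
  with \<open>x = 1 / n\<close>; for an exact solution in place of the truncated sum it would
  vanish.\<close>

definition theta_residual :: "nat \<Rightarrow> real \<Rightarrow> real \<Rightarrow> real" where
  "theta_residual K x \<kappa> = (theta_sum K x \<kappa>)\<^sup>2 + (1 + \<kappa>) * theta_sum K x \<kappa>
     + x * (\<kappa> / (1 + \<kappa>)) * (1 + theta_sum K x \<kappa> - 2 * \<kappa> * theta_sum_deriv K x \<kappa>)"

lemma theta_residual_bounded:
  assumes "K \<ge> 1"
  obtains C where "C > 0" "\<And>x \<kappa>. 0 < \<kappa> \<Longrightarrow> \<kappa> < 1 \<Longrightarrow> 0 \<le> x \<Longrightarrow> x \<le> 1 \<Longrightarrow> \<bar>theta_residual K x \<kappa>\<bar> \<le> C * x ^ K"
    "\<And>x \<kappa>. 0 < \<kappa> \<Longrightarrow> \<kappa> < 1 \<Longrightarrow> 0 \<le> x \<Longrightarrow> x \<le> 1 \<Longrightarrow> \<bar>theta_sum K x \<kappa>\<bar> \<le> C * x"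
proof -
  have "\<exists>T. \<forall>\<kappa>. 0 < \<kappa> \<longrightarrow> \<kappa> < 1 \<longrightarrow> \<bar>theta_coeff k \<kappa>\<bar> \<le> T \<and> \<bar>theta_coeff_deriv k \<kappa>\<bar> \<le> T" for k
    by (rule theta_coeff_bounded[of k]) blast
  then have "\<forall>k. \<exists>T. \<forall>\<kappa>. 0 < \<kappa> \<longrightarrow> \<kappa> < 1 \<longrightarrow> \<bar>theta_coeff k \<kappa>\<bar> \<le> T \<and> \<bar>theta_coeff_deriv k \<kappa>\<bar> \<le> T" ..
  from choice[OF this] obtain T where T': "\<forall>k. \<forall>\<kappa>. 0 < \<kappa> \<longrightarrow> \<kappa> < 1 \<longrightarrow> \<bar>theta_coeff k \<kappa>\<bar> \<le> T k \<and> \<bar>theta_coeff_deriv k \<kappa>\<bar> \<le> T k" ..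
  have T: "\<bar>theta_coeff k \<kappa>\<bar> \<le> T k" "\<bar>theta_coeff_deriv k \<kappa>\<bar> \<le> T k" if "0 < \<kappa>" "\<kappa> < 1" for k \<kappa>
    using T' that by blast+
  have T0: "T k \<ge> 0" for k by (rule order_trans[OF abs_ge_zero T(1)[of "1/2" k]]) auto
  define S where "S = (\<Sum>k<K. T k)"
  have S0: "S \<ge> 0" unfolding S_def by (intro sum_nonneg T0)
  have S: "(\<Sum>k<K. \<bar>theta_coeff k \<kappa>\<bar>) \<le> S" if "0 < \<kappa>" "\<kappa> < 1" for \<kappa>
    unfolding S_def by (intro sum_mono T that)
  define C where "C = S * S + 1 + S + 3 * T (K - 1)"
  show ?thesis
  proof (rule that[of C])
    show "C > 0" unfolding C_def using S0 T0[of "K - 1"] by (intro add_pos_nonneg add_nonneg_pos) auto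
    fix x \<kappa> :: real assume a: "0 < \<kappa>" "\<kappa> < 1" "0 \<le> x" "x \<le> 1"
    define f where "f k = (if k = 0 then 1 else 0) + theta_coeff k \<kappa> - 2 * \<kappa> * theta_coeff_deriv k \<kappa>" for k
    define cv where "cv k = (\<Sum>i\<le>k. theta_coeff i \<kappa> * theta_coeff (k - i) \<kappa>)" for k
    have e1: "1 + theta_sum K x \<kappa> - 2 * \<kappa> * theta_sum_deriv K x \<kappa> = (\<Sum>k<K. f k * x ^ k)"
    proof -
      have "(\<Sum>k<K. (if k = 0 then 1 else 0) * x ^ k) = 1"
        using assms by (simp add: if_distrib[of "\<lambda>a. a * _"] sum.delta cong: if_cong)
      then show ?thesis
        unfolding theta_sum_def theta_sum_deriv_def f_def
        by (simp add: left_diff_distrib distrib_right sum_subtractf sum.distrib sum_distrib_left mult.assoc)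
    qed
    obtain J where J: "K = Suc J" using assms by (cases K) auto
    have e2: "(\<Sum>k<K. (cv k + (1 + \<kappa>) * theta_coeff k \<kappa>) * x ^ k) = - (\<kappa> / (1 + \<kappa>)) * x * (\<Sum>k<J. f k * x ^ k)"
    proof -
      have "(\<Sum>k<K. (cv k + (1 + \<kappa>) * theta_coeff k \<kappa>) * x ^ k)
          = (cv 0 + (1 + \<kappa>) * theta_coeff 0 \<kappa>) * x ^ 0 + (\<Sum>k<J. (cv (Suc k) + (1 + \<kappa>) * theta_coeff (Suc k) \<kappa>) * x ^ Suc k)"
        unfolding J by (rule sum.lessThan_Suc_shift)
      also have "cv 0 + (1 + \<kappa>) * theta_coeff 0 \<kappa> = 0" by (simp add: cv_def)
      also have "(\<Sum>k<J. (cv (Suc k) + (1 + \<kappa>) * theta_coeff (Suc k) \<kappa>) * x ^ Suc k)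
          = (\<Sum>k<J. - (\<kappa> / (1 + \<kappa>)) * x * (f k * x ^ k))"
        by (rule sum.cong) (use theta_coeff_Suc[OF a(1)] in \<open>auto simp: cv_def f_def\<close>)
      finally show ?thesis by (simp add: sum_distrib_left)
    qed
    \<comment> \<open>All orders below \<open>K\<close> cancel; what survives is the tail of the
      square and the top term of the linear part, which the truncation leaves unmatched.\<close>
    have e3: "theta_residual K x \<kappa> = ((theta_sum K x \<kappa>)\<^sup>2 - (\<Sum>k<K. cv k * x ^ k)) + \<kappa> / (1 + \<kappa>) * f J * x ^ K"
    proof -
      have "(\<Sum>k<K. (cv k + (1 + \<kappa>) * theta_coeff k \<kappa>) * x ^ k) = (\<Sum>k<K. cv k * x ^ k) + (1 + \<kappa>) * theta_sum K x \<kappa>"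
        by (simp add: theta_sum_def distrib_right sum.distrib sum_distrib_left mult.assoc)
      moreover have "(\<Sum>k<K. f k * x ^ k) = (\<Sum>k<J. f k * x ^ k) + f J * x ^ J" by (simp add: J)
      ultimately show ?thesis
        unfolding theta_residual_def e1 using e2 by (simp add: J algebra_simps)
    qed
    have b1: "\<bar>(theta_sum K x \<kappa>)\<^sup>2 - (\<Sum>k<K. cv k * x ^ k)\<bar> \<le> S * S * x ^ K"
    proof -
      have "\<bar>(theta_sum K x \<kappa>)\<^sup>2 - (\<Sum>k<K. cv k * x ^ k)\<bar> \<le> (\<Sum>k<K. \<bar>theta_coeff k \<kappa>\<bar>) * (\<Sum>k<K. \<bar>theta_coeff k \<kappa>\<bar>) * x ^ K"
        using truncated_series_mult[OF a(3,4), where K=K and a="\<lambda>k. theta_coeff k \<kappa>" and b="\<lambda>k. theta_coeff k \<kappa>"]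
        by (simp add: theta_sum_def power2_eq_square cv_def)
      also have "\<dots> \<le> S * S * x ^ K"
        using S[OF a(1,2)] S0 a by (intro mult_right_mono mult_mono) (auto intro!: sum_nonneg)
      finally show ?thesis .
    qed
    have b2: "\<bar>\<kappa> / (1 + \<kappa>) * f J * x ^ K\<bar> \<le> (1 + 3 * T J) * x ^ K"
    proof -
      have "\<bar>2 * \<kappa> * theta_coeff_deriv J \<kappa>\<bar> \<le> 2 * 1 * T J"
        unfolding abs_mult using a T(2)[of \<kappa> J] by (intro mult_mono) auto
      then have "\<bar>f J\<bar> \<le> 1 + 3 * T J" unfolding f_def using T(1)[OF a(1,2), of J] by (auto split: if_splits)
      then have "\<bar>\<kappa> / (1 + \<kappa>)\<bar> * \<bar>f J\<bar> \<le> 1 * (1 + 3 * T J)"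
        using a by (intro mult_mono) auto
      then have "\<bar>\<kappa> / (1 + \<kappa>)\<bar> * \<bar>f J\<bar> * \<bar>x ^ K\<bar> \<le> 1 * (1 + 3 * T J) * \<bar>x ^ K\<bar>"
        by (rule mult_right_mono) simp
      then show ?thesis using a(3) by (simp only: abs_mult mult_1 abs_of_nonneg zero_le_power)
    qed
    have "\<bar>theta_residual K x \<kappa>\<bar> \<le> S * S * x ^ K + (1 + 3 * T J) * x ^ K"
      unfolding e3 by (rule order_trans[OF abs_triangle_ineq add_mono[OF b1 b2]])
    also have "\<dots> = (S * S + 1 + 3 * T J) * x ^ K" by (simp add: algebra_simps)
    also have "\<dots> \<le> C * x ^ K" using S0 a by (intro mult_right_mono) (auto simp: C_def J)
    finally show "\<bar>theta_residual K x \<kappa>\<bar> \<le> C * x ^ K" .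
    have "\<bar>theta_sum K x \<kappa>\<bar> \<le> (\<Sum>k<K. \<bar>theta_coeff k \<kappa> * x ^ k\<bar>)"
      unfolding theta_sum_def by (rule sum_abs)
    also have "\<dots> \<le> (\<Sum>k<K. T k * x)"
    proof (rule sum_mono)
      fix k
      show "\<bar>theta_coeff k \<kappa> * x ^ k\<bar> \<le> T k * x"
      proof (cases k)
        case (Suc j)
        have "x * x ^ j \<le> x * 1" using a by (intro mult_left_mono power_le_one) auto
        then have "\<bar>theta_coeff k \<kappa>\<bar> * (x ^ k) \<le> T k * x" using T(1)[OF a(1,2), of k] a Suc
          by (intro mult_mono) auto
        then show ?thesis using a by (simp add: abs_mult)
      qed (use T0 a in simp)
    qed
    also have "\<dots> = S * x" by (simp add: S_def sum_distrib_right)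
    also have "\<dots> \<le> C * x" using S0 T0[of "K - 1"] a by (intro mult_right_mono) (auto simp: C_def)
    finally show "\<bar>theta_sum K x \<kappa>\<bar> \<le> C * x" .
  qed
qed

text \<open>A single term of the exponential series bounds the exponential from below, so an
  exponentially small quantity is absorbed by any prescribed power of \<open>1 / n\<close>.\<close>

lemma exp_neg_le_power:
  fixes \<alpha> n :: real
  assumes "\<alpha> > 0" "n > 0" shows "exp (- (\<alpha> * n)) \<le> fact p / \<alpha> ^ p * (1 / n) ^ p"
proof -
  have "(\<alpha> * n) ^ p / fact p \<le> exp (\<alpha> * n)"
  proof -
    have "(\<Sum>i\<in>{p}. (\<alpha> * n) ^ i / fact i) \<le> (\<Sum>i. (\<alpha> * n) ^ i / fact i)"
      by (rule sum_le_suminf) (use summable_exp[of "\<alpha> * n"] assms in \<open>auto simp: field_simps\<close>)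
    then show ?thesis by (simp add: exp_def field_simps)
  qed
  then have "1 / exp (\<alpha> * n) \<le> 1 / ((\<alpha> * n) ^ p / fact p)" using assms by (intro divide_left_mono) auto
  then show ?thesis by (simp add: exp_minus inverse_eq_divide power_mult_distrib power_divide)
qed

text \<open>The difference \<open>e\<close> between \<open>theta\<close> and the truncated series satisfies a linear equation that is
  strongly unstable in the direction of increasing \<open>\<kappa>\<close>; hence it is small to the left of any point
  where it is merely bounded.\<close>

lemma theta_expansion:
  assumes "0 < \<kappa>1" "\<kappa>1 < 1" "K \<ge> 1"
  obtains C N where "N \<ge> 1" "\<And>n \<kappa>. n \<ge> N \<Longrightarrow> 0 < \<kappa> \<Longrightarrow> \<kappa> \<le> \<kappa>1 \<Longrightarrow> \<bar>theta n \<kappa> - theta_sum K (1 / n) \<kappa>\<bar> \<le> C * (1 / n) ^ K"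
proof -
  obtain R where R: "R > 0" "\<And>x \<kappa>. 0 < \<kappa> \<Longrightarrow> \<kappa> < 1 \<Longrightarrow> 0 \<le> x \<Longrightarrow> x \<le> 1 \<Longrightarrow> \<bar>theta_residual K x \<kappa>\<bar> \<le> R * x ^ K"
    "\<And>x \<kappa>. 0 < \<kappa> \<Longrightarrow> \<kappa> < 1 \<Longrightarrow> 0 \<le> x \<Longrightarrow> x \<le> 1 \<Longrightarrow> \<bar>theta_sum K x \<kappa>\<bar> \<le> R * x"
    using theta_residual_bounded[OF assms(3)] by blast
  \<comment> \<open>A point between \<kappa>1 and 1 at which only the crude bounds on
    \<open>theta\<close> are used; the gap to \<kappa>1 pays for their crudeness.\<close>
  define \<kappa>2 where "\<kappa>2 = (1 + \<kappa>1) / 2"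
  have k2: "\<kappa>1 < \<kappa>2" "\<kappa>2 < 1" "0 < \<kappa>2" using assms by (auto simp: \<kappa>2_def)
  \<comment> \<open>The rate at which the integrating factor falls between \<kappa>1 and \<kappa>2,
    so that the contribution of the starting error at \<kappa>2 is
    \<open>exp (- \<alpha> * n)\<close>.\<close>
  define \<alpha> where "\<alpha> = (1 / \<kappa>1 - 1 / \<kappa>2) / 4"
  have \<alpha>: "\<alpha> > 0" using k2 assms by (simp add: \<alpha>_def frac_less2)
  define B where "B = 2 / (1 - \<kappa>2) + 2"
  have B: "B \<ge> 2" using k2 by (simp add: B_def)
  define C2 where "C2 = 4 * R\<^sup>2 + B\<^sup>2 * (fact (2 * K) / \<alpha> ^ (2 * K))"
  have C2: "C2 \<ge> 0" using \<alpha> by (auto simp: C2_def intro!: add_nonneg_nonneg)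
  show ?thesis
  proof (rule that[of "max 1 (2 * R)" "sqrt C2"])
    show "max 1 (2 * R) \<ge> 1" by simp
    fix n \<kappa> assume n: "n \<ge> max 1 (2 * R)" and kappa_of: "0 < \<kappa>" "\<kappa> \<le> \<kappa>1"
    define x where "x = 1 / n"
    have x: "0 < x" "x \<le> 1" "R * x \<le> 1/2" using n R(1) by (auto simp: x_def field_simps)
    have nx: "n * x = 1" "n > 0" using n by (auto simp: x_def)
    define e where "e k = theta n k - theta_sum K x k" for k
    define Rx where "Rx = R * x ^ K"
    \<comment> \<open>The subtracted constant absorbs the forcing by the residual, so that
      \<open>g\<close> times the integrating factor is monotone.\<close>
    define g where "g k = (e k)\<^sup>2 - 4 * Rx\<^sup>2" for k
    \<comment> \<open>An integrating factor: its logarithmic derivative is \<open>- c / 2\<close>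
      with the large coefficient \<open>c = n * (1 + k) / (2 * k^2)\<close>.\<close>
    define E where "E k = exp (- (n / 4) * (ln k - 1 / k))" for k :: real
    have dH: "\<exists>D. ((\<lambda>k. g k * E k) has_real_derivative D) (at k) \<and> 0 \<le> D" if k: "\<kappa> \<le> k" "k \<le> \<kappa>2" for k
    proof -
      have k01: "0 < k" "k < 1" using k kappa_of k2 by auto
      define c where "c = n * (1 + k) / (2 * k\<^sup>2)"
      have c: "c > 0" using k01 nx by (simp add: c_def)
      define th ts res where "th = theta n k" and "ts = theta_sum K x k" and "res = theta_residual K x k"
      define M where "M = th + ts + 1 + k + x * (k / (1 + k))"
      have d1: "(theta n has_real_derivative (c * (th\<^sup>2 + (1 + k) * th) + (1 + th) / (2 * k))) (at k)"
        using theta_has_derivative[of n k] k01 nx by (simp add: c_def th_def)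
      have d2: "(theta_sum K x has_real_derivative theta_sum_deriv K x k) (at k)"
        by (rule theta_sum_has_derivative[OF k01(1)])
      have cx: "c * (x * (k / (1 + k))) = 1 / (2 * k)"
      proof -
        have "c * (x * (k / (1 + k))) = (n * x) * ((1 + k) * k / (2 * k\<^sup>2 * (1 + k)))" by (simp add: c_def)
        also have "(1 + k) * k / (2 * k\<^sup>2 * (1 + k)) = 1 / (2 * k)" using k01 by (simp add: power2_eq_square)
        finally show ?thesis using nx by simp
      qed
      have ts': "theta_sum_deriv K x k = c * (ts\<^sup>2 + (1 + k) * ts) + (1 + ts) / (2 * k) - c * res"
      proof -
        have "c * res = c * (ts\<^sup>2 + (1 + k) * ts) + c * (x * (k / (1 + k))) * (1 + ts - 2 * k * theta_sum_deriv K x k)"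
          by (simp add: res_def theta_residual_def ts_def algebra_simps)
        also have "c * (x * (k / (1 + k))) * (1 + ts - 2 * k * theta_sum_deriv K x k) = (1 + ts) / (2 * k) - theta_sum_deriv K x k"
          unfolding cx using k01 by (simp add: field_simps)
        finally show ?thesis by simp
      qed
      have de: "(e has_real_derivative c * (e k * M + res)) (at k)"
      proof -
        have "(e has_real_derivative (c * (th\<^sup>2 + (1 + k) * th) + (1 + th) / (2 * k)) - theta_sum_deriv K x k) (at k)"
          unfolding e_def[abs_def] by (rule DERIV_diff[OF d1 d2])
        moreover have "(c * (th\<^sup>2 + (1 + k) * th) + (1 + th) / (2 * k)) - theta_sum_deriv K x k = c * (e k * M + res)"
        proof -
          have "(1 + th) / (2 * k) - (1 + ts) / (2 * k) = (1 / (2 * k)) * (th - ts)" by (simp add: diff_divide_distrib[symmetric])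
          also have "\<dots> = c * (x * (k / (1 + k))) * (th - ts)" by (simp only: cx)
          finally have "(1 + th) / (2 * k) = (1 + ts) / (2 * k) + c * (x * (k / (1 + k))) * (th - ts)" by simp
          then show ?thesis unfolding ts' e_def th_def[symmetric] ts_def[symmetric] M_def
            by (simp add: power2_eq_square algebra_simps)
        qed
        ultimately show ?thesis by simp
      qed
      \<comment> \<open>The lower bound \<open>theta \<ge> - k\<close> makes the linear coefficient
        positive. Near the other root it would be negative and the argument would fail.\<close>
      have M: "M \<ge> 1/2"
      proof -
        have "th \<ge> - k" unfolding th_def using theta_bounds(1)[of n k] n k01 by simp
        moreover have "\<bar>ts\<bar> \<le> 1/2" unfolding ts_def using R(3)[OF k01, of x] x by simp
        moreover have "x * (k / (1 + k)) \<ge> 0" using x k01 by simp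
        ultimately show ?thesis unfolding M_def by linarith
      qed
      have res: "\<bar>res\<bar> \<le> Rx" unfolding res_def Rx_def using R(2)[OF k01, of x] x by simp
      have dg: "(g has_real_derivative 2 * e k * (c * (e k * M + res))) (at k)"
        unfolding g_def[abs_def] using de by (auto intro!: derivative_eq_intros)
      have dE: "(E has_real_derivative - (c / 2) * E k) (at k)"
        unfolding E_def[abs_def] using k01 by (auto intro!: derivative_eq_intros simp: c_def field_simps power2_eq_square)
      have "((\<lambda>k. g k * E k) has_real_derivative (2 * e k * (c * (e k * M + res))) * E k + (- (c / 2) * E k) * g k) (at k)"
        by (rule DERIV_mult[OF dg dE])
      moreover have "(2 * e k * (c * (e k * M + res))) * E k + (- (c / 2) * E k) * g k
          = c * E k * (2 * (e k)\<^sup>2 * M + 2 * e k * res - (1/2) * (e k)\<^sup>2 + 2 * Rx\<^sup>2)"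
        unfolding g_def by (simp add: power2_eq_square algebra_simps)
      moreover have "2 * (e k)\<^sup>2 * M + 2 * e k * res - (1/2) * (e k)\<^sup>2 + 2 * Rx\<^sup>2 \<ge> 0"
      proof -
        have "2 * (e k)\<^sup>2 * (1/2) \<le> 2 * (e k)\<^sup>2 * M" using M by (intro mult_left_mono) auto
        moreover have "res\<^sup>2 \<le> Rx\<^sup>2" using res by (metis abs_ge_zero power2_abs power_mono)
        \<comment> \<open>The mixed term is absorbed by completing the square; this is why
          \<open>g\<close> subtracts four times the squared residual bound.\<close>
        moreover have "0 \<le> (1/2) * (e k + 2 * res)\<^sup>2" by simp
        ultimately show ?thesis by (simp add: power2_eq_square algebra_simps)
      qed
      ultimately show ?thesis using c by (intro exI[of _ "c * E k * (2 * (e k)\<^sup>2 * M + 2 * e k * res - (1/2) * (e k)\<^sup>2 + 2 * Rx\<^sup>2)"])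
        (auto simp: E_def intro!: mult_nonneg_nonneg)
    qed
    have H: "g \<kappa> * E \<kappa> \<le> g \<kappa>2 * E \<kappa>2"
      by (rule DERIV_nonneg_imp_nondecreasing[where f="\<lambda>k. g k * E k"]) (use dH kappa_of k2 in auto)
    have g2: "g \<kappa>2 \<le> B\<^sup>2"
    proof -
      have "\<bar>e \<kappa>2\<bar> \<le> B"
      proof -
        have "0 \<le> 2 / (1 - \<kappa>2)" using k2 by simp
        moreover have "- \<kappa>2 \<le> theta n \<kappa>2" "theta n \<kappa>2 \<le> 2 / (1 - \<kappa>2)" using theta_bounds[of n \<kappa>2] k2 n by auto
        moreover have "\<bar>theta_sum K x \<kappa>2\<bar> \<le> 1/2" using R(3)[of \<kappa>2 x] x k2 by auto
        ultimately show ?thesis using k2 unfolding e_def B_def by linarith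
      qed
      then have "(e \<kappa>2)\<^sup>2 \<le> B\<^sup>2" by (metis abs_ge_zero power2_abs power_mono)
      then show ?thesis unfolding g_def by (smt (verit) zero_le_power2)
    qed
    have "g \<kappa> \<le> B\<^sup>2 * (E \<kappa>2 / E \<kappa>)"
    proof -
      have "E \<kappa> > 0" "E \<kappa>2 > 0" by (auto simp: E_def)
      then have "g \<kappa> \<le> g \<kappa>2 * (E \<kappa>2 / E \<kappa>)" using H by (simp add: field_simps)
      also have "\<dots> \<le> B\<^sup>2 * (E \<kappa>2 / E \<kappa>)" using g2 \<open>E \<kappa> > 0\<close> \<open>E \<kappa>2 > 0\<close> by (intro mult_right_mono) auto
      finally show ?thesis .
    qed
    also have "E \<kappa>2 / E \<kappa> \<le> exp (- (\<alpha> * n))"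
    proof -
      have "E \<kappa>2 / E \<kappa> = exp (- (n / 4) * ((ln \<kappa>2 - 1 / \<kappa>2) - (ln \<kappa> - 1 / \<kappa>)))"
        by (simp only: E_def exp_diff[symmetric] right_diff_distrib)
      moreover have "ln \<kappa> \<le> ln \<kappa>2" "1 / \<kappa>1 \<le> 1 / \<kappa>" using kappa_of k2 by (auto simp: frac_le)
      then have "4 * \<alpha> \<le> (ln \<kappa>2 - 1 / \<kappa>2) - (ln \<kappa> - 1 / \<kappa>)" by (simp add: \<alpha>_def)
      then have "(n / 4) * (4 * \<alpha>) \<le> (n / 4) * ((ln \<kappa>2 - 1 / \<kappa>2) - (ln \<kappa> - 1 / \<kappa>))"
        using nx by (intro mult_left_mono) auto
      ultimately show ?thesis by (simp add: mult.commute)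
    qed
    also have "exp (- (\<alpha> * n)) \<le> fact (2 * K) / \<alpha> ^ (2 * K) * (1 / n) ^ (2 * K)"
      by (rule exp_neg_le_power[OF \<alpha> nx(2)])
    finally have "g \<kappa> \<le> B\<^sup>2 * (fact (2 * K) / \<alpha> ^ (2 * K) * (1 / n) ^ (2 * K))"
      by (simp add: mult_left_mono)
    moreover have "(1 / n) ^ (2 * K) = (x ^ K)\<^sup>2" by (simp add: x_def power_mult[symmetric] mult.commute)
    moreover have "(e \<kappa>)\<^sup>2 = g \<kappa> + 4 * R\<^sup>2 * (x ^ K)\<^sup>2" by (simp add: g_def Rx_def power_mult_distrib)
    ultimately have "(e \<kappa>)\<^sup>2 \<le> B\<^sup>2 * (fact (2 * K) / \<alpha> ^ (2 * K) * (x ^ K)\<^sup>2) + 4 * R\<^sup>2 * (x ^ K)\<^sup>2" by simp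
    also have "\<dots> = C2 * (x ^ K)\<^sup>2" by (simp only: C2_def distrib_right mult.assoc add.commute)
    also have "\<dots> = (sqrt C2 * x ^ K)\<^sup>2" using C2 by (simp add: power_mult_distrib)
    finally have "\<bar>e \<kappa>\<bar> \<le> \<bar>sqrt C2 * x ^ K\<bar>" by (simp only: abs_le_square_iff)
    also have "\<dots> = sqrt C2 * x ^ K" using x C2 by simp
    finally have "\<bar>e \<kappa>\<bar> \<le> sqrt C2 * x ^ K" .
    then show "\<bar>theta n \<kappa> - theta_sum K (1 / n) \<kappa>\<bar> \<le> sqrt C2 * (1 / n) ^ K" by (simp add: e_def x_def)
  qed
qed

section \<open>The coefficient functions\<close>

definition Dc :: "real \<Rightarrow> complex \<Rightarrow> complex" where "Dc \<kappa> u = of_real (1 - \<kappa>) + of_real \<kappa> * u"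

text \<open>The Taylor coefficients at \<open>u = 1\<close> of the phase difference divided by
  \<open>(u - 1)^2\<close>; the constant and linear terms of the phase difference vanish at the
  saddle point.\<close>

definition omega_coeff :: "real \<Rightarrow> nat \<Rightarrow> real" where
  "omega_coeff \<kappa> k = (- 1) ^ k * (1 - \<kappa> ^ (k + 2)) / real (k + 2)"

definition Omega :: "real \<Rightarrow> complex \<Rightarrow> complex" where
  "Omega \<kappa> u = (\<Sum>k. of_real (omega_coeff \<kappa> k) * (u - 1) ^ k)"

definition omega :: "real \<Rightarrow> complex \<Rightarrow> complex" where "omega \<kappa> u = csqrt (Omega \<kappa> u)"

text \<open>The holomorphic continuation of eta near \<open>u = 1\<close>. Factoring out
  \<open>u - 1\<close> before taking the root gives a branch whose sign follows that of
  \<open>u - 1\<close> on the real axis.\<close>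

definition Wc :: "real \<Rightarrow> complex \<Rightarrow> complex" where "Wc \<kappa> u = (u - 1) * omega \<kappa> u"

definition Psic :: "real \<Rightarrow> complex \<Rightarrow> complex" where
  "Psic \<kappa> u = of_real (1 - \<kappa>) * (u - 1) - Ln u + Ln (Dc \<kappa> u)"

text \<open>The factor \<open>1 - \<kappa>\<close> is kept because the leading coefficient is of
  that size too; the later comparison is relative to it.\<close>

lemma omega_coeff_le:
  assumes "0 < \<kappa>" "\<kappa> < 1" shows "\<bar>omega_coeff \<kappa> k\<bar> \<le> 1 - \<kappa>"
proof -
  have "1 - \<kappa> ^ (k + 2) = (1 - \<kappa>) * (\<Sum>i<k+2. \<kappa> ^ i)" by (rule one_diff_power_eq)
  also have "(\<Sum>i<k+2. \<kappa> ^ i) \<le> (\<Sum>i<k+2. 1)" by (rule sum_mono) (use assms in \<open>auto intro: power_le_one\<close>)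
  finally have "1 - \<kappa> ^ (k + 2) \<le> (1 - \<kappa>) * real (k + 2)" using assms by (simp add: mult_left_mono)
  moreover have "0 \<le> 1 - \<kappa> ^ (k + 2)" using power_le_one[of \<kappa> "k + 2"] assms by simp
  ultimately show ?thesis by (simp only: omega_coeff_def abs_mult abs_divide power_abs) (simp add: divide_le_eq)
qed

lemma Omega_sums:
  assumes "0 < \<kappa>" "\<kappa> < 1" "u \<in> ball 1 1"
  shows "(\<lambda>k. of_real (omega_coeff \<kappa> k) * (u - 1) ^ k) sums Omega \<kappa> u"
proof -
  have n: "norm (u - 1) < 1" using assms(3) by (simp add: dist_norm norm_minus_commute)
  have "summable (\<lambda>k. of_real (omega_coeff \<kappa> k) * (u - 1) ^ k)"
  proof (rule summable_comparison_test')
    show "summable (\<lambda>k. norm (u - 1) ^ k)" using n by (intro summable_geometric) simp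
    fix k
    have "\<bar>omega_coeff \<kappa> k\<bar> * norm (u - 1) ^ k \<le> 1 * norm (u - 1) ^ k"
      using omega_coeff_le[OF assms(1,2), of k] assms by (intro mult_right_mono) auto
    then show "norm (of_real (omega_coeff \<kappa> k) * (u - 1) ^ k) \<le> norm (u - 1) ^ k"
      by (simp add: norm_mult norm_power)
  qed
  then show ?thesis unfolding Omega_def by (rule summable_sums)
qed

lemma Omega_holomorphic:
  assumes "0 < \<kappa>" "\<kappa> < 1" shows "Omega \<kappa> holomorphic_on ball 1 1"
  by (rule power_series_holomorphic) (rule Omega_sums[OF assms])

lemma Omega_at_1: "Omega \<kappa> 1 = of_real ((1 - \<kappa>\<^sup>2) / 2)"
proof -
  have "(\<lambda>k. of_real (omega_coeff \<kappa> k) * (1 - 1) ^ k) sums (of_real (omega_coeff \<kappa> 0) :: complex)"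
    using powser_sums_zero[of "\<lambda>k. complex_of_real (omega_coeff \<kappa> k)"] by simp
  then have "Omega \<kappa> 1 = of_real (omega_coeff \<kappa> 0)" unfolding Omega_def by (simp add: sums_iff)
  then show ?thesis by (simp add: omega_coeff_def power2_eq_square)
qed

text \<open>The origin of the radius 1/4: for \<open>r < 1/4\<close> the geometric tail
  \<open>r / (1 - r)\<close> is at most 1/3, less than the 1/2 guaranteed by the leading
  coefficient. Hence \<open>Omega\<close> stays in the right half plane and its principal root is
  holomorphic.\<close>

lemma Omega_near:
  assumes "0 < \<kappa>" "\<kappa> < 1" "u \<in> ball 1 (1/4)"
  shows "norm (Omega \<kappa> u - of_real ((1 - \<kappa>\<^sup>2) / 2)) \<le> (1 - \<kappa>) / 3"
proof -
  define r where "r = norm (u - 1)"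
  have r: "0 \<le> r" "r < 1/4" using assms(3) by (auto simp: r_def dist_norm norm_minus_commute)
  have s: "(\<lambda>k. of_real (omega_coeff \<kappa> k) * (u - 1) ^ k) sums Omega \<kappa> u"
    using assms by (intro Omega_sums) auto
  have s1: "(\<lambda>k. of_real (omega_coeff \<kappa> (Suc k)) * (u - 1) ^ Suc k) sums (Omega \<kappa> u - of_real ((1 - \<kappa>\<^sup>2) / 2))"
    using sums_split_initial_segment[OF s, of 1] by (simp add: omega_coeff_def power2_eq_square)
  have g: "(\<lambda>k. (1 - \<kappa>) * (r * r ^ k)) sums ((1 - \<kappa>) * (r * (1 / (1 - r))))"
    using r by (intro sums_mult geometric_sums) auto
  have le: "norm (of_real (omega_coeff \<kappa> (Suc k)) * (u - 1) ^ Suc k) \<le> (1 - \<kappa>) * (r * r ^ k)" for k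
    using omega_coeff_le[OF assms(1,2), of "Suc k"] r by (auto simp: norm_mult norm_power r_def intro!: mult_right_mono)
  have "norm (Omega \<kappa> u - of_real ((1 - \<kappa>\<^sup>2) / 2)) \<le> (\<Sum>k. (1 - \<kappa>) * (r * r ^ k))"
    using norm_suminf_le[OF le sums_summable[OF g]] unfolding sums_unique[OF s1, symmetric] .
  also have "\<dots> = (1 - \<kappa>) * (r * (1 / (1 - r)))" using g by (rule sums_unique[symmetric])
  also have "\<dots> \<le> (1 - \<kappa>) * (1/3)"
  proof (rule mult_left_mono)
    show "r * (1 / (1 - r)) \<le> 1/3" using r by (simp add: field_simps)
  qed (use assms in simp)
  finally show ?thesis by simp
qed

lemma Omega_bounds:
  assumes "0 < \<kappa>" "\<kappa> < 1" "u \<in> ball 1 (1/4)"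
  shows "(1 - \<kappa>) / 6 \<le> Re (Omega \<kappa> u)" "(1 - \<kappa>) / 6 \<le> norm (Omega \<kappa> u)" "norm (Omega \<kappa> u) \<le> 2"
proof -
  define q where "q = (1 - \<kappa>\<^sup>2) / 2"
  have k: "1 - \<kappa> \<le> 2 * q" "2 * q \<le> 1" "1 - \<kappa> \<le> 1" using assms by (auto simp: q_def power2_eq_square mult_le_one)
  have near: "norm (Omega \<kappa> u - of_real q) \<le> (1 - \<kappa>) / 3" using Omega_near[OF assms] by (simp only: q_def)
  have "\<bar>Re (Omega \<kappa> u - of_real q)\<bar> \<le> (1 - \<kappa>) / 3"
    using near abs_Re_le_cmod order_trans by blast
  then have "- Re (Omega \<kappa> u - of_real q) \<le> (1 - \<kappa>) / 3" using abs_ge_minus_self order_trans by blast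
  then have "3 * q - (1 - \<kappa>) \<le> 3 * Re (Omega \<kappa> u)" by (simp add: field_simps)
  then show 1: "(1 - \<kappa>) / 6 \<le> Re (Omega \<kappa> u)" using k by (simp add: field_simps)
  then show "(1 - \<kappa>) / 6 \<le> norm (Omega \<kappa> u)" using complex_Re_le_cmod[of "Omega \<kappa> u"] by linarith
  have "norm (Omega \<kappa> u) \<le> norm (Omega \<kappa> u - of_real q) + norm (complex_of_real q)"
    using norm_triangle_ineq[of "Omega \<kappa> u - of_real q" "of_real q"] by simp
  moreover have "norm (complex_of_real q) = q"
    unfolding norm_of_real using k assms by simp
  moreover have "(1 - \<kappa>) / 3 \<le> 1" using k by simp
  ultimately show "norm (Omega \<kappa> u) \<le> 2" using near k by linarith
qed

lemma Omega_not_nonpos: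
  assumes "0 < \<kappa>" "\<kappa> < 1" "u \<in> ball 1 (1/4)" shows "Omega \<kappa> u \<notin> \<real>\<^sub>\<le>\<^sub>0"
  using Omega_bounds(1)[OF assms] assms by (auto simp: complex_nonpos_Reals_iff)

lemma omega_holomorphic:
  assumes "0 < \<kappa>" "\<kappa> < 1" shows "omega \<kappa> holomorphic_on ball 1 (1/4)"
  unfolding omega_def[abs_def]
  by (rule holomorphic_on_csqrt') (use assms in \<open>auto intro: holomorphic_on_subset[OF Omega_holomorphic] simp: Omega_not_nonpos\<close>)

lemma omega_nonzero:
  assumes "0 < \<kappa>" "\<kappa> < 1" "u \<in> ball 1 (1/4)" shows "omega \<kappa> u \<noteq> 0"
  using Omega_bounds(1)[OF assms] assms by (auto simp: omega_def)

lemma Wc_holomorphic: assumes "0 < \<kappa>" "\<kappa> < 1" shows "Wc \<kappa> holomorphic_on ball 1 (1/4)"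
  unfolding Wc_def[abs_def] by (intro holomorphic_intros omega_holomorphic assms)

lemma Dc_Re_pos: assumes "0 < \<kappa>" "\<kappa> < 1" "Re u > 0" shows "Re (Dc \<kappa> u) > 0"
  using assms by (simp add: Dc_def add_pos_pos)

lemma Re_pos_near_1: "u \<in> ball 1 (1/4) \<Longrightarrow> Re u > 0"
  using abs_Re_le_cmod[of "1 - u"] by (auto simp: dist_norm)

text \<open>Termwise comparison with the logarithm series at 1: the phase difference is a linear
  term plus \<open>Ln (1 + \<kappa> * h) - Ln (1 + h)\<close>, and removing the first two terms
  leaves \<open>h^2 * Omega\<close>.\<close>

lemma Wc_square:
  assumes "0 < \<kappa>" "\<kappa> < 1" "u \<in> ball 1 (1/4)" shows "(Wc \<kappa> u)\<^sup>2 = Psic \<kappa> u"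
proof -
  define h where "h = u - 1"
  have h: "norm h < 1" using assms(3) by (simp add: h_def dist_norm norm_minus_commute)
  have kh: "norm (of_real \<kappa> * h) < 1"
  proof -
    have "\<kappa> * norm h \<le> 1 * norm h" using assms by (intro mult_right_mono) auto
    with h assms show ?thesis by (simp add: norm_mult)
  qed
  have "(\<lambda>n. (- 1) ^ Suc n / of_nat n * (of_real \<kappa> * h) ^ n - (- 1) ^ Suc n / of_nat n * h ^ n) sums (Ln (1 + of_real \<kappa> * h) - Ln (1 + h))"
    by (intro sums_diff Ln_series h kh)
  from sums_split_initial_segment[OF this, of 2]
  have a: "(\<lambda>n. (- 1) ^ Suc (n + 2) / of_nat (n + 2) * (of_real \<kappa> * h) ^ (n + 2) - (- 1) ^ Suc (n + 2) / of_nat (n + 2) * h ^ (n + 2))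
     sums (Ln (1 + of_real \<kappa> * h) - Ln (1 + h) - (of_real \<kappa> * h - h))"
    by (simp add: numeral_2_eq_2)
  have "(\<lambda>n. h\<^sup>2 * (of_real (omega_coeff \<kappa> n) * h ^ n)) sums (h\<^sup>2 * Omega \<kappa> u)"
    using Omega_sums[of \<kappa> u] assms by (intro sums_mult) (simp add: h_def)
  moreover have "h\<^sup>2 * (of_real (omega_coeff \<kappa> n) * h ^ n)
    = (- 1) ^ Suc (n + 2) / of_nat (n + 2) * (of_real \<kappa> * h) ^ (n + 2) - (- 1) ^ Suc (n + 2) / of_nat (n + 2) * h ^ (n + 2)" for n
  proof -
    have c: "complex_of_real (omega_coeff \<kappa> n) = (- 1) ^ n * (1 - of_real \<kappa> ^ (n + 2)) / of_nat (n + 2)"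
      unfolding omega_coeff_def by (simp only: of_real_divide of_real_mult of_real_diff of_real_power of_real_of_nat_eq of_real_1 of_real_minus)
    have p: "(- 1 :: complex) ^ Suc (n + 2) = - ((- 1) ^ n)" by simp
    have "h\<^sup>2 * (of_real (omega_coeff \<kappa> n) * h ^ n) = of_real (omega_coeff \<kappa> n) * h ^ (n + 2)" by (simp add: power_add power2_eq_square)
    also have "\<dots> = - ((- 1) ^ n) / of_nat (n + 2) * (of_real \<kappa> * h) ^ (n + 2) - - ((- 1) ^ n) / of_nat (n + 2) * h ^ (n + 2)"
      unfolding c power_mult_distrib[of _ h] by (simp only: right_diff_distrib left_diff_distrib diff_divide_distrib) (simp del: of_nat_add power_Suc)
    finally show ?thesis unfolding p .
  qed
  ultimately have "h\<^sup>2 * Omega \<kappa> u = Ln (1 + of_real \<kappa> * h) - Ln (1 + h) - (of_real \<kappa> * h - h)"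
    using a sums_unique2 by simp
  moreover have "Psic \<kappa> u = of_real (1 - \<kappa>) * h - Ln (1 + h) + Ln (1 + of_real \<kappa> * h)"
    by (simp add: Psic_def h_def Dc_def algebra_simps)
  moreover have "(Wc \<kappa> u)\<^sup>2 = h\<^sup>2 * Omega \<kappa> u" by (simp add: Wc_def omega_def power_mult_distrib h_def)
  ultimately have "(Wc \<kappa> u)\<^sup>2 = Psic \<kappa> u" by (simp only:) (simp add: algebra_simps)
  then show ?thesis .
qed

text \<open>The reciprocal of \<open>omega\<close> at 1. In the original variables
  \<open>tau \<kappa> * (t0 - 1)\<close> is the coefficient \<open>t1\<close>.\<close>

definition tau :: "real \<Rightarrow> real" where "tau \<kappa> = sqrt (2 / (1 - \<kappa>\<^sup>2))"

lemma tau_pos: "0 < \<kappa> \<Longrightarrow> \<kappa> < 1 \<Longrightarrow> tau \<kappa> > 0"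
  by (simp add: tau_def power_less_one_iff)

lemma tau_square: "0 < \<kappa> \<Longrightarrow> \<kappa> < 1 \<Longrightarrow> (tau \<kappa>)\<^sup>2 = 2 / (1 - \<kappa>\<^sup>2)"
  by (simp add: tau_def power_le_one)

text \<open>The quotient of \<open>2 * (u - 1)\<close> by the derivative of the phase difference,
  simplified so that it is holomorphic and nonzero at \<open>u = 1\<close>.\<close>

definition Vc :: "real \<Rightarrow> complex \<Rightarrow> complex" where
  "Vc \<kappa> u = 2 * u * Dc \<kappa> u / (of_real (1 - \<kappa>) * (1 + of_real \<kappa> * u))"

text \<open>The divided difference at 1 with the removable singularity filled in, so that dividing
  by \<open>u - 1\<close> does not lead out of the holomorphic functions.\<close>

definition slope :: "(complex \<Rightarrow> complex) \<Rightarrow> complex \<Rightarrow> complex" where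
  "slope f u = (if u = 1 then deriv f 1 else (f u - f 1) / (u - 1))"

lemma slope_holomorphic: "f holomorphic_on S \<Longrightarrow> open S \<Longrightarrow> slope f holomorphic_on S"
  unfolding slope_def[abs_def] by (rule pole_lemma_open)

text \<open>The recursion \<open>\<Psi>' c\<^sub>k\<^sub>+\<^sub>1 / 2 = r\<^sub>k\<^sub>+\<^sub>1 + c\<^sub>k'\<close> is solved twice: near \<open>u = 1\<close> by functions \<open>E\<close>
  holomorphic at \<open>1\<close>, and away from \<open>1\<close> by explicit functions \<open>R\<close>, where \<open>c\<^sub>k = R - d\<^sub>k / W ^ (2 k + 1)\<close>.
  The third component collects the normalising constants that make \<open>E\<close> regular at \<open>1\<close>.\<close>

definition source :: "real \<Rightarrow> real \<Rightarrow> real \<Rightarrow> complex \<Rightarrow> complex" where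
  "source \<kappa> \<nu> t u = of_real (tau \<kappa>) * csqrt (Dc \<kappa> u) * (of_real \<nu> + of_real t / (1 + of_real \<kappa> * u))"

primrec coeff_state :: "real \<Rightarrow> nat \<Rightarrow> (complex \<Rightarrow> complex) \<times> (complex \<Rightarrow> complex) \<times> (nat \<Rightarrow> real)" where
  "coeff_state \<kappa> 0 = ((\<lambda>u. slope (\<lambda>u. of_real (tau \<kappa>) * csqrt (Dc \<kappa> u) * omega \<kappa> u) u / omega \<kappa> u),
     (\<lambda>u. of_real (tau \<kappa>) * csqrt (Dc \<kappa> u) / (u - 1)), (\<lambda>i. if i = 0 then 1 else 0))"
| "coeff_state \<kappa> (Suc k) =
     (let E = fst (coeff_state \<kappa> k); R = fst (snd (coeff_state \<kappa> k)); \<nu> = snd (snd (coeff_state \<kappa> k));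
          t = (\<Sum>i\<le>k. \<nu> i * theta_coeff (Suc k - i) \<kappa>);
          m = - t / (1 + \<kappa>) - tau \<kappa> * Re (deriv E 1)
      in (slope (\<lambda>u. source \<kappa> m t u + Vc \<kappa> u * deriv E u),
          (\<lambda>u. (source \<kappa> m t u + Vc \<kappa> u * deriv R u) / (u - 1)), \<nu>(Suc k := m)))"

definition cE :: "real \<Rightarrow> nat \<Rightarrow> complex \<Rightarrow> complex" where "cE \<kappa> k = fst (coeff_state \<kappa> k)"
definition cR :: "real \<Rightarrow> nat \<Rightarrow> complex \<Rightarrow> complex" where "cR \<kappa> k = fst (snd (coeff_state \<kappa> k))"
definition nu :: "real \<Rightarrow> nat \<Rightarrow> real" where "nu \<kappa> k = snd (snd (coeff_state \<kappa> k)) k"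
text \<open>The coefficient of \<open>n^-k\<close> in the product of the two series. As
  \<open>theta_coeff 0\<close> vanishes, only \<open>nu \<kappa> i\<close> with \<open>i < k\<close>
  enters, which keeps the recursion well founded.\<close>

definition nutheta :: "real \<Rightarrow> nat \<Rightarrow> real" where "nutheta \<kappa> k = (\<Sum>i\<le>k. nu \<kappa> i * theta_coeff (k - i) \<kappa>)"

lemma coeff_state_nu: "i \<le> k \<Longrightarrow> snd (snd (coeff_state \<kappa> k)) i = nu \<kappa> i"
  by (induction k) (auto simp: nu_def Let_def le_Suc_eq)

lemma nu_0 [simp]: "nu \<kappa> 0 = 1" by (simp add: nu_def)
lemma nutheta_0 [simp]: "nutheta \<kappa> 0 = 0" by (simp add: nutheta_def)

lemma nutheta_Suc_eq: "(\<Sum>i\<le>k. snd (snd (coeff_state \<kappa> k)) i * theta_coeff (Suc k - i) \<kappa>) = nutheta \<kappa> (Suc k)"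
  by (simp add: nutheta_def coeff_state_nu)

lemma nu_Suc: "nu \<kappa> (Suc k) = - nutheta \<kappa> (Suc k) / (1 + \<kappa>) - tau \<kappa> * Re (deriv (cE \<kappa> k) 1)"
  unfolding nu_def[of \<kappa> "Suc k"] coeff_state.simps Let_def nutheta_Suc_eq by (simp add: cE_def)

lemma cE_Suc: "cE \<kappa> (Suc k) = slope (\<lambda>u. source \<kappa> (nu \<kappa> (Suc k)) (nutheta \<kappa> (Suc k)) u + Vc \<kappa> u * deriv (cE \<kappa> k) u)"
  unfolding nu_Suc cE_def[of \<kappa> "Suc k"] coeff_state.simps Let_def nutheta_Suc_eq by (simp add: cE_def)

lemma cR_Suc: "cR \<kappa> (Suc k) = (\<lambda>u. (source \<kappa> (nu \<kappa> (Suc k)) (nutheta \<kappa> (Suc k)) u + Vc \<kappa> u * deriv (cR \<kappa> k) u) / (u - 1))"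
  unfolding nu_Suc cR_def[of \<kappa> "Suc k"] coeff_state.simps Let_def nutheta_Suc_eq by (simp add: cE_def cR_def)

lemma cR_0: "cR \<kappa> 0 = (\<lambda>u. of_real (tau \<kappa>) * csqrt (Dc \<kappa> u) / (u - 1))" by (simp add: cR_def)

lemma cE_0: "cE \<kappa> 0 = (\<lambda>u. slope (\<lambda>u. of_real (tau \<kappa>) * csqrt (Dc \<kappa> u) * omega \<kappa> u) u / omega \<kappa> u)" by (simp add: cE_def)

abbreviation half_plane :: "complex set" where "half_plane \<equiv> {u. Re u > 0}"

lemma open_half_plane: "open half_plane" by (rule open_halfspace_Re_gt)

lemma one_plus_nonzero: assumes "0 < \<kappa>" "Re u > 0" shows "1 + of_real \<kappa> * u \<noteq> 0"
proof -
  have "Re (1 + of_real \<kappa> * u) > 0" using assms by (simp add: add_pos_pos)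
  then show ?thesis by (metis less_irrefl zero_complex.sel(1))
qed

lemma source_holomorphic:
  assumes "0 < \<kappa>" "\<kappa> < 1" shows "source \<kappa> \<nu> t holomorphic_on half_plane"
proof -
  have "Dc \<kappa> u \<notin> \<real>\<^sub>\<le>\<^sub>0" if "Re u > 0" for u
    using Dc_Re_pos[OF assms that] by (auto simp: complex_nonpos_Reals_iff)
  moreover have "Dc \<kappa> holomorphic_on half_plane" unfolding Dc_def[abs_def] by (intro holomorphic_intros)
  ultimately show ?thesis unfolding source_def[abs_def]
    by (intro holomorphic_intros holomorphic_on_csqrt) (use one_plus_nonzero[OF assms(1)] in auto)
qed

lemma Vc_holomorphic:
  assumes "0 < \<kappa>" "\<kappa> < 1" shows "Vc \<kappa> holomorphic_on half_plane"
  unfolding Vc_def[abs_def] Dc_def[abs_def]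
  by (intro holomorphic_intros) (use one_plus_nonzero[OF assms(1)] assms in auto)

lemma near_1_half_plane: "ball 1 (1/4) \<subseteq> half_plane" using Re_pos_near_1 by auto

lemma cR_0_source: "cR \<kappa> 0 = (\<lambda>u. source \<kappa> 1 0 u / (u - 1))"
  by (simp add: cR_0 source_def[abs_def])

lemma cE_0_source: "cE \<kappa> 0 = (\<lambda>u. slope (\<lambda>u. source \<kappa> 1 0 u * omega \<kappa> u) u / omega \<kappa> u)"
  by (simp add: cE_0 source_def[abs_def])

lemma cE_holomorphic:
  assumes "0 < \<kappa>" "\<kappa> < 1" shows "cE \<kappa> k holomorphic_on ball 1 (1/4)"
proof (induction k)
  case 0
  have "(\<lambda>u. source \<kappa> 1 0 u * omega \<kappa> u) holomorphic_on ball 1 (1/4)"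
    by (intro holomorphic_intros omega_holomorphic assms holomorphic_on_subset[OF source_holomorphic near_1_half_plane])
  then show ?case unfolding cE_0_source
    by (intro holomorphic_on_divide slope_holomorphic omega_holomorphic assms) (auto simp: omega_nonzero assms)
next
  case (Suc k)
  then show ?case unfolding cE_Suc
    by (intro slope_holomorphic holomorphic_intros holomorphic_on_subset[OF source_holomorphic near_1_half_plane]
       holomorphic_on_subset[OF Vc_holomorphic near_1_half_plane] holomorphic_deriv) (use assms in auto)
qed

lemma cR_holomorphic:
  assumes "0 < \<kappa>" "\<kappa> < 1" shows "cR \<kappa> k holomorphic_on half_plane - {1}"
proof (induction k)
  case 0
  show ?case unfolding cR_0_source
    by (intro holomorphic_intros holomorphic_on_subset[OF source_holomorphic]) (use assms in auto)
next
  case (Suc k)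
  then show ?case unfolding cR_Suc
    by (intro holomorphic_intros holomorphic_on_subset[OF source_holomorphic] holomorphic_on_subset[OF Vc_holomorphic] holomorphic_deriv)
      (use assms open_half_plane in auto)
qed

text \<open>The normalizing constants are defined through real parts; reality of the derivatives is
  what makes the complex identities hold with them.\<close>

lemma deriv_real_of_real_valued:
  assumes "(f has_field_derivative f') (at (complex_of_real a))" "r > 0"
    and "\<And>x. \<bar>x - a\<bar> < r \<Longrightarrow> Im (f (of_real x)) = 0"
  shows "Im f' = 0"
proof -
  have "((\<lambda>x. f (of_real x)) has_vector_derivative f') (at a)"
    using has_vector_derivative_real_field[OF assms(1)] .
  then have "((\<lambda>x. Im (f (of_real x))) has_vector_derivative Im f') (at a)"
    by (rule bounded_linear.has_vector_derivative[OF bounded_linear_Im])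
  moreover have "((\<lambda>x. Im (f (of_real x))) has_vector_derivative 0) (at a)"
  proof (rule has_vector_derivative_transform_within_open[where f="\<lambda>_. 0" and S="ball a r"])
    show "((\<lambda>_. 0) has_vector_derivative 0) (at a)" by simp
  qed (use assms in \<open>auto simp: dist_real_def abs_minus_commute\<close>)
  ultimately show ?thesis using vector_derivative_unique_at by blast
qed

lemma Dc_of_real: "Dc \<kappa> (of_real x) = of_real (1 - \<kappa> + \<kappa> * x)" by (simp add: Dc_def)

lemma Omega_of_real:
  assumes "0 < \<kappa>" "\<kappa> < 1" "of_real x \<in> ball (1::complex) 1"
  shows "Omega \<kappa> (of_real x) = of_real (Re (Omega \<kappa> (of_real x)))"
proof -
  have "(\<lambda>k. complex_of_real (omega_coeff \<kappa> k * (x - 1) ^ k)) sums Omega \<kappa> (of_real x)"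
    using Omega_sums[OF assms] by simp
  from sums_Im[OF this] have "Im (Omega \<kappa> (of_real x)) = 0" by (simp add: sums_iff)
  then show ?thesis by (simp add: complex_eq_iff)
qed

lemma of_real_near_1: "complex_of_real x \<in> ball 1 r \<longleftrightarrow> \<bar>x - 1\<bar> < r"
proof -
  have "dist 1 (complex_of_real x) = \<bar>x - 1\<bar>"
    by (metis dist_commute dist_norm norm_of_real of_real_1 of_real_diff)
  then show ?thesis by simp
qed

lemma omega_of_real:
  assumes "0 < \<kappa>" "\<kappa> < 1" "\<bar>x - 1\<bar> < 1/4"
  shows "omega \<kappa> (of_real x) = of_real (sqrt (Re (Omega \<kappa> (of_real x))))"
proof -
  have "of_real x \<in> ball (1::complex) (1/4)" using assms of_real_near_1 by blast
  then have "Re (Omega \<kappa> (of_real x)) \<ge> 0" using Omega_bounds(1)[of \<kappa> "of_real x"] assms by simp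
  then have "csqrt (of_real (Re (Omega \<kappa> (of_real x)))) = of_real (sqrt (Re (Omega \<kappa> (of_real x))))"
    by (rule csqrt_of_real)
  moreover have "complex_of_real x \<in> ball 1 1" using of_real_near_1[of x 1] assms(3) by linarith
  ultimately show ?thesis unfolding omega_def using Omega_of_real[OF assms(1,2)] by metis
qed

lemma omega_at_1: assumes "0 < \<kappa>" "\<kappa> < 1" shows "of_real (tau \<kappa>) * omega \<kappa> 1 = 1"
proof -
  have k: "1 - \<kappa>\<^sup>2 > 0" using assms by (simp add: power_less_one_iff)
  have "omega \<kappa> 1 = of_real (sqrt ((1 - \<kappa>\<^sup>2) / 2))"
    unfolding omega_def Omega_at_1 using k by (intro of_real_sqrt[symmetric]) auto
  moreover have "tau \<kappa> * sqrt ((1 - \<kappa>\<^sup>2) / 2) = 1"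
    unfolding tau_def using k by (simp add: real_sqrt_mult[symmetric])
  ultimately show ?thesis by (metis of_real_1 of_real_mult)
qed

lemma source_of_real:
  assumes "0 < \<kappa>" "\<kappa> < 1" "x > 0"
  shows "source \<kappa> \<nu> t (of_real x) = of_real (tau \<kappa> * sqrt (1 - \<kappa> + \<kappa> * x) * (\<nu> + t / (1 + \<kappa> * x)))"
  unfolding source_def Dc_of_real using assms
  by (subst of_real_sqrt[symmetric]) (auto intro!: add_nonneg_nonneg)

lemma Vc_of_real:
  "Vc \<kappa> (of_real x) = of_real (2 * x * (1 - \<kappa> + \<kappa> * x) / ((1 - \<kappa>) * (1 + \<kappa> * x)))"
  unfolding Vc_def Dc_of_real by simp

lemma slope_real:
  assumes "f holomorphic_on ball 1 (1/4)" "\<And>x. \<bar>x - 1\<bar> < 1/4 \<Longrightarrow> Im (f (of_real x)) = 0" "\<bar>x - 1\<bar> < 1/4"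
  shows "Im (slope f (of_real x)) = 0"
proof (cases "x = 1")
  case True
  have "(f has_field_derivative deriv f 1) (at (of_real 1))"
    using holomorphic_derivI[OF assms(1), of 1] by simp
  then have "Im (deriv f 1) = 0" by (rule deriv_real_of_real_valued[where r="1/4"]) (use assms in auto)
  then show ?thesis using True by (simp add: slope_def)
next
  case False
  have "f (of_real x) = of_real (Re (f (of_real x)))" "f 1 = of_real (Re (f 1))"
    using assms(2)[OF assms(3)] assms(2)[of 1] by (auto simp: complex_eq_iff)
  then have "slope f (of_real x) = of_real ((Re (f (of_real x)) - Re (f 1)) / (x - 1))"
    using False by (simp add: slope_def)
  then show ?thesis by simp
qed

lemma cE_real:
  assumes "0 < \<kappa>" "\<kappa> < 1"
  shows "\<bar>x - 1\<bar> < 1/4 \<Longrightarrow> Im (cE \<kappa> k (of_real x)) = 0"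
proof (induction k arbitrary: x)
  case 0
  have h: "(\<lambda>u. source \<kappa> 1 0 u * omega \<kappa> u) holomorphic_on ball 1 (1/4)"
    by (intro holomorphic_intros omega_holomorphic assms holomorphic_on_subset[OF source_holomorphic near_1_half_plane])
  have "Im (slope (\<lambda>u. source \<kappa> 1 0 u * omega \<kappa> u) (of_real x)) = 0"
  proof (rule slope_real[OF h _ 0])
    fix y :: real assume y: "\<bar>y - 1\<bar> < 1/4"
    then have "y > 0" by linarith
    with y show "Im (source \<kappa> 1 0 (of_real y) * omega \<kappa> (of_real y)) = 0"
      using source_of_real[OF assms, of y] omega_of_real[OF assms, of y] by simp
  qed
  then show ?case unfolding cE_0_source using omega_of_real[OF assms 0] by (simp add: Im_divide_of_real)
next
  case (Suc k)
  show ?case unfolding cE_Suc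
  proof (rule slope_real[OF _ _ Suc.prems])
    show "(\<lambda>u. source \<kappa> (nu \<kappa> (Suc k)) (nutheta \<kappa> (Suc k)) u + Vc \<kappa> u * deriv (cE \<kappa> k) u) holomorphic_on ball 1 (1/4)"
      by (intro holomorphic_intros holomorphic_on_subset[OF source_holomorphic near_1_half_plane]
        holomorphic_on_subset[OF Vc_holomorphic near_1_half_plane] holomorphic_deriv cE_holomorphic) (use assms in auto)
    fix y :: real assume y: "\<bar>y - 1\<bar> < 1/4"
    then have "complex_of_real y \<in> ball 1 (1/4)" using of_real_near_1 by blast
    then have "(cE \<kappa> k has_field_derivative deriv (cE \<kappa> k) (of_real y)) (at (of_real y))"
      using holomorphic_derivI[OF cE_holomorphic[OF assms]] by simp
    then have "Im (deriv (cE \<kappa> k) (of_real y)) = 0"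
    proof (rule deriv_real_of_real_valued[where r="1/4 - \<bar>y - 1\<bar>"])
      show "Im (cE \<kappa> k (of_real x)) = 0" if "\<bar>x - y\<bar> < 1/4 - \<bar>y - 1\<bar>" for x
        by (rule Suc.IH) (use that in linarith)
    qed (use y in simp)
    moreover have "y > 0" using y by linarith
    ultimately show "Im (source \<kappa> (nu \<kappa> (Suc k)) (nutheta \<kappa> (Suc k)) (of_real y) + Vc \<kappa> (of_real y) * deriv (cE \<kappa> k) (of_real y)) = 0"
      using source_of_real[OF assms, of y] Vc_of_real[of \<kappa> y] by simp
  qed
qed

lemma cE_deriv_1_real: assumes "0 < \<kappa>" "\<kappa> < 1" shows "deriv (cE \<kappa> k) 1 = of_real (Re (deriv (cE \<kappa> k) 1))"
proof -
  have "(cE \<kappa> k has_field_derivative deriv (cE \<kappa> k) 1) (at (of_real 1))"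
    using holomorphic_derivI[OF cE_holomorphic[OF assms], of 1] by simp
  then have "Im (deriv (cE \<kappa> k) 1) = 0"
    by (rule deriv_real_of_real_valued[where r="1/4"]) (use cE_real[OF assms] in auto)
  then show ?thesis by (simp add: complex_eq_iff)
qed

text \<open>The constant \<open>nu\<close> was chosen for this: since \<open>Vc\<close> equals
  \<open>tau^2\<close> at 1 and the derivative there is real, the numerator vanishes, so
  \<open>slope\<close> really divides it by \<open>u - 1\<close> without subtracting a
  constant.\<close>

lemma cE_recursion_at_1:
  assumes "0 < \<kappa>" "\<kappa> < 1"
  shows "source \<kappa> (nu \<kappa> (Suc k)) (nutheta \<kappa> (Suc k)) 1 + Vc \<kappa> 1 * deriv (cE \<kappa> k) 1 = 0"
proof -
  define e where "e = Re (deriv (cE \<kappa> k) 1)"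
  have k: "1 - \<kappa>\<^sup>2 > 0" using assms by (simp add: power_less_one_iff)
  have s: "source \<kappa> (nu \<kappa> (Suc k)) (nutheta \<kappa> (Suc k)) 1 = of_real (tau \<kappa> * (nu \<kappa> (Suc k) + nutheta \<kappa> (Suc k) / (1 + \<kappa>)))"
    using source_of_real[OF assms, of 1] by simp
  have "Vc \<kappa> 1 = of_real (2 / ((1 - \<kappa>) * (1 + \<kappa>)))" using Vc_of_real[of \<kappa> 1] by simp
  also have "2 / ((1 - \<kappa>) * (1 + \<kappa>)) = tau \<kappa> * tau \<kappa>"
    using tau_square[OF assms] by (simp add: power2_eq_square algebra_simps)
  finally have v: "Vc \<kappa> 1 = of_real (tau \<kappa> * tau \<kappa>)" .
  have "tau \<kappa> * (nu \<kappa> (Suc k) + nutheta \<kappa> (Suc k) / (1 + \<kappa>)) + tau \<kappa> * tau \<kappa> * e = 0"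
    unfolding nu_Suc e_def by (simp add: algebra_simps)
  moreover have "deriv (cE \<kappa> k) 1 = of_real e" unfolding e_def by (rule cE_deriv_1_real[OF assms])
  ultimately show ?thesis unfolding s v by (metis of_real_0 of_real_add of_real_mult)
qed

text \<open>The coefficients \<open>1, -1, 3, -15, ...\<close> of the large argument expansion of
  \<open>erfc\<close>; away from 1 they cancel the expansion of the error function term.\<close>

primrec dcoeff :: "nat \<Rightarrow> real" where
  "dcoeff 0 = 1" | "dcoeff (Suc k) = - (2 * real k + 1) * dcoeff k"

lemma Psic_has_derivative:
  assumes "0 < \<kappa>" "\<kappa> < 1" "Re u > 0"
  shows "(Psic \<kappa> has_field_derivative 2 * (u - 1) / Vc \<kappa> u) (at u)"
proof -
  have nz: "u \<noteq> 0" "Dc \<kappa> u \<noteq> 0" "1 + of_real \<kappa> * u \<noteq> 0" "1 - of_real \<kappa> \<noteq> (0::complex)"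
    using Dc_Re_pos[OF assms] assms one_plus_nonzero[OF assms(1,3)] by (auto simp: complex_eq_iff)
  have n: "u \<notin> \<real>\<^sub>\<le>\<^sub>0" "Dc \<kappa> u \<notin> \<real>\<^sub>\<le>\<^sub>0"
    using Dc_Re_pos[OF assms] assms by (auto simp: complex_nonpos_Reals_iff)
  have d: "(Dc \<kappa> has_field_derivative of_real \<kappa>) (at u)"
    unfolding Dc_def[abs_def] by (auto intro!: derivative_eq_intros)
  have "(Psic \<kappa> has_field_derivative (of_real (1 - \<kappa>) - 1 / u + of_real \<kappa> / Dc \<kappa> u)) (at u)"
    unfolding Psic_def[abs_def] using d n by (auto intro!: derivative_eq_intros simp: divide_inverse)
  moreover have "of_real (1 - \<kappa>) - 1 / u + of_real \<kappa> / Dc \<kappa> u = 2 * (u - 1) / Vc \<kappa> u"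
  proof -
    have "2 * (u - 1) / Vc \<kappa> u = (u - 1) * (of_real (1 - \<kappa>) * (1 + of_real \<kappa> * u)) / (u * Dc \<kappa> u)"
    proof -
      have "2 * (u - 1) / Vc \<kappa> u = (2 * ((u - 1) * (of_real (1 - \<kappa>) * (1 + of_real \<kappa> * u)))) / (2 * (u * Dc \<kappa> u))"
        unfolding Vc_def by (simp only: divide_divide_eq_right mult.assoc)
      then show ?thesis by (simp only: mult_divide_mult_cancel_left_if) simp
    qed
    moreover have "of_real (1 - \<kappa>) - 1 / u + of_real \<kappa> / Dc \<kappa> u = (of_real (1 - \<kappa>) * u * Dc \<kappa> u - Dc \<kappa> u + of_real \<kappa> * u) / (u * Dc \<kappa> u)"
      using nz by (simp add: field_simps)
    moreover have "of_real (1 - \<kappa>) * u * Dc \<kappa> u - Dc \<kappa> u + of_real \<kappa> * u = (u - 1) * (of_real (1 - \<kappa>) * (1 + of_real \<kappa> * u))"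
      by (simp add: Dc_def algebra_simps)
    ultimately show ?thesis by simp
  qed
  ultimately show ?thesis by simp
qed

lemma Vc_nonzero: assumes "0 < \<kappa>" "\<kappa> < 1" "Re u > 0" shows "Vc \<kappa> u \<noteq> 0"
proof -
  have "u \<noteq> 0" "Dc \<kappa> u \<noteq> 0" "of_real (1 - \<kappa>) \<noteq> (0::complex)"
    using Dc_Re_pos[OF assms] assms by (auto simp: complex_eq_iff)
  then show ?thesis using one_plus_nonzero[OF assms(1,3)] unfolding Vc_def by simp
qed

lemma Wc_nonzero:
  assumes "0 < \<kappa>" "\<kappa> < 1" "u \<in> ball 1 (1/4)" "u \<noteq> 1" shows "Wc \<kappa> u \<noteq> 0"
  using omega_nonzero[OF assms(1-3)] assms(4) by (simp add: Wc_def)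

text \<open>Differentiates \<open>Wc^2 = Psic\<close> instead of the square root, then divides by
  \<open>Wc\<close>, which is nonzero off 1.\<close>

lemma Wc_has_derivative:
  assumes "0 < \<kappa>" "\<kappa> < 1" "u \<in> ball 1 (1/4)" "u \<noteq> 1"
  shows "(Wc \<kappa> has_field_derivative (u - 1) / (Vc \<kappa> u * Wc \<kappa> u)) (at u)"
proof -
  have W: "(Wc \<kappa> has_field_derivative deriv (Wc \<kappa>) u) (at u)"
    using holomorphic_derivI[OF Wc_holomorphic[OF assms(1,2)], of u] assms(3) by simp
  have "((\<lambda>u. (Wc \<kappa> u)\<^sup>2) has_field_derivative 2 * Wc \<kappa> u * deriv (Wc \<kappa>) u) (at u)"
    using W by (auto intro!: derivative_eq_intros)
  then have "(Psic \<kappa> has_field_derivative 2 * Wc \<kappa> u * deriv (Wc \<kappa>) u) (at u)"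
    by (rule has_field_derivative_transform_within_open[where S="ball 1 (1/4)"]) (use assms Wc_square in auto)
  with Psic_has_derivative[OF assms(1,2) Re_pos_near_1[OF assms(3)]]
  have "2 * Wc \<kappa> u * deriv (Wc \<kappa>) u = 2 * (u - 1) / Vc \<kappa> u" by (rule DERIV_unique[rotated])
  then have "2 * (Wc \<kappa> u * deriv (Wc \<kappa>) u) = 2 * ((u - 1) / Vc \<kappa> u)" by (simp only: mult.assoc times_divide_eq_right)
  then have "Wc \<kappa> u * deriv (Wc \<kappa>) u = (u - 1) / Vc \<kappa> u" by (simp only: mult_cancel_left) simp
  then have "deriv (Wc \<kappa>) u = (u - 1) / Vc \<kappa> u / Wc \<kappa> u"
    using Wc_nonzero[OF assms] by (metis nonzero_mult_div_cancel_left)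
  then have "deriv (Wc \<kappa>) u = (u - 1) / (Vc \<kappa> u * Wc \<kappa> u)" by simp
  with W show ?thesis by simp
qed

text \<open>Both sides obey the same recursion: \<open>Vc\<close> times the derivative of
  \<open>dcoeff k / W ^ (2 * k + 1)\<close> is
  \<open>dcoeff (k + 1) * (u - 1) / W ^ (2 * k + 3)\<close>. The base case uses that the function
  inside \<open>slope\<close> has the value 1 at \<open>u = 1\<close>.\<close>

lemma cE_eq_cR:
  assumes "0 < \<kappa>" "\<kappa> < 1"
  shows "u \<in> ball 1 (1/4) \<Longrightarrow> u \<noteq> 1 \<Longrightarrow> cE \<kappa> k u = cR \<kappa> k u - of_real (dcoeff k) / Wc \<kappa> u ^ (2 * k + 1)"
proof (induction k arbitrary: u)
  case 0
  have "of_real (tau \<kappa>) * csqrt (Dc \<kappa> 1) * omega \<kappa> 1 = 1"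
    using omega_at_1[OF assms] by (simp add: Dc_def)
  then have "cE \<kappa> 0 u = (of_real (tau \<kappa>) * csqrt (Dc \<kappa> u) * omega \<kappa> u - 1) / (u - 1) / omega \<kappa> u"
    using 0 by (simp add: cE_0 slope_def)
  then show ?case using 0 omega_nonzero[OF assms 0(1)]
    by (simp add: cR_0 Wc_def diff_divide_distrib)
next
  case (Suc k)
  have nz: "Wc \<kappa> u \<noteq> 0" by (rule Wc_nonzero[OF assms Suc.prems])
  have R: "(cR \<kappa> k has_field_derivative deriv (cR \<kappa> k) u) (at u)"
    using holomorphic_derivI[OF cR_holomorphic[OF assms] open_Diff[OF open_half_plane closed_singleton], of u]
      Suc.prems near_1_half_plane by blast
  have "((\<lambda>u. cR \<kappa> k u - of_real (dcoeff k) / Wc \<kappa> u ^ (2 * k + 1)) has_field_derivative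
     deriv (cR \<kappa> k) u + of_real (dcoeff k) * (of_nat (2 * k + 1) * Wc \<kappa> u ^ (2 * k) * ((u - 1) / (Vc \<kappa> u * Wc \<kappa> u))) / (Wc \<kappa> u ^ (2 * k + 1) * Wc \<kappa> u ^ (2 * k + 1))) (at u)"
  proof -
    let ?Q = "(u - 1) / (Vc \<kappa> u * Wc \<kappa> u)"
    have p: "((\<lambda>u. Wc \<kappa> u ^ (2 * k + 1)) has_field_derivative of_nat (2 * k + 1) * Wc \<kappa> u ^ (2 * k) * ?Q) (at u)"
      by (rule DERIV_cong[OF DERIV_power[OF Wc_has_derivative[OF assms Suc.prems], of "2 * k + 1"]]) (simp only: diff_add_inverse2 One_nat_def mult_ac)
    have "Wc \<kappa> u ^ (2 * k + 1) \<noteq> 0" using nz by simp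
    from DERIV_diff[OF R DERIV_divide[OF DERIV_const[of "of_real (dcoeff k)"] p this]]
    show ?thesis by (rule DERIV_cong) (simp only: mult_zero_left diff_0 minus_divide_left[symmetric] diff_minus_eq_add)
  qed
  then have "(cE \<kappa> k has_field_derivative
     deriv (cR \<kappa> k) u + of_real (dcoeff k) * (of_nat (2 * k + 1) * Wc \<kappa> u ^ (2 * k) * ((u - 1) / (Vc \<kappa> u * Wc \<kappa> u))) / (Wc \<kappa> u ^ (2 * k + 1) * Wc \<kappa> u ^ (2 * k + 1))) (at u)"
    by (rule has_field_derivative_transform_within_open[where S="ball 1 (1/4) - {1}"]) (use Suc in auto)
  then have dE: "deriv (cE \<kappa> k) u = deriv (cR \<kappa> k) u + of_real (dcoeff k) * (of_nat (2 * k + 1) * Wc \<kappa> u ^ (2 * k) * ((u - 1) / (Vc \<kappa> u * Wc \<kappa> u))) / (Wc \<kappa> u ^ (2 * k + 1) * Wc \<kappa> u ^ (2 * k + 1))"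
    by (rule DERIV_imp_deriv)
  have "Vc \<kappa> u * deriv (cE \<kappa> k) u = Vc \<kappa> u * deriv (cR \<kappa> k) u - of_real (dcoeff (Suc k)) * (u - 1) / Wc \<kappa> u ^ (2 * Suc k + 1)"
    unfolding dE using nz Vc_nonzero[OF assms Re_pos_near_1[OF Suc.prems(1)]]
    by (simp add: field_simps power_add)
  then show ?case
    unfolding cE_Suc cR_Suc slope_def cE_recursion_at_1[OF assms] using Suc.prems
    by (simp add: diff_divide_distrib add_divide_distrib)
qed

section \<open>Real restrictions of the coefficient functions\<close>

text \<open>Polynomials in \<open>1 / (u - 1)\<close> and \<open>1 / (1 + \<kappa> * u)\<close> with
  coefficients bounded for \<kappa> in (0, \<kappa>1]. Both generators are bounded on the right half
  plane away from 1, uniformly in \<kappa> and up to infinity.\<close>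

inductive rat_fam :: "real \<Rightarrow> (real \<Rightarrow> complex \<Rightarrow> complex) \<Rightarrow> bool" for \<kappa>1 where
  rat_const: "(\<And>\<kappa>. 0 < \<kappa> \<Longrightarrow> \<kappa> \<le> \<kappa>1 \<Longrightarrow> \<bar>f \<kappa>\<bar> \<le> B) \<Longrightarrow> rat_fam \<kappa>1 (\<lambda>\<kappa> u. of_real (f \<kappa>))"
| rat_p: "rat_fam \<kappa>1 (\<lambda>\<kappa> u. 1 / (u - 1))"
| rat_s: "rat_fam \<kappa>1 (\<lambda>\<kappa> u. 1 / (1 + of_real \<kappa> * u))"
| rat_add: "rat_fam \<kappa>1 f \<Longrightarrow> rat_fam \<kappa>1 g \<Longrightarrow> rat_fam \<kappa>1 (\<lambda>\<kappa> u. f \<kappa> u + g \<kappa> u)"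
| rat_mult: "rat_fam \<kappa>1 f \<Longrightarrow> rat_fam \<kappa>1 g \<Longrightarrow> rat_fam \<kappa>1 (\<lambda>\<kappa> u. f \<kappa> u * g \<kappa> u)"

lemma rat_fam_num: "rat_fam \<kappa>1 (\<lambda>\<kappa> u. of_real c)"
  by (rule rat_const[where f="\<lambda>_. c" and B="\<bar>c\<bar>"]) simp

lemma rat_fam_kappa: "rat_fam \<kappa>1 (\<lambda>\<kappa> u. of_real \<kappa>)"
  by (rule rat_const[where B=\<kappa>1]) simp

text \<open>The derivative of each generator is, up to a bounded coefficient, its square, so the
  recursion for the coefficients never leaves the class.\<close>

lemma rat_fam_derivative:
  assumes "rat_fam \<kappa>1 g"
  shows "\<exists>g'. rat_fam \<kappa>1 g' \<and> (\<forall>\<kappa> u. 0 < \<kappa> \<longrightarrow> \<kappa> \<le> \<kappa>1 \<longrightarrow> Re u > 0 \<longrightarrow> u \<noteq> 1 \<longrightarrow> (g \<kappa> has_field_derivative g' \<kappa> u) (at u))"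
  using assms
proof induction
  case (rat_const f B)
  show ?case
    by (rule exI[of _ "\<lambda>\<kappa> u. of_real 0"]) (use rat_fam_num[of \<kappa>1 0] in simp)
next
  case rat_p
  have "((\<lambda>u. 1 / (u - 1)) has_field_derivative of_real (- 1) * (1 / (u - 1)) * (1 / (u - 1))) (at u)" if "u \<noteq> 1" for u :: complex
    using that by (auto intro!: derivative_eq_intros simp: power2_eq_square)
  moreover have "rat_fam \<kappa>1 (\<lambda>\<kappa> u. of_real (- 1) * (1 / (u - 1)) * (1 / (u - 1)))"
    by (intro rat_fam.rat_mult rat_fam_num rat_fam.rat_p)
  ultimately show ?case by (intro exI[of _ "\<lambda>\<kappa> u. of_real (- 1) * (1 / (u - 1)) * (1 / (u - 1))"]) blast
next
  case rat_s
  have "((\<lambda>u. 1 / (1 + of_real \<kappa> * u)) has_field_derivative of_real (- 1) * of_real \<kappa> * (1 / (1 + of_real \<kappa> * u)) * (1 / (1 + of_real \<kappa> * u))) (at u)"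
    if "0 < \<kappa>" "Re u > 0" for u \<kappa>
    using one_plus_nonzero[OF that] by (auto intro!: derivative_eq_intros simp: power2_eq_square)
  moreover have "rat_fam \<kappa>1 (\<lambda>\<kappa> u. of_real (- 1) * of_real \<kappa> * (1 / (1 + of_real \<kappa> * u)) * (1 / (1 + of_real \<kappa> * u)))"
    by (intro rat_fam.rat_mult rat_fam_num rat_fam_kappa rat_fam.rat_s)
  ultimately show ?case
    by (intro exI[of _ "\<lambda>\<kappa> u. of_real (- 1) * of_real \<kappa> * (1 / (1 + of_real \<kappa> * u)) * (1 / (1 + of_real \<kappa> * u))"]) blast
next
  case (rat_add f g)
  then obtain f' g' where "rat_fam \<kappa>1 f'" "rat_fam \<kappa>1 g'"
    and d: "\<And>\<kappa> u. 0 < \<kappa> \<Longrightarrow> \<kappa> \<le> \<kappa>1 \<Longrightarrow> Re u > 0 \<Longrightarrow> u \<noteq> 1 \<Longrightarrow> (f \<kappa> has_field_derivative f' \<kappa> u) (at u)"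
      "\<And>\<kappa> u. 0 < \<kappa> \<Longrightarrow> \<kappa> \<le> \<kappa>1 \<Longrightarrow> Re u > 0 \<Longrightarrow> u \<noteq> 1 \<Longrightarrow> (g \<kappa> has_field_derivative g' \<kappa> u) (at u)"
    by blast
  then show ?case
    by (intro exI[of _ "\<lambda>\<kappa> u. f' \<kappa> u + g' \<kappa> u"] conjI rat_fam.rat_add allI impI DERIV_add) auto
next
  case (rat_mult f g)
  then obtain f' g' where "rat_fam \<kappa>1 f'" "rat_fam \<kappa>1 g'"
    and d: "\<And>\<kappa> u. 0 < \<kappa> \<Longrightarrow> \<kappa> \<le> \<kappa>1 \<Longrightarrow> Re u > 0 \<Longrightarrow> u \<noteq> 1 \<Longrightarrow> (f \<kappa> has_field_derivative f' \<kappa> u) (at u)"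
      "\<And>\<kappa> u. 0 < \<kappa> \<Longrightarrow> \<kappa> \<le> \<kappa>1 \<Longrightarrow> Re u > 0 \<Longrightarrow> u \<noteq> 1 \<Longrightarrow> (g \<kappa> has_field_derivative g' \<kappa> u) (at u)"
    by blast
  with rat_mult.hyps show ?case
    by (intro exI[of _ "\<lambda>\<kappa> u. f' \<kappa> u * g \<kappa> u + g' \<kappa> u * f \<kappa> u"] conjI rat_fam.rat_add rat_fam.rat_mult allI impI DERIV_mult) auto
qed

lemma rat_fam_bounded:
  assumes "rat_fam \<kappa>1 g"
  shows "\<exists>B. \<forall>\<kappa> u. 0 < \<kappa> \<longrightarrow> \<kappa> \<le> \<kappa>1 \<longrightarrow> Re u > 0 \<longrightarrow> 1/8 \<le> norm (u - 1) \<longrightarrow> norm (g \<kappa> u) \<le> B"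
  using assms
proof induction
  case (rat_const f B)
  then show ?case by (intro exI[of _ B]) auto
next
  case rat_p
  have "norm (1 / (u - 1)) \<le> 8" if "1/8 \<le> norm (u - 1)" for u :: complex
    using that frac_le[of 1 1 "1/8" "norm (u - 1)"] by (simp add: norm_divide)
  then show ?case by blast
next
  case rat_s
  have "norm (1 / (1 + of_real \<kappa> * u)) \<le> 1" if "0 < \<kappa>" "Re u > 0" for u \<kappa>
  proof -
    have "1 \<le> Re (1 + of_real \<kappa> * u)" using that by simp
    also have "\<dots> \<le> norm (1 + of_real \<kappa> * u)" by (rule complex_Re_le_cmod)
    finally show ?thesis by (simp add: norm_divide divide_le_eq)
  qed
  then show ?case by blast
next
  case (rat_add f g)
  then obtain B1 B2 where "\<And>\<kappa> u. 0 < \<kappa> \<Longrightarrow> \<kappa> \<le> \<kappa>1 \<Longrightarrow> Re u > 0 \<Longrightarrow> 1/8 \<le> norm (u - 1) \<Longrightarrow> norm (f \<kappa> u) \<le> B1"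
    "\<And>\<kappa> u. 0 < \<kappa> \<Longrightarrow> \<kappa> \<le> \<kappa>1 \<Longrightarrow> Re u > 0 \<Longrightarrow> 1/8 \<le> norm (u - 1) \<Longrightarrow> norm (g \<kappa> u) \<le> B2" by blast
  then show ?case by (intro exI[of _ "B1 + B2"] allI impI order_trans[OF norm_triangle_ineq add_mono]) auto
next
  case (rat_mult f g)
  then obtain B1 B2 where B: "\<And>\<kappa> u. 0 < \<kappa> \<Longrightarrow> \<kappa> \<le> \<kappa>1 \<Longrightarrow> Re u > 0 \<Longrightarrow> 1/8 \<le> norm (u - 1) \<Longrightarrow> norm (f \<kappa> u) \<le> B1"
    "\<And>\<kappa> u. 0 < \<kappa> \<Longrightarrow> \<kappa> \<le> \<kappa>1 \<Longrightarrow> Re u > 0 \<Longrightarrow> 1/8 \<le> norm (u - 1) \<Longrightarrow> norm (g \<kappa> u) \<le> B2" by blast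
  have "norm (f \<kappa> u * g \<kappa> u) \<le> \<bar>B1\<bar> * \<bar>B2\<bar>" if "0 < \<kappa>" "\<kappa> \<le> \<kappa>1" "Re u > 0" "1/8 \<le> norm (u - 1)" for \<kappa> u
    unfolding norm_mult using B(1)[OF that] B(2)[OF that] by (intro mult_mono) auto
  then show ?case by blast
qed

section \<open>The phase on the positive half-line\<close>

definition Psi :: "real \<Rightarrow> real \<Rightarrow> real" where
  "Psi \<kappa> u = (1 - \<kappa>) * (u - 1) - ln u + ln (1 - \<kappa> + \<kappa> * u)"

text \<open>The number eta as a function of \<kappa> and \<open>u\<close>; near 1 it agrees with the
  holomorphic \<open>Wc\<close>.\<close>

definition Wr :: "real \<Rightarrow> real \<Rightarrow> real" where "Wr \<kappa> u = sgn (u - 1) * sqrt (Psi \<kappa> u)"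

definition vr :: "real \<Rightarrow> real \<Rightarrow> real" where
  "vr \<kappa> u = 2 * u * (1 - \<kappa> + \<kappa> * u) / ((1 - \<kappa>) * (1 + \<kappa> * u))"

lemma vr_pos: "0 < \<kappa> \<Longrightarrow> \<kappa> < 1 \<Longrightarrow> 0 < u \<Longrightarrow> vr \<kappa> u > 0"
  by (simp add: vr_def add_pos_pos)

lemma Vc_vr: "Vc \<kappa> (of_real u) = of_real (vr \<kappa> u)"
  unfolding vr_def by (rule Vc_of_real)

lemma Dr_pos: "0 < \<kappa> \<Longrightarrow> \<kappa> < 1 \<Longrightarrow> 0 < u \<Longrightarrow> 0 < 1 - \<kappa> + \<kappa> * (u::real)"
  by (simp add: add_pos_pos)

lemma Psic_of_real:
  assumes "0 < \<kappa>" "\<kappa> < 1" "u > 0" shows "Psic \<kappa> (of_real u) = of_real (Psi \<kappa> u)"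
  using Dr_pos[OF assms] assms unfolding Psic_def Psi_def Dc_of_real by (simp only: Ln_of_real) simp

lemma Psi_has_derivative:
  assumes "0 < \<kappa>" "\<kappa> < 1" "u > 0"
  shows "(Psi \<kappa> has_real_derivative 2 * (u - 1) / vr \<kappa> u) (at u)"
proof -
  have D: "1 - \<kappa> + \<kappa> * u > 0" by (rule Dr_pos[OF assms])
  have "(Psi \<kappa> has_real_derivative (1 - \<kappa>) - 1 / u + \<kappa> / (1 - \<kappa> + \<kappa> * u)) (at u)"
    unfolding Psi_def[abs_def] using D assms by (auto intro!: derivative_eq_intros simp: divide_inverse)
  moreover have "(1 - \<kappa>) - 1 / u + \<kappa> / (1 - \<kappa> + \<kappa> * u) = 2 * (u - 1) / vr \<kappa> u"
  proof -
    have "2 * (u - 1) / vr \<kappa> u = (u - 1) * ((1 - \<kappa>) * (1 + \<kappa> * u)) / (u * (1 - \<kappa> + \<kappa> * u))"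
    proof -
      have "2 * (u - 1) / vr \<kappa> u = (2 * ((u - 1) * ((1 - \<kappa>) * (1 + \<kappa> * u)))) / (2 * (u * (1 - \<kappa> + \<kappa> * u)))"
        unfolding vr_def by (simp only: divide_divide_eq_right mult.assoc)
      then show ?thesis by (simp only: mult_divide_mult_cancel_left_if) simp
    qed
    moreover have "(1 - \<kappa>) - 1 / u + \<kappa> / D = ((1 - \<kappa>) * u * D - D + \<kappa> * u) / (u * D)" if "D > 0" for D
      using that assms by (simp add: field_simps)
    moreover have "(1 - \<kappa>) * u * (1 - \<kappa> + \<kappa> * u) - (1 - \<kappa> + \<kappa> * u) + \<kappa> * u = (u - 1) * ((1 - \<kappa>) * (1 + \<kappa> * u))"
      by (simp add: algebra_simps)
    ultimately show ?thesis using D by simp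
  qed
  ultimately show ?thesis by simp
qed

lemma Psi_1 [simp]: "Psi \<kappa> 1 = 0" by (simp add: Psi_def)

lemma Psi_mono_right:
  assumes "0 < \<kappa>" "\<kappa> < 1" "1 \<le> u" "u \<le> v" shows "Psi \<kappa> u \<le> Psi \<kappa> v"
proof (rule DERIV_nonneg_imp_nondecreasing[OF assms(4)])
  fix x assume "u \<le> x" "x \<le> v"
  then show "\<exists>y. (Psi \<kappa> has_real_derivative y) (at x) \<and> 0 \<le> y"
    using Psi_has_derivative[of \<kappa> x] vr_pos[of \<kappa> x] assms by (intro exI[of _ "2 * (x - 1) / vr \<kappa> x"]) auto
qed

lemma Psi_mono_left:
  assumes "0 < \<kappa>" "\<kappa> < 1" "0 < u" "u \<le> v" "v \<le> 1" shows "Psi \<kappa> v \<le> Psi \<kappa> u"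
proof (rule DERIV_nonpos_imp_nonincreasing[OF assms(4)])
  fix x assume "u \<le> x" "x \<le> v"
  then show "\<exists>y. (Psi \<kappa> has_real_derivative y) (at x) \<and> y \<le> 0"
    using Psi_has_derivative[of \<kappa> x] vr_pos[of \<kappa> x] assms
    by (intro exI[of _ "2 * (x - 1) / vr \<kappa> x"]) (auto simp: divide_nonpos_pos)
qed

lemma Wc_of_real:
  assumes "0 < \<kappa>" "\<kappa> < 1" "\<bar>x - 1\<bar> < 1/4" shows "Wc \<kappa> (of_real x) = of_real (Wr \<kappa> x)"
proof -
  define o' where "o' = Re (Omega \<kappa> (of_real x))"
  have x: "x > 0" "complex_of_real x \<in> ball 1 (1/4)" using assms(3) of_real_near_1[of x "1/4"] by linarith+
  have o: "o' \<ge> 0" using Omega_bounds(1)[OF assms(1,2) x(2)] assms by (simp add: o'_def)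
  have W: "Wc \<kappa> (of_real x) = of_real ((x - 1) * sqrt o')"
    unfolding Wc_def omega_of_real[OF assms] o'_def by simp
  have "of_real (((x - 1) * sqrt o')\<^sup>2) = complex_of_real (Psi \<kappa> x)"
    using Wc_square[OF assms(1,2) x(2)] unfolding W Psic_of_real[OF assms(1,2) x(1)] by simp
  then have "Psi \<kappa> x = ((x - 1) * sqrt o')\<^sup>2" by (simp only: of_real_eq_iff)
  then have "Wr \<kappa> x = sgn (x - 1) * \<bar>(x - 1) * sqrt o'\<bar>" by (simp only: Wr_def real_sqrt_abs)
  also have "\<dots> = (x - 1) * sqrt o'" using o by (simp add: abs_mult sgn_if)
  finally show ?thesis unfolding W by simp
qed

text \<open>At distance exactly 1/8 the lower bound on \<open>Omega\<close> gives
  \<open>(1/8)^2 * (1 - \<kappa>) / 6\<close>, whence 384; monotonicity on either side of 1 carries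
  it outwards.\<close>

lemma Psi_lower:
  assumes "0 < \<kappa>" "\<kappa> < 1" "0 < u" "1/8 \<le> \<bar>u - 1\<bar>" shows "(1 - \<kappa>) / 384 \<le> Psi \<kappa> u"
proof -
  have e: "(1 - \<kappa>) / 384 \<le> Psi \<kappa> x" if "\<bar>x - 1\<bar> = 1/8" for x
  proof -
    have x: "x > 0" "complex_of_real x \<in> ball 1 (1/4)" "\<bar>x - 1\<bar> < 1/4" using that of_real_near_1[of x "1/4"] by linarith+
    have "Psi \<kappa> x = norm (Psic \<kappa> (of_real x))"
    proof -
      have "Psi \<kappa> x \<ge> 0" using Psi_mono_right[OF assms(1,2), of 1 x] Psi_mono_left[OF assms(1,2) x(1), of 1] by (cases "x \<ge> 1") auto
      then show ?thesis using Psic_of_real[OF assms(1,2) x(1)] by simp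
    qed
    also have "\<dots> = norm (Wc \<kappa> (of_real x)) ^ 2" by (metis Wc_square[OF assms(1,2) x(2)] norm_power)
    also have "\<dots> = \<bar>x - 1\<bar>\<^sup>2 * norm (Omega \<kappa> (of_real x))"
    proof -
      have "norm (complex_of_real x - 1) = \<bar>x - 1\<bar>" by (metis norm_of_real of_real_1 of_real_diff)
      moreover have "norm (omega \<kappa> (of_real x)) ^ 2 = norm (Omega \<kappa> (of_real x))"
        unfolding omega_def by (metis norm_power power2_csqrt)
      ultimately show ?thesis by (simp add: Wc_def norm_mult power_mult_distrib)
    qed
    also have "\<dots> \<ge> \<bar>x - 1\<bar>\<^sup>2 * ((1 - \<kappa>) / 6)" by (intro mult_left_mono Omega_bounds(2)[OF assms(1,2) x(2)]) simp
    finally show ?thesis unfolding that by (simp add: power2_eq_square)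
  qed
  show ?thesis
  proof (cases "u \<ge> 1")
    case True
    then have "Psi \<kappa> (9/8) \<le> Psi \<kappa> u" using assms by (intro Psi_mono_right) auto
    then show ?thesis using e[of "9/8"] by simp
  next
    case False
    then have "Psi \<kappa> (7/8) \<le> Psi \<kappa> u" using assms by (intro Psi_mono_left) auto
    then show ?thesis using e[of "7/8"] by simp
  qed
qed

lemma Psi_pos:
  assumes "0 < \<kappa>" "\<kappa> < 1" "0 < u" "u \<noteq> 1" shows "Psi \<kappa> u > 0"
proof (cases "1/8 \<le> \<bar>u - 1\<bar>")
  case True
  then show ?thesis using Psi_lower[OF assms(1-3)] assms by (simp add: field_simps)
next
  case False
  then have u: "\<bar>u - 1\<bar> < 1/4" "complex_of_real u \<in> ball 1 (1/4)" using of_real_near_1[of u "1/4"] by linarith+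
  have "u \<noteq> 1 \<Longrightarrow> complex_of_real u \<noteq> 1" by simp
  then have "Wr \<kappa> u \<noteq> 0" using Wc_nonzero[OF assms(1,2) u(2)] Wc_of_real[OF assms(1,2) u(1)] assms(4) by auto
  then have "Psi \<kappa> u \<noteq> 0" by (auto simp: Wr_def)
  moreover have "Psi \<kappa> u \<ge> 0" using Psi_mono_right[OF assms(1,2), of 1 u] Psi_mono_left[OF assms(1-3), of 1] by (cases "u \<ge> 1") auto
  ultimately show ?thesis by simp
qed

lemma Psi_nonneg: "0 < \<kappa> \<Longrightarrow> \<kappa> < 1 \<Longrightarrow> 0 < u \<Longrightarrow> 0 \<le> Psi \<kappa> u"
  using Psi_pos[of \<kappa> u] by (cases "u = 1") auto

lemma Wr_square: "0 < \<kappa> \<Longrightarrow> \<kappa> < 1 \<Longrightarrow> 0 < u \<Longrightarrow> (Wr \<kappa> u)\<^sup>2 = Psi \<kappa> u"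
  using Psi_nonneg[of \<kappa> u] by (cases "u = 1") (auto simp: Wr_def power_mult_distrib sgn_if)

lemma Wr_abs: "0 < \<kappa> \<Longrightarrow> \<kappa> < 1 \<Longrightarrow> 0 < u \<Longrightarrow> \<bar>Wr \<kappa> u\<bar> = sqrt (Psi \<kappa> u)"
  using Wr_square by (metis real_sqrt_abs)

lemma Wr_1 [simp]: "Wr \<kappa> 1 = 0" by (simp add: Wr_def)

lemma Wr_nonzero: "0 < \<kappa> \<Longrightarrow> \<kappa> < 1 \<Longrightarrow> 0 < u \<Longrightarrow> u \<noteq> 1 \<Longrightarrow> Wr \<kappa> u \<noteq> 0"
  using Psi_pos[of \<kappa> u] by (simp add: Wr_def sgn_if)

definition rsrc :: "real \<Rightarrow> real \<Rightarrow> real \<Rightarrow> real \<Rightarrow> real" where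
  "rsrc \<kappa> \<nu> t u = tau \<kappa> * sqrt (1 - \<kappa> + \<kappa> * u) * (\<nu> + t / (1 + \<kappa> * u))"

lemma source_rsrc: "0 < \<kappa> \<Longrightarrow> \<kappa> < 1 \<Longrightarrow> u > 0 \<Longrightarrow> source \<kappa> \<nu> t (of_real u) = of_real (rsrc \<kappa> \<nu> t u)"
  unfolding rsrc_def by (rule source_of_real)

text \<open>The holomorphic description supplies the value at 1 and the explicit one reaches all
  other \<open>u\<close>. They agree on the punctured neighbourhood, so the switching distance is
  immaterial there.\<close>

definition coef :: "nat \<Rightarrow> real \<Rightarrow> real \<Rightarrow> real" where
  "coef k \<kappa> u = (if \<bar>u - 1\<bar> < 1/4 then Re (cE \<kappa> k (of_real u))
     else Re (cR \<kappa> k (of_real u)) - dcoeff k / Wr \<kappa> u ^ (2 * k + 1))"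

lemma coef_off_1:
  assumes "0 < \<kappa>" "\<kappa> < 1" "u \<noteq> 1"
  shows "coef k \<kappa> u = Re (cR \<kappa> k (of_real u)) - dcoeff k / Wr \<kappa> u ^ (2 * k + 1)"
proof (cases "\<bar>u - 1\<bar> < 1/4")
  case True
  have "cE \<kappa> k (of_real u) = cR \<kappa> k (of_real u) - of_real (dcoeff k) / Wc \<kappa> (of_real u) ^ (2 * k + 1)"
    by (rule cE_eq_cR[OF assms(1,2)]) (use True assms(3) of_real_near_1[of u "1/4"] in \<open>blast, simp\<close>)
  also have "of_real (dcoeff k) / Wc \<kappa> (of_real u) ^ (2 * k + 1) = complex_of_real (dcoeff k / Wr \<kappa> u ^ (2 * k + 1))"
    unfolding Wc_of_real[OF assms(1,2) True] by simp
  finally show ?thesis using True by (simp add: coef_def)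
qed (simp add: coef_def)

text \<open>The derivative of \<open>Wr\<close>; at 1 it is the value of
  \<open>omega\<close>.\<close>

definition wd :: "real \<Rightarrow> real \<Rightarrow> real" where
  "wd \<kappa> u = (if u = 1 then 1 / tau \<kappa> else (u - 1) / (vr \<kappa> u * Wr \<kappa> u))"

lemma Wr_mult_wd: "0 < \<kappa> \<Longrightarrow> \<kappa> < 1 \<Longrightarrow> 0 < u \<Longrightarrow> Wr \<kappa> u * wd \<kappa> u = (u - 1) / vr \<kappa> u"
  using Wr_nonzero[of \<kappa> u] by (simp add: wd_def)

lemma wd_pos: assumes "0 < \<kappa>" "\<kappa> < 1" "0 < u" shows "wd \<kappa> u > 0"
proof (cases "u = 1")
  case False
  have "(u - 1) / Wr \<kappa> u > 0"
  proof (cases "u > 1")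
    case True
    then show ?thesis using Psi_pos[OF assms False] by (simp add: Wr_def)
  next
    case u1: False
    then have "Wr \<kappa> u = - sqrt (Psi \<kappa> u)" using False by (simp add: Wr_def)
    then show ?thesis using u1 False Psi_pos[OF assms False] by (intro divide_neg_neg) auto
  qed
  then have "((u - 1) / Wr \<kappa> u) / vr \<kappa> u > 0" using vr_pos[OF assms] by (rule divide_pos_pos)
  then show ?thesis using False by (simp add: wd_def mult.commute)
qed (simp add: wd_def tau_pos assms)

lemma has_real_derivative_Re:
  assumes "(f has_field_derivative f') (at (complex_of_real a))"
  shows "((\<lambda>x. Re (f (of_real x))) has_real_derivative Re f') (at a)"
  unfolding has_real_derivative_iff_has_vector_derivative
  by (rule bounded_linear.has_vector_derivative[OF bounded_linear_Re has_vector_derivative_real_field[OF assms]])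

lemma Wr_has_derivative_off_1:
  assumes "0 < \<kappa>" "\<kappa> < 1" "0 < u" "u \<noteq> 1" shows "(Wr \<kappa> has_real_derivative wd \<kappa> u) (at u)"
proof -
  have P: "Psi \<kappa> u > 0" by (rule Psi_pos[OF assms])
  define S where "S = (if u > 1 then {1<..} else {..<1::real})"
  have "((\<lambda>x. sqrt (Psi \<kappa> x)) has_real_derivative (inverse (sqrt (Psi \<kappa> u)) / 2) * (2 * (u - 1) / vr \<kappa> u)) (at u)"
    by (rule DERIV_chain2[OF DERIV_real_sqrt[OF P] Psi_has_derivative[OF assms(1-3)]])
  from DERIV_cmult[OF this, of "sgn (u - 1)"]
  have "(Wr \<kappa> has_real_derivative sgn (u - 1) * ((inverse (sqrt (Psi \<kappa> u)) / 2) * (2 * (u - 1) / vr \<kappa> u))) (at u)"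
  proof (rule has_field_derivative_transform_within_open)
    show "open S" by (simp add: S_def)
    show "u \<in> S" using assms by (auto simp: S_def)
    show "sgn (u - 1) * sqrt (Psi \<kappa> x) = Wr \<kappa> x" if "x \<in> S" for x
      using that assms by (auto simp: Wr_def sgn_if S_def split: if_splits)
  qed
  moreover have "sgn (u - 1) * ((inverse (sqrt (Psi \<kappa> u)) / 2) * (2 * (u - 1) / vr \<kappa> u)) = wd \<kappa> u"
  proof -
    have e: "(inverse s / 2) * (2 * (u - 1) / v) = (u - 1) / (v * s)" for s v :: real
      by (cases "s = 0"; cases "v = 0") (auto simp: field_simps)
    show ?thesis unfolding e using assms(4) by (cases "u > 1") (auto simp: wd_def Wr_def sgn_if minus_divide_left)
  qed
  ultimately show ?thesis by simp
qed

lemma Wr_has_derivative: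
  assumes "0 < \<kappa>" "\<kappa> < 1" "0 < u" shows "(Wr \<kappa> has_real_derivative wd \<kappa> u) (at u)"
proof (cases "u = 1")
  case True
  have "(Wc \<kappa> has_field_derivative (1 * omega \<kappa> 1 + deriv (omega \<kappa>) 1 * (1 - 1))) (at 1)"
    unfolding Wc_def[abs_def]
    by (rule DERIV_mult) (use holomorphic_derivI[OF omega_holomorphic[OF assms(1,2)], of 1] in \<open>auto intro!: derivative_eq_intros\<close>)
  then have "(Wc \<kappa> has_field_derivative (1 * omega \<kappa> 1 + deriv (omega \<kappa>) 1 * (1 - 1))) (at (of_real 1))" by simp
  from has_real_derivative_Re[OF this]
  have d: "((\<lambda>x. Re (Wc \<kappa> (of_real x))) has_real_derivative Re (omega \<kappa> 1)) (at 1)" by simp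
  have "(Wr \<kappa> has_real_derivative Re (omega \<kappa> 1)) (at 1)"
  proof (rule has_field_derivative_transform_within_open[OF d])
    show "Re (Wc \<kappa> (of_real x)) = Wr \<kappa> x" if "x \<in> ball 1 (1/4)" for x
      using Wc_of_real[OF assms(1,2), of x] that by (simp add: dist_real_def abs_minus_commute)
  qed auto
  moreover have "Re (omega \<kappa> 1) = 1 / tau \<kappa>"
  proof -
    have "Re (of_real (tau \<kappa>) * omega \<kappa> 1) = 1" using omega_at_1[OF assms(1,2)] by simp
    then show ?thesis using tau_pos[OF assms(1,2)] by (simp add: field_simps)
  qed
  ultimately show ?thesis using True by (simp add: wd_def)
qed (use Wr_has_derivative_off_1 assms in auto)

text \<open>Fixes the leading coefficient: the derivative of the error function contributes
  \<open>wd\<close> and that of the exponential contributes \<open>Wr * wd * coef 0\<close>, and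
  together they must equal the leading source.\<close>

lemma coef_0_relation:
  assumes "0 < \<kappa>" "\<kappa> < 1" "0 < u"
  shows "rsrc \<kappa> 1 0 u / vr \<kappa> u = wd \<kappa> u * (1 + Wr \<kappa> u * coef 0 \<kappa> u)"
proof (cases "u = 1")
  case True
  have "vr \<kappa> 1 = (tau \<kappa>)\<^sup>2" unfolding tau_square[OF assms(1,2)] by (simp add: vr_def power2_eq_square algebra_simps)
  then show ?thesis using True tau_pos[OF assms(1,2)] by (simp add: rsrc_def wd_def power2_eq_square)
next
  case False
  have "cR \<kappa> 0 (of_real u) = of_real (rsrc \<kappa> 1 0 u / (u - 1))"
    unfolding cR_0_source using source_rsrc[OF assms, of 1 0] by simp
  then have "coef 0 \<kappa> u = rsrc \<kappa> 1 0 u / (u - 1) - 1 / Wr \<kappa> u"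
    using coef_off_1[OF assms(1,2) False, of 0] by simp
  then have "1 + Wr \<kappa> u * coef 0 \<kappa> u = Wr \<kappa> u * (rsrc \<kappa> 1 0 u / (u - 1))"
    using Wr_nonzero[OF assms False] by (simp only: right_diff_distrib) simp
  then have "wd \<kappa> u * (1 + Wr \<kappa> u * coef 0 \<kappa> u) = wd \<kappa> u * Wr \<kappa> u * (rsrc \<kappa> 1 0 u / (u - 1))" by simp
  also have "wd \<kappa> u * Wr \<kappa> u = (u - 1) / vr \<kappa> u" using Wr_mult_wd[OF assms] by (simp only: mult.commute)
  finally show ?thesis using False by simp
qed

text \<open>The coefficient recursion solved for the derivative. Near 1 it follows from the
  holomorphic version and elsewhere from the explicit one, where the pole terms contribute
  consistently because of the recursion for \<open>dcoeff\<close>.\<close>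

lemma coef_has_derivative:
  assumes "0 < \<kappa>" "\<kappa> < 1" "0 < u"
  shows "(coef k \<kappa> has_real_derivative
     ((u - 1) * coef (Suc k) \<kappa> u - rsrc \<kappa> (nu \<kappa> (Suc k)) (nutheta \<kappa> (Suc k)) u) / vr \<kappa> u) (at u)"
proof (cases "\<bar>u - 1\<bar> < 1/4")
  case True
  define S where "S = source \<kappa> (nu \<kappa> (Suc k)) (nutheta \<kappa> (Suc k)) (of_real u)"
  have u: "complex_of_real u \<in> ball 1 (1/4)" using True of_real_near_1 by blast
  have v: "vr \<kappa> u > 0" by (rule vr_pos[OF assms])
  have rec: "(of_real u - 1) * cE \<kappa> (Suc k) (of_real u) = S + Vc \<kappa> (of_real u) * deriv (cE \<kappa> k) (of_real u)"
    using cE_recursion_at_1[OF assms(1,2), of k] unfolding cE_Suc slope_def S_def by (cases "u = 1") auto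
  have "(cE \<kappa> k has_field_derivative deriv (cE \<kappa> k) (of_real u)) (at (of_real u))"
    using holomorphic_derivI[OF cE_holomorphic[OF assms(1,2)] _ u] by simp
  from has_real_derivative_Re[OF this]
  have "(coef k \<kappa> has_real_derivative Re (deriv (cE \<kappa> k) (of_real u))) (at u)"
    by (rule has_field_derivative_transform_within_open[where S="ball 1 (1/4)"])
       (use True in \<open>auto simp: coef_def dist_real_def abs_minus_commute\<close>)
  moreover have "Re (deriv (cE \<kappa> k) (of_real u)) = ((u - 1) * coef (Suc k) \<kappa> u - rsrc \<kappa> (nu \<kappa> (Suc k)) (nutheta \<kappa> (Suc k)) u) / vr \<kappa> u"
  proof -
    have "(u - 1) * coef (Suc k) \<kappa> u = Re ((of_real u - 1) * cE \<kappa> (Suc k) (of_real u))" using True by (simp add: coef_def)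
    also have "\<dots> = rsrc \<kappa> (nu \<kappa> (Suc k)) (nutheta \<kappa> (Suc k)) u + vr \<kappa> u * Re (deriv (cE \<kappa> k) (of_real u))"
      unfolding rec S_def source_rsrc[OF assms] Vc_vr by simp
    finally show ?thesis using v by simp
  qed
  ultimately show ?thesis by simp
next
  case False
  define S where "S = source \<kappa> (nu \<kappa> (Suc k)) (nutheta \<kappa> (Suc k)) (of_real u)"
  have u1: "u \<noteq> 1" using False by auto
  have v: "vr \<kappa> u > 0" by (rule vr_pos[OF assms])
  have W: "Wr \<kappa> u \<noteq> 0" by (rule Wr_nonzero[OF assms u1])
  have c1: "complex_of_real u \<noteq> 1" using u1 by simp
  have rec: "(of_real u - 1) * cR \<kappa> (Suc k) (of_real u) = S + Vc \<kappa> (of_real u) * deriv (cR \<kappa> k) (of_real u)"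
    unfolding cR_Suc S_def using c1 by simp
  have "complex_of_real u \<in> half_plane - {1}" using assms c1 by simp
  from has_real_derivative_Re[OF holomorphic_derivI[OF cR_holomorphic[OF assms(1,2)] open_Diff[OF open_half_plane closed_singleton] this]]
  have dR: "((\<lambda>x. Re (cR \<kappa> k (of_real x))) has_real_derivative Re (deriv (cR \<kappa> k) (of_real u))) (at u)" .
  have p: "((\<lambda>x. Wr \<kappa> x ^ (2 * k + 1)) has_real_derivative real (2 * k + 1) * Wr \<kappa> u ^ (2 * k) * wd \<kappa> u) (at u)"
    by (rule DERIV_cong[OF DERIV_power[OF Wr_has_derivative[OF assms], of "2 * k + 1"]]) (simp only: diff_add_inverse2 One_nat_def mult_ac)
  have nz: "Wr \<kappa> u ^ (2 * k + 1) \<noteq> 0" using W by simp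
  have "((\<lambda>x. Re (cR \<kappa> k (of_real x)) - dcoeff k / Wr \<kappa> x ^ (2 * k + 1)) has_real_derivative
      Re (deriv (cR \<kappa> k) (of_real u)) - (0 * Wr \<kappa> u ^ (2 * k + 1) - dcoeff k * (real (2 * k + 1) * Wr \<kappa> u ^ (2 * k) * wd \<kappa> u)) / (Wr \<kappa> u ^ (2 * k + 1) * Wr \<kappa> u ^ (2 * k + 1))) (at u)"
    by (rule DERIV_diff[OF dR DERIV_divide[OF DERIV_const p nz]])
  then have D: "(coef k \<kappa> has_real_derivative
      Re (deriv (cR \<kappa> k) (of_real u)) - (0 * Wr \<kappa> u ^ (2 * k + 1) - dcoeff k * (real (2 * k + 1) * Wr \<kappa> u ^ (2 * k) * wd \<kappa> u)) / (Wr \<kappa> u ^ (2 * k + 1) * Wr \<kappa> u ^ (2 * k + 1))) (at u)"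
    by (rule has_field_derivative_transform_within_open[where S="- {1}"])
       (use coef_off_1[OF assms(1,2)] u1 in auto)
  have 1: "(0 * Wr \<kappa> u ^ (2 * k + 1) - dcoeff k * (real (2 * k + 1) * Wr \<kappa> u ^ (2 * k) * wd \<kappa> u)) / (Wr \<kappa> u ^ (2 * k + 1) * Wr \<kappa> u ^ (2 * k + 1))
     = (u - 1) / vr \<kappa> u * (dcoeff (Suc k) / Wr \<kappa> u ^ (2 * Suc k + 1))"
  proof -
    have g: "(0 * (A * X) - d * (c * A * (Q / X))) / ((A * X) * (A * X)) = Q * (- c * d / (A * X * X * X))"
      if "A \<noteq> 0" "X \<noteq> 0" for A X d c Q :: real
      using that by (simp add: field_simps)
    have w: "wd \<kappa> u = (u - 1) / vr \<kappa> u / Wr \<kappa> u" using u1 by (simp add: wd_def)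
    have p: "Wr \<kappa> u ^ (2 * k + 1) = Wr \<kappa> u ^ (2 * k) * Wr \<kappa> u"
      "Wr \<kappa> u ^ (2 * Suc k + 1) = Wr \<kappa> u ^ (2 * k) * Wr \<kappa> u * Wr \<kappa> u * Wr \<kappa> u"
      by (simp_all add: power_add)
    have c: "real (2 * k + 1) = 2 * real k + 1" by simp
    show ?thesis unfolding w p c dcoeff.simps by (rule g) (use W in auto)
  qed
  have 2: "Re (deriv (cR \<kappa> k) (of_real u)) - (u - 1) / vr \<kappa> u * (dcoeff (Suc k) / Wr \<kappa> u ^ (2 * Suc k + 1))
     = ((u - 1) * coef (Suc k) \<kappa> u - rsrc \<kappa> (nu \<kappa> (Suc k)) (nutheta \<kappa> (Suc k)) u) / vr \<kappa> u"
  proof -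
    have "(u - 1) * Re (cR \<kappa> (Suc k) (of_real u)) = Re ((of_real u - 1) * cR \<kappa> (Suc k) (of_real u))" by simp
    also have "\<dots> = rsrc \<kappa> (nu \<kappa> (Suc k)) (nutheta \<kappa> (Suc k)) u + vr \<kappa> u * Re (deriv (cR \<kappa> k) (of_real u))"
      unfolding rec S_def source_rsrc[OF assms] Vc_vr by simp
    finally have e: "Re (deriv (cR \<kappa> k) (of_real u)) = ((u - 1) * Re (cR \<kappa> (Suc k) (of_real u)) - rsrc \<kappa> (nu \<kappa> (Suc k)) (nutheta \<kappa> (Suc k)) u) / vr \<kappa> u"
      using v by simp
    have "((u - 1) * X - r) / v - (u - 1) / v * e = ((u - 1) * (X - e) - r) / v" for X r v e :: real
      by (simp add: right_diff_distrib left_diff_distrib diff_divide_distrib)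
    then show ?thesis unfolding e coef_off_1[OF assms(1,2) u1] .
  qed
  show ?thesis using D unfolding 1 2 .
qed

section \<open>Uniform bounds for the coefficients\<close>

text \<open>The root factor grows like \<open>sqrt u\<close> and lies outside the rational class. It
  is split off together with one factor \<open>1 / (u - 1)\<close>, which compensates its
  growth.\<close>

definition cR_rational :: "real \<Rightarrow> nat \<Rightarrow> (real \<Rightarrow> complex \<Rightarrow> complex) \<Rightarrow> bool" where
  "cR_rational \<kappa>1 k g \<longleftrightarrow> rat_fam \<kappa>1 g \<and>
     (\<forall>\<kappa> u. 0 < \<kappa> \<longrightarrow> \<kappa> \<le> \<kappa>1 \<longrightarrow> Re u > 0 \<longrightarrow> u \<noteq> 1 \<longrightarrow> cR \<kappa> k u = csqrt (Dc \<kappa> u) * (1 / (u - 1) * g \<kappa> u))"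

lemma tau_bounded: assumes "0 < \<kappa>" "\<kappa> \<le> \<kappa>1" "\<kappa>1 < 1" shows "\<bar>tau \<kappa>\<bar> \<le> tau \<kappa>1"
proof -
  have "\<kappa>\<^sup>2 \<le> \<kappa>1\<^sup>2" using assms by (intro power_mono) auto
  moreover have "\<kappa>1\<^sup>2 < 1" using assms by (simp add: power_less_one_iff)
  ultimately have "2 / (1 - \<kappa>\<^sup>2) \<le> 2 / (1 - \<kappa>1\<^sup>2)" "0 \<le> 2 / (1 - \<kappa>\<^sup>2)" by (auto intro!: frac_le)
  then show ?thesis by (simp add: tau_def)
qed

lemma cR_rational_0:
  assumes "\<kappa>1 < 1" shows "cR_rational \<kappa>1 0 (\<lambda>\<kappa> u. of_real (tau \<kappa>))"
  unfolding cR_rational_def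
  by (intro conjI rat_const[where B="tau \<kappa>1"] tau_bounded) (use assms in \<open>auto simp: cR_0\<close>)

text \<open>\<open>Vc\<close> brings the growing factors \<open>u\<close> and \<open>Dc\<close>.
  Each is paired with a bounded generator, so that the next coefficient again has the split
  form.\<close>

lemma cR_rational_Suc:
  assumes "0 < \<kappa>1" "\<kappa>1 < 1" "cR_rational \<kappa>1 k g"
    and b1: "\<And>\<kappa>. 0 < \<kappa> \<Longrightarrow> \<kappa> \<le> \<kappa>1 \<Longrightarrow> \<bar>nu \<kappa> (Suc k)\<bar> \<le> B1"
    and b2: "\<And>\<kappa>. 0 < \<kappa> \<Longrightarrow> \<kappa> \<le> \<kappa>1 \<Longrightarrow> \<bar>nutheta \<kappa> (Suc k)\<bar> \<le> B2"
  shows "\<exists>g'. cR_rational \<kappa>1 (Suc k) g'"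
proof -
  from assms(3) have g: "rat_fam \<kappa>1 g"
    and R: "\<And>\<kappa> u. 0 < \<kappa> \<Longrightarrow> \<kappa> \<le> \<kappa>1 \<Longrightarrow> Re u > 0 \<Longrightarrow> u \<noteq> 1 \<Longrightarrow> cR \<kappa> k u = csqrt (Dc \<kappa> u) * (1 / (u - 1) * g \<kappa> u)"
    by (auto simp: cR_rational_def)
  obtain g' where g': "rat_fam \<kappa>1 g'"
    and dg: "\<And>\<kappa> u. 0 < \<kappa> \<Longrightarrow> \<kappa> \<le> \<kappa>1 \<Longrightarrow> Re u > 0 \<Longrightarrow> u \<noteq> 1 \<Longrightarrow> (g \<kappa> has_field_derivative g' \<kappa> u) (at u)"
    using rat_fam_derivative[OF g] by blast
  let ?p = "\<lambda>\<kappa> u. 1 / (u - 1)" and ?s = "\<lambda>\<kappa> u. 1 / (1 + of_real \<kappa> * u)"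
  define G where "G \<kappa> u = of_real (tau \<kappa>) * (of_real (nu \<kappa> (Suc k)) + of_real (nutheta \<kappa> (Suc k)) * ?s \<kappa> u)
     + of_real (2 / (1 - \<kappa>)) * ((of_real 1 + ?p \<kappa> u) * (of_real (\<kappa> / 2) * (?s \<kappa> u * g \<kappa> u)
        + (of_real 1 + of_real (- \<kappa>) * ?s \<kappa> u) * (g' \<kappa> u + of_real (- 1) * (?p \<kappa> u * g \<kappa> u))))" for \<kappa> u
  have "rat_fam \<kappa>1 G"
  proof -
    have c1: "rat_fam \<kappa>1 (\<lambda>\<kappa> u. of_real (2 / (1 - \<kappa>)))"
      by (rule rat_const[where B="2 / (1 - \<kappa>1)"]) (use assms in \<open>auto intro!: divide_left_mono\<close>)
    have c2: "rat_fam \<kappa>1 (\<lambda>\<kappa> u. of_real (- \<kappa>))" by (rule rat_const[where B="\<kappa>1"]) simp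
    have c3: "rat_fam \<kappa>1 (\<lambda>\<kappa> u. of_real (\<kappa> / 2))" by (rule rat_const[where B="\<kappa>1"]) simp
    have c4: "rat_fam \<kappa>1 (\<lambda>\<kappa> u. of_real (tau \<kappa>))" by (rule rat_const[where B="tau \<kappa>1"]) (use assms tau_bounded in auto)
    have c5: "rat_fam \<kappa>1 (\<lambda>\<kappa> u. of_real (nu \<kappa> (Suc k)))" by (rule rat_const[OF b1])
    have c6: "rat_fam \<kappa>1 (\<lambda>\<kappa> u. of_real (nutheta \<kappa> (Suc k)))" by (rule rat_const[OF b2])
    show ?thesis unfolding G_def[abs_def]
      by (rule rat_add rat_mult c1 c2 c3 c4 c5 c6 rat_p rat_s g g' rat_fam_num)+
  qed
  moreover have "cR \<kappa> (Suc k) u = csqrt (Dc \<kappa> u) * (1 / (u - 1) * G \<kappa> u)"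
    if k: "0 < \<kappa>" "\<kappa> \<le> \<kappa>1" and u: "Re u > 0" "u \<noteq> 1" for \<kappa> u
  proof -
    have k1: "\<kappa> < 1" using k assms by simp
    define S D p s where "S = csqrt (Dc \<kappa> u)" and "D = Dc \<kappa> u" and "p = 1 / (u - 1)" and "s = 1 / (1 + of_real \<kappa> * u)"
    have D: "D \<noteq> 0" "D \<notin> \<real>\<^sub>\<le>\<^sub>0" using Dc_Re_pos[OF k(1) k1 u(1)] by (auto simp: D_def complex_nonpos_Reals_iff)
    have S: "S * S = D" "S \<noteq> 0" using D by (auto simp: S_def D_def power2_eq_square[symmetric])
    have s0: "1 + of_real \<kappa> * u \<noteq> 0" by (rule one_plus_nonzero[OF k(1) u(1)])
    \<comment> \<open>These two identities absorb the growth: \<open>u / (u - 1)\<close> and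
      \<open>Dc / (1 + \<kappa> * u)\<close> are affine in the generators.\<close>
    have up: "u * p = 1 + p" using u by (simp add: p_def field_simps)
    have sD: "s * D = 1 - of_real \<kappa> * s" using s0 by (simp add: s_def D_def Dc_def field_simps)
    have dD: "(Dc \<kappa> has_field_derivative of_real \<kappa>) (at u)" unfolding Dc_def[abs_def] by (auto intro!: derivative_eq_intros)
    have dS: "((\<lambda>u. csqrt (Dc \<kappa> u)) has_field_derivative of_real \<kappa> / (2 * S)) (at u)"
    proof -
      have "(csqrt has_field_derivative 1 / (2 * csqrt D)) (at (Dc \<kappa> u))"
        using has_field_derivative_csqrt'[OF DERIV_ident] D by (simp add: D_def)
      from DERIV_chain2[OF this dD] show ?thesis by (simp add: S_def D_def)
    qed
    have dp: "((\<lambda>u. 1 / (u - 1)) has_field_derivative - (p * p)) (at u)"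
      using u by (auto intro!: derivative_eq_intros simp: p_def)
    have "((\<lambda>u. csqrt (Dc \<kappa> u) * (1 / (u - 1) * g \<kappa> u)) has_field_derivative
       (of_real \<kappa> / (2 * S)) * (1 / (u - 1) * g \<kappa> u) + (- (p * p) * g \<kappa> u + g' \<kappa> u * (1 / (u - 1))) * csqrt (Dc \<kappa> u)) (at u)"
      by (intro DERIV_mult dS dp dg k u)
    then have "(cR \<kappa> k has_field_derivative
       (of_real \<kappa> / (2 * S)) * (1 / (u - 1) * g \<kappa> u) + (- (p * p) * g \<kappa> u + g' \<kappa> u * (1 / (u - 1))) * csqrt (Dc \<kappa> u)) (at u)"
      by (rule has_field_derivative_transform_within_open[where S="half_plane - {1}"])
         (use R k u open_half_plane in \<open>auto intro: open_Diff\<close>)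
    then have dR: "deriv (cR \<kappa> k) u = (of_real \<kappa> / (2 * S)) * (p * g \<kappa> u) + (- (p * p) * g \<kappa> u + g' \<kappa> u * p) * S"
      unfolding p_def S_def by (rule DERIV_imp_deriv)
    have "of_real \<kappa> / (2 * S) = S * (of_real \<kappa> / (2 * D))" using S D by (simp add: S(1)[symmetric])
    then have dR2: "deriv (cR \<kappa> k) u = S * p * ((of_real \<kappa> / 2 * g \<kappa> u) / D + (g' \<kappa> u - p * g \<kappa> u))"
      unfolding dR by (simp add: algebra_simps)
    have V: "Vc \<kappa> u = of_real (2 / (1 - \<kappa>)) * u * (s * D)"
      unfolding Vc_def s_def D_def by simp
    have "Vc \<kappa> u * deriv (cR \<kappa> k) u = S * (of_real (2 / (1 - \<kappa>)) * (u * p) * (s * D * ((of_real \<kappa> / 2 * g \<kappa> u) / D) + s * D * (g' \<kappa> u - p * g \<kappa> u)))"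
      unfolding V dR2 by (simp only: distrib_left mult_ac)
    also have "s * D * ((of_real \<kappa> / 2 * g \<kappa> u) / D) = of_real \<kappa> / 2 * (s * g \<kappa> u)" using D by simp
    finally have VR: "Vc \<kappa> u * deriv (cR \<kappa> k) u = S * (of_real (2 / (1 - \<kappa>)) * (1 + p) * (of_real \<kappa> / 2 * (s * g \<kappa> u) + (1 - of_real \<kappa> * s) * (g' \<kappa> u - p * g \<kappa> u)))"
      unfolding up sD .
    have src: "source \<kappa> (nu \<kappa> (Suc k)) (nutheta \<kappa> (Suc k)) u = S * (of_real (tau \<kappa>) * (of_real (nu \<kappa> (Suc k)) + of_real (nutheta \<kappa> (Suc k)) * s))"
      by (simp add: source_def S_def s_def)
    have "cR \<kappa> (Suc k) u = (source \<kappa> (nu \<kappa> (Suc k)) (nutheta \<kappa> (Suc k)) u + Vc \<kappa> u * deriv (cR \<kappa> k) u) * p"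
      unfolding cR_Suc p_def by simp
    also have "\<dots> = S * (p * G \<kappa> u)"
    proof -
      have alg: "(S * (T * (N + O' * s)) + S * (A * (1 + p) * (H * (s * x) + (1 - K * s) * (x' - p * x)))) * p
        = S * (p * (T * (N + O' * s) + A * ((1 + p) * (H * (s * x) + (1 + - K * s) * (x' + - 1 * (p * x))))))"
        for T N O' A H K x x' :: complex by (simp add: algebra_simps)
      have h: "complex_of_real (\<kappa> / 2) = of_real \<kappa> / 2" by simp
      show ?thesis unfolding src VR G_def p_def[symmetric] s_def[symmetric] of_real_1 of_real_minus h by (rule alg)
    qed
    finally show ?thesis by (simp add: S_def p_def)
  qed
  ultimately show ?thesis unfolding cR_rational_def by blast
qed

text \<open>The modulus of the root is at most \<open>1 + r\<close> with \<open>r\<close> the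
  distance to 1, and \<open>(1 + r) / r \<le> 9\<close> for \<open>r \<ge> 1/8\<close>.\<close>

lemma cR_bounded:
  assumes "0 < \<kappa>1" "\<kappa>1 < 1" "cR_rational \<kappa>1 k g"
  obtains B where "\<And>\<kappa> u. 0 < \<kappa> \<Longrightarrow> \<kappa> \<le> \<kappa>1 \<Longrightarrow> Re u > 0 \<Longrightarrow> 1/8 \<le> norm (u - 1) \<Longrightarrow> norm (cR \<kappa> k u) \<le> B"
proof -
  from assms(3) have g: "rat_fam \<kappa>1 g"
    and R: "\<And>\<kappa> u. 0 < \<kappa> \<Longrightarrow> \<kappa> \<le> \<kappa>1 \<Longrightarrow> Re u > 0 \<Longrightarrow> u \<noteq> 1 \<Longrightarrow> cR \<kappa> k u = csqrt (Dc \<kappa> u) * (1 / (u - 1) * g \<kappa> u)"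
    by (auto simp: cR_rational_def)
  obtain B where B: "\<And>\<kappa> u. 0 < \<kappa> \<Longrightarrow> \<kappa> \<le> \<kappa>1 \<Longrightarrow> Re u > 0 \<Longrightarrow> 1/8 \<le> norm (u - 1) \<Longrightarrow> norm (g \<kappa> u) \<le> B"
    using rat_fam_bounded[OF g] by blast
  show ?thesis
  proof (rule that[of "9 * \<bar>B\<bar>"])
    fix \<kappa> u assume k: "0 < \<kappa>" "\<kappa> \<le> \<kappa>1" and u: "Re u > 0" "1/8 \<le> norm (u - 1)"
    define r where "r = norm (u - 1)"
    have r: "r \<ge> 1/8" using u by (simp add: r_def)
    have "Dc \<kappa> u = 1 + of_real \<kappa> * (u - 1)" by (simp add: Dc_def algebra_simps)
    then have "norm (Dc \<kappa> u) \<le> 1 + \<kappa> * r"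
      using norm_triangle_ineq[of 1 "of_real \<kappa> * (u - 1)"] k by (simp add: norm_mult r_def)
    also have "\<kappa> * r \<le> 1 * r" using k assms r by (intro mult_right_mono) auto
    moreover have "1 + r \<le> (1 + r)\<^sup>2" using r by (simp add: power2_eq_square algebra_simps)
    ultimately have "norm (Dc \<kappa> u) \<le> (1 + r)\<^sup>2" by simp
    then have "sqrt (norm (Dc \<kappa> u)) \<le> 1 + r" using r by (intro real_le_lsqrt) auto
    then have "norm (csqrt (Dc \<kappa> u)) \<le> 1 + r" by (simp add: norm_csqrt)
    then have "norm (csqrt (Dc \<kappa> u)) * (1 / r) \<le> (1 + r) * (1 / r)" using r by (intro mult_right_mono) auto
    also have "\<dots> \<le> 9" using r by (simp add: field_simps)
    finally have "norm (csqrt (Dc \<kappa> u)) * (1 / r) * norm (g \<kappa> u) \<le> 9 * \<bar>B\<bar>"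
      using B[OF k u] r by (intro mult_mono) auto
    moreover have "u \<noteq> 1" using u by auto
    ultimately show "norm (cR \<kappa> k u) \<le> 9 * \<bar>B\<bar>" using R[OF k u(1)] by (simp add: norm_mult norm_divide r_def)
  qed
qed

text \<open>One lower bound for the modulus of eta for all \<kappa> up to \<kappa>1, both on the
  complex circle of radius 1/8 and for real points outside it.\<close>

definition Wlow :: "real \<Rightarrow> real" where "Wlow \<kappa>1 = sqrt ((1 - \<kappa>1) / 384)"

lemma Wlow_pos: "\<kappa>1 < 1 \<Longrightarrow> Wlow \<kappa>1 > 0" by (simp add: Wlow_def)

lemma norm_Wc_ge:
  assumes "0 < \<kappa>" "\<kappa> \<le> \<kappa>1" "\<kappa>1 < 1" "norm (u - 1) = 1/8"
  shows "Wlow \<kappa>1 \<le> norm (Wc \<kappa> u)"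
proof -
  have u: "u \<in> ball 1 (1/4)" using assms(4) by (simp add: dist_norm norm_minus_commute)
  have "norm (omega \<kappa> u) ^ 2 = norm (Omega \<kappa> u)" unfolding omega_def by (metis norm_power power2_csqrt)
  then have "norm (Wc \<kappa> u) ^ 2 = (1/8)\<^sup>2 * norm (Omega \<kappa> u)" using assms(4) by (simp add: Wc_def norm_mult power_mult_distrib)
  also have "\<dots> \<ge> (1/8)\<^sup>2 * ((1 - \<kappa>) / 6)" by (intro mult_left_mono Omega_bounds(2) u) (use assms in auto)
  finally have "(1 - \<kappa>1) / 384 \<le> norm (Wc \<kappa> u) ^ 2" using assms by (simp add: power2_eq_square)
  then show ?thesis unfolding Wlow_def by (intro real_le_lsqrt) auto
qed

lemma Wr_ge:
  assumes "0 < \<kappa>" "\<kappa> \<le> \<kappa>1" "\<kappa>1 < 1" "0 < u" "1/8 \<le> \<bar>u - 1\<bar>"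
  shows "Wlow \<kappa>1 \<le> \<bar>Wr \<kappa> u\<bar>"
proof -
  have "(1 - \<kappa>1) / 384 \<le> (1 - \<kappa>) / 384" using assms by simp
  also have "\<dots> \<le> Psi \<kappa> u" by (rule Psi_lower) (use assms in auto)
  finally show ?thesis using assms by (simp add: Wr_abs Wlow_def)
qed

text \<open>On the circle the regular coefficient is the difference of the rational one and the pole
  term, both of which are bounded there uniformly in \<kappa>.\<close>

lemma cE_bounded_sphere:
  assumes "0 < \<kappa>1" "\<kappa>1 < 1" "cR_rational \<kappa>1 k g"
  obtains B where "\<And>\<kappa> u. 0 < \<kappa> \<Longrightarrow> \<kappa> \<le> \<kappa>1 \<Longrightarrow> norm (u - 1) = 1/8 \<Longrightarrow> norm (cE \<kappa> k u) \<le> B"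
proof -
  obtain B where B: "\<And>\<kappa> u. 0 < \<kappa> \<Longrightarrow> \<kappa> \<le> \<kappa>1 \<Longrightarrow> Re u > 0 \<Longrightarrow> 1/8 \<le> norm (u - 1) \<Longrightarrow> norm (cR \<kappa> k u) \<le> B"
    using cR_bounded[OF assms] by blast
  show ?thesis
  proof (rule that[of "B + \<bar>dcoeff k\<bar> / Wlow \<kappa>1 ^ (2 * k + 1)"])
    fix \<kappa> and u :: complex assume k: "0 < \<kappa>" "\<kappa> \<le> \<kappa>1" and u: "norm (u - 1) = 1/8"
    have ub: "u \<in> ball 1 (1/4)" "u \<noteq> 1" using u by (auto simp: dist_norm norm_minus_commute)
    have "Wlow \<kappa>1 ^ (2 * k + 1) \<le> norm (Wc \<kappa> u) ^ (2 * k + 1)"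
      using norm_Wc_ge[OF k assms(2) u] Wlow_pos[OF assms(2)] by (intro power_mono) auto
    then have "\<bar>dcoeff k\<bar> / norm (Wc \<kappa> u) ^ (2 * k + 1) \<le> \<bar>dcoeff k\<bar> / Wlow \<kappa>1 ^ (2 * k + 1)"
      using Wlow_pos[OF assms(2)] by (intro frac_le) auto
    then have "norm (of_real (dcoeff k) / Wc \<kappa> u ^ (2 * k + 1)) \<le> \<bar>dcoeff k\<bar> / Wlow \<kappa>1 ^ (2 * k + 1)"
      by (simp only: norm_divide norm_power norm_of_real)
    moreover have "norm (cR \<kappa> k u) \<le> B" using B[OF k Re_pos_near_1[OF ub(1)]] u by simp
    moreover have eq: "cE \<kappa> k u = cR \<kappa> k u - of_real (dcoeff k) / Wc \<kappa> u ^ (2 * k + 1)"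
      by (rule cE_eq_cR) (use k assms ub in auto)
    ultimately show "norm (cE \<kappa> k u) \<le> B + \<bar>dcoeff k\<bar> / Wlow \<kappa>1 ^ (2 * k + 1)"
      using norm_triangle_ineq4[of "cR \<kappa> k u" "of_real (dcoeff k) / Wc \<kappa> u ^ (2 * k + 1)"] unfolding eq by linarith
  qed
qed

text \<open>The summand \<open>i = K\<close> vanishes with \<open>theta_coeff 0\<close>, so bounds
  for smaller indices suffice; this prevents circularity in the next induction.\<close>

lemma nutheta_bounded:
  assumes "\<kappa>1 < 1" "\<And>i. i < K \<Longrightarrow> \<exists>B. \<forall>\<kappa>. 0 < \<kappa> \<longrightarrow> \<kappa> \<le> \<kappa>1 \<longrightarrow> \<bar>nu \<kappa> i\<bar> \<le> B"
  shows "\<exists>B. \<forall>\<kappa>. 0 < \<kappa> \<longrightarrow> \<kappa> \<le> \<kappa>1 \<longrightarrow> \<bar>nutheta \<kappa> K\<bar> \<le> B"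
proof -
  have "\<exists>B. \<forall>\<kappa>. 0 < \<kappa> \<longrightarrow> \<kappa> \<le> \<kappa>1 \<longrightarrow> \<bar>nu \<kappa> i * theta_coeff (K - i) \<kappa>\<bar> \<le> B" if "i \<le> K" for i
  proof (cases "i = K")
    case True
    then show ?thesis by (intro exI[of _ 0]) simp
  next
    case False
    then obtain B where B: "\<forall>\<kappa>. 0 < \<kappa> \<longrightarrow> \<kappa> \<le> \<kappa>1 \<longrightarrow> \<bar>nu \<kappa> i\<bar> \<le> B" using assms(2)[of i] \<open>i \<le> K\<close> by auto
    obtain T where T: "\<And>\<kappa>. 0 < \<kappa> \<Longrightarrow> \<kappa> < 1 \<Longrightarrow> \<bar>theta_coeff (K - i) \<kappa>\<bar> \<le> T"
        "\<And>\<kappa>. 0 < \<kappa> \<Longrightarrow> \<kappa> < 1 \<Longrightarrow> \<bar>theta_coeff_deriv (K - i) \<kappa>\<bar> \<le> T"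
      by (rule theta_coeff_bounded[of "K - i"]) (rule that)
    have "\<bar>nu \<kappa> i * theta_coeff (K - i) \<kappa>\<bar> \<le> \<bar>B\<bar> * \<bar>T\<bar>" if "0 < \<kappa>" "\<kappa> \<le> \<kappa>1" for \<kappa>
    proof -
      have "\<bar>nu \<kappa> i\<bar> \<le> \<bar>B\<bar>" using B[rule_format, OF that] abs_ge_self[of B] by linarith
      moreover have "\<bar>theta_coeff (K - i) \<kappa>\<bar> \<le> \<bar>T\<bar>" using order_trans[OF T(1)[of \<kappa>] abs_ge_self] that assms(1) by linarith
      ultimately show ?thesis unfolding abs_mult by (intro mult_mono) auto
    qed
    then show ?thesis by blast
  qed
  then have "\<forall>i. \<exists>B. i \<le> K \<longrightarrow> (\<forall>\<kappa>. 0 < \<kappa> \<longrightarrow> \<kappa> \<le> \<kappa>1 \<longrightarrow> \<bar>nu \<kappa> i * theta_coeff (K - i) \<kappa>\<bar> \<le> B)" by blast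
  from choice[OF this] obtain B where B: "\<forall>i. i \<le> K \<longrightarrow> (\<forall>\<kappa>. 0 < \<kappa> \<longrightarrow> \<kappa> \<le> \<kappa>1 \<longrightarrow> \<bar>nu \<kappa> i * theta_coeff (K - i) \<kappa>\<bar> \<le> B i)" ..
  have "\<bar>nutheta \<kappa> K\<bar> \<le> (\<Sum>i\<le>K. B i)" if "0 < \<kappa>" "\<kappa> \<le> \<kappa>1" for \<kappa>
  proof -
    have "\<bar>nutheta \<kappa> K\<bar> \<le> (\<Sum>i\<le>K. \<bar>nu \<kappa> i * theta_coeff (K - i) \<kappa>\<bar>)" unfolding nutheta_def by (rule sum_abs)
    also have "\<dots> \<le> (\<Sum>i\<le>K. B i)" by (rule sum_mono) (use B that in auto)
    finally show ?thesis .
  qed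
  then show ?thesis by blast
qed

text \<open>The two claims have to be proved together: the next constant \<open>nu\<close> depends
  on the derivative of the regular coefficient, which is bounded through the rational form, and the
  next rational form has that constant among its coefficients.\<close>

lemma nu_bounded_cR_rational:
  assumes "0 < \<kappa>1" "\<kappa>1 < 1"
  shows "(\<forall>i\<le>k. \<exists>B. \<forall>\<kappa>. 0 < \<kappa> \<longrightarrow> \<kappa> \<le> \<kappa>1 \<longrightarrow> \<bar>nu \<kappa> i\<bar> \<le> B) \<and> (\<exists>g. cR_rational \<kappa>1 k g)"
proof (induction k)
  case 0
  have "\<exists>B. \<forall>\<kappa>. 0 < \<kappa> \<longrightarrow> \<kappa> \<le> \<kappa>1 \<longrightarrow> \<bar>nu \<kappa> 0\<bar> \<le> B" by (intro exI[of _ 1]) simp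
  then show ?case using cR_rational_0[OF assms(2)] by blast
next
  case (Suc k)
  then obtain g where g: "cR_rational \<kappa>1 k g" by blast
  obtain B2 where B2: "\<forall>\<kappa>. 0 < \<kappa> \<longrightarrow> \<kappa> \<le> \<kappa>1 \<longrightarrow> \<bar>nutheta \<kappa> (Suc k)\<bar> \<le> B2"
    using nutheta_bounded[OF assms(2), of "Suc k"] Suc.IH by (meson less_Suc_eq_le)
  obtain BE where BE: "\<And>\<kappa> u. 0 < \<kappa> \<Longrightarrow> \<kappa> \<le> \<kappa>1 \<Longrightarrow> norm (u - 1) = 1/8 \<Longrightarrow> norm (cE \<kappa> k u) \<le> BE"
    using cE_bounded_sphere[OF assms g] by blast
  have nub: "\<bar>nu \<kappa> (Suc k)\<bar> \<le> B2 + tau \<kappa>1 * (8 * BE)" if k: "0 < \<kappa>" "\<kappa> \<le> \<kappa>1" for \<kappa>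
  proof -
    have hol: "cE \<kappa> k holomorphic_on ball 1 (1/4)" by (rule cE_holomorphic) (use k assms in auto)
    \<comment> \<open>Cauchy's inequality on the circle of radius 1/8, the source of the factor
      8.\<close>
    have "norm ((deriv ^^ 1) (cE \<kappa> k) 1) \<le> fact 1 * BE / (1/8) ^ 1"
    proof (rule Cauchy_inequality)
      show "cE \<kappa> k holomorphic_on ball 1 (1/8)" by (rule holomorphic_on_subset[OF hol]) auto
      show "continuous_on (cball 1 (1/8)) (cE \<kappa> k)"
        by (rule holomorphic_on_imp_continuous_on, rule holomorphic_on_subset[OF hol]) auto
      show "norm (cE \<kappa> k x) \<le> BE" if "norm (1 - x) = 1/8" for x
        by (rule BE[OF k]) (use that in \<open>simp add: norm_minus_commute\<close>)
    qed simp
    then have "norm (deriv (cE \<kappa> k) 1) \<le> 8 * BE" by simp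
    then have d: "\<bar>Re (deriv (cE \<kappa> k) 1)\<bar> \<le> 8 * BE" using abs_Re_le_cmod order_trans by blast
    have "\<bar>tau \<kappa> * Re (deriv (cE \<kappa> k) 1)\<bar> \<le> tau \<kappa>1 * (8 * BE)"
      unfolding abs_mult using tau_bounded[OF k assms(2)] d by (intro mult_mono) auto
    moreover have "\<bar>- nutheta \<kappa> (Suc k) / (1 + \<kappa>)\<bar> \<le> B2"
    proof -
      have "\<bar>nutheta \<kappa> (Suc k)\<bar> / (1 + \<kappa>) \<le> B2 / 1"
        using B2 k by (intro frac_le) (auto intro: order_trans[OF abs_ge_zero])
      then show ?thesis using k by simp
    qed
    ultimately show ?thesis unfolding nu_Suc by linarith
  qed
  have "\<exists>g. cR_rational \<kappa>1 (Suc k) g"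
    by (rule cR_rational_Suc[OF assms g nub]) (use B2 in auto)
  moreover have "\<exists>B. \<forall>\<kappa>. 0 < \<kappa> \<longrightarrow> \<kappa> \<le> \<kappa>1 \<longrightarrow> \<bar>nu \<kappa> (Suc k)\<bar> \<le> B" using nub by blast
  ultimately show ?case using Suc.IH by (simp add: le_Suc_eq)
qed

lemma nu_bounded:
  assumes "0 < \<kappa>1" "\<kappa>1 < 1"
  obtains B where "\<And>\<kappa>. 0 < \<kappa> \<Longrightarrow> \<kappa> \<le> \<kappa>1 \<Longrightarrow> \<bar>nu \<kappa> k\<bar> \<le> B"
proof -
  have "\<exists>B. \<forall>\<kappa>. 0 < \<kappa> \<longrightarrow> \<kappa> \<le> \<kappa>1 \<longrightarrow> \<bar>nu \<kappa> k\<bar> \<le> B"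
    using nu_bounded_cR_rational[OF assms, of k] by blast
  then show ?thesis using that by blast
qed

text \<open>Within distance 1/8 of 1 the maximum principle transfers the bound from the circle;
  outside it the rational form and the lower bound on eta apply directly.\<close>

lemma coef_bounded:
  assumes "0 < \<kappa>1" "\<kappa>1 < 1"
  obtains B where "\<And>\<kappa> u. 0 < \<kappa> \<Longrightarrow> \<kappa> \<le> \<kappa>1 \<Longrightarrow> 0 < u \<Longrightarrow> \<bar>coef k \<kappa> u\<bar> \<le> B"
proof -
  obtain g where g: "cR_rational \<kappa>1 k g" using nu_bounded_cR_rational[OF assms, of k] by blast
  obtain BE where BE: "\<And>\<kappa> u. 0 < \<kappa> \<Longrightarrow> \<kappa> \<le> \<kappa>1 \<Longrightarrow> norm (u - 1) = 1/8 \<Longrightarrow> norm (cE \<kappa> k u) \<le> BE"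
    using cE_bounded_sphere[OF assms g] by blast
  obtain B where B: "\<And>\<kappa> u. 0 < \<kappa> \<Longrightarrow> \<kappa> \<le> \<kappa>1 \<Longrightarrow> Re u > 0 \<Longrightarrow> 1/8 \<le> norm (u - 1) \<Longrightarrow> norm (cR \<kappa> k u) \<le> B"
    using cR_bounded[OF assms g] by blast
  let ?d = "\<bar>dcoeff k\<bar> / Wlow \<kappa>1 ^ (2 * k + 1)"
  show ?thesis
  proof (rule that[of "max BE (B + ?d)"])
    fix \<kappa> u :: real assume k: "0 < \<kappa>" "\<kappa> \<le> \<kappa>1" and u: "0 < u"
    have n: "norm (complex_of_real u - 1) = \<bar>u - 1\<bar>" by (metis norm_of_real of_real_1 of_real_diff)
    show "\<bar>coef k \<kappa> u\<bar> \<le> max BE (B + ?d)"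
    proof (cases "\<bar>u - 1\<bar> < 1/8")
      case True
      have hol: "cE \<kappa> k holomorphic_on ball 1 (1/4)" by (rule cE_holomorphic) (use k assms in auto)
      have "norm (cE \<kappa> k (of_real u)) \<le> BE"
      proof (rule maximum_modulus_frontier[of "cE \<kappa> k" "cball 1 (1/8)" BE])
        show "cE \<kappa> k holomorphic_on interior (cball 1 (1/8))" by (rule holomorphic_on_subset[OF hol]) auto
        show "continuous_on (closure (cball 1 (1/8))) (cE \<kappa> k)"
          by (rule holomorphic_on_imp_continuous_on, rule holomorphic_on_subset[OF hol]) auto
        show "norm (cE \<kappa> k z) \<le> BE" if "z \<in> frontier (cball 1 (1/8))" for z
          by (rule BE[OF k]) (use that in \<open>simp add: dist_norm norm_minus_commute\<close>)
        show "complex_of_real u \<in> cball 1 (1/8)" using n True by (simp add: dist_norm norm_minus_commute)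
      qed auto
      then have "\<bar>Re (cE \<kappa> k (of_real u))\<bar> \<le> BE" using abs_Re_le_cmod order_trans by blast
      then show ?thesis using True by (simp add: coef_def)
    next
      case False
      then have u1: "u \<noteq> 1" "1/8 \<le> \<bar>u - 1\<bar>" by auto
      have "norm (cR \<kappa> k (of_real u)) \<le> B" by (rule B[OF k]) (use u u1 n in auto)
      then have "\<bar>Re (cR \<kappa> k (of_real u))\<bar> \<le> B" using abs_Re_le_cmod order_trans by blast
      moreover have "\<bar>dcoeff k / Wr \<kappa> u ^ (2 * k + 1)\<bar> \<le> ?d"
      proof -
        have "Wlow \<kappa>1 ^ (2 * k + 1) \<le> \<bar>Wr \<kappa> u\<bar> ^ (2 * k + 1)"
          using Wr_ge[OF k assms(2) u u1(2)] Wlow_pos[OF assms(2)] by (intro power_mono) auto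
        then have "\<bar>dcoeff k\<bar> / \<bar>Wr \<kappa> u\<bar> ^ (2 * k + 1) \<le> ?d"
          using Wlow_pos[OF assms(2)] by (intro frac_le) auto
        then show ?thesis by (simp only: abs_divide power_abs)
      qed
      moreover have "coef k \<kappa> u = Re (cR \<kappa> k (of_real u)) - dcoeff k / Wr \<kappa> u ^ (2 * k + 1)"
        by (rule coef_off_1) (use k assms u1 in auto)
      ultimately show ?thesis by linarith
    qed
  qed
qed

section \<open>The complementary error function\<close>

lemma gauss_integrable_on_Ici: "(\<lambda>t::real. exp (- t\<^sup>2)) integrable_on {a..}"
  and gauss_has_integral_Ici_0: "((\<lambda>t::real. exp (- t\<^sup>2)) has_integral sqrt pi / 2) {0..}"
proof -
  have "has_bochner_integral lborel (\<lambda>t::real. exp (- t\<^sup>2)) (sqrt pi)"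
    using has_bochner_integral_even_function[OF gaussian_moment_0] by simp
  then have i: "integrable lborel (\<lambda>t::real. exp (- t\<^sup>2))" by (simp add: has_bochner_integral_iff)
  then have "set_integrable lborel {a..} (\<lambda>t::real. exp (- t\<^sup>2))"
    unfolding set_integrable_def by (rule integrable_mult_indicator[rotated]) simp
  from set_borel_integral_eq_integral(1)[OF this] show "(\<lambda>t::real. exp (- t\<^sup>2)) integrable_on {a..}" .
  have "has_bochner_integral lborel (\<lambda>x::real. indicator {0..} x *\<^sub>R exp (- x\<^sup>2)) (sqrt pi / 2)"
    by (rule gaussian_moment_0)
  then have "set_integrable lborel {0..} (\<lambda>x::real. exp (- x\<^sup>2))" "(LINT x:{0..}|lborel. exp (- x\<^sup>2)) = sqrt pi / (2::real)"
    by (simp_all add: has_bochner_integral_iff set_integrable_def set_lebesgue_integral_def)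
  from set_borel_integral_eq_integral[OF this(1)] this(2)
  show "((\<lambda>t::real. exp (- t\<^sup>2)) has_integral sqrt pi / 2) {0..}" by (simp add: has_integral_integrable_integral)
qed

lemma integral_gauss_split:
  fixes a b :: real assumes "a \<le> b"
  shows "integral {a..} (\<lambda>t. exp (- t\<^sup>2)) = integral {a..b} (\<lambda>t. exp (- t\<^sup>2)) + integral {b..} (\<lambda>t. exp (- t\<^sup>2))"
proof -
  have "{a..} = {a..b} \<union> {b..}" using assms by auto
  moreover have "integral ({a..b} \<union> {b..}) (\<lambda>t. exp (- t\<^sup>2)) = integral {a..b} (\<lambda>t. exp (- t\<^sup>2)) + integral {b..} (\<lambda>t. exp (- t\<^sup>2))"
  proof (rule integral_Un)
    show "(\<lambda>t::real. exp (- t\<^sup>2)) integrable_on {a..b}" by (intro integrable_continuous_real continuous_intros)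
    show "negligible ({a..b} \<inter> {b..})" by (rule negligible_subset[OF negligible_sing[of b]]) auto
  qed (rule gauss_integrable_on_Ici)
  ultimately show ?thesis by simp
qed

lemma erfc_0: "erfc 0 = 1"
  using gauss_has_integral_Ici_0 by (simp add: erfc_def integral_unique)

lemma erfc_has_derivative: "(erfc has_real_derivative - (2 / sqrt pi * exp (- x\<^sup>2))) (at x)"
proof -
  let ?g = "\<lambda>t::real. exp (- t\<^sup>2)"
  define F where "F y = integral {x - 1..y} ?g" for y
  have "(F has_real_derivative ?g x) (at x within {x - 1..x + 1})" unfolding F_def
    by (rule integral_has_real_derivative) (auto intro!: continuous_intros)
  then have dF: "(F has_real_derivative ?g x) (at x)" by (simp add: at_within_Icc_at)
  have "((\<lambda>y. 2 / sqrt pi * (integral {x - 1..} ?g - F y)) has_real_derivative 2 / sqrt pi * (0 - ?g x)) (at x)"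
    by (intro DERIV_cmult DERIV_diff DERIV_const dF)
  then have "((\<lambda>y. 2 / sqrt pi * (integral {x - 1..} ?g - F y)) has_real_derivative - (2 / sqrt pi * ?g x)) (at x)"
    by (simp only: diff_0 mult_minus_right)
  then show ?thesis
  proof (rule has_field_derivative_transform_within_open[where S="{x - 1<..}"])
    show "2 / sqrt pi * (integral {x - 1..} ?g - F y) = erfc y" if "y \<in> {x - 1<..}" for y
      using integral_gauss_split[of "x - 1" y] that by (simp add: erfc_def F_def)
  qed auto
qed

lemma erfc_tendsto_0: "(erfc \<longlongrightarrow> 0) at_top"
proof -
  let ?g = "\<lambda>t::real. exp (- t\<^sup>2)"
  have "((\<lambda>y. integral {0..y} ?g) \<longlongrightarrow> integral {0..} ?g) at_top"
  proof -
    have "set_integrable lborel {0..} ?g"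
      using gaussian_moment_0 by (simp add: has_bochner_integral_iff set_integrable_def)
    then have "((\<lambda>y. LINT x:{0..y}|lborel. ?g x) \<longlongrightarrow> (LINT x:{0..}|lborel. ?g x)) at_top"
      by (intro tendsto_set_lebesgue_integral_at_top) auto
    moreover have "(LINT x:{0..}|lborel. ?g x) = integral {0..} ?g"
      by (rule set_borel_integral_eq_integral(2)[OF \<open>set_integrable lborel {0..} ?g\<close>])
    moreover have "(LINT x:{0..y}|lborel. ?g x) = integral {0..y} ?g" for y
      by (rule set_borel_integral_eq_integral(2), rule set_integrable_subset[OF \<open>set_integrable lborel {0..} ?g\<close>]) auto
    ultimately show ?thesis by simp
  qed
  then have "((\<lambda>y. 2 / sqrt pi * (integral {0..} ?g - integral {0..y} ?g)) \<longlongrightarrow> 2 / sqrt pi * (integral {0..} ?g - integral {0..} ?g)) at_top"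
    by (intro tendsto_intros)
  then have "((\<lambda>y. 2 / sqrt pi * (integral {0..} ?g - integral {0..y} ?g)) \<longlongrightarrow> 0) at_top" by simp
  then show ?thesis
  proof (rule Lim_transform_eventually)
    show "\<forall>\<^sub>F y in at_top. 2 / sqrt pi * (integral {0..} ?g - integral {0..y} ?g) = erfc y"
      using eventually_ge_at_top[of 0] by eventually_elim (simp add: integral_gauss_split erfc_def)
  qed
qed

lemma erfc_reflect: "erfc (- x) = 2 - erfc x"
proof -
  have "\<exists>c. \<forall>x\<in>UNIV. erfc (- x) + erfc x = c"
  proof (rule has_field_derivative_zero_constant)
    fix x :: real
    have "((\<lambda>x. erfc (- x)) has_real_derivative - (2 / sqrt pi * exp (- (- x)\<^sup>2)) * (- 1)) (at x)"
      by (rule DERIV_chain2[OF erfc_has_derivative]) (auto intro!: derivative_eq_intros)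
    from DERIV_add[OF this erfc_has_derivative[of x]]
    show "((\<lambda>x. erfc (- x) + erfc x) has_real_derivative 0) (at x within UNIV)" by simp
  qed auto
  then obtain c where c: "erfc (- x) + erfc x = c" for x by auto
  from c[of 0] c[of x] show ?thesis by (simp add: erfc_0)
qed

text \<open>A decreasing function lies above its limit at infinity.\<close>

lemma nonneg_if_antimono_tendsto_0:
  fixes f f' :: "real \<Rightarrow> real"
  assumes "\<And>x. x \<ge> a \<Longrightarrow> (f has_real_derivative f' x) (at x)" "\<And>x. x \<ge> a \<Longrightarrow> f' x \<le> 0" "(f \<longlongrightarrow> 0) at_top" "x \<ge> a"
  shows "0 \<le> f x"
proof (rule tendsto_upperbound[OF assms(3)])
  show "\<forall>\<^sub>F y in at_top. f y \<le> f x"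
    using eventually_ge_at_top[of x]
  proof eventually_elim
    case (elim y)
    show "f y \<le> f x" by (rule DERIV_nonpos_imp_nonincreasing[OF elim]) (meson assms(1,2,4) order_trans)
  qed
qed simp

lemma erfc_nonneg: "0 \<le> erfc x"
  by (rule nonneg_if_antimono_tendsto_0[where a=x, OF erfc_has_derivative _ erfc_tendsto_0]) auto

text \<open>The difference vanishes at 0 and at infinity, and its derivative changes sign only at
  \<open>1 / sqrt pi\<close>: it rises before that point and falls after it.\<close>

lemma erfc_le_exp:
  assumes "0 \<le> x" shows "erfc x \<le> exp (- x\<^sup>2)"
proof -
  define g where "g x = exp (- x\<^sup>2) - erfc x" for x :: real
  define g' where "g' x = exp (- x\<^sup>2) * (2 / sqrt pi - 2 * x)" for x :: real
  have d: "(g has_real_derivative g' x) (at x)" for x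
    unfolding g_def g'_def by (auto intro!: derivative_eq_intros erfc_has_derivative simp: algebra_simps)
  have lim: "(g \<longlongrightarrow> 0) at_top"
  proof -
    have "((\<lambda>x::real. exp (- x\<^sup>2)) \<longlongrightarrow> 0) at_top" by real_asymp
    from tendsto_diff[OF this erfc_tendsto_0] show ?thesis by (simp add: g_def[abs_def])
  qed
  have "0 \<le> g x"
  proof (cases "x \<ge> 1 / sqrt pi")
    case True
    show ?thesis
    proof (rule nonneg_if_antimono_tendsto_0[where a="1 / sqrt pi", OF d _ lim True])
      show "g' x \<le> 0" if "1 / sqrt pi \<le> x" for x using that unfolding g'_def by (intro mult_nonneg_nonpos) auto
    qed
  next
    case False
    have "g 0 \<le> g x"
    proof (rule DERIV_nonneg_imp_nondecreasing[OF assms])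
      fix y assume y: "0 \<le> y" "y \<le> x"
      have "g' y \<ge> 0" unfolding g'_def using y False by (intro mult_nonneg_nonneg) auto
      then show "\<exists>l. (g has_real_derivative l) (at y) \<and> 0 \<le> l" using d by blast
    qed
    then show ?thesis by (simp add: g_def erfc_0)
  qed
  then show ?thesis by (simp add: g_def)
qed

section \<open>Comparison with the truncated expansion\<close>

definition vexp :: "real \<Rightarrow> real \<Rightarrow> real \<Rightarrow> real" where "vexp n \<kappa> u = exp (- (n / 2) * Psi \<kappa> u)"

text \<open>The ray probability in the variables \<kappa> and \<open>u\<close>: the argument in
  second place is \<open>n * z / 2\<close>, the last one is \<rho>.\<close>

definition scaled_prob :: "real \<Rightarrow> real \<Rightarrow> real \<Rightarrow> real" where
  "scaled_prob n \<kappa> u = ray_prob (n / 2) (n * (1 - \<kappa>)\<^sup>2 / (2 * \<kappa>)) ((1 - \<kappa> + \<kappa> * u) / (1 - \<kappa>))"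

definition ansatz :: "nat \<Rightarrow> real \<Rightarrow> real \<Rightarrow> real \<Rightarrow> real" where
  "ansatz K n \<kappa> u = 1/4 * erfc (Wr \<kappa> u * sqrt (n / 2))
     + 1/2 * (vexp n \<kappa> u / sqrt (2 * pi * n)) * (\<Sum>k<K. coef k \<kappa> u / n ^ k)"

lemma vexp_pos [simp]: "vexp n \<kappa> u > 0" by (simp add: vexp_def)
lemma vexp_nonneg [simp]: "0 \<le> vexp n \<kappa> u" by (simp add: vexp_def)
lemma vexp_1 [simp]: "vexp n \<kappa> 1 = 1" by (simp add: vexp_def)

lemma vexp_Wr: "0 < \<kappa> \<Longrightarrow> \<kappa> < 1 \<Longrightarrow> 0 < u \<Longrightarrow> n > 0 \<Longrightarrow> exp (- (Wr \<kappa> u * sqrt (n / 2))\<^sup>2) = vexp n \<kappa> u"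
  by (simp add: vexp_def power_mult_distrib Wr_square)

lemma vexp_has_derivative:
  assumes "0 < \<kappa>" "\<kappa> < 1" "0 < u"
  shows "(vexp n \<kappa> has_real_derivative - n * vexp n \<kappa> u * ((u - 1) / vr \<kappa> u)) (at u)"
  unfolding vexp_def[abs_def] using vr_pos[OF assms] by (auto intro!: derivative_eq_intros Psi_has_derivative assms simp: field_simps)

text \<open>All factors free of \<open>u\<close> are collected in \<open>N\<close>, including the
  Kummer function itself; the quotient of the two Kummer combinations enters through
  \<open>theta\<close>. The value of \<open>N\<close> stays open, to be determined by
  matching.\<close>

lemma scaled_prob_has_derivative:
  assumes "0 < \<kappa>" "\<kappa> < 1" "n > 0"
  obtains N where "N > 0" "\<And>u. u > 0 \<Longrightarrow> (scaled_prob n \<kappa> has_real_derivative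
     - (1/2 * sqrt (n / (2 * pi)) * vexp n \<kappa> u * (N * (rsrc \<kappa> 1 (theta n \<kappa>) u / vr \<kappa> u)))) (at u)"
proof -
  define m b where "m = n * (1 - \<kappa>)\<^sup>2 / (2 * \<kappa>)" and "b = n / 2"
  have m: "m > 0" "b > 0" using assms by (auto simp: m_def b_def)
  \<comment> \<open>This is \<open>exp (- (n/2) * phase z t0)\<close> at the saddle point, split off
    from the exponential at \<rho> so that \<open>vexp\<close> remains.\<close>
  define E where "E = exp (- (n/2) * ((1 - \<kappa>) / \<kappa> - ln \<kappa>))"
  define A where "A = kummer_A b m"
  have A: "A > 0" unfolding A_def by (rule kummer_A_pos[OF m(2,1)])
  have B: "kummer_B b m = A * ((1 + theta n \<kappa>) / (1 - \<kappa>))"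
    using A assms by (simp add: theta_def kummer_q_def A_def b_def m_def)
  have t: "tau \<kappa> > 0" by (rule tau_pos[OF assms(1,2)])
  define s where "s = sqrt (n / (2 * pi))"
  have s: "s > 0" using assms by (simp add: s_def)
  define N where "N = 2 * E * A / (sqrt (1 - \<kappa>) * tau \<kappa> * (1 - \<kappa>) * s)"
  show ?thesis
  proof (rule that[of N])
    show "N > 0" unfolding N_def using A t s assms by (auto simp: E_def intro!: divide_pos_pos mult_pos_pos)
    fix u :: real assume u: "u > 0"
    define D where "D = 1 - \<kappa> + \<kappa> * u"
    have D: "D > 0" unfolding D_def by (rule Dr_pos[OF assms(1,2) u])
    have r: "D / (1 - \<kappa>) > 1" using assms u by (simp add: D_def field_simps)
    have r1: "D / (1 - \<kappa>) - 1 = \<kappa> * u / (1 - \<kappa>)" using assms by (simp add: D_def field_simps)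
    have ra: "((\<lambda>u. (1 - \<kappa> + \<kappa> * u) / (1 - \<kappa>)) has_real_derivative \<kappa> / (1 - \<kappa>)) (at u)"
      using assms by (auto intro!: derivative_eq_intros)
    have "(scaled_prob n \<kappa> has_real_derivative
      - (1/2 * exp (- (m * (D / (1 - \<kappa>)))) * (1 - 1/(D / (1 - \<kappa>))) powr b / sqrt (D / (1 - \<kappa>)) * (A + A * ((1 + theta n \<kappa>) / (1 - \<kappa>)) / (D / (1 - \<kappa>) - 1))) * (\<kappa> / (1 - \<kappa>))) (at u)"
      unfolding scaled_prob_def[abs_def] m_def[symmetric] b_def[symmetric] A_def B[unfolded A_def, symmetric] D_def
      by (rule DERIV_chain2[OF ray_prob_has_derivative[OF m(2,1)] ra]) (use r D_def in simp)
    moreover have "- (1/2 * exp (- (m * (D / (1 - \<kappa>)))) * (1 - 1/(D / (1 - \<kappa>))) powr b / sqrt (D / (1 - \<kappa>)) * (A + A * ((1 + theta n \<kappa>) / (1 - \<kappa>)) / (D / (1 - \<kappa>) - 1))) * (\<kappa> / (1 - \<kappa>))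
      = - (1/2 * s * vexp n \<kappa> u * (N * (rsrc \<kappa> 1 (theta n \<kappa>) u / vr \<kappa> u)))"
    proof -
      define S q where "S = sqrt D" and "q = sqrt (1 - \<kappa>)"
      have S: "S > 0" "D = S * S" using D by (auto simp: S_def)
      have q: "q > 0" "sqrt (1 - \<kappa>) = q" "1 - \<kappa> = q * q" using assms by (auto simp: q_def)
      have y: "1 - 1/(D / (1 - \<kappa>)) = \<kappa> * u / D" using D by (simp add: D_def field_simps)
      have "\<kappa> * u / D \<noteq> 0" using assms u D by simp
      then have "exp (- (m * (D / (1 - \<kappa>)))) * (\<kappa> * u / D) powr b = exp (- (m * (D / (1 - \<kappa>))) + b * ln (\<kappa> * u / D))"
        by (simp only: powr_def exp_add if_False)
      also have "ln (\<kappa> * u / D) = ln \<kappa> + ln u - ln D" using assms u D by (simp add: ln_div ln_mult)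
      also have "- (m * (D / (1 - \<kappa>))) + b * (ln \<kappa> + ln u - ln D) = - (n/2) * Psi \<kappa> u + - (n/2) * ((1 - \<kappa>) / \<kappa> - ln \<kappa>)"
      proof -
        have "m * (D / (1 - \<kappa>)) = (n/2) * ((1 - \<kappa>) * D / \<kappa>)" using assms by (simp add: m_def power2_eq_square)
        also have "(1 - \<kappa>) * D / \<kappa> = (1 - \<kappa>) * (u - 1) + (1 - \<kappa>) / \<kappa>" using assms by (simp add: D_def field_simps)
        finally have h: "m * (D / (1 - \<kappa>)) = n/2 * ((1 - \<kappa>) * (u - 1) + (1 - \<kappa>) / \<kappa>)" .
        have alg: "- (c * (x + a)) + c * (lk + lu - lD) = - c * (x - lu + lD) + - c * (a - lk)" for c x a lk lu lD :: real
          by (simp add: algebra_simps)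
        show ?thesis unfolding h Psi_def D_def[symmetric] b_def by (rule alg)
      qed
      finally have e: "exp (- (m * (D / (1 - \<kappa>)))) * (\<kappa> * u / D) powr b = vexp n \<kappa> u * E"
        by (simp only: exp_add vexp_def E_def)
      have e0: "1/2 * exp (- (m * (D / (1 - \<kappa>)))) * (\<kappa> * u / D) powr b = 1/2 * (vexp n \<kappa> u * E)"
        by (simp only: mult.assoc e)
      define X where "X = 1 + \<kappa> * u + theta n \<kappa>"
      have a: "A + A * ((1 + theta n \<kappa>) / (1 - \<kappa>)) / (D / (1 - \<kappa>) - 1) = A * X / (\<kappa> * u)"
        unfolding r1 using assms u by (simp add: X_def field_simps)
      have rr: "rsrc \<kappa> 1 (theta n \<kappa>) u / vr \<kappa> u = tau \<kappa> * (q * q) * X / (2 * u * S)"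
      proof -
        have nz: "1 + \<kappa> * u > 0" using assms u by (simp add: add_pos_pos)
        have 1: "rsrc \<kappa> 1 (theta n \<kappa>) u = tau \<kappa> * S * (X / (1 + \<kappa> * u))"
          unfolding rsrc_def D_def[symmetric] S_def[symmetric] X_def using nz by (simp add: field_simps)
        have 2: "vr \<kappa> u = 2 * u * (S * S) / ((q * q) * (1 + \<kappa> * u))"
          unfolding vr_def D_def[symmetric] S(2)[symmetric] q(3)[symmetric] ..
        show ?thesis unfolding 1 2 using nz S(1) q(1) u by (simp add: divide_simps)
      qed
      have sq: "sqrt (D / (1 - \<kappa>)) = S / q" by (simp add: real_sqrt_divide S_def q_def)
      have alg: "- (1/2 * (v * E) / (S / q) * (A * X / (\<kappa> * u))) * (\<kappa> / (q * q)) = - (1/2 * s * v * (2 * E * A / (q * t * (q * q) * s) * (t * (q * q) * X / (2 * u * S))))"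
        if "t > 0" for v t
        using that s S(1) q(1) u assms by (simp add: field_simps)
      show ?thesis unfolding y e0 sq a rr N_def q(2) unfolding q(3) by (rule alg[OF t])
    qed
    ultimately show "(scaled_prob n \<kappa> has_real_derivative
     - (1/2 * sqrt (n / (2 * pi)) * vexp n \<kappa> u * (N * (rsrc \<kappa> 1 (theta n \<kappa>) u / vr \<kappa> u)))) (at u)"
      unfolding s_def by simp
  qed
qed

lemma scaled_prob_tendsto_0: assumes "0 < \<kappa>" "\<kappa> < 1" "n > 0" shows "(scaled_prob n \<kappa> \<longlongrightarrow> 0) at_top"
  unfolding scaled_prob_def[abs_def]
proof (rule filterlim_compose[OF ray_prob_tendsto_0])
  have "filterlim (\<lambda>u. 1 + \<kappa> / (1 - \<kappa>) * u) at_top at_top"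
    by (intro filterlim_tendsto_add_at_top[OF tendsto_const] filterlim_tendsto_pos_mult_at_top[OF tendsto_const] filterlim_ident)
       (use assms in auto)
  also have "(\<lambda>u. 1 + \<kappa> / (1 - \<kappa>) * u) = (\<lambda>u. (1 - \<kappa> + \<kappa> * u) / (1 - \<kappa>))"
    using assms by (auto simp: field_simps)
  finally show "filterlim (\<lambda>u. (1 - \<kappa> + \<kappa> * u) / (1 - \<kappa>)) at_top at_top" .
qed (use assms in auto)

lemma scaled_prob_tendsto_half: assumes "0 < \<kappa>" "\<kappa> < 1" "n > 0" shows "(scaled_prob n \<kappa> \<longlongrightarrow> 1/2) (at_right 0)"
  unfolding scaled_prob_def[abs_def]
proof (rule filterlim_compose[OF ray_prob_tendsto_half])
  have "((\<lambda>u. (1 - \<kappa> + \<kappa> * u) / (1 - \<kappa>)) \<longlongrightarrow> (1 - \<kappa> + \<kappa> * 0) / (1 - \<kappa>)) (at_right 0)"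
    using assms by (intro tendsto_intros) auto
  then have "((\<lambda>u. (1 - \<kappa> + \<kappa> * u) / (1 - \<kappa>)) \<longlongrightarrow> 1) (at_right 0)" using assms by simp
  moreover have "\<forall>\<^sub>F u in at_right 0. (1 - \<kappa> + \<kappa> * u) / (1 - \<kappa>) \<in> {1<..} \<and> (1 - \<kappa> + \<kappa> * u) / (1 - \<kappa>) \<noteq> 1"
    unfolding eventually_at_right_field by (intro exI[of _ 1]) (use assms in \<open>auto simp: field_simps\<close>)
  ultimately show "filterlim (\<lambda>u. (1 - \<kappa> + \<kappa> * u) / (1 - \<kappa>)) (at_right 1) (at_right 0)"
    by (simp add: filterlim_at)
qed (use assms in auto)

text \<open>The phase difference grows linearly at infinity and like \<open>- ln u\<close> at 0. In
  both cases the remaining logarithm of \<open>1 - \<kappa> + \<kappa> * u\<close> is bounded below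
  by a simpler one.\<close>

lemma vexp_tendsto_0:
  assumes "0 < \<kappa>" "\<kappa> < 1" "n > 0"
  shows "(vexp n \<kappa> \<longlongrightarrow> 0) at_top" "(vexp n \<kappa> \<longlongrightarrow> 0) (at_right 0)"
proof -
  have *: "(vexp n \<kappa> \<longlongrightarrow> 0) F" if "filterlim (Psi \<kappa>) at_top F" for F
  proof -
    have "filterlim (\<lambda>u. - ((n/2) * Psi \<kappa> u)) at_bot F"
      unfolding filterlim_uminus_at_top[symmetric]
      by (intro filterlim_tendsto_pos_mult_at_top[OF tendsto_const] that) (use assms in auto)
    from filterlim_compose[OF exp_at_bot this] show ?thesis by (simp add: vexp_def[abs_def])
  qed
  show "(vexp n \<kappa> \<longlongrightarrow> 0) at_top"
  proof (rule *, rule filterlim_at_top_mono)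
    show "filterlim (\<lambda>u. (ln \<kappa> - (1 - \<kappa>)) + (1 - \<kappa>) * u) at_top at_top"
      by (intro filterlim_tendsto_add_at_top[OF tendsto_const] filterlim_tendsto_pos_mult_at_top[OF tendsto_const] filterlim_ident)
         (use assms in auto)
    show "\<forall>\<^sub>F u in at_top. (ln \<kappa> - (1 - \<kappa>)) + (1 - \<kappa>) * u \<le> Psi \<kappa> u"
      using eventually_gt_at_top[of 0]
    proof eventually_elim
      case (elim u)
      have "ln (\<kappa> * u) \<le> ln (1 - \<kappa> + \<kappa> * u)" using assms elim by (subst ln_le_cancel_iff) (auto intro: add_pos_pos)
      then show ?case using assms elim by (simp add: Psi_def ln_mult algebra_simps)
    qed
  qed
  show "(vexp n \<kappa> \<longlongrightarrow> 0) (at_right 0)"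
  proof (rule *, rule filterlim_at_top_mono)
    have "filterlim (\<lambda>u::real. - ln u) at_top (at_right 0)"
      using ln_at_0 by (simp add: filterlim_uminus_at_top)
    then show "filterlim (\<lambda>u. (ln (1 - \<kappa>) - (1 - \<kappa>)) + - ln u) at_top (at_right 0)"
      by (intro filterlim_tendsto_add_at_top[OF tendsto_const])
    show "\<forall>\<^sub>F u in at_right 0. (ln (1 - \<kappa>) - (1 - \<kappa>)) + - ln u \<le> Psi \<kappa> u"
      unfolding eventually_at_right_field
    proof (intro exI[of _ 1] conjI allI impI)
      fix u :: real assume u: "0 < u"
      have "ln (1 - \<kappa>) \<le> ln (1 - \<kappa> + \<kappa> * u)" using assms u by (subst ln_le_cancel_iff) (auto intro: add_pos_pos)
      moreover have "0 \<le> (1 - \<kappa>) * u" using assms u by simp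
      ultimately show "(ln (1 - \<kappa>) - (1 - \<kappa>)) + - ln u \<le> Psi \<kappa> u" by (simp add: Psi_def algebra_simps)
    qed simp
  qed
qed

lemma sum_lessThan_shift_telescope:
  fixes a :: "nat \<Rightarrow> real" shows "(\<Sum>k<K. a k) - (\<Sum>k<K. a (Suc k)) = a 0 - a K"
  by (induction K) auto

text \<open>The terms with \<open>coef k\<close> telescope. Each correction term contributes its own
  source, and the last coefficient is left without a successor; hence \<open>Suc K\<close> source
  terms and a single remainder of order \<open>K\<close>.\<close>

lemma ansatz_has_derivative:
  assumes "0 < \<kappa>" "\<kappa> < 1" "n > 0" "u > 0"
  shows "(ansatz K n \<kappa> has_real_derivative - (1/2 * sqrt (n / (2 * pi)) * vexp n \<kappa> u *
     ((rsrc \<kappa> (\<Sum>k<Suc K. nu \<kappa> k * (1/n)^k) (\<Sum>k<Suc K. nutheta \<kappa> k * (1/n)^k) u - (u - 1) * coef K \<kappa> u * (1/n) ^ K) / vr \<kappa> u))) (at u)"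
proof -
  define x s where "x = 1 / n" and "s = sqrt (n / (2 * pi))"
  define V p w where "V = vexp n \<kappa> u" and "p = (u - 1) / vr \<kappa> u" and "w = wd \<kappa> u"
  have vr: "vr \<kappa> u > 0" by (rule vr_pos[OF assms(1,2,4)])
  let ?S = "\<lambda>u. \<Sum>k<K. coef k \<kappa> u / n ^ k"
  let ?d = "\<lambda>k. ((u - 1) * coef (Suc k) \<kappa> u - rsrc \<kappa> (nu \<kappa> (Suc k)) (nutheta \<kappa> (Suc k)) u) / vr \<kappa> u"
  have dW: "((\<lambda>u. Wr \<kappa> u * sqrt (n/2)) has_real_derivative w * sqrt (n/2)) (at u)"
    unfolding w_def by (rule DERIV_cmult_right[OF Wr_has_derivative[OF assms(1,2,4)]])
  have 1: "((\<lambda>u. 1/4 * erfc (Wr \<kappa> u * sqrt (n/2))) has_real_derivative 1/4 * (- (2 / sqrt pi * V) * (w * sqrt (n/2)))) (at u)"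
    using DERIV_cmult[OF DERIV_chain2[OF erfc_has_derivative dW], of "1/4"] vexp_Wr[OF assms(1,2,4,3)] by (simp add: V_def)
  have 2: "(?S has_real_derivative (\<Sum>k<K. ?d k / n ^ k)) (at u)"
    by (intro DERIV_sum DERIV_cdivide coef_has_derivative assms)
  have 3: "((\<lambda>u. 1/2 * (vexp n \<kappa> u / sqrt (2 * pi * n)) * ?S u) has_real_derivative
     (1/2 * (- n * V * p / sqrt (2 * pi * n))) * ?S u + (\<Sum>k<K. ?d k / n ^ k) * (1/2 * (V / sqrt (2 * pi * n)))) (at u)"
    unfolding V_def p_def by (intro DERIV_mult DERIV_cmult DERIV_cdivide 2 vexp_has_derivative assms)
  have s1: "1/4 * (- (2 / sqrt pi * V) * (w * sqrt (n/2))) = - (1/2 * s * V * w)"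
    by (simp add: s_def real_sqrt_divide real_sqrt_mult mult_ac)
  have q: "sqrt (2 * pi * n) > 0" "s > 0" using assms by (auto simp: s_def)
  have s2: "n / sqrt (2 * pi * n) = s"
  proof -
    have "sqrt n * sqrt n = n" using assms by simp
    then have "n / (sqrt (2 * pi) * sqrt n) = sqrt n / sqrt (2 * pi)" using assms by (simp add: field_simps)
    then show ?thesis unfolding s_def real_sqrt_divide real_sqrt_mult[of "2*pi" n] .
  qed
  have s3: "1 / sqrt (2 * pi * n) = s * x" unfolding s2[symmetric] x_def using assms by simp
  have pow: "a / n ^ k = a * x ^ k" for a k by (simp add: x_def power_one_over)
  let ?a = "\<lambda>k. p * coef k \<kappa> u * x ^ k" and ?r = "\<lambda>k. rsrc \<kappa> (nu \<kappa> k) (nutheta \<kappa> k) u / vr \<kappa> u * x ^ k"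
  have lin: "(\<Sum>k<Suc K. ?r k) = rsrc \<kappa> (\<Sum>k<Suc K. nu \<kappa> k * x^k) (\<Sum>k<Suc K. nutheta \<kappa> k * x^k) u / vr \<kappa> u"
  proof -
    have "(\<Sum>k<M. ?r k) = rsrc \<kappa> (\<Sum>k<M. nu \<kappa> k * x^k) (\<Sum>k<M. nutheta \<kappa> k * x^k) u / vr \<kappa> u" for M
      by (induction M) (simp_all add: rsrc_def algebra_simps add_divide_distrib)
    then show ?thesis .
  qed
  have "(1/2 * (- n * V * p / sqrt (2 * pi * n))) * ?S u = - (1/2 * s * V * (\<Sum>k<K. ?a k))"
  proof -
    have "(1/2 * (- n * V * p / sqrt (2 * pi * n))) * ?S u = - (1/2 * (n / sqrt (2 * pi * n)) * V * (p * ?S u))" by simp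
    also have "p * ?S u = (\<Sum>k<K. ?a k)" by (simp add: sum_distrib_left pow mult.assoc)
    finally show ?thesis unfolding s2 .
  qed
  moreover have "(\<Sum>k<K. ?d k / n ^ k) * (1/2 * (V / sqrt (2 * pi * n))) = 1/2 * s * V * ((\<Sum>k<K. ?a (Suc k)) - (\<Sum>k<K. ?r (Suc k)))"
  proof -
    have "(\<Sum>k<K. ?d k / n ^ k) * (1/2 * (V / sqrt (2 * pi * n))) = 1/2 * V * ((1 / sqrt (2 * pi * n)) * (\<Sum>k<K. ?d k / n ^ k))" by simp
    also have "(1 / sqrt (2 * pi * n)) * (\<Sum>k<K. ?d k / n ^ k) = s * (\<Sum>k<K. x * (?d k * x ^ k))"
      unfolding s3 pow by (simp add: sum_distrib_left mult.assoc)
    also have "(\<Sum>k<K. x * (?d k * x ^ k)) = (\<Sum>k<K. ?a (Suc k)) - (\<Sum>k<K. ?r (Suc k))"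
      unfolding sum_subtractf[symmetric] by (rule sum.cong) (auto simp: p_def diff_divide_distrib add_divide_distrib algebra_simps)
    finally show ?thesis by simp
  qed
  \<comment> \<open>The start of the telescope: the error function part combines with the leading
    coefficient into the leading source.\<close>
  moreover have "w + ?a 0 = ?r 0"
    unfolding p_def Wr_mult_wd[OF assms(1,2,4), symmetric]
    using coef_0_relation[OF assms(1,2,4)] by (simp add: w_def nu_0 nutheta_0 algebra_simps)
  moreover have "(\<Sum>k<K. ?r (Suc k)) = (\<Sum>k<Suc K. ?r k) - ?r 0" by (simp only: sum.lessThan_Suc_shift add_diff_cancel_left')
  moreover note sum_lessThan_shift_telescope[of ?a K]
  ultimately have fin1: "1/4 * (- (2 / sqrt pi * V) * (w * sqrt (n/2))) + ((1/2 * (- n * V * p / sqrt (2 * pi * n))) * ?S u + (\<Sum>k<K. ?d k / n ^ k) * (1/2 * (V / sqrt (2 * pi * n))))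
    = - (1/2 * s * V * ((\<Sum>k<Suc K. ?r k) - ?a K))"
    unfolding s1
  proof -
    assume h: "(1/2 * (- n * V * p / sqrt (2 * pi * n))) * ?S u = - (1/2 * s * V * (\<Sum>k<K. ?a k))"
      "(\<Sum>k<K. ?d k / n ^ k) * (1/2 * (V / sqrt (2 * pi * n))) = 1/2 * s * V * ((\<Sum>k<K. ?a (Suc k)) - (\<Sum>k<K. ?r (Suc k)))"
      "w + ?a 0 = ?r 0" "(\<Sum>k<K. ?r (Suc k)) = (\<Sum>k<Suc K. ?r k) - ?r 0" "(\<Sum>k<K. ?a k) - (\<Sum>k<K. ?a (Suc k)) = ?a 0 - ?a K"
    have alg: "- (c * w) + (- (c * A) + c * (A' - R)) = - (c * (T - ak))"
      if "w + a0 = r0" "R = T - r0" "A - A' = a0 - ak" for c w A A' R T ak a0 r0 :: real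
    proof -
      have "- (c * w) + (- (c * A) + c * (A' - R)) = - (c * (w + A - A' + R))" by (simp add: algebra_simps)
      also have "w + A - A' + R = T - ak" using that by linarith
      finally show ?thesis .
    qed
    show "- (1/2 * s * V * w) + ((1/2 * (- n * V * p / sqrt (2 * pi * n))) * ?S u + (\<Sum>k<K. ?d k / n ^ k) * (1/2 * (V / sqrt (2 * pi * n))))
      = - (1/2 * s * V * ((\<Sum>k<Suc K. ?r k) - ?a K))"
      unfolding h(1,2) by (rule alg[OF h(3-5)])
  qed
  have fin2: "(\<Sum>k<Suc K. ?r k) - ?a K = (rsrc \<kappa> (\<Sum>k<Suc K. nu \<kappa> k * x^k) (\<Sum>k<Suc K. nutheta \<kappa> k * x^k) u - (u - 1) * coef K \<kappa> u * x ^ K) / vr \<kappa> u"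
    unfolding lin p_def by (simp only: times_divide_eq_left) (simp only: diff_divide_distrib)
  show ?thesis
    using DERIV_add[OF 1 3] unfolding fin1 fin2 unfolding x_def s_def V_def ansatz_def[abs_def] .
qed

text \<open>The derivative bound makes both \<open>B - f\<close> and \<open>B + f\<close>
  decreasing; vanishing at infinity, they are nonnegative.\<close>

lemma abs_le_if_deriv_le_at_top:
  fixes f B :: "real \<Rightarrow> real"
  assumes "\<And>u. u \<ge> a \<Longrightarrow> (f has_real_derivative f' u) (at u)" "\<And>u. u \<ge> a \<Longrightarrow> (B has_real_derivative B' u) (at u)"
    and "\<And>u. u \<ge> a \<Longrightarrow> \<bar>f' u\<bar> \<le> - B' u" "(f \<longlongrightarrow> 0) at_top" "(B \<longlongrightarrow> 0) at_top" "u \<ge> a"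
  shows "\<bar>f u\<bar> \<le> B u"
proof -
  have "0 \<le> B u - f u"
  proof (rule nonneg_if_antimono_tendsto_0[where f="\<lambda>u. B u - f u" and a=a and x=u and f'="\<lambda>u. B' u - f' u"])
    show "((\<lambda>u. B u - f u) \<longlongrightarrow> 0) at_top" using tendsto_diff[OF assms(5,4)] by simp
    show "B' u - f' u \<le> 0" if "u \<ge> a" for u using assms(3)[OF that] by linarith
  qed (use assms in \<open>auto intro: DERIV_diff\<close>)
  moreover have "0 \<le> B u + f u"
  proof (rule nonneg_if_antimono_tendsto_0[where f="\<lambda>u. B u + f u" and a=a and x=u and f'="\<lambda>u. B' u + f' u"])
    show "((\<lambda>u. B u + f u) \<longlongrightarrow> 0) at_top" using tendsto_add[OF assms(5,4)] by simp
    show "B' u + f' u \<le> 0" if "u \<ge> a" for u using assms(3)[OF that] by linarith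
  qed (use assms in \<open>auto intro: DERIV_add\<close>)
  ultimately show ?thesis by linarith
qed

lemma nonneg_if_mono_tendsto_0_at_right:
  fixes f f' :: "real \<Rightarrow> real"
  assumes "\<And>x. 0 < x \<Longrightarrow> x \<le> a \<Longrightarrow> (f has_real_derivative f' x) (at x)" "\<And>x. 0 < x \<Longrightarrow> x \<le> a \<Longrightarrow> 0 \<le> f' x"
    "(f \<longlongrightarrow> 0) (at_right 0)" "0 < x" "x \<le> a"
  shows "0 \<le> f x"
proof (rule tendsto_upperbound[OF assms(3)])
  show "\<forall>\<^sub>F y in at_right 0. f y \<le> f x"
    unfolding eventually_at_right_field
  proof (intro exI[of _ x] conjI allI impI assms(4))
    fix y assume y: "0 < y" "y < x"
    show "f y \<le> f x"
    proof (rule DERIV_nonneg_imp_nondecreasing[where f=f and a=y and b=x])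
      show "y \<le> x" using y by simp
      fix z assume "y \<le> z" "z \<le> x"
      then show "\<exists>l. (f has_real_derivative l) (at z) \<and> 0 \<le> l"
        using assms(1)[of z] assms(2)[of z] y assms(5) by (intro exI[of _ "f' z"]) auto
    qed
  qed
qed simp

lemma abs_le_if_deriv_le_at_right:
  fixes f B :: "real \<Rightarrow> real"
  assumes "\<And>u. 0 < u \<Longrightarrow> u \<le> a \<Longrightarrow> (f has_real_derivative f' u) (at u)" "\<And>u. 0 < u \<Longrightarrow> u \<le> a \<Longrightarrow> (B has_real_derivative B' u) (at u)"
    and "\<And>u. 0 < u \<Longrightarrow> u \<le> a \<Longrightarrow> \<bar>f' u\<bar> \<le> B' u" "(f \<longlongrightarrow> 0) (at_right 0)" "(B \<longlongrightarrow> 0) (at_right 0)" "0 < u" "u \<le> a"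
  shows "\<bar>f u\<bar> \<le> B u"
proof -
  have "0 \<le> B u - f u"
  proof (rule nonneg_if_mono_tendsto_0_at_right[where f="\<lambda>u. B u - f u" and a=a and x=u and f'="\<lambda>u. B' u - f' u"])
    show "((\<lambda>u. B u - f u) \<longlongrightarrow> 0) (at_right 0)" using tendsto_diff[OF assms(5,4)] by simp
    show "0 \<le> B' u - f' u" if "0 < u" "u \<le> a" for u using assms(3)[OF that] by linarith
  qed (use assms in \<open>auto intro: DERIV_diff\<close>)
  moreover have "0 \<le> B u + f u"
  proof (rule nonneg_if_mono_tendsto_0_at_right[where f="\<lambda>u. B u + f u" and a=a and x=u and f'="\<lambda>u. B' u + f' u"])
    show "((\<lambda>u. B u + f u) \<longlongrightarrow> 0) (at_right 0)" using tendsto_add[OF assms(5,4)] by simp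
    show "0 \<le> B' u + f' u" if "0 < u" "u \<le> a" for u using assms(3)[OF that] by linarith
  qed (use assms in \<open>auto intro: DERIV_add\<close>)
  ultimately show ?thesis by linarith
qed

lemma abs_sum_power_le:
  fixes a :: "nat \<Rightarrow> real"
  assumes "0 \<le> x" "x \<le> 1" "\<And>k. k < K \<Longrightarrow> \<bar>a k\<bar> \<le> B k"
  shows "\<bar>\<Sum>k<K. a k * x ^ k\<bar> \<le> (\<Sum>k<K. B k)"
proof -
  have "\<bar>\<Sum>k<K. a k * x ^ k\<bar> \<le> (\<Sum>k<K. \<bar>a k * x ^ k\<bar>)" by (rule sum_abs)
  also have "\<dots> \<le> (\<Sum>k<K. B k)"
  proof (rule sum_mono)
    fix k assume "k \<in> {..<K}"
    then have "\<bar>a k\<bar> \<le> B k" using assms(3) by simp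
    moreover have "\<bar>a k\<bar> * x ^ k \<le> \<bar>a k\<bar> * 1" using assms by (intro mult_left_mono power_le_one) auto
    ultimately show "\<bar>a k * x ^ k\<bar> \<le> B k" using assms by (simp add: abs_mult)
  qed
  finally show ?thesis .
qed

text \<open>Measures how far the exact source, which contains \<open>theta\<close> itself, is from
  the truncated product series. \<open>theta\<close> is expanded to the length \<open>Suc K\<close>
  of the sums, and the product is compared with its truncation.\<close>

lemma source_defect_bound:
  assumes "0 < \<kappa>1" "\<kappa>1 < 1"
  obtains C M where "M \<ge> 1" "\<And>n \<kappa>. n \<ge> M \<Longrightarrow> 0 < \<kappa> \<Longrightarrow> \<kappa> \<le> \<kappa>1 \<Longrightarrow>
    \<bar>(\<Sum>k<Suc K. nu \<kappa> k * (1/n)^k) * theta n \<kappa> - (\<Sum>k<Suc K. nutheta \<kappa> k * (1/n)^k)\<bar> \<le> C * (1/n) ^ K"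
proof -
  have "\<forall>k. \<exists>B. \<forall>\<kappa>. 0 < \<kappa> \<longrightarrow> \<kappa> \<le> \<kappa>1 \<longrightarrow> \<bar>nu \<kappa> k\<bar> \<le> B"
    by (intro allI, rule nu_bounded[OF assms]) blast
  from choice[OF this] obtain B where B: "\<forall>k. \<forall>\<kappa>. 0 < \<kappa> \<longrightarrow> \<kappa> \<le> \<kappa>1 \<longrightarrow> \<bar>nu \<kappa> k\<bar> \<le> B k" ..
  have "\<exists>T. \<forall>\<kappa>. 0 < \<kappa> \<longrightarrow> \<kappa> < 1 \<longrightarrow> \<bar>theta_coeff k \<kappa>\<bar> \<le> T" for k
    by (rule theta_coeff_bounded[of k]) blast
  then have "\<forall>k. \<exists>T. \<forall>\<kappa>. 0 < \<kappa> \<longrightarrow> \<kappa> < 1 \<longrightarrow> \<bar>theta_coeff k \<kappa>\<bar> \<le> T" ..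
  from choice[OF this] obtain T where T: "\<forall>k. \<forall>\<kappa>. 0 < \<kappa> \<longrightarrow> \<kappa> < 1 \<longrightarrow> \<bar>theta_coeff k \<kappa>\<bar> \<le> T k" ..
  obtain C0 M where M: "M \<ge> 1" and C0: "\<And>n \<kappa>. n \<ge> M \<Longrightarrow> 0 < \<kappa> \<Longrightarrow> \<kappa> \<le> \<kappa>1 \<Longrightarrow> \<bar>theta n \<kappa> - theta_sum (Suc K) (1 / n) \<kappa>\<bar> \<le> C0 * (1 / n) ^ Suc K"
    by (rule theta_expansion[OF assms, of "Suc K"]) auto
  define SB ST where "SB = (\<Sum>k<Suc K. B k)" and "ST = (\<Sum>k<Suc K. T k)"
  show ?thesis
  proof (rule that[of M "SB * \<bar>C0\<bar> + SB * ST"])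
    fix n \<kappa> assume n: "n \<ge> M" and k: "0 < \<kappa>" "\<kappa> \<le> \<kappa>1"
    define x where "x = 1 / n"
    have x: "0 \<le> x" "x \<le> 1" using n M by (auto simp: x_def)
    have k1: "\<kappa> < 1" using k assms by simp
    define Ns Ts where "Ns = (\<Sum>k<Suc K. nu \<kappa> k * x^k)" and "Ts = theta_sum (Suc K) x \<kappa>"
    have N: "\<bar>Ns\<bar> \<le> SB" unfolding Ns_def SB_def by (rule abs_sum_power_le[OF x]) (use B k in auto)
    have aB: "(\<Sum>k<Suc K. \<bar>nu \<kappa> k\<bar>) \<le> SB" unfolding SB_def by (rule sum_mono) (use B k in auto)
    have aT: "(\<Sum>k<Suc K. \<bar>theta_coeff k \<kappa>\<bar>) \<le> ST" unfolding ST_def by (rule sum_mono) (use T k k1 in auto)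
    have SB0: "0 \<le> SB" using N by linarith
    have xK: "x ^ Suc K \<le> x ^ K" using x by (intro power_decreasing) auto
    have "\<bar>Ns * Ts - (\<Sum>k<Suc K. nutheta \<kappa> k * x^k)\<bar> \<le> (\<Sum>k<Suc K. \<bar>nu \<kappa> k\<bar>) * (\<Sum>k<Suc K. \<bar>theta_coeff k \<kappa>\<bar>) * x ^ Suc K"
      unfolding Ns_def Ts_def theta_sum_def nutheta_def by (rule truncated_series_mult[OF x])
    also have "\<dots> \<le> SB * ST * x ^ K"
    proof (rule mult_mono[OF _ xK])
      show "(\<Sum>k<Suc K. \<bar>nu \<kappa> k\<bar>) * (\<Sum>k<Suc K. \<bar>theta_coeff k \<kappa>\<bar>) \<le> SB * ST"
        by (rule mult_mono[OF aB aT SB0]) (intro sum_nonneg abs_ge_zero)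
      have "0 \<le> ST" using aT by (rule order_trans[rotated]) (intro sum_nonneg abs_ge_zero)
      then show "0 \<le> SB * ST" using SB0 by simp
    qed (use x in simp)
    finally have 1: "\<bar>Ns * Ts - (\<Sum>k<Suc K. nutheta \<kappa> k * x^k)\<bar> \<le> SB * ST * x ^ K" .
    have "\<bar>theta n \<kappa> - Ts\<bar> \<le> C0 * x ^ Suc K" unfolding Ts_def x_def by (rule C0[OF n k])
    also have "\<dots> \<le> \<bar>C0\<bar> * x ^ K" by (rule mult_mono[OF abs_ge_self xK]) (use x in auto)
    finally have "\<bar>Ns\<bar> * \<bar>theta n \<kappa> - Ts\<bar> \<le> SB * (\<bar>C0\<bar> * x ^ K)" by (intro mult_mono[OF N]) (use SB0 in auto)
    then have 2: "\<bar>Ns * (theta n \<kappa> - Ts)\<bar> \<le> SB * \<bar>C0\<bar> * x ^ K" by (simp add: abs_mult)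
    have "Ns * theta n \<kappa> - (\<Sum>k<Suc K. nutheta \<kappa> k * x^k) = Ns * (theta n \<kappa> - Ts) + (Ns * Ts - (\<Sum>k<Suc K. nutheta \<kappa> k * x^k))"
      by (simp add: algebra_simps)
    then have "\<bar>Ns * theta n \<kappa> - (\<Sum>k<Suc K. nutheta \<kappa> k * x^k)\<bar> \<le> SB * \<bar>C0\<bar> * x ^ K + SB * ST * x ^ K"
      using 1 2 by linarith
    then show "\<bar>(\<Sum>k<Suc K. nu \<kappa> k * (1/n)^k) * theta n \<kappa> - (\<Sum>k<Suc K. nutheta \<kappa> k * (1/n)^k)\<bar> \<le> (SB * \<bar>C0\<bar> + SB * ST) * (1/n) ^ K"
      unfolding Ns_def x_def by (simp only: distrib_right)
  qed (rule M)
qed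

lemma inverse_sqrt_2_pi_n_le_1: "n \<ge> 1 \<Longrightarrow> 1 / sqrt (2 * pi * n) \<le> 1"
proof -
  assume "n \<ge> 1"
  then have "2 * pi * n \<ge> 1 * 1" using pi_gt3 by (intro mult_mono) auto
  then show ?thesis by simp
qed

text \<open>To the right of 1 the error function is at most \<open>vexp\<close>; to the left
  reflection turns the complement to 1/2 into the same situation. These bounds make the ends match
  and later turn the error in the factor into a relative error.\<close>

lemma ansatz_bounds:
  assumes "0 < \<kappa>1" "\<kappa>1 < 1"
  obtains C where "C \<ge> 0"
    "\<And>n \<kappa> u. n \<ge> 1 \<Longrightarrow> 0 < \<kappa> \<Longrightarrow> \<kappa> \<le> \<kappa>1 \<Longrightarrow> 1 \<le> u \<Longrightarrow> \<bar>ansatz K n \<kappa> u\<bar> \<le> C * vexp n \<kappa> u"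
    "\<And>n \<kappa> u. n \<ge> 1 \<Longrightarrow> 0 < \<kappa> \<Longrightarrow> \<kappa> \<le> \<kappa>1 \<Longrightarrow> 0 < u \<Longrightarrow> u \<le> 1 \<Longrightarrow> \<bar>1/2 - ansatz K n \<kappa> u\<bar> \<le> C * vexp n \<kappa> u"
proof -
  have "\<forall>k. \<exists>B. \<forall>\<kappa> u. 0 < \<kappa> \<longrightarrow> \<kappa> \<le> \<kappa>1 \<longrightarrow> 0 < u \<longrightarrow> \<bar>coef k \<kappa> u\<bar> \<le> B"
    by (intro allI, rule coef_bounded[OF assms]) blast
  from choice[OF this] obtain B where B: "\<forall>k. \<forall>\<kappa> u. 0 < \<kappa> \<longrightarrow> \<kappa> \<le> \<kappa>1 \<longrightarrow> 0 < u \<longrightarrow> \<bar>coef k \<kappa> u\<bar> \<le> B k" ..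
  define S where "S = (\<Sum>k<K. B k)"
  have corr: "\<bar>1/2 * (vexp n \<kappa> u / sqrt (2 * pi * n)) * (\<Sum>k<K. coef k \<kappa> u / n ^ k)\<bar> \<le> 1/2 * \<bar>S\<bar> * vexp n \<kappa> u"
    if "n \<ge> 1" "0 < \<kappa>" "\<kappa> \<le> \<kappa>1" "0 < u" for n \<kappa> u
  proof -
    have "\<bar>\<Sum>k<K. coef k \<kappa> u * (1/n) ^ k\<bar> \<le> S" unfolding S_def by (rule abs_sum_power_le) (use that B in auto)
    then have s: "\<bar>\<Sum>k<K. coef k \<kappa> u / n ^ k\<bar> \<le> \<bar>S\<bar>" by (simp add: power_one_over)
    have "\<bar>1/2 * (vexp n \<kappa> u / sqrt (2 * pi * n)) * (\<Sum>k<K. coef k \<kappa> u / n ^ k)\<bar>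
      = 1/2 * vexp n \<kappa> u * (1 / sqrt (2 * pi * n) * \<bar>\<Sum>k<K. coef k \<kappa> u / n ^ k\<bar>)"
      using that by (simp add: abs_mult)
    also have "\<dots> \<le> 1/2 * vexp n \<kappa> u * (1 * \<bar>S\<bar>)"
      by (intro mult_left_mono mult_mono inverse_sqrt_2_pi_n_le_1 s) (use that in auto)
    finally show ?thesis by (simp add: mult_ac)
  qed
  show ?thesis
  proof (rule that[of "1/4 + 1/2 * \<bar>S\<bar>"])
    fix n \<kappa> u :: real assume n: "n \<ge> 1" and k: "0 < \<kappa>" "\<kappa> \<le> \<kappa>1"
    have k1: "\<kappa> < 1" using k assms by simp
    let ?W = "Wr \<kappa> u * sqrt (n / 2)"
    show "\<bar>ansatz K n \<kappa> u\<bar> \<le> (1/4 + 1/2 * \<bar>S\<bar>) * vexp n \<kappa> u" if u: "1 \<le> u"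
    proof -
      have "?W \<ge> 0" using u n k k1 by (simp add: Wr_def Psi_nonneg sgn_if)
      then have "erfc ?W \<le> exp (- ?W\<^sup>2)" by (rule erfc_le_exp)
      also have "\<dots> = vexp n \<kappa> u" by (rule vexp_Wr) (use u k k1 n in auto)
      finally have "\<bar>1/4 * erfc ?W\<bar> \<le> 1/4 * vexp n \<kappa> u" using erfc_nonneg[of ?W] by simp
      moreover have "\<bar>1/2 * (vexp n \<kappa> u / sqrt (2 * pi * n)) * (\<Sum>k<K. coef k \<kappa> u / n ^ k)\<bar> \<le> 1/2 * \<bar>S\<bar> * vexp n \<kappa> u"
        by (rule corr) (use n k u in auto)
      ultimately show ?thesis unfolding ansatz_def distrib_right by linarith
    qed
    show "\<bar>1/2 - ansatz K n \<kappa> u\<bar> \<le> (1/4 + 1/2 * \<bar>S\<bar>) * vexp n \<kappa> u" if u: "0 < u" "u \<le> 1"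
    proof -
      have "- ?W \<ge> 0" using u n k k1 by (simp add: Wr_def Psi_nonneg sgn_if mult_nonpos_nonneg)
      then have "erfc (- ?W) \<le> exp (- (- ?W)\<^sup>2)" by (rule erfc_le_exp)
      also have "\<dots> = vexp n \<kappa> u" unfolding power2_minus by (rule vexp_Wr) (use u k k1 n in auto)
      finally have "\<bar>1/4 * erfc (- ?W)\<bar> \<le> 1/4 * vexp n \<kappa> u" using erfc_nonneg[of "- ?W"] by simp
      moreover have "\<bar>1/2 * (vexp n \<kappa> u / sqrt (2 * pi * n)) * (\<Sum>k<K. coef k \<kappa> u / n ^ k)\<bar> \<le> 1/2 * \<bar>S\<bar> * vexp n \<kappa> u"
        by (rule corr) (use n k u in auto)
      moreover have "1/2 - ansatz K n \<kappa> u = 1/4 * erfc (- ?W) - 1/2 * (vexp n \<kappa> u / sqrt (2 * pi * n)) * (\<Sum>k<K. coef k \<kappa> u / n ^ k)"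
        unfolding ansatz_def erfc_reflect by simp
      ultimately show ?thesis unfolding distrib_right by linarith
    qed
  qed simp
qed

text \<open>The unknown factor is replaced by the series of \<open>nu\<close> through a multiplier
  \<open>Q\<close>. The estimates from the two ends overlap at \<open>u = 1\<close>, where they
  determine \<open>Q\<close> up to the same order, after which \<open>Q\<close> can be removed
  again.\<close>

lemma scaled_prob_ansatz_bound:
  assumes "0 < \<kappa>1" "\<kappa>1 < 1"
  obtains C M where "M \<ge> 1" "C \<ge> 0" "\<And>n \<kappa> u. n \<ge> M \<Longrightarrow> 0 < \<kappa> \<Longrightarrow> \<kappa> \<le> \<kappa>1 \<Longrightarrow> 0 < u \<Longrightarrow>
    \<bar>scaled_prob n \<kappa> u - ansatz (Suc K) n \<kappa> u\<bar> \<le> C * (1/n) ^ Suc K * vexp n \<kappa> u"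
proof -
  define K' where "K' = Suc K"
  obtain CT where CT: "CT \<ge> 0"
    "\<And>n \<kappa> u. n \<ge> 1 \<Longrightarrow> 0 < \<kappa> \<Longrightarrow> \<kappa> \<le> \<kappa>1 \<Longrightarrow> 1 \<le> u \<Longrightarrow> \<bar>ansatz K' n \<kappa> u\<bar> \<le> CT * vexp n \<kappa> u"
    "\<And>n \<kappa> u. n \<ge> 1 \<Longrightarrow> 0 < \<kappa> \<Longrightarrow> \<kappa> \<le> \<kappa>1 \<Longrightarrow> 0 < u \<Longrightarrow> u \<le> 1 \<Longrightarrow> \<bar>1/2 - ansatz K' n \<kappa> u\<bar> \<le> CT * vexp n \<kappa> u"
    using ansatz_bounds[OF assms, of K'] by blast
  obtain C1 M1 where M1: "M1 \<ge> 1" and C1: "\<And>n \<kappa>. n \<ge> M1 \<Longrightarrow> 0 < \<kappa> \<Longrightarrow> \<kappa> \<le> \<kappa>1 \<Longrightarrow>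
    \<bar>(\<Sum>k<Suc K'. nu \<kappa> k * (1/n)^k) * theta n \<kappa> - (\<Sum>k<Suc K'. nutheta \<kappa> k * (1/n)^k)\<bar> \<le> C1 * (1/n) ^ K'"
  proof (rule source_defect_bound[OF assms, of K'], goal_cases)
    case 1
    show ?case by (rule 1(1)[OF 1(2,3)])
  qed
  obtain B0 where B0: "\<And>\<kappa> u. 0 < \<kappa> \<Longrightarrow> \<kappa> \<le> \<kappa>1 \<Longrightarrow> 0 < u \<Longrightarrow> \<bar>coef 0 \<kappa> u\<bar> \<le> B0"
    using coef_bounded[OF assms, of 0] by blast
  obtain B where B: "\<And>\<kappa> u. 0 < \<kappa> \<Longrightarrow> \<kappa> \<le> \<kappa>1 \<Longrightarrow> 0 < u \<Longrightarrow> \<bar>coef K' \<kappa> u\<bar> \<le> B"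
    using coef_bounded[OF assms, of K'] by blast
  define C where "C = \<bar>C1\<bar> + \<bar>C1\<bar> * \<bar>B0\<bar> + \<bar>B\<bar>"
  have C: "C \<ge> 0" by (simp add: C_def)
  \<comment> \<open>From \<open>8 * C\<close> on the quantity \<open>C / n\<close> is at most 1/8,
    which will keep \<open>Q\<close> above 1/2.\<close>
  define M where "M = max M1 (8 * C)"
  show ?thesis
  proof (rule that[of M "2 * (C + 4 * C * CT)"])
    show "M \<ge> 1" using M1 by (simp add: M_def)
    show "0 \<le> 2 * (C + 4 * C * CT)" using C CT(1) by simp
    fix n \<kappa> u :: real assume n: "n \<ge> M" and k: "0 < \<kappa>" "\<kappa> \<le> \<kappa>1" and u0: "0 < u"
    have k1: "\<kappa> < 1" using k assms by simp
    have n1: "n \<ge> 1" "n \<ge> M1" "n \<ge> 8 * C" "n > 0" using n M1 by (auto simp: M_def)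
    define x where "x = 1 / n"
    have x: "0 \<le> x" "x \<le> 1" using n1 by (auto simp: x_def)
    obtain N where N: "N > 0" "\<And>u. u > 0 \<Longrightarrow> (scaled_prob n \<kappa> has_real_derivative
       - (1/2 * sqrt (n / (2 * pi)) * vexp n \<kappa> u * (N * (rsrc \<kappa> 1 (theta n \<kappa>) u / vr \<kappa> u)))) (at u)"
      using scaled_prob_has_derivative[OF k(1) k1 n1(4)] by blast
    define s where "s = 1/2 * sqrt (n / (2 * pi))"
    have s: "s > 0" using n1 by (simp add: s_def)
    define Ns Ts where "Ns = (\<Sum>k<Suc K'. nu \<kappa> k * x^k)" and "Ts = (\<Sum>k<Suc K'. nutheta \<kappa> k * x^k)"
    \<comment> \<open>With this multiplier the part of the source free of \<open>theta\<close>
      cancels exactly, leaving the defect \<open>Ns * theta n \<kappa> - Ts\<close> and the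
      unmatched last coefficient.\<close>
    define Q where "Q = Ns / N"
    define f where "f u = Q * scaled_prob n \<kappa> u - ansatz K' n \<kappa> u" for u
    define f' where "f' u = - (s * vexp n \<kappa> u * ((rsrc \<kappa> 0 (Ns * theta n \<kappa> - Ts) u + (u - 1) * coef K' \<kappa> u * x ^ K') / vr \<kappa> u))" for u
    \<comment> \<open>An explicit primitive of the majorant, up to sign: \<open>wd * vexp\<close>
      integrates to the error function and \<open>Wr * wd * vexp\<close> to \<open>vexp / n\<close>.
      The sign \<sigma> is 1 to the right of 1 and -1 to the left.\<close>
    define Bd where "Bd \<sigma> u = C * x ^ K' * (s * (sqrt (pi / (2 * n)) * erfc (\<sigma> * (Wr \<kappa> u * sqrt (n/2))) + x * vexp n \<kappa> u))" for \<sigma> u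
    have df: "(f has_real_derivative f' u) (at u)" if u: "u > 0" for u
    proof -
      have "(f has_real_derivative Q * (- (s * vexp n \<kappa> u * (N * (rsrc \<kappa> 1 (theta n \<kappa>) u / vr \<kappa> u))))
         - (- (s * vexp n \<kappa> u * ((rsrc \<kappa> Ns Ts u - (u - 1) * coef K' \<kappa> u * x ^ K') / vr \<kappa> u)))) (at u)"
        unfolding f_def[abs_def] s_def Ns_def Ts_def x_def
        by (intro DERIV_diff DERIV_cmult N(2) ansatz_has_derivative k k1 u n1)
      moreover have "Q * (- (s * vexp n \<kappa> u * (N * (rsrc \<kappa> 1 (theta n \<kappa>) u / vr \<kappa> u))))
         - (- (s * vexp n \<kappa> u * ((rsrc \<kappa> Ns Ts u - (u - 1) * coef K' \<kappa> u * x ^ K') / vr \<kappa> u))) = f' u"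
      proof -
        have r: "Ns * rsrc \<kappa> 1 (theta n \<kappa>) u - rsrc \<kappa> Ns Ts u = rsrc \<kappa> 0 (Ns * theta n \<kappa> - Ts) u"
          by (simp add: rsrc_def algebra_simps diff_divide_distrib)
        have alg: "(Ns / N) * (- (s * v * (N * (R / w)))) - (- (s * v * ((R' - y) / w))) = - (s * v * (((Ns * R - R') + y) / w))" for v R w R' y
          using N(1) by (simp add: diff_divide_distrib add_divide_distrib algebra_simps)
        show ?thesis unfolding f'_def r[symmetric] Q_def by (rule alg)
      qed
      ultimately show ?thesis by simp
    qed
    have df_le: "\<bar>f' u\<bar> \<le> C * x ^ K' * (s * (vexp n \<kappa> u * (wd \<kappa> u * (1 + \<bar>Wr \<kappa> u\<bar>))))" if u: "u > 0" for u
    proof -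
      let ?w = "wd \<kappa> u" and ?W = "Wr \<kappa> u" and ?d = "Ns * theta n \<kappa> - Ts"
      have w: "?w > 0" by (rule wd_pos[OF k(1) k1 u])
      have v: "vr \<kappa> u > 0" by (rule vr_pos[OF k(1) k1 u])
      have d: "\<bar>?d\<bar> \<le> \<bar>C1\<bar> * x ^ K'"
        unfolding Ns_def Ts_def x_def
        by (rule order_trans[OF C1[OF n1(2) k]]) (use n1 in \<open>auto intro!: mult_right_mono\<close>)
      have r0: "rsrc \<kappa> 1 0 u \<ge> 0"
        unfolding rsrc_def using tau_pos[OF k(1) k1] Dr_pos[OF k(1) k1 u] by simp
      \<comment> \<open>The defect is divided by \<open>1 + \<kappa> * u \<ge> 1\<close>, so its
        source is dominated by the leading one, which \<open>coef_0_relation\<close> rewrites in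
        terms of \<open>wd\<close> and \<open>Wr\<close>.\<close>
      have "\<bar>rsrc \<kappa> 0 ?d u\<bar> \<le> \<bar>?d\<bar> * rsrc \<kappa> 1 0 u"
      proof -
        have p: "1 + \<kappa> * u \<ge> 1" using k u by simp
        have "\<bar>?d / (1 + \<kappa> * u)\<bar> = \<bar>?d\<bar> / (1 + \<kappa> * u)" using p by (simp add: abs_divide)
        also have "\<dots> \<le> \<bar>?d\<bar> / 1" using p by (intro divide_left_mono) auto
        finally have "\<bar>?d / (1 + \<kappa> * u)\<bar> \<le> \<bar>?d\<bar>" by simp
        moreover have "tau \<kappa> * sqrt (1 - \<kappa> + \<kappa> * u) \<ge> 0" using tau_pos[OF k(1) k1] Dr_pos[OF k(1) k1 u] by simp
        ultimately have "\<bar>tau \<kappa> * sqrt (1 - \<kappa> + \<kappa> * u) * (?d / (1 + \<kappa> * u))\<bar> \<le> tau \<kappa> * sqrt (1 - \<kappa> + \<kappa> * u) * \<bar>?d\<bar>"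
          unfolding abs_mult[of "tau \<kappa> * sqrt (1 - \<kappa> + \<kappa> * u)"] by (metis abs_of_nonneg mult_left_mono)
        then show ?thesis by (simp add: rsrc_def mult_ac)
      qed
      then have "\<bar>rsrc \<kappa> 0 ?d u / vr \<kappa> u\<bar> \<le> \<bar>?d\<bar> * (rsrc \<kappa> 1 0 u / vr \<kappa> u)"
        using v by (simp add: abs_divide divide_right_mono)
      also have "\<dots> = \<bar>?d\<bar> * (?w * (1 + ?W * coef 0 \<kappa> u))" unfolding coef_0_relation[OF k(1) k1 u] ..
      also have "\<dots> \<le> (\<bar>C1\<bar> * x ^ K') * (?w * (1 + \<bar>?W\<bar> * \<bar>B0\<bar>))"
      proof (rule mult_mono[OF d])
        have "?W * coef 0 \<kappa> u \<le> \<bar>?W\<bar> * \<bar>coef 0 \<kappa> u\<bar>" by (metis abs_ge_self abs_mult)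
        also have "\<dots> \<le> \<bar>?W\<bar> * \<bar>B0\<bar>" using B0[OF k u] by (intro mult_left_mono) auto
        finally show "?w * (1 + ?W * coef 0 \<kappa> u) \<le> ?w * (1 + \<bar>?W\<bar> * \<bar>B0\<bar>)" using w by (intro mult_left_mono) auto
        show "0 \<le> ?w * (1 + ?W * coef 0 \<kappa> u)" unfolding coef_0_relation[OF k(1) k1 u, symmetric] using r0 v by simp
      qed (use x in simp)
      finally have 1: "\<bar>rsrc \<kappa> 0 ?d u / vr \<kappa> u\<bar> \<le> (\<bar>C1\<bar> * x ^ K') * (?w * (1 + \<bar>?W\<bar> * \<bar>B0\<bar>))" .
      have "\<bar>(u - 1) * coef K' \<kappa> u * x ^ K' / vr \<kappa> u\<bar> = \<bar>(u - 1) / vr \<kappa> u\<bar> * (\<bar>coef K' \<kappa> u\<bar> * x ^ K')"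
        using x v by (simp add: abs_mult abs_divide)
      also have "(u - 1) / vr \<kappa> u = ?W * ?w" by (rule Wr_mult_wd[OF k(1) k1 u, symmetric])
      also have "\<bar>?W * ?w\<bar> * (\<bar>coef K' \<kappa> u\<bar> * x ^ K') \<le> \<bar>?W * ?w\<bar> * (\<bar>B\<bar> * x ^ K')"
        using B[OF k u] x by (intro mult_left_mono mult_right_mono) auto
      also have "\<bar>?W * ?w\<bar> = ?w * \<bar>?W\<bar>" using w by (simp add: abs_mult)
      finally have 2: "\<bar>(u - 1) * coef K' \<kappa> u * x ^ K' / vr \<kappa> u\<bar> \<le> ?w * \<bar>?W\<bar> * (\<bar>B\<bar> * x ^ K')" .
      have nn: "0 \<le> ?w * x ^ K'" using w x by simp
      have "(\<bar>C1\<bar> * x ^ K') * (?w * (1 + \<bar>?W\<bar> * \<bar>B0\<bar>)) + ?w * \<bar>?W\<bar> * (\<bar>B\<bar> * x ^ K')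
        = (?w * x ^ K') * (\<bar>C1\<bar> + (\<bar>C1\<bar> * \<bar>B0\<bar> + \<bar>B\<bar>) * \<bar>?W\<bar>)" by (simp add: algebra_simps)
      also have "\<dots> \<le> (?w * x ^ K') * (C * (1 + \<bar>?W\<bar>))"
      proof (rule mult_left_mono[OF _ nn])
        have "C * (1 + \<bar>?W\<bar>) - (\<bar>C1\<bar> + (\<bar>C1\<bar> * \<bar>B0\<bar> + \<bar>B\<bar>) * \<bar>?W\<bar>) = \<bar>C1\<bar> * \<bar>B0\<bar> + \<bar>B\<bar> + \<bar>C1\<bar> * \<bar>?W\<bar>"
          by (simp add: C_def algebra_simps)
        also have "\<dots> \<ge> 0" by simp
        finally show "\<bar>C1\<bar> + (\<bar>C1\<bar> * \<bar>B0\<bar> + \<bar>B\<bar>) * \<bar>?W\<bar> \<le> C * (1 + \<bar>?W\<bar>)" by simp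
      qed
      finally have "\<bar>(rsrc \<kappa> 0 ?d u + (u - 1) * coef K' \<kappa> u * x ^ K') / vr \<kappa> u\<bar> \<le> (?w * x ^ K') * (C * (1 + \<bar>?W\<bar>))"
        unfolding add_divide_distrib using 1 2 by linarith
      then have "s * vexp n \<kappa> u * \<bar>(rsrc \<kappa> 0 ?d u + (u - 1) * coef K' \<kappa> u * x ^ K') / vr \<kappa> u\<bar> \<le> s * vexp n \<kappa> u * ((?w * x ^ K') * (C * (1 + \<bar>?W\<bar>)))"
        by (rule mult_left_mono) (use s in simp)
      moreover have "\<bar>f' u\<bar> = s * vexp n \<kappa> u * \<bar>(rsrc \<kappa> 0 ?d u + (u - 1) * coef K' \<kappa> u * x ^ K') / vr \<kappa> u\<bar>"
        unfolding f'_def abs_minus_cancel abs_mult[of "s * vexp n \<kappa> u"] using s by (simp add: abs_mult)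
      ultimately show ?thesis by (simp add: mult_ac)
    qed
    have dBd: "(Bd \<sigma> has_real_derivative - (C * x ^ K' * (s * (vexp n \<kappa> u * (wd \<kappa> u * (\<sigma> + Wr \<kappa> u)))))) (at u)"
      if u: "u > 0" and sg: "\<sigma> * \<sigma> = 1" for \<sigma> u
    proof -
      have dW: "((\<lambda>u. \<sigma> * (Wr \<kappa> u * sqrt (n/2))) has_real_derivative \<sigma> * (wd \<kappa> u * sqrt (n/2))) (at u)"
        by (intro DERIV_cmult DERIV_cmult_right Wr_has_derivative k k1 u)
      have e: "exp (- (\<sigma> * (Wr \<kappa> u * sqrt (n/2)))\<^sup>2) = vexp n \<kappa> u"
      proof -
        have "(\<sigma> * (Wr \<kappa> u * sqrt (n/2)))\<^sup>2 = (Wr \<kappa> u * sqrt (n/2))\<^sup>2" using sg by (simp add: power_mult_distrib power2_eq_square)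
        then show ?thesis using vexp_Wr[OF k(1) k1 u n1(4)] by simp
      qed
      have "(Bd \<sigma> has_real_derivative C * x ^ K' * (s * (sqrt (pi / (2 * n)) * (- (2 / sqrt pi * exp (- (\<sigma> * (Wr \<kappa> u * sqrt (n/2)))\<^sup>2)) * (\<sigma> * (wd \<kappa> u * sqrt (n/2)))) + x * (- n * vexp n \<kappa> u * ((u - 1) / vr \<kappa> u))))) (at u)"
        unfolding Bd_def[abs_def]
        by (intro DERIV_cmult DERIV_add DERIV_chain2[OF erfc_has_derivative] dW vexp_has_derivative k k1 u)
      moreover have "sqrt (pi / (2 * n)) * (- (2 / sqrt pi * exp (- (\<sigma> * (Wr \<kappa> u * sqrt (n/2)))\<^sup>2)) * (\<sigma> * (wd \<kappa> u * sqrt (n/2)))) = - (vexp n \<kappa> u * (wd \<kappa> u * \<sigma>))"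
      proof -
        have "sqrt (pi / (2 * n)) * (2 / sqrt pi) * sqrt (n/2) = 1"
        proof -
          have "sqrt n > 0" "sqrt pi > 0" "sqrt 2 * sqrt 2 = (2::real)" using n1 by auto
          then show ?thesis by (simp add: real_sqrt_divide real_sqrt_mult field_simps)
        qed
        then have "sqrt (pi / (2 * n)) * (2 / sqrt pi) * sqrt (n/2) * (vexp n \<kappa> u * (wd \<kappa> u * \<sigma>)) = vexp n \<kappa> u * (wd \<kappa> u * \<sigma>)" by (simp only: mult_1_left)
        moreover have "sqrt (pi / (2 * n)) * (- (2 / sqrt pi * V) * (\<sigma> * (w * sqrt (n/2)))) = - (sqrt (pi / (2 * n)) * (2 / sqrt pi) * sqrt (n/2) * (V * (w * \<sigma>)))" for V w
          by (simp only: mult_ac mult_minus_left mult_minus_right)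
        ultimately show ?thesis unfolding e by metis
      qed
      moreover have "x * (- n * vexp n \<kappa> u * ((u - 1) / vr \<kappa> u)) = - (vexp n \<kappa> u * (wd \<kappa> u * Wr \<kappa> u))"
        unfolding Wr_mult_wd[OF k(1) k1 u, symmetric] x_def using n1 by simp
      moreover have "C * x ^ K' * (s * (- (vexp n \<kappa> u * (wd \<kappa> u * \<sigma>)) + - (vexp n \<kappa> u * (wd \<kappa> u * Wr \<kappa> u)))) = - (C * x ^ K' * (s * (vexp n \<kappa> u * (wd \<kappa> u * (\<sigma> + Wr \<kappa> u)))))"
        by (simp add: algebra_simps)
      ultimately show ?thesis by simp
    qed
    have Bd: "0 \<le> Bd \<sigma> u \<and> Bd \<sigma> u \<le> C * x ^ K' * vexp n \<kappa> u" if u: "u > 0" and sg: "\<sigma> * \<sigma> = 1" "0 \<le> \<sigma> * (u - 1)" for \<sigma> u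
    proof -
      let ?a = "\<sigma> * (Wr \<kappa> u * sqrt (n/2))"
      have "?a \<ge> 0"
      proof -
        have "\<sigma> = 1 \<or> \<sigma> = - 1" using sg(1) by (metis mult_1_right square_eq_1_iff power2_eq_square power2_eq_1_iff)
        then show ?thesis using sg(2) Psi_nonneg[OF k(1) k1 u] n1 by (auto simp: Wr_def sgn_if mult_nonpos_nonneg)
      qed
      then have "erfc ?a \<le> exp (- ?a\<^sup>2)" by (rule erfc_le_exp)
      also have "?a\<^sup>2 = (Wr \<kappa> u * sqrt (n/2))\<^sup>2" using sg by (simp add: power_mult_distrib power2_eq_square)
      also have "exp (- (Wr \<kappa> u * sqrt (n/2))\<^sup>2) = vexp n \<kappa> u" by (rule vexp_Wr[OF k(1) k1 u n1(4)])
      finally have e: "erfc ?a \<le> vexp n \<kappa> u" .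
      have "s * (sqrt (pi / (2 * n)) * erfc ?a + x * vexp n \<kappa> u) \<le> s * (sqrt (pi / (2 * n)) * vexp n \<kappa> u + x * vexp n \<kappa> u)"
        using e s n1 by (intro mult_left_mono add_right_mono) auto
      also have "\<dots> = (s * sqrt (pi / (2 * n)) + s * x) * vexp n \<kappa> u" by (simp add: algebra_simps)
      also have "s * sqrt (pi / (2 * n)) = 1/4"
      proof -
        have "sqrt (n / (2 * pi)) * sqrt (pi / (2 * n)) = sqrt ((1/2)\<^sup>2)"
          unfolding real_sqrt_mult[symmetric] using n1 by (simp add: power2_eq_square)
        then show ?thesis by (simp add: s_def mult_ac)
      qed
      also have "s * x = 1/2 * (1 / sqrt (2 * pi * n))"
      proof -
        have "sqrt n * sqrt n = n" using n1 by simp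
        then have "sqrt n / n = 1 / sqrt n" using n1 by (simp add: field_simps)
        moreover have "s * x = 1/2 / sqrt (2 * pi) * (sqrt n / n)" by (simp add: s_def x_def real_sqrt_divide)
        ultimately show ?thesis unfolding real_sqrt_mult[of "2 * pi" n] by simp
      qed
      also have "(1/4 + 1/2 * (1 / sqrt (2 * pi * n))) * vexp n \<kappa> u \<le> 1 * vexp n \<kappa> u"
        using inverse_sqrt_2_pi_n_le_1[OF n1(1)] by (intro mult_right_mono) auto
      finally have "s * (sqrt (pi / (2 * n)) * erfc ?a + x * vexp n \<kappa> u) \<le> vexp n \<kappa> u" by simp
      then have "Bd \<sigma> u \<le> C * x ^ K' * vexp n \<kappa> u" unfolding Bd_def using C x by (intro mult_left_mono) auto
      moreover have "0 \<le> Bd \<sigma> u" unfolding Bd_def using C x s erfc_nonneg[of ?a] n1 by (intro mult_nonneg_nonneg add_nonneg_nonneg) auto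
      ultimately show ?thesis by blast
    qed
    have Vlim: "((\<lambda>u. c * vexp n \<kappa> u) \<longlongrightarrow> 0) at_top" "((\<lambda>u. c * vexp n \<kappa> u) \<longlongrightarrow> 0) (at_right 0)" for c
      using tendsto_mult_left[OF vexp_tendsto_0(1)[OF k(1) k1 n1(4)], of c] tendsto_mult_left[OF vexp_tendsto_0(2)[OF k(1) k1 n1(4)], of c] by simp_all
    have ev: "\<forall>\<^sub>F u::real in at_right 0. 0 < u \<and> u \<le> 1"
      unfolding eventually_at_right_field by (intro exI[of _ 1]) auto
    have right: "\<bar>f u\<bar> \<le> Bd 1 u" if u: "1 \<le> u" for u
    proof (rule abs_le_if_deriv_le_at_top[where f=f and B="Bd 1" and a=1 and u=u])
      show "(f has_real_derivative f' u) (at u)" if "1 \<le> u" for u using df that by simp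
      show "(Bd 1 has_real_derivative - (C * x ^ K' * (s * (vexp n \<kappa> u * (wd \<kappa> u * (1 + Wr \<kappa> u)))))) (at u)" if "1 \<le> u" for u
        using dBd that by simp
      show "\<bar>f' u\<bar> \<le> - (- (C * x ^ K' * (s * (vexp n \<kappa> u * (wd \<kappa> u * (1 + Wr \<kappa> u))))))" if "1 \<le> u" for u
      proof -
        have "\<bar>Wr \<kappa> u\<bar> = Wr \<kappa> u" using that Psi_nonneg[OF k(1) k1, of u] by (simp add: Wr_def sgn_if)
        then show ?thesis using df_le[of u] that by simp
      qed
      have "(ansatz K' n \<kappa> \<longlongrightarrow> 0) at_top"
      proof (rule Lim_null_comparison[OF _ Vlim(1)[of CT]])
        show "\<forall>\<^sub>F u in at_top. norm (ansatz K' n \<kappa> u) \<le> CT * vexp n \<kappa> u"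
          using eventually_ge_at_top[of 1] by eventually_elim (use CT(2)[OF n1(1) k] in simp)
      qed
      from tendsto_diff[OF tendsto_mult_left[OF scaled_prob_tendsto_0[OF k(1) k1 n1(4)], of Q] this]
      show "(f \<longlongrightarrow> 0) at_top" by (simp add: f_def[abs_def])
      show "(Bd 1 \<longlongrightarrow> 0) at_top"
      proof (rule Lim_null_comparison[OF _ Vlim(1)[of "C * x ^ K'"]])
        show "\<forall>\<^sub>F u in at_top. norm (Bd 1 u) \<le> C * x ^ K' * vexp n \<kappa> u"
          using eventually_ge_at_top[of 1] by eventually_elim (use Bd[of _ 1] in simp)
      qed
    qed (rule u)
    \<comment> \<open>The complementary quantity: it vanishes as \<open>u\<close> tends to 0, as
      \<open>f\<close> does at infinity, and differs from \<open>- f\<close> by the constant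
      \<open>(Q - 1) / 2\<close>.\<close>
    define h where "h u = Q * (1/2 - scaled_prob n \<kappa> u) - (1/2 - ansatz K' n \<kappa> u)" for u
    have hf: "h u = (Q - 1) / 2 - f u" for u by (simp add: h_def f_def field_simps)
    have left: "\<bar>h u\<bar> \<le> Bd (- 1) u" if u: "0 < u" "u \<le> 1" for u
    proof (rule abs_le_if_deriv_le_at_right[where f=h and B="Bd (- 1)" and a=1 and u=u])
      show "(h has_real_derivative 0 - f' u) (at u)" if "0 < u" "u \<le> 1" for u
        unfolding hf[abs_def] by (intro DERIV_diff DERIV_const df that)
      show "(Bd (- 1) has_real_derivative - (C * x ^ K' * (s * (vexp n \<kappa> u * (wd \<kappa> u * (- 1 + Wr \<kappa> u)))))) (at u)" if "0 < u" "u \<le> 1" for u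
        using dBd[of u "- 1"] that by simp
      show "\<bar>0 - f' u\<bar> \<le> - (C * x ^ K' * (s * (vexp n \<kappa> u * (wd \<kappa> u * (- 1 + Wr \<kappa> u)))))" if "0 < u" "u \<le> 1" for u
      proof -
        have "\<bar>Wr \<kappa> u\<bar> = - Wr \<kappa> u" using that Psi_nonneg[OF k(1) k1, of u] by (simp add: Wr_def sgn_if)
        then show ?thesis using df_le[of u] that by (simp add: algebra_simps)
      qed
      have "((\<lambda>u. 1/2 - ansatz K' n \<kappa> u) \<longlongrightarrow> 0) (at_right 0)"
      proof (rule Lim_null_comparison[OF _ Vlim(2)[of CT]])
        show "\<forall>\<^sub>F u in at_right 0. norm (1/2 - ansatz K' n \<kappa> u) \<le> CT * vexp n \<kappa> u"
          using ev by eventually_elim (use CT(3)[OF n1(1) k] in simp)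
      qed
      from tendsto_diff[OF tendsto_mult_left[OF tendsto_diff[OF tendsto_const[of "1/2"] scaled_prob_tendsto_half[OF k(1) k1 n1(4)]], of Q] this]
      show "(h \<longlongrightarrow> 0) (at_right 0)" by (simp add: h_def[abs_def])
      show "(Bd (- 1) \<longlongrightarrow> 0) (at_right 0)"
      proof (rule Lim_null_comparison[OF _ Vlim(2)[of "C * x ^ K'"]])
        show "\<forall>\<^sub>F u in at_right 0. norm (Bd (- 1) u) \<le> C * x ^ K' * vexp n \<kappa> u"
          using ev by eventually_elim (use Bd[of _ "- 1"] in simp)
      qed
    qed (use u in auto)
    let ?e = "C * x ^ K'"
    have "\<bar>f 1\<bar> \<le> ?e" using right[of 1] Bd[of 1 1] by simp
    have "\<bar>h 1\<bar> \<le> ?e" using left[of 1] Bd[of 1 "- 1"] by simp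
    \<comment> \<open>Both one-sided estimates hold at \<open>u = 1\<close>; adding them isolates
      the constant.\<close>
    have Q1: "\<bar>Q - 1\<bar> \<le> 4 * ?e"
    proof -
      have "Q - 1 = 2 * h 1 + 2 * f 1" using hf[of 1] by simp
      then show ?thesis using \<open>\<bar>f 1\<bar> \<le> ?e\<close> \<open>\<bar>h 1\<bar> \<le> ?e\<close> by linarith
    qed
    have "?e \<le> C * x" using x C unfolding K'_def by (intro mult_left_mono) (simp_all add: mult_left_le power_le_one)
    also have "C * x \<le> 1/8" using n1 by (simp add: x_def field_simps)
    finally have Qh: "Q \<ge> 1/2" using Q1 by linarith
    \<comment> \<open>Removes \<open>Q\<close>: its deviation from 1 multiplies a quantity of size
      \<open>CT * vexp\<close>, so the error keeps the exponential factor.\<close>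
    have main: "\<bar>p - t\<bar> \<le> 2 * (C + 4 * C * CT) * x ^ K' * vexp n \<kappa> u"
      if a: "\<bar>Q * p - t\<bar> \<le> ?e * vexp n \<kappa> u" "\<bar>t\<bar> \<le> CT * vexp n \<kappa> u" for p t
    proof -
      have "Q * (p - t) = (Q * p - t) - (Q - 1) * t" by (simp add: algebra_simps)
      then have "\<bar>Q * (p - t)\<bar> \<le> \<bar>Q * p - t\<bar> + \<bar>Q - 1\<bar> * \<bar>t\<bar>" by (simp add: abs_mult[symmetric])
      also have "\<dots> \<le> ?e * vexp n \<kappa> u + (4 * ?e) * (CT * vexp n \<kappa> u)"
        by (intro add_mono mult_mono a Q1) (use C x in auto)
      also have "?e * vexp n \<kappa> u + (4 * ?e) * (CT * vexp n \<kappa> u) = (C + 4 * C * CT) * x ^ K' * vexp n \<kappa> u" by (simp add: algebra_simps)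
      also have "\<bar>Q * (p - t)\<bar> = Q * \<bar>p - t\<bar>" using Qh by (simp only: abs_mult abs_of_nonneg)
      finally have 1: "Q * \<bar>p - t\<bar> \<le> (C + 4 * C * CT) * x ^ K' * vexp n \<kappa> u" .
      have "1/2 * \<bar>p - t\<bar> \<le> Q * \<bar>p - t\<bar>" using Qh by (intro mult_right_mono) auto
      then have "2 * (1/2 * \<bar>p - t\<bar>) \<le> 2 * ((C + 4 * C * CT) * x ^ K' * vexp n \<kappa> u)"
        by (intro mult_left_mono order_trans[OF _ 1]) auto
      then have "\<bar>p - t\<bar> \<le> 2 * ((C + 4 * C * CT) * x ^ K' * vexp n \<kappa> u)" by simp
      then show ?thesis by (simp only: mult.assoc)
    qed
    have "\<bar>scaled_prob n \<kappa> u - ansatz K' n \<kappa> u\<bar> \<le> 2 * (C + 4 * C * CT) * x ^ K' * vexp n \<kappa> u"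
    proof (cases "1 \<le> u")
      case True
      show ?thesis
      proof (rule main)
        show "\<bar>Q * scaled_prob n \<kappa> u - ansatz K' n \<kappa> u\<bar> \<le> ?e * vexp n \<kappa> u"
          using right[OF True] Bd[of u 1] True unfolding f_def by simp
        show "\<bar>ansatz K' n \<kappa> u\<bar> \<le> CT * vexp n \<kappa> u" by (rule CT(2)[OF n1(1) k True])
      qed
    next
      case False
      have "\<bar>(1/2 - scaled_prob n \<kappa> u) - (1/2 - ansatz K' n \<kappa> u)\<bar> \<le> 2 * (C + 4 * C * CT) * x ^ K' * vexp n \<kappa> u"
      proof (rule main)
        show "\<bar>Q * (1/2 - scaled_prob n \<kappa> u) - (1/2 - ansatz K' n \<kappa> u)\<bar> \<le> ?e * vexp n \<kappa> u"
          using left[of u] Bd[of u "- 1"] u0 False unfolding h_def by simp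
        show "\<bar>1/2 - ansatz K' n \<kappa> u\<bar> \<le> CT * vexp n \<kappa> u" by (rule CT(3)[OF n1(1) k u0]) (use False in simp)
      qed
      then show ?thesis by (simp add: abs_minus_commute)
    qed
    then show "\<bar>scaled_prob n \<kappa> u - ansatz (Suc K) n \<kappa> u\<bar> \<le> 2 * (C + 4 * C * CT) * (1/n) ^ Suc K * vexp n \<kappa> u"
      unfolding K'_def x_def .
  qed
qed

text \<open>The previous bound lacks the factor \<open>1 / sqrt n\<close>. It is applied with one
  term more, which gains \<open>1 / n\<close> and so more than compensates; the additional term is
  itself of the permitted size.\<close>

lemma scaled_prob_expansion:
  assumes "0 < \<kappa>1" "\<kappa>1 < 1"
  obtains C M where "M \<ge> 1" "\<And>n \<kappa> u. n \<ge> M \<Longrightarrow> 0 < \<kappa> \<Longrightarrow> \<kappa> \<le> \<kappa>1 \<Longrightarrow> 0 < u \<Longrightarrow>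
    \<bar>scaled_prob n \<kappa> u - ansatz K n \<kappa> u\<bar> \<le> C * (vexp n \<kappa> u / sqrt (2 * pi * n)) / n ^ K"
proof -
  obtain C M where M: "M \<ge> 1" and C0: "C \<ge> 0" and C: "\<And>n \<kappa> u. n \<ge> M \<Longrightarrow> 0 < \<kappa> \<Longrightarrow> \<kappa> \<le> \<kappa>1 \<Longrightarrow> 0 < u \<Longrightarrow>
    \<bar>scaled_prob n \<kappa> u - ansatz (Suc K) n \<kappa> u\<bar> \<le> C * (1/n) ^ Suc K * vexp n \<kappa> u"
  proof (rule scaled_prob_ansatz_bound[OF assms, of K], goal_cases)
    case 1
    show ?case by (rule 1(1)[OF 1(2-4)])
  qed
  obtain B where B: "\<And>\<kappa> u. 0 < \<kappa> \<Longrightarrow> \<kappa> \<le> \<kappa>1 \<Longrightarrow> 0 < u \<Longrightarrow> \<bar>coef K \<kappa> u\<bar> \<le> B"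
    using coef_bounded[OF assms, of K] by blast
  show ?thesis
  proof (rule that[of M "C * sqrt (2 * pi) + 1/2 * \<bar>B\<bar>"])
    fix n \<kappa> u :: real assume n: "n \<ge> M" and k: "0 < \<kappa>" "\<kappa> \<le> \<kappa>1" and u: "0 < u"
    define g where "g = vexp n \<kappa> u / sqrt (2 * pi * n)"
    have n1: "n \<ge> 1" using n M by simp
    have g: "g \<ge> 0" using n1 by (simp add: g_def)
    have "ansatz (Suc K) n \<kappa> u - ansatz K n \<kappa> u = 1/2 * g * (coef K \<kappa> u / n ^ K)"
      by (simp add: ansatz_def g_def algebra_simps)
    then have "\<bar>ansatz (Suc K) n \<kappa> u - ansatz K n \<kappa> u\<bar> = 1/2 * g * \<bar>coef K \<kappa> u\<bar> / n ^ K"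
      using g n1 by (simp add: abs_mult)
    also have "\<dots> \<le> 1/2 * g * \<bar>B\<bar> / n ^ K"
      using B[OF k u] g n1 by (intro divide_right_mono mult_left_mono) auto
    finally have 1: "\<bar>ansatz (Suc K) n \<kappa> u - ansatz K n \<kappa> u\<bar> \<le> (1/2 * \<bar>B\<bar>) * (g / n ^ K)" by (simp add: mult_ac)
    have "C * (1/n) ^ Suc K * vexp n \<kappa> u = C * sqrt (2 * pi) * (1 / sqrt n) * (g / n ^ K)"
    proof -
      have q: "sqrt n * sqrt n = n" "sqrt n > 0" using n1 by auto
      have "vexp n \<kappa> u = sqrt (2 * pi) * sqrt n * g" using n1 by (simp add: g_def real_sqrt_mult)
      moreover have "(1/n) * sqrt n = 1 / sqrt n" using q n1 by (simp add: field_simps)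
      moreover have "C * (1/n) ^ Suc K * (sqrt (2 * pi) * sqrt n * g) = C * sqrt (2 * pi) * ((1/n) * sqrt n) * (g / n ^ K)"
        by (simp add: power_one_over)
      ultimately show ?thesis by simp
    qed
    also have "\<dots> \<le> C * sqrt (2 * pi) * 1 * (g / n ^ K)"
      using C0 g n1 by (intro mult_right_mono mult_left_mono) auto
    finally have "\<bar>scaled_prob n \<kappa> u - ansatz K n \<kappa> u\<bar> \<le> (C * sqrt (2 * pi)) * (g / n ^ K) + (1/2 * \<bar>B\<bar>) * (g / n ^ K)"
      using C[OF n k u] 1 by linarith
    then show "\<bar>scaled_prob n \<kappa> u - ansatz K n \<kappa> u\<bar> \<le> (C * sqrt (2 * pi) + 1/2 * \<bar>B\<bar>) * (vexp n \<kappa> u / sqrt (2 * pi * n)) / n ^ K"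
      unfolding g_def[symmetric] by (simp only: distrib_right times_divide_eq_right add_divide_distrib)
  qed (rule M)
qed

section \<open>The first two coefficients\<close>

lemma powser_derivative_at_center:
  fixes a :: "nat \<Rightarrow> complex"
  assumes "summable (\<lambda>n. a n * (1/2) ^ n)"
  shows "((\<lambda>u. \<Sum>n. a n * (u - 1) ^ n) has_field_derivative a 1) (at 1)"
proof -
  have "((\<lambda>x. \<Sum>n. a n * x ^ n) has_field_derivative (\<Sum>n. diffs a n * 0 ^ n)) (at 0)"
    by (rule termdiffs_strong[OF assms]) simp
  then have "((\<lambda>x. \<Sum>n. a n * x ^ n) has_field_derivative a 1) (at (1 - 1))"
    by (simp add: diffs_def)
  moreover have "((\<lambda>u::complex. u - 1) has_field_derivative 1) (at 1)" by (auto intro!: derivative_eq_intros)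
  ultimately show ?thesis using DERIV_chain2[of "\<lambda>x. \<Sum>n. a n * x ^ n" "a 1" "\<lambda>u. u - 1" 1 1] by simp
qed

text \<open>The divided difference of \<open>Omega\<close> at 1; its first two Taylor coefficients
  enter the derivative of the leading coefficient.\<close>

definition Omega1 :: "real \<Rightarrow> complex \<Rightarrow> complex" where
  "Omega1 \<kappa> u = (\<Sum>k. of_real (omega_coeff \<kappa> (Suc k)) * (u - 1) ^ k)"

lemma Omega_powser_summable:
  assumes "0 < \<kappa>" "\<kappa> < 1" "norm h < 1" shows "summable (\<lambda>k. of_real (omega_coeff \<kappa> k) * h ^ k :: complex)"
proof -
  have "1 + h \<in> ball 1 1" using assms(3) by (simp add: dist_norm)
  from Omega_sums[OF assms(1,2) this] show ?thesis by (simp add: sums_iff)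
qed

lemma Omega_split:
  assumes "0 < \<kappa>" "\<kappa> < 1" "u \<in> ball 1 1"
  shows "Omega \<kappa> u = of_real (omega_coeff \<kappa> 0) + (u - 1) * Omega1 \<kappa> u"
  using powser_split_head(1)[OF Omega_powser_summable[OF assms(1,2), of "u - 1"]] assms(3)
  by (simp add: Omega_def Omega1_def dist_norm norm_minus_commute mult.commute)

lemma Omega_derivative_at_1:
  assumes "0 < \<kappa>" "\<kappa> < 1" shows "(Omega \<kappa> has_field_derivative of_real (omega_coeff \<kappa> 1)) (at 1)"
  unfolding Omega_def[abs_def] by (rule powser_derivative_at_center[OF Omega_powser_summable[OF assms]]) (simp add: norm_divide)

lemma Omega1_derivative_at_1:
  assumes "0 < \<kappa>" "\<kappa> < 1" shows "(Omega1 \<kappa> has_field_derivative of_real (omega_coeff \<kappa> 2)) (at 1)"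
proof -
  have "summable (\<lambda>n. complex_of_real (omega_coeff \<kappa> (Suc n)) * (1/2) ^ n)"
    by (rule powser_split_head(3)[OF Omega_powser_summable[OF assms]]) (simp add: norm_divide)
  from powser_derivative_at_center[OF this] show ?thesis by (simp add: Omega1_def[abs_def] numeral_2_eq_2)
qed

lemma Omega1_at_1: "Omega1 \<kappa> 1 = of_real (omega_coeff \<kappa> 1)"
  unfolding Omega1_def using powser_zero[of "\<lambda>k. complex_of_real (omega_coeff \<kappa> (Suc k))"] by simp

text \<open>Instead of expanding roots, \<open>A = omega * cE 0\<close> is characterized by an
  algebraic equation obtained by squaring. Evaluating that equation and its derivative at 1 gives
  \<open>A\<close> and its derivative there.\<close>

lemma cE_0_deriv_1:
  assumes "0 < \<kappa>" "\<kappa> < 1"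
  defines "p \<equiv> (tau \<kappa>)\<^sup>2 * omega_coeff \<kappa> 1" and "q \<equiv> (tau \<kappa>)\<^sup>2 * omega_coeff \<kappa> 2"
  shows "Re (deriv (cE \<kappa> 0) 1) = tau \<kappa> * ((q + \<kappa> * p - ((\<kappa> + p) / 2)\<^sup>2) / 2 - p * ((\<kappa> + p) / 2) / 2)"
proof -
  let ?B = "ball (1::complex) (1/4)"
  have t: "tau \<kappa> > 0" by (rule tau_pos[OF assms(1,2)])
  define E' o' where "E' = deriv (cE \<kappa> 0) 1" and "o' = deriv (omega \<kappa>) 1"
  have dE: "(cE \<kappa> 0 has_field_derivative E') (at 1)" unfolding E'_def
    by (rule holomorphic_derivI[OF cE_holomorphic[OF assms(1,2)]]) auto
  have do: "(omega \<kappa> has_field_derivative o') (at 1)" unfolding o'_def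
    by (rule holomorphic_derivI[OF omega_holomorphic[OF assms(1,2)]]) auto
  define A where "A u = omega \<kappa> u * cE \<kappa> 0 u" for u
  define a' where "a' = o' * cE \<kappa> 0 1 + E' * omega \<kappa> 1"
  have dA: "(A has_field_derivative a') (at 1)" unfolding A_def[abs_def] a'_def by (rule DERIV_mult[OF do dE])
  have om2: "omega \<kappa> u * omega \<kappa> u = Omega \<kappa> u" for u by (simp add: omega_def power2_eq_square[symmetric])
  have t2: "(tau \<kappa>)\<^sup>2 * omega_coeff \<kappa> 0 = 1"
  proof -
    have "omega_coeff \<kappa> 0 = (1 - \<kappa>\<^sup>2) / 2" by (simp add: omega_coeff_def power2_eq_square)
    moreover have "1 - \<kappa>\<^sup>2 > 0" using assms by (simp add: power_less_one_iff)
    ultimately show ?thesis unfolding tau_square[OF assms(1,2)] by simp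
  qed
  define T where "T = complex_of_real ((tau \<kappa>)\<^sup>2)"
  \<comment> \<open>Squaring \<open>tau * sqrt D * omega = 1 + (u - 1) * A\<close>, cancelling the 1
    and dividing by \<open>u - 1\<close> gives \<open>F = 0\<close> off 1, and hence at 1 by
    continuity.\<close>
  define F where "F u = 2 * A u + (u - 1) * (A u)\<^sup>2 - (of_real \<kappa> + T * Omega1 \<kappa> u * (1 + of_real \<kappa> * (u - 1)))" for u
  have F0: "F u = 0" if u: "u \<in> ?B" "u \<noteq> 1" for u
  proof -
    define G where "G u = of_real (tau \<kappa>) * csqrt (Dc \<kappa> u) * omega \<kappa> u" for u
    have G1: "G 1 = 1" using omega_at_1[OF assms(1,2)] by (simp add: G_def Dc_def)
    have "A u = slope G u" using omega_nonzero[OF assms(1,2) u(1)] by (simp add: A_def cE_0 G_def[abs_def])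
    then have "G u = 1 + (u - 1) * A u" using u(2) G1 by (simp add: slope_def)
    moreover have "G u * G u = T * (1 + of_real \<kappa> * (u - 1)) * Omega \<kappa> u"
    proof -
      have "csqrt (Dc \<kappa> u) * csqrt (Dc \<kappa> u) = 1 + of_real \<kappa> * (u - 1)"
        by (simp add: power2_eq_square[symmetric] Dc_def algebra_simps)
      moreover have "G u * G u = T * (csqrt (Dc \<kappa> u) * csqrt (Dc \<kappa> u)) * (omega \<kappa> u * omega \<kappa> u)"
        by (simp add: G_def T_def power2_eq_square)
      ultimately show ?thesis unfolding om2 by simp
    qed
    moreover have "Omega \<kappa> u = of_real (omega_coeff \<kappa> 0) + (u - 1) * Omega1 \<kappa> u"
      by (rule Omega_split[OF assms(1,2)]) (use u(1) in auto)
    moreover have "T * of_real (omega_coeff \<kappa> 0) = 1" unfolding T_def using t2 by (metis of_real_1 of_real_mult)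
    ultimately have "(u - 1) * F u = 0" unfolding F_def by algebra
    then show ?thesis using u(2) by simp
  qed
  define F' where "F' = 2 * a' + (A 1)\<^sup>2 - T * (of_real (omega_coeff \<kappa> 2) + of_real \<kappa> * of_real (omega_coeff \<kappa> 1))"
  have dF: "(F has_field_derivative F') (at 1)"
    unfolding F_def[abs_def]
    by (rule derivative_eq_intros dA Omega1_derivative_at_1[OF assms(1,2)] refl)+
       (simp add: F'_def Omega1_at_1 algebra_simps)
  have ev: "\<forall>\<^sub>F u in at 1. F u = 0"
    using eventually_at_ball'[of "1/4" "1::complex" UNIV] by (auto elim!: eventually_mono intro!: F0)
  have F1: "F 1 = 0"
  proof (rule LIM_unique)
    show "F \<midarrow>1\<rightarrow> F 1" using DERIV_isCont[OF dF] by (simp add: isCont_def)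
    show "F \<midarrow>1\<rightarrow> 0" by (rule tendsto_eventually[OF ev])
  qed
  have F': "F' = 0"
  proof (rule DERIV_unique[OF dF])
    show "(F has_field_derivative 0) (at 1)"
    proof (rule has_field_derivative_transform_within_open[where f="\<lambda>_. 0" and S="?B"])
      show "0 = F x" if "x \<in> ?B" for x using F0[OF that] F1 by (cases "x = 1") auto
      show "((\<lambda>_. 0) has_field_derivative 0) (at (1::complex))" by (rule DERIV_const)
    qed simp_all
  qed
  define a where "a = (\<kappa> + p) / 2"
  have A1: "A 1 = of_real a"
    using F1 by (simp add: F_def T_def Omega1_at_1 a_def p_def field_simps)
  have o1: "omega \<kappa> 1 * of_real (tau \<kappa>) = 1" using omega_at_1[OF assms(1,2)] by (simp add: mult.commute)
  have o'1: "2 * omega \<kappa> 1 * o' = of_real (omega_coeff \<kappa> 1)"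
  proof (rule DERIV_unique[OF _ Omega_derivative_at_1[OF assms(1,2)]])
    have "((\<lambda>u. omega \<kappa> u * omega \<kappa> u) has_field_derivative (o' * omega \<kappa> 1 + o' * omega \<kappa> 1)) (at 1)"
      by (rule DERIV_mult[OF do do])
    then show "(Omega \<kappa> has_field_derivative (2 * omega \<kappa> 1 * o')) (at 1)" unfolding om2 by (simp add: algebra_simps)
  qed
  have "2 * (E' * omega \<kappa> 1) = of_real (q + \<kappa> * p - a\<^sup>2) - of_real (p * a)"
  proof -
    have "2 * a' = of_real (q + \<kappa> * p - a\<^sup>2)"
      using F' unfolding F'_def A1 by (simp add: T_def q_def p_def algebra_simps)
    moreover have "2 * (o' * cE \<kappa> 0 1) = of_real (p * a)"
    proof -
      have "2 * (o' * cE \<kappa> 0 1) = (2 * omega \<kappa> 1 * o') * (of_real (tau \<kappa>) * of_real (tau \<kappa>)) * (omega \<kappa> 1 * cE \<kappa> 0 1)"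
        using o1 by algebra
      also have "\<dots> = of_real (p * a)" unfolding o'1 using A1 by (simp add: A_def p_def power2_eq_square)
      finally show ?thesis .
    qed
    ultimately show ?thesis unfolding a'_def by (simp add: algebra_simps)
  qed
  then have "2 * E' = of_real (tau \<kappa>) * (of_real (q + \<kappa> * p - a\<^sup>2) - of_real (p * a))" using o1 by algebra
  also have "\<dots> = of_real (2 * (tau \<kappa> * ((q + \<kappa> * p - a\<^sup>2) / 2 - p * a / 2)))"
    unfolding of_real_diff[symmetric] of_real_mult[symmetric] by (simp only: of_real_eq_iff) (simp add: field_simps)
  also have "\<dots> = 2 * of_real (tau \<kappa> * ((q + \<kappa> * p - a\<^sup>2) / 2 - p * a / 2))" by simp
  finally have "E' = of_real (tau \<kappa> * ((q + \<kappa> * p - a\<^sup>2) / 2 - p * a / 2))" by (simp only: mult_cancel_left) simp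
  then show ?thesis unfolding E'_def a_def by simp
qed

lemma nutheta_1: "nutheta \<kappa> 1 = theta_coeff 1 \<kappa>"
  by (simp add: nutheta_def)

text \<open>The isolated first term comes from \<open>theta_coeff 1\<close>. In the bracket
  \<open>tau^2\<close> has cancelled the factor that \<open>1 - \<kappa>^3\<close> and
  \<open>1 - \<kappa>^4\<close> share with it.\<close>

lemma nu_1:
  assumes "0 < \<kappa>" "\<kappa> < 1"
  shows "nu \<kappa> 1 = \<kappa> / (1 + \<kappa>) ^ 3 - 2 / (1 - \<kappa>\<^sup>2) * ((1/2 * (1 + \<kappa>\<^sup>2) - \<kappa> * (2/3 * (1 + \<kappa> + \<kappa>\<^sup>2) / (1 + \<kappa>))
     - ((\<kappa> - 2/3 * (1 + \<kappa> + \<kappa>\<^sup>2) / (1 + \<kappa>)) / 2)\<^sup>2) / 2 + (2/3 * (1 + \<kappa> + \<kappa>\<^sup>2) / (1 + \<kappa>)) * ((\<kappa> - 2/3 * (1 + \<kappa> + \<kappa>\<^sup>2) / (1 + \<kappa>)) / 2) / 2)"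
proof -
  have k: "1 - \<kappa> > 0" "1 + \<kappa> > 0" "1 - \<kappa>\<^sup>2 = (1 - \<kappa>) * (1 + \<kappa>)" using assms by (auto simp: power2_eq_square algebra_simps)
  define e where "e = 2/3 * (1 + \<kappa> + \<kappa>\<^sup>2) / (1 + \<kappa>)"
  have p: "(tau \<kappa>)\<^sup>2 * omega_coeff \<kappa> 1 = - e"
  proof -
    have "1 - \<kappa> ^ 3 = (1 - \<kappa>) * (1 + \<kappa> + \<kappa>\<^sup>2)" by (simp add: power3_eq_cube power2_eq_square algebra_simps)
    then have "omega_coeff \<kappa> 1 = - ((1 - \<kappa>) * (1 + \<kappa> + \<kappa>\<^sup>2) / 3)" by (simp add: omega_coeff_def numeral_3_eq_3)
    moreover have "2 / (c * d) * - (c * X / 3) = - (2/3 * X / d)" if "c > 0" "d > 0" for c d X :: real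
      using that by (simp add: field_simps)
    ultimately show ?thesis unfolding tau_square[OF assms] k(3) e_def using k(1,2) by metis
  qed
  have q: "(tau \<kappa>)\<^sup>2 * omega_coeff \<kappa> 2 = 1/2 * (1 + \<kappa>\<^sup>2)"
  proof -
    have "1 - \<kappa> ^ 4 = (1 - \<kappa>) * (1 + \<kappa>) * (1 + \<kappa>\<^sup>2)" by (simp add: power4_eq_xxxx power2_eq_square algebra_simps)
    then have "omega_coeff \<kappa> 2 = (1 - \<kappa>) * (1 + \<kappa>) * (1 + \<kappa>\<^sup>2) / 4" by (simp add: omega_coeff_def)
    moreover have "2 / (c * d) * (c * d * X / 4) = 1/2 * X" if "c > 0" "d > 0" for c d X :: real
      using that by (simp add: field_simps)
    ultimately show ?thesis unfolding tau_square[OF assms] k(3) using k(1,2) by metis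
  qed
  have "nu \<kappa> 1 = - theta_coeff 1 \<kappa> / (1 + \<kappa>) - tau \<kappa> * Re (deriv (cE \<kappa> 0) 1)"
    using nu_Suc[of \<kappa> 0] nutheta_1[of \<kappa>] by simp
  also have "- theta_coeff 1 \<kappa> / (1 + \<kappa>) = \<kappa> / (1 + \<kappa>) ^ 3"
    unfolding theta_coeff_1[OF assms(1)] by (simp add: power3_eq_cube power2_eq_square)
  also have "tau \<kappa> * Re (deriv (cE \<kappa> 0) 1) = (tau \<kappa>)\<^sup>2 * ((1/2 * (1 + \<kappa>\<^sup>2) - \<kappa> * e - ((\<kappa> - e) / 2)\<^sup>2) / 2 + e * ((\<kappa> - e) / 2) / 2)"
    unfolding cE_0_deriv_1[OF assms] p q by (simp add: power2_eq_square)
  finally show ?thesis unfolding tau_square[OF assms] e_def .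
qed

lemma coef_0_off_1:
  assumes "0 < \<kappa>" "\<kappa> < 1" "0 < u" "u \<noteq> 1"
  shows "coef 0 \<kappa> u = tau \<kappa> * sqrt (1 - \<kappa> + \<kappa> * u) / (u - 1) - 1 / Wr \<kappa> u"
proof -
  have "csqrt (Dc \<kappa> (of_real u)) = of_real (sqrt (1 - \<kappa> + \<kappa> * u))"
    unfolding Dc_of_real by (rule csqrt_of_real) (use Dr_pos[OF assms(1-3)] in simp)
  then have "cR \<kappa> 0 (of_real u) = of_real (tau \<kappa> * sqrt (1 - \<kappa> + \<kappa> * u) / (u - 1))" by (simp add: cR_0)
  then show ?thesis using coef_off_1[OF assms(1,2,4), of 0] by (simp only: Re_complex_of_real) simp
qed

text \<open>The derivative of the explicit leading coefficient is compared with the one prescribed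
  by the recursion; uniqueness of derivatives lets the latter be solved for the next
  coefficient.\<close>

lemma coef_1_off_1:
  assumes "0 < \<kappa>" "\<kappa> < 1" "0 < u" "u \<noteq> 1"
  defines "S \<equiv> sqrt (1 - \<kappa> + \<kappa> * u)"
  shows "coef 1 \<kappa> u = (vr \<kappa> u * (tau \<kappa> * (\<kappa> / (2 * S * (u - 1)) - S / (u - 1)\<^sup>2)) + rsrc \<kappa> (nu \<kappa> 1) (nutheta \<kappa> 1) u) / (u - 1) + 1 / Wr \<kappa> u ^ 3"
proof -
  have D: "1 - \<kappa> + \<kappa> * u > 0" by (rule Dr_pos[OF assms(1-3)])
  have S: "S > 0" using D by (simp add: S_def)
  have W: "Wr \<kappa> u \<noteq> 0" by (rule Wr_nonzero[OF assms(1-4)])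
  have v: "vr \<kappa> u > 0" by (rule vr_pos[OF assms(1-3)])
  let ?R = "tau \<kappa> * (\<kappa> / (2 * S * (u - 1)) - S / (u - 1)\<^sup>2)"
  have dS: "((\<lambda>u. sqrt (1 - \<kappa> + \<kappa> * u)) has_real_derivative \<kappa> / (2 * S)) (at u)"
    using D by (auto intro!: derivative_eq_intros simp: S_def field_simps)
  have d1: "((\<lambda>u. u - 1) has_real_derivative 1) (at u)" by (auto intro!: derivative_eq_intros)
  have "((\<lambda>u. tau \<kappa> * sqrt (1 - \<kappa> + \<kappa> * u) / (u - 1) - 1 / Wr \<kappa> u) has_real_derivative
     (tau \<kappa> * (\<kappa> / (2 * S)) * (u - 1) - tau \<kappa> * sqrt (1 - \<kappa> + \<kappa> * u) * 1) / ((u - 1) * (u - 1))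
     - (0 * Wr \<kappa> u - 1 * wd \<kappa> u) / (Wr \<kappa> u * Wr \<kappa> u)) (at u)"
    by (intro DERIV_diff DERIV_divide DERIV_cmult dS d1 DERIV_const Wr_has_derivative assms(1-3)) (use W assms(4) in auto)
  moreover have "(tau \<kappa> * (\<kappa> / (2 * S)) * (u - 1) - tau \<kappa> * sqrt (1 - \<kappa> + \<kappa> * u) * 1) / ((u - 1) * (u - 1))
     - (0 * Wr \<kappa> u - 1 * wd \<kappa> u) / (Wr \<kappa> u * Wr \<kappa> u) = ?R + wd \<kappa> u / (Wr \<kappa> u)\<^sup>2"
  proof -
    have "(t * (\<kappa> / (2 * S)) * e - t * S * 1) / (e * e) = t * (\<kappa> / (2 * S * e) - S / e\<^sup>2)" if "e \<noteq> 0" for t e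
      using that S by (simp add: field_simps power2_eq_square)
    then show ?thesis unfolding S_def[symmetric] using assms(4) by (simp add: power2_eq_square)
  qed
  ultimately have "((\<lambda>u. tau \<kappa> * sqrt (1 - \<kappa> + \<kappa> * u) / (u - 1) - 1 / Wr \<kappa> u) has_real_derivative ?R + wd \<kappa> u / (Wr \<kappa> u)\<^sup>2) (at u)"
    by simp
  then have "(coef 0 \<kappa> has_real_derivative ?R + wd \<kappa> u / (Wr \<kappa> u)\<^sup>2) (at u)"
    by (rule has_field_derivative_transform_within_open[where S="{0<..} - {1}"]) (use assms coef_0_off_1 in auto)
  from DERIV_unique[OF this coef_has_derivative[OF assms(1-3), of 0]]
  have "?R + wd \<kappa> u / (Wr \<kappa> u)\<^sup>2 = ((u - 1) * coef 1 \<kappa> u - rsrc \<kappa> (nu \<kappa> 1) (nutheta \<kappa> 1) u) / vr \<kappa> u" by simp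
  then have "(u - 1) * coef 1 \<kappa> u = vr \<kappa> u * ?R + rsrc \<kappa> (nu \<kappa> 1) (nutheta \<kappa> 1) u + vr \<kappa> u * (wd \<kappa> u / (Wr \<kappa> u)\<^sup>2)"
    using v by (simp add: field_simps)
  moreover have "vr \<kappa> u * (wd \<kappa> u / (Wr \<kappa> u)\<^sup>2) = (u - 1) * (1 / Wr \<kappa> u ^ 3)"
  proof -
    have "vr \<kappa> u * wd \<kappa> u = (u - 1) / Wr \<kappa> u" using Wr_mult_wd[OF assms(1-3)] W v by (simp add: field_simps)
    then show ?thesis using W by (simp add: power2_eq_square power3_eq_cube field_simps)
  qed
  ultimately have "(u - 1) * coef 1 \<kappa> u = (u - 1) * ((vr \<kappa> u * ?R + rsrc \<kappa> (nu \<kappa> 1) (nutheta \<kappa> 1) u) / (u - 1) + 1 / Wr \<kappa> u ^ 3)"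
    using assms(4) unfolding distrib_left[of "u - 1"] by simp
  moreover have "u - 1 \<noteq> 0" using assms(4) by simp
  ultimately show ?thesis by (metis mult_left_cancel)
qed

text \<open>The bracket with coefficients \<open>a0\<close> to \<open>a5\<close> in the formula for
  the second coefficient.\<close>

definition c1_poly :: "real \<Rightarrow> real \<Rightarrow> real" where
  "c1_poly \<rho> t = - \<rho>\<^sup>2 + 2 * \<rho> * (7 + 3 * \<rho>) * t + (- 3 * \<rho>\<^sup>2 - 84 * \<rho> + 11) * t ^ 2 + (186 * \<rho> - 66) * t ^ 3
     + (- 216 * \<rho> + 129) * t ^ 4 + (96 * \<rho> - 72) * t ^ 5"

text \<open>With the denominators \<open>1 - \<kappa>\<close>, \<open>1 + \<kappa>\<close> and
  \<open>1 + \<kappa> * u\<close> cleared, the claim is a polynomial identity in \<kappa> and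
  \<open>u\<close>. The sixth power of \<open>1 - \<kappa>\<close> clears the total degree 6 of
  \<open>c1_poly\<close>.\<close>

lemma c1_identity:
  assumes "0 < \<kappa>" "\<kappa> < 1" "0 < u"
  shows "(u - 1)\<^sup>2 * (nu \<kappa> 1 + - \<kappa> / (1 + \<kappa>)\<^sup>2 / (1 + \<kappa> * u)) - u * (2 + \<kappa> * (u - 1)) / ((1 - \<kappa>) * (1 + \<kappa> * u))
    = - (2 / (1 - \<kappa>\<^sup>2)) * c1_poly ((1 - \<kappa> + \<kappa> * u) / (1 - \<kappa>)) (1 / (1 - \<kappa>)) / (24 * (\<kappa>\<^sup>2 * (1 + \<kappa>)\<^sup>2 / (1 - \<kappa>) ^ 6))"
proof -
  have nz: "1 + \<kappa> * u \<noteq> 0" "1 - \<kappa> \<noteq> 0" "1 + \<kappa> \<noteq> 0" "\<kappa> \<noteq> 0" "1 - \<kappa>\<^sup>2 = (1 - \<kappa>) * (1 + \<kappa>)"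
    using assms by (auto simp: power2_eq_square algebra_simps add_pos_pos[THEN less_imp_neq, symmetric])
  define c d g where "c = 1 - \<kappa>" and "d = 1 + \<kappa>" and "g = 1 + \<kappa> * u"
  have P: "c ^ 6 * c1_poly ((1 - \<kappa> + \<kappa> * u) / c) (1 / c) = - (1 - \<kappa> + \<kappa> * u)\<^sup>2 * c ^ 4 + 2 * (1 - \<kappa> + \<kappa> * u) * (7 * c + 3 * (1 - \<kappa> + \<kappa> * u)) * c ^ 3
     + (- 3 * (1 - \<kappa> + \<kappa> * u)\<^sup>2 - 84 * (1 - \<kappa> + \<kappa> * u) * c + 11 * c\<^sup>2) * c\<^sup>2 + (186 * (1 - \<kappa> + \<kappa> * u) - 66 * c) * c\<^sup>2
     + (- 216 * (1 - \<kappa> + \<kappa> * u) + 129 * c) * c + (96 * (1 - \<kappa> + \<kappa> * u) - 72 * c)"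
    using nz(2) unfolding c1_poly_def c_def[symmetric] by (simp add: field_simps power_divide eval_nat_numeral)
  define E N where "E = 2 * (1 + \<kappa> + \<kappa>\<^sup>2)" and "N = 18 * d\<^sup>2 * (1 + \<kappa>\<^sup>2) - 12 * d * \<kappa> * E - (3 * d * \<kappa> - E)\<^sup>2 + 2 * E * (3 * d * \<kappa> - E)"
  have nz': "c \<noteq> 0" "d \<noteq> 0" "g \<noteq> 0" using nz by (auto simp: c_def d_def g_def)
  have e: "2/3 * (1 + \<kappa> + \<kappa>\<^sup>2) / (1 + \<kappa>) = E / (3 * d)" using nz by (simp add: E_def d_def field_simps)
  have nu: "nu \<kappa> 1 = (36 * \<kappa> * c - N) / (36 * c * d ^ 3)"
    unfolding nu_1[OF assms(1,2)] e nz(5) unfolding c_def[symmetric] d_def[symmetric] N_def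
    using nz'(1,2) by (simp add: field_simps power2_eq_square power3_eq_cube)
  define Pv where "Pv = c ^ 6 * c1_poly ((1 - \<kappa> + \<kappa> * u) / c) (1 / c)"
  \<comment> \<open>The factor \<open>g\<close> on the right shows that the apparent pole at
    \<open>1 + \<kappa> * u = 0\<close> cancels.\<close>
  have key: "\<kappa>\<^sup>2 * ((u - 1)\<^sup>2 * ((36 * \<kappa> * c - N) * g - 36 * \<kappa> * c * d) - 36 * d ^ 3 * (u * (2 + \<kappa> * (u - 1)))) = - 3 * g * Pv"
    unfolding Pv_def P unfolding N_def E_def c_def d_def g_def by algebra
  have "(u - 1)\<^sup>2 * (nu \<kappa> 1 + - \<kappa> / d\<^sup>2 / g) - u * (2 + \<kappa> * (u - 1)) / (c * g)
     = ((u - 1)\<^sup>2 * ((36 * \<kappa> * c - N) * g - 36 * \<kappa> * c * d) - 36 * d ^ 3 * (u * (2 + \<kappa> * (u - 1)))) / (36 * c * d ^ 3 * g)"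
    unfolding nu using nz' by (simp add: field_simps power2_eq_square power3_eq_cube)
  also have "\<dots> = (- 3 * g * Pv / \<kappa>\<^sup>2) / (36 * c * d ^ 3 * g)"
    unfolding key[symmetric] using nz(4) by simp
  also have "\<dots> = - (2 / (c * d)) * (Pv / c ^ 6) / (24 * (\<kappa>\<^sup>2 * d\<^sup>2 / c ^ 6))"
    using nz' nz(4) by (simp add: field_simps power2_eq_square power3_eq_cube)
  also have "Pv / c ^ 6 = c1_poly ((1 - \<kappa> + \<kappa> * u) / c) (1 / c)" using nz'(1) by (simp add: Pv_def)
  finally show ?thesis unfolding nz(5) c_def d_def g_def .
qed
text \<open>Both contributions to the numerator share the factor \<open>tau * S / (u - 1)^2\<close>;
  the bracket that remains is \<open>c1_identity\<close>, and \<open>t0 - 1\<close>,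
  \<open>2 * t0 - 1\<close> and \<open>\<rho> - t0\<close> are rational in \<kappa> and
  \<open>u\<close>.\<close>

lemma coef_1_formula:
  assumes "0 < \<kappa>" "\<kappa> < 1" "0 < u" "u \<noteq> 1"
  defines "t0 \<equiv> 1 / (1 - \<kappa>)" and "\<rho> \<equiv> (1 - \<kappa> + \<kappa> * u) / (1 - \<kappa>)"
  shows "coef 1 \<kappa> u = - (sqrt (1 - \<kappa> + \<kappa> * u) * ((tau \<kappa> * (t0 - 1)) ^ 3 * c1_poly \<rho> t0 /
     (24 * t0\<^sup>2 * (t0 - 1)\<^sup>2 * (2 * t0 - 1)\<^sup>2 * (\<rho> - t0) ^ 3)) - 1 / Wr \<kappa> u ^ 3)"
proof -
  define S D e where "S = sqrt (1 - \<kappa> + \<kappa> * u)" and "D = 1 - \<kappa> + \<kappa> * u" and "e = u - 1"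
  have D: "D > 0" unfolding D_def by (rule Dr_pos[OF assms(1-3)])
  have S: "S > 0" "S * S = D" using D by (auto simp: S_def D_def)
  have e: "e \<noteq> 0" using assms(4) by (simp add: e_def)
  define c d g where "c = 1 - \<kappa>" and "d = 1 + \<kappa>" and "g = 1 + \<kappa> * u"
  have nz: "c > 0" "d > 0" "g > 0" using assms(1-3) by (auto simp: c_def d_def g_def add_pos_pos)
  have v: "vr \<kappa> u = 2 * u * D / (c * g)" unfolding vr_def D_def c_def g_def ..
  have th: "nutheta \<kappa> 1 = - \<kappa> / d\<^sup>2" unfolding nutheta_1 theta_coeff_1[OF assms(1)] d_def ..
  have r: "rsrc \<kappa> (nu \<kappa> 1) (nutheta \<kappa> 1) u = tau \<kappa> * S * (nu \<kappa> 1 + - \<kappa> / d\<^sup>2 / g)"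
    unfolding rsrc_def th S_def g_def ..
  define X where "X = e\<^sup>2 * (nu \<kappa> 1 + - \<kappa> / d\<^sup>2 / g) - u * (2 + \<kappa> * e) / (c * g)"
  have X: "X = - (tau \<kappa>)\<^sup>2 * c1_poly \<rho> t0 / (24 * (\<kappa>\<^sup>2 * d\<^sup>2 / c ^ 6))"
    unfolding X_def e_def d_def g_def c_def c1_identity[OF assms(1-3)] tau_square[OF assms(1,2)] t0_def \<rho>_def ..
  have "(vr \<kappa> u * (tau \<kappa> * (\<kappa> / (2 * S * e) - S / e\<^sup>2)) + rsrc \<kappa> (nu \<kappa> 1) (nutheta \<kappa> 1) u) / e = tau \<kappa> * S * X / e ^ 3"
  proof -
    have "\<kappa> / (2 * S * e) - S / e\<^sup>2 = S * ((\<kappa> * e / 2 - D) / (D * e\<^sup>2))"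
      using S(1) e unfolding S(2)[symmetric] by (simp add: field_simps power2_eq_square)
    moreover have "\<kappa> * e / 2 - D = - (2 + \<kappa> * e) / 2" by (simp add: D_def e_def field_simps)
    ultimately have q: "\<kappa> / (2 * S * e) - S / e\<^sup>2 = S * (- (2 + \<kappa> * e) / 2 / (D * e\<^sup>2))" by simp
    have "vr \<kappa> u * (tau \<kappa> * (\<kappa> / (2 * S * e) - S / e\<^sup>2)) = tau \<kappa> * S * (- (u * (2 + \<kappa> * e) / (c * g)) / e\<^sup>2)"
      unfolding v q using D e nz by (simp add: field_simps)
    then have "vr \<kappa> u * (tau \<kappa> * (\<kappa> / (2 * S * e) - S / e\<^sup>2)) + rsrc \<kappa> (nu \<kappa> 1) (nutheta \<kappa> 1) u
      = tau \<kappa> * S * (- (u * (2 + \<kappa> * e) / (c * g)) / e\<^sup>2 + (nu \<kappa> 1 + - \<kappa> / d\<^sup>2 / g))"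
      unfolding r by (simp only: distrib_left)
    also have "- (u * (2 + \<kappa> * e) / (c * g)) / e\<^sup>2 + (nu \<kappa> 1 + - \<kappa> / d\<^sup>2 / g) = X / e\<^sup>2"
      unfolding X_def diff_divide_distrib using e by simp
    finally show ?thesis using e by (simp add: power2_eq_square power3_eq_cube)
  qed
  also have "tau \<kappa> * S * X / e ^ 3 = - (S * ((tau \<kappa> * (t0 - 1)) ^ 3 * c1_poly \<rho> t0 /
     (24 * t0\<^sup>2 * (t0 - 1)\<^sup>2 * (2 * t0 - 1)\<^sup>2 * (\<rho> - t0) ^ 3)))"
  proof -
    have t: "t0 = 1 / c" "t0 - 1 = \<kappa> / c" "2 * t0 - 1 = d / c"
      using nz(1) unfolding t0_def c_def d_def by (simp_all add: field_simps)
    have "\<rho> - t0 = (\<kappa> * u - \<kappa>) / c" unfolding t0_def \<rho>_def c_def by (simp add: diff_divide_distrib[symmetric])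
    also have "\<dots> = \<kappa> / c * e" by (simp add: e_def right_diff_distrib diff_divide_distrib)
    finally have t4: "\<rho> - t0 = \<kappa> / c * e" .
    have "t * S * (- t\<^sup>2 * P / (24 * (\<kappa>\<^sup>2 * d\<^sup>2 / c ^ 6))) / e ^ 3
      = - (S * ((t * (\<kappa> / c)) ^ 3 * P / (24 * (1 / c)\<^sup>2 * (\<kappa> / c)\<^sup>2 * (d / c)\<^sup>2 * (\<kappa> / c * e) ^ 3)))" for t P
      using nz e assms(1) by (simp add: field_simps eval_nat_numeral)
    then show ?thesis unfolding X t(2,3) t4 unfolding t(1) .
  qed
  finally have "(vr \<kappa> u * (tau \<kappa> * (\<kappa> / (2 * S * (u - 1)) - S / (u - 1)\<^sup>2)) + rsrc \<kappa> (nu \<kappa> 1) (nutheta \<kappa> 1) u) / (u - 1)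
    = - (S * ((tau \<kappa> * (t0 - 1)) ^ 3 * c1_poly \<rho> t0 / (24 * t0\<^sup>2 * (t0 - 1)\<^sup>2 * (2 * t0 - 1)\<^sup>2 * (\<rho> - t0) ^ 3)))"
    unfolding e_def .
  then show ?thesis
    using coef_1_off_1[OF assms(1-4)] unfolding S_def[symmetric] by linarith
qed

section \<open>Passage to the original parameters\<close>

lemma saddle_root:
  assumes "z > 0"
  shows "1 < saddle z" "z * (saddle z)\<^sup>2 - z * saddle z - 1 = 0"
proof -
  define r where "r = sqrt (z * (z + 4))"
  have r: "r * r = z * (z + 4)" using assms by (simp add: r_def)
  have "z < r" unfolding r_def using assms by (intro real_less_rsqrt) (simp add: power2_eq_square)
  then show "1 < saddle z" using assms by (simp add: saddle_def r_def[symmetric])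
  have "saddle z = (z + r) / (2 * z)" by (simp add: saddle_def r_def)
  then have s: "2 * z * saddle z = z + r" using assms by simp
  have "4 * z * (z * (saddle z)\<^sup>2 - z * saddle z - 1) = (2 * z * saddle z)\<^sup>2 - 2 * z * (2 * z * saddle z) - 4 * z"
    by (simp add: power2_eq_square algebra_simps)
  also have "\<dots> = 0" unfolding s using r by (simp add: power2_eq_square algebra_simps)
  finally show "z * (saddle z)\<^sup>2 - z * saddle z - 1 = 0" using assms by simp
qed

text \<open>The two roots of the quadratic add up to 1, so the other one is negative.\<close>

lemma saddle_unique:
  assumes "z > 0" "t > 0" shows "z * t\<^sup>2 - z * t - 1 = 0 \<longleftrightarrow> t = saddle z"
proof
  assume h: "z * t\<^sup>2 - z * t - 1 = 0"
  have "z * ((t - saddle z) * (t + saddle z - 1)) = (z * t\<^sup>2 - z * t - 1) - (z * (saddle z)\<^sup>2 - z * saddle z - 1)"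
    by (simp add: power2_eq_square algebra_simps)
  then have "(t - saddle z) * (t + saddle z - 1) = 0" using h saddle_root(2)[OF assms(1)] assms by simp
  moreover have "t + saddle z - 1 \<noteq> 0" using saddle_root(1)[OF assms(1)] assms by simp
  ultimately show "t = saddle z" by simp
qed (use saddle_root[OF assms(1)] in simp)

text \<open>The saddle point solves \<open>z * t * (t - 1) = 1\<close>, and
  \<open>t * (t - 1)\<close> increases for \<open>t > 1\<close>.\<close>

lemma saddle_antimono:
  assumes "0 < z0" "z0 \<le> z" shows "saddle z \<le> saddle z0"
proof (rule ccontr)
  assume "\<not> ?thesis"
  then have l: "saddle z0 < saddle z" by simp
  have s: "1 < saddle z0" "z0 * (saddle z0 * (saddle z0 - 1)) = 1" "z * (saddle z * (saddle z - 1)) = 1"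
    using saddle_root[of z0] saddle_root[of z] assms by (simp_all add: power2_eq_square algebra_simps)
  have "saddle z0 * (saddle z0 - 1) < saddle z * (saddle z - 1)"
    using l s(1) by (intro mult_strict_mono) auto
  then have "z0 * (saddle z0 * (saddle z0 - 1)) < z0 * (saddle z * (saddle z - 1))" using assms by simp
  also have "\<dots> \<le> z * (saddle z * (saddle z - 1))" using assms l s(1) by (intro mult_right_mono) auto
  finally show False using s by simp
qed

lemma phase_has_derivative:
  assumes "t > 1" shows "(phase z has_real_derivative (z * t\<^sup>2 - z * t - 1) / (t * (t - 1))) (at t)"
proof -
  have "(phase z has_real_derivative z + 1 / t - 1 / (t - 1)) (at t)"
    unfolding phase_def[abs_def] using assms by (auto intro!: derivative_eq_intros simp: divide_inverse)
  moreover have "z + 1 / t - 1 / (t - 1) = (z * t\<^sup>2 - z * t - 1) / (t * (t - 1))"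
    using assms by (simp add: field_simps power2_eq_square)
  ultimately show ?thesis by simp
qed

definition kappa_of :: "real \<Rightarrow> real" where "kappa_of z = 1 - 1 / saddle z"
definition ratio_par :: "real \<Rightarrow> real \<Rightarrow> real" where "ratio_par \<xi> \<sigma> = (1 / y_par \<xi> - 1) / (saddle (z_par \<xi> \<sigma>) - 1)"

lemma kappa_of_bounds: assumes "z > 0" shows "0 < kappa_of z" "kappa_of z < 1"
  using saddle_root(1)[OF assms] by (simp_all add: kappa_of_def)

text \<open>The source of uniformity: a positive lower bound on z confines \<kappa> to an interval
  bounded away from 1.\<close>

lemma kappa_of_antimono: "0 < z0 \<Longrightarrow> z0 \<le> z \<Longrightarrow> kappa_of z \<le> kappa_of z0"
  using saddle_antimono[of z0 z] saddle_root(1)[of z0] saddle_root(1)[of z] by (simp add: kappa_of_def frac_le)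

lemma kappa_of_saddle:
  assumes "z > 0"
  shows "saddle z = 1 / (1 - kappa_of z)" "saddle z - 1 = kappa_of z / (1 - kappa_of z)" "z = (1 - kappa_of z)\<^sup>2 / kappa_of z"
proof -
  have s: "saddle z > 1" "z * (saddle z * (saddle z - 1)) = 1"
    using saddle_root[OF assms] by (simp_all add: power2_eq_square algebra_simps)
  show 1: "saddle z = 1 / (1 - kappa_of z)" "saddle z - 1 = kappa_of z / (1 - kappa_of z)" using s(1) by (simp_all add: kappa_of_def field_simps)
  have k: "0 < kappa_of z" "kappa_of z < 1" by (rule kappa_of_bounds[OF assms])+
  show "z = (1 - kappa_of z)\<^sup>2 / kappa_of z" using s(2) k unfolding 1(2) unfolding 1(1) by (simp add: field_simps power2_eq_square)
qed

lemma y_par_bounds: assumes "\<xi> > 0" shows "0 < y_par \<xi>" "y_par \<xi> < 1"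
  using assms by (simp_all add: y_par_def add_pos_pos)

lemma z_par_pos: "0 < \<xi> \<Longrightarrow> \<sigma> \<noteq> 0 \<Longrightarrow> 0 < z_par \<xi> \<sigma>"
  using y_par_bounds[of \<xi>] by (simp add: z_par_def)

text \<open>The dictionary between the original parameters and (\<kappa>, u). The phase difference
  splits into a linear term, where z times \<open>\<kappa> / (1 - \<kappa>)\<close> is
  \<open>1 - \<kappa>\<close>, and the logarithms of \<open>\<rho> / t0\<close> and of
  \<open>u\<close>.\<close>

lemma ratio_par_relations:
  assumes "0 < \<xi>" "\<sigma> \<noteq> 0"
  defines "\<kappa> \<equiv> kappa_of (z_par \<xi> \<sigma>)" and "u \<equiv> ratio_par \<xi> \<sigma>"
  shows "0 < u" "1 / y_par \<xi> = (1 - \<kappa> + \<kappa> * u) / (1 - \<kappa>)"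
    "1 / y_par \<xi> - saddle (z_par \<xi> \<sigma>) = \<kappa> / (1 - \<kappa>) * (u - 1)"
    "phase (z_par \<xi> \<sigma>) (1 / y_par \<xi>) - phase (z_par \<xi> \<sigma>) (saddle (z_par \<xi> \<sigma>)) = Psi \<kappa> u"
    "eta \<xi> \<sigma> = Wr \<kappa> u"
proof -
  define z \<rho> where "z = z_par \<xi> \<sigma>" and "\<rho> = 1 / y_par \<xi>"
  have z: "z > 0" unfolding z_def by (rule z_par_pos[OF assms(1,2)])
  have r: "\<rho> > 1" using y_par_bounds[OF assms(1)] by (simp add: \<rho>_def)
  have s: "saddle z > 1" by (rule saddle_root[OF z])
  have k: "0 < \<kappa>" "\<kappa> < 1" using kappa_of_bounds[OF z] by (simp_all add: \<kappa>_def z_def)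
  have ks: "saddle z = 1 / (1 - \<kappa>)" "saddle z - 1 = \<kappa> / (1 - \<kappa>)" "z = (1 - \<kappa>)\<^sup>2 / \<kappa>"
    using kappa_of_saddle[OF z] by (simp_all add: \<kappa>_def z_def)
  have u: "u = (\<rho> - 1) / (saddle z - 1)" by (simp add: u_def ratio_par_def \<rho>_def z_def)
  show u0: "0 < u" unfolding u using r s by simp
  have r1: "\<rho> - 1 = \<kappa> / (1 - \<kappa>) * u" unfolding ks(2)[symmetric] u using s by simp
  then have r2: "\<rho> = (1 - \<kappa> + \<kappa> * u) / (1 - \<kappa>)" using k by (simp add: field_simps)
  then show "1 / y_par \<xi> = (1 - \<kappa> + \<kappa> * u) / (1 - \<kappa>)" by (simp add: \<rho>_def)
  have r3: "\<rho> - saddle z = \<kappa> / (1 - \<kappa>) * (u - 1)"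
  proof -
    have "\<rho> - saddle z = \<kappa> / (1 - \<kappa>) * u - \<kappa> / (1 - \<kappa>)" using r1 ks(2) by linarith
    then show ?thesis by (simp only: right_diff_distrib mult_1_right)
  qed
  then show "1 / y_par \<xi> - saddle (z_par \<xi> \<sigma>) = \<kappa> / (1 - \<kappa>) * (u - 1)" by (simp add: \<rho>_def z_def)
  have D: "0 < 1 - \<kappa> + \<kappa> * u" by (rule Dr_pos[OF k u0])
  have ph: "phase z \<rho> - phase z (saddle z) = Psi \<kappa> u"
  proof -
    have "phase z \<rho> - phase z (saddle z) = z * (\<rho> - saddle z) + (ln \<rho> - ln (saddle z)) - (ln (\<rho> - 1) - ln (saddle z - 1))"
      by (simp add: phase_def algebra_simps)
    also have "z * (\<rho> - saddle z) = (1 - \<kappa>) * (u - 1)"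
    proof -
      have "z * (\<kappa> / (1 - \<kappa>) * (u - 1)) = (1 - \<kappa>)\<^sup>2 / \<kappa> * (\<kappa> / (1 - \<kappa>) * (u - 1))" by (simp only: ks(3)[symmetric])
      also have "\<dots> = (1 - \<kappa>) * (u - 1)" using k by (simp add: power2_eq_square)
      finally show ?thesis unfolding r3 .
    qed
    also have "ln \<rho> - ln (saddle z) = ln (1 - \<kappa> + \<kappa> * u)" unfolding r2 ks(1) using k D by (simp add: ln_div)
    also have "ln (\<rho> - 1) - ln (saddle z - 1) = ln u"
      unfolding r1 ks(2) using ln_mult_pos[of "\<kappa> / (1 - \<kappa>)" u] k u0 by (simp del: times_divide_eq_left)
    finally show ?thesis by (simp add: Psi_def)
  qed
  then show "phase (z_par \<xi> \<sigma>) (1 / y_par \<xi>) - phase (z_par \<xi> \<sigma>) (saddle (z_par \<xi> \<sigma>)) = Psi \<kappa> u" by (simp add: \<rho>_def z_def)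
  have "sgn (\<rho> - saddle z) = sgn (u - 1)" unfolding r3 using k by (simp add: sgn_mult)
  then show "eta \<xi> \<sigma> = Wr \<kappa> u" using ph by (simp add: eta_def Let_def Wr_def \<rho>_def z_def)
qed

lemma eta_properties:
  assumes "0 < \<xi>" "\<sigma> \<noteq> 0"
  shows "phase (z_par \<xi> \<sigma>) (1 / y_par \<xi>) - phase (z_par \<xi> \<sigma>) (saddle (z_par \<xi> \<sigma>)) = (eta \<xi> \<sigma>)\<^sup>2"
    "sgn (eta \<xi> \<sigma>) = sgn (1 / y_par \<xi> - saddle (z_par \<xi> \<sigma>))"
proof -
  define \<kappa> u where "\<kappa> = kappa_of (z_par \<xi> \<sigma>)" and "u = ratio_par \<xi> \<sigma>"
  have k: "0 < \<kappa>" "\<kappa> < 1" using kappa_of_bounds[OF z_par_pos[OF assms]] by (simp_all add: \<kappa>_def)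
  note r = ratio_par_relations[OF assms, folded \<kappa>_def u_def]
  show "phase (z_par \<xi> \<sigma>) (1 / y_par \<xi>) - phase (z_par \<xi> \<sigma>) (saddle (z_par \<xi> \<sigma>)) = (eta \<xi> \<sigma>)\<^sup>2"
    unfolding r(4,5) by (rule Wr_square[OF k r(1), symmetric])
  have "sgn (Wr \<kappa> u) = sgn (u - 1)"
    using Psi_pos[OF k r(1)] by (cases "u = 1") (auto simp: Wr_def sgn_mult)
  then show "sgn (eta \<xi> \<sigma>) = sgn (1 / y_par \<xi> - saddle (z_par \<xi> \<sigma>))"
    unfolding r(3,5) using k by (simp add: sgn_mult)
qed

definition nct_coeff :: "nat \<Rightarrow> real \<Rightarrow> real \<Rightarrow> real" where
  "nct_coeff k \<xi> \<sigma> = coef k (kappa_of (z_par \<xi> \<sigma>)) (ratio_par \<xi> \<sigma>)"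

lemma nct_P_eq_scaled_prob:
  assumes "n > 0" "0 < \<xi>" "\<sigma> \<noteq> 0"
  shows "nct_P n (\<xi> * sqrt n) (\<sigma> * sqrt n) = scaled_prob n (kappa_of (z_par \<xi> \<sigma>)) (ratio_par \<xi> \<sigma>)"
proof -
  define \<kappa> u where "\<kappa> = kappa_of (z_par \<xi> \<sigma>)" and "u = ratio_par \<xi> \<sigma>"
  note r = ratio_par_relations[OF assms(2,3), folded \<kappa>_def u_def]
  have y: "(\<xi> * sqrt n)\<^sup>2 / (n + (\<xi> * sqrt n)\<^sup>2) = y_par \<xi>"
  proof -
    have "(\<xi> * sqrt n)\<^sup>2 = n * \<xi>\<^sup>2" "n + n * \<xi>\<^sup>2 = n * (1 + \<xi>\<^sup>2)" using assms by (simp_all add: power_mult_distrib algebra_simps)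
    then show ?thesis using assms by (simp add: y_par_def)
  qed
  have "z_par \<xi> \<sigma> = (1 - \<kappa>)\<^sup>2 / \<kappa>" using kappa_of_saddle(3)[OF z_par_pos[OF assms(2,3)]] by (simp add: \<kappa>_def)
  then have m: "n * (1 - \<kappa>)\<^sup>2 / (2 * \<kappa>) = n / 2 * z_par \<xi> \<sigma>" by simp
  have mr: "n / 2 * z_par \<xi> \<sigma> * (1 / y_par \<xi>) = n * \<sigma>\<^sup>2 / 2" using y_par_bounds[OF assms(2)] by (simp add: z_par_def)
  have s: "(\<sigma> * sqrt n)\<^sup>2 = n * \<sigma>\<^sup>2" using assms by (simp add: power_mult_distrib)
  show ?thesis
    unfolding nct_P_poisson_ibeta y s scaled_prob_def \<kappa>_def[symmetric] u_def[symmetric] r(2)[symmetric] m ray_prob_def mr by simp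
qed

text \<open>The condition \<open>z0 \<le> z\<close> becomes
  \<open>\<kappa> \<le> kappa_of z0 < 1\<close>, and the expansion in (\<kappa>, u) applies with
  \<kappa>1 taken as \<open>kappa_of z0\<close>.\<close>

lemma nct_P_expansion:
  assumes "z0 > 0"
  obtains C M where "M \<ge> 1" "\<And>n \<xi> \<sigma>. n \<ge> M \<Longrightarrow> 0 < \<xi> \<Longrightarrow> z0 \<le> z_par \<xi> \<sigma> \<Longrightarrow>
    \<bar>nct_P n (\<xi> * sqrt n) (\<sigma> * sqrt n) - (1 / 4 * erfc (eta \<xi> \<sigma> * sqrt (n / 2))
       + 1 / 2 * (exp (- (n / 2) * (eta \<xi> \<sigma>)\<^sup>2) / sqrt (2 * pi * n)) * (\<Sum>k<K. nct_coeff k \<xi> \<sigma> / n ^ k))\<bar>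
     \<le> C * (exp (- (n / 2) * (eta \<xi> \<sigma>)\<^sup>2) / sqrt (2 * pi * n)) / n ^ K"
proof (rule scaled_prob_expansion[OF kappa_of_bounds[OF assms], of K], goal_cases)
  case (1 C M)
  show ?case
  proof (rule 1(1)[of M C, OF 1(2)], goal_cases)
    case h: (1 n \<xi> \<sigma>)
    have s: "\<sigma> \<noteq> 0" using h(3) assms by (auto simp: z_par_def)
    define \<kappa> u where "\<kappa> = kappa_of (z_par \<xi> \<sigma>)" and "u = ratio_par \<xi> \<sigma>"
    note r = ratio_par_relations[OF h(2) s, folded \<kappa>_def u_def]
    have k: "0 < \<kappa>" "\<kappa> < 1" using kappa_of_bounds[OF z_par_pos[OF h(2) s]] by (simp_all add: \<kappa>_def)
    have k1: "\<kappa> \<le> kappa_of z0" unfolding \<kappa>_def by (rule kappa_of_antimono[OF assms h(3)])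
    have n: "n > 0" using h(1) 1(2) by simp
    have e: "exp (- (n / 2) * (eta \<xi> \<sigma>)\<^sup>2) = vexp n \<kappa> u" unfolding r(5) Wr_square[OF k r(1)] vexp_def ..
    show ?case
      using 1(3)[OF h(1) k(1) k1 r(1)]
      unfolding e unfolding nct_P_eq_scaled_prob[OF n h(2) s] r(5) nct_coeff_def \<kappa>_def[symmetric] u_def[symmetric] ansatz_def .
  qed
qed

section \<open>Continuity in the parameters\<close>

text \<open>The sign can jump only where the other factor vanishes, and the product is dominated by
  that factor.\<close>

lemma continuous_on_sgn_mult:
  fixes a b :: "'a::topological_space \<Rightarrow> real"
  assumes "continuous_on S a" "continuous_on S b" "\<And>p. p \<in> S \<Longrightarrow> a p = 0 \<Longrightarrow> b p = 0"
  shows "continuous_on S (\<lambda>p. sgn (a p) * b p)"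
  unfolding continuous_on_def
proof
  fix p assume p: "p \<in> S"
  have a: "(a \<longlongrightarrow> a p) (at p within S)" and b: "(b \<longlongrightarrow> b p) (at p within S)"
    using assms(1,2) p by (auto simp: continuous_on_def)
  show "((\<lambda>p. sgn (a p) * b p) \<longlongrightarrow> sgn (a p) * b p) (at p within S)"
  proof (cases "a p = 0")
    case False
    then show ?thesis by (intro tendsto_mult tendsto_sgn a b)
  next
    case True
    have "((\<lambda>p. sgn (a p) * b p) \<longlongrightarrow> 0) (at p within S)"
    proof (rule Lim_null_comparison)
      show "((\<lambda>p. \<bar>b p\<bar>) \<longlongrightarrow> 0) (at p within S)" using tendsto_rabs[OF b] assms(3)[OF p True] by simp
      show "\<forall>\<^sub>F q in at p within S. norm (sgn (a q) * b q) \<le> \<bar>b q\<bar>"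
        by (intro always_eventually) (auto simp: abs_mult sgn_if)
    qed
    then show ?thesis using True by simp
  qed
qed

abbreviation params :: "(real \<times> real) set" where "params \<equiv> {(\<xi>, \<sigma>). 0 < \<xi> \<and> \<sigma> \<noteq> 0}"

lemma params_iff: "p \<in> params \<longleftrightarrow> 0 < fst p \<and> snd p \<noteq> 0" by (cases p) auto

lemma continuous_on_y_par: "continuous_on params (\<lambda>p. y_par (fst p))"
  unfolding y_par_def
proof (intro continuous_intros ballI)
  fix p :: "real \<times> real"
  have "0 < 1 + (fst p)\<^sup>2" by (intro add_pos_nonneg) auto
  then show "1 + (fst p)\<^sup>2 \<noteq> 0" by simp
qed

lemma continuous_on_z_par: "continuous_on params (\<lambda>p. z_par (fst p) (snd p))"
  unfolding z_par_def by (intro continuous_intros continuous_on_y_par)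

lemma continuous_on_saddle: "continuous_on params (\<lambda>p. saddle (z_par (fst p) (snd p)))"
  unfolding saddle_def
  by (intro continuous_intros continuous_on_z_par) (use z_par_pos in \<open>force simp: params_iff\<close>)

lemma continuous_on_eta: "continuous_on params (\<lambda>p. eta (fst p) (snd p))"
proof -
  let ?z = "\<lambda>p. z_par (fst p) (snd p)" and ?r = "\<lambda>p. 1 / y_par (fst p)"
  have y: "0 < y_par (fst p)" "y_par (fst p) < 1" if "p \<in> params" for p using y_par_bounds[of "fst p"] that by auto
  have z: "0 < ?z p" if "p \<in> params" for p using z_par_pos[of "fst p" "snd p"] that by auto
  have s: "1 < saddle (?z p)" if "p \<in> params" for p using saddle_root(1)[OF z[OF that]] .
  have r: "1 < ?r p" if "p \<in> params" for p using y[OF that] by simp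
  have cr: "continuous_on params ?r" by (intro continuous_intros continuous_on_y_par) (use y in force)
  have ph: "continuous_on params (\<lambda>p. phase (?z p) (f p))" if "continuous_on params f" "\<And>p. p \<in> params \<Longrightarrow> 1 < f p" for f :: "real \<times> real \<Rightarrow> real"
    unfolding phase_def of_real_eq_id id_def
    by (intro continuous_intros continuous_on_z_par that(1)) (use that(2) in force)+
  have "continuous_on params (\<lambda>p. sgn (?r p - saddle (?z p)) * sqrt (phase (?z p) (?r p) - phase (?z p) (saddle (?z p))))"
  proof (rule continuous_on_sgn_mult)
    show "continuous_on params (\<lambda>p. ?r p - saddle (?z p))" by (intro continuous_intros cr continuous_on_saddle)
    show "continuous_on params (\<lambda>p. sqrt (phase (?z p) (?r p) - phase (?z p) (saddle (?z p))))"
      by (intro continuous_on_real_sqrt continuous_on_diff ph cr continuous_on_saddle r s)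
  qed simp
  then show ?thesis unfolding eta_def Let_def .
qed

text \<open>The bound on the second parameter keeps the Poisson parameter in a compact interval, on
  which joint continuity is available.\<close>

lemma continuous_on_nct_P:
  assumes "n > 0" shows "continuous_on (params \<inter> {p. \<bar>snd p\<bar> < L}) (\<lambda>p. nct_P n (fst p * sqrt n) (snd p * sqrt n))"
proof -
  let ?U = "params \<inter> {p. \<bar>snd p\<bar> < L}"
  have y: "(x * sqrt n)\<^sup>2 / (n + (x * sqrt n)\<^sup>2) = y_par x" for x
  proof -
    have "(x * sqrt n)\<^sup>2 = n * x\<^sup>2" "n + n * x\<^sup>2 = n * (1 + x\<^sup>2)" using assms by (simp_all add: power_mult_distrib algebra_simps)
    then show ?thesis using assms by (simp add: y_par_def)
  qed
  have "continuous_on ?U (\<lambda>p. (\<lambda>(\<mu>, y). poisson_ibeta (n / 2) \<mu> y) ((snd p * sqrt n)\<^sup>2 / 2, y_par (fst p)))"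
  proof (rule continuous_on_compose2[OF continuous_on_poisson_ibeta[of "n/2" "(L * sqrt n)\<^sup>2 / 2"]])
    show "continuous_on ?U (\<lambda>p. ((snd p * sqrt n)\<^sup>2 / 2, y_par (fst p)))"
      by (intro continuous_intros continuous_on_subset[OF continuous_on_y_par]) auto
    show "(\<lambda>p. ((snd p * sqrt n)\<^sup>2 / 2, y_par (fst p))) ` ?U \<subseteq> {0..(L * sqrt n)\<^sup>2 / 2} \<times> {0..1}"
    proof (rule image_subsetI)
      fix p assume p: "p \<in> ?U"
      have "(snd p)\<^sup>2 \<le> L\<^sup>2" using p by (intro power2_le_iff_abs_le[THEN iffD2]) auto
      then have "(snd p * sqrt n)\<^sup>2 \<le> (L * sqrt n)\<^sup>2" using assms by (simp add: power_mult_distrib)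
      moreover have "0 < y_par (fst p)" "y_par (fst p) < 1" using y_par_bounds[of "fst p"] p by auto
      ultimately show "((snd p * sqrt n)\<^sup>2 / 2, y_par (fst p)) \<in> {0..(L * sqrt n)\<^sup>2 / 2} \<times> {0..1}" by simp
    qed
  qed (use assms in simp)
  then show ?thesis unfolding nct_P_poisson_ibeta y prod.case
    by (intro continuous_intros) auto
qed

lemma continuous_on_erfc: "continuous_on UNIV erfc"
  by (intro continuous_at_imp_continuous_on ballI DERIV_isCont[OF erfc_has_derivative])

text \<open>The coefficient \<open>c\<^sub>k\<close> is a locally uniform limit of continuous functions, by the expansion itself.\<close>

lemma continuous_on_nct_coeff: "continuous_on params (\<lambda>p. nct_coeff k (fst p) (snd p))"
proof (induction k rule: less_induct)
  case (less k)
  have "continuous (at p0 within params) (\<lambda>p. nct_coeff k (fst p) (snd p))" if p0: "p0 \<in> params" for p0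
  proof -
    \<comment> \<open>Half the value of z at the point, and a bound just above the second parameter,
      cut out an open neighbourhood on which the expansion is uniform.\<close>
    define z0 L where "z0 = z_par (fst p0) (snd p0) / 2" and "L = \<bar>snd p0\<bar> + 1"
    have z0: "z0 > 0" using z_par_pos[of "fst p0" "snd p0"] p0 by (auto simp: z0_def)
    obtain C M where M: "M \<ge> 1" and C: "\<And>n \<xi> \<sigma>. n \<ge> M \<Longrightarrow> 0 < \<xi> \<Longrightarrow> z0 \<le> z_par \<xi> \<sigma> \<Longrightarrow>
      \<bar>nct_P n (\<xi> * sqrt n) (\<sigma> * sqrt n) - (1 / 4 * erfc (eta \<xi> \<sigma> * sqrt (n / 2))
         + 1 / 2 * (exp (- (n / 2) * (eta \<xi> \<sigma>)\<^sup>2) / sqrt (2 * pi * n)) * (\<Sum>k<Suc k. nct_coeff k \<xi> \<sigma> / n ^ k))\<bar>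
       \<le> C * (exp (- (n / 2) * (eta \<xi> \<sigma>)\<^sup>2) / sqrt (2 * pi * n)) / n ^ Suc k"
    proof (rule nct_P_expansion[OF z0, of "Suc k"], goal_cases)
      case (1 C M)
      show ?case by (rule 1(1)[of M C]) (fact 1(2), fact 1(3))
    qed
    define U where "U = params \<inter> {p. \<bar>snd p\<bar> < L} \<inter> {p. z0 < z_par (fst p) (snd p)}"
    \<comment> \<open>The expansion with \<open>k + 1\<close> terms, solved for its last
      coefficient; every other ingredient is continuous by now, the lower coefficients by
      induction.\<close>
    define F where "F m p = (let n = M + real m in
      n ^ k * (2 * (sqrt (2 * pi * n) / exp (- (n / 2) * (eta (fst p) (snd p))\<^sup>2))
        * (nct_P n (fst p * sqrt n) (snd p * sqrt n) - 1 / 4 * erfc (eta (fst p) (snd p) * sqrt (n / 2)))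
        - (\<Sum>i<k. nct_coeff i (fst p) (snd p) / n ^ i)))" for m p
    have opn: "open params"
    proof -
      have "params = ({0<..} \<times> UNIV) \<inter> (UNIV \<times> - {0})" by auto
      then show ?thesis by (simp add: open_Times open_Int open_Compl)
    qed
    have U: "open U"
    proof -
      have "open (params \<inter> (\<lambda>p. z_par (fst p) (snd p)) -` {z0<..})"
        by (rule continuous_open_preimage[OF continuous_on_z_par opn]) simp
      moreover have "open {p :: real \<times> real. \<bar>snd p\<bar> < L}" by (intro open_Collect_less continuous_intros)
      ultimately have "open ((params \<inter> (\<lambda>p. z_par (fst p) (snd p)) -` {z0<..}) \<inter> {p. \<bar>snd p\<bar> < L})" by (rule open_Int)
      also have "(params \<inter> (\<lambda>p. z_par (fst p) (snd p)) -` {z0<..}) \<inter> {p. \<bar>snd p\<bar> < L} = U" by (auto simp: U_def)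
      finally show ?thesis .
    qed
    have p0U: "p0 \<in> U" using p0 z0 by (auto simp: U_def L_def z0_def)
    have sub: "U \<subseteq> params" by (auto simp: U_def)
    have cF: "continuous_on U (F m)" for m
    proof -
      have n: "M + real m > 0" using M by simp
      have e: "continuous_on U (\<lambda>p. eta (fst p) (snd p))" by (rule continuous_on_subset[OF continuous_on_eta sub])
      have A: "continuous_on U (\<lambda>p. nct_P (M + real m) (fst p * sqrt (M + real m)) (snd p * sqrt (M + real m)))"
        by (rule continuous_on_subset[OF continuous_on_nct_P[OF n, of L]]) (auto simp: U_def)
      have B: "continuous_on U (\<lambda>p. erfc (eta (fst p) (snd p) * sqrt ((M + real m) / 2)))"
      proof (rule continuous_on_compose2[where g=erfc and t=UNIV])
        show "continuous_on U (\<lambda>p. eta (fst p) (snd p) * sqrt ((M + real m) / 2))"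
          by (rule continuous_on_mult_right[OF e])
      qed (rule continuous_on_erfc, rule subset_UNIV)
      have S: "continuous_on U (\<lambda>p. \<Sum>i<k. nct_coeff i (fst p) (snd p) / (M + real m) ^ i)"
      proof (rule continuous_on_sum)
        fix i assume "i \<in> {..<k}"
        then have "continuous_on U (\<lambda>p. nct_coeff i (fst p) (snd p))" by (intro continuous_on_subset[OF less.IH sub]) simp
        then show "continuous_on U (\<lambda>p. nct_coeff i (fst p) (snd p) / (M + real m) ^ i)"
          by (rule continuous_on_divide[OF _ continuous_on_const]) (use n in simp)
      qed
      have G: "continuous_on U (\<lambda>p. sqrt (2 * pi * (M + real m)) / exp (- ((M + real m) / 2) * (eta (fst p) (snd p))\<^sup>2))"
        by (intro continuous_on_divide continuous_on_const continuous_on_exp continuous_on_mult continuous_on_power e) simp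
      show ?thesis unfolding F_def[abs_def] Let_def
        by (rule continuous_on_mult[OF continuous_on_const], rule continuous_on_diff[OF _ S],
            rule continuous_on_mult[OF continuous_on_mult[OF continuous_on_const G]],
            rule continuous_on_diff[OF A], rule continuous_on_mult[OF continuous_on_const B])
    qed
    \<comment> \<open>Multiplying the remainder by \<open>2 * n ^ k\<close> and dividing by the
      Gaussian factor leaves \<open>2 * C / n\<close>, with the parameters gone.\<close>
    have est: "\<bar>F m p - nct_coeff k (fst p) (snd p)\<bar> \<le> 2 * C / (M + real m)" if p: "p \<in> U" for m p
    proof -
      define n \<xi> \<sigma> where "n = M + real m" and "\<xi> = fst p" and "\<sigma> = snd p"
      have n: "n \<ge> M" "n > 0" using M by (auto simp: n_def)
      have x: "0 < \<xi>" "z0 \<le> z_par \<xi> \<sigma>" using p by (auto simp: U_def \<xi>_def \<sigma>_def)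
      define g where "g = exp (- (n / 2) * (eta \<xi> \<sigma>)\<^sup>2) / sqrt (2 * pi * n)"
      have g: "g > 0" using n by (simp add: g_def)
      define Z where "Z = nct_P n (\<xi> * sqrt n) (\<sigma> * sqrt n) - 1 / 4 * erfc (eta \<xi> \<sigma> * sqrt (n / 2))"
      define S where "S = (\<Sum>i<k. nct_coeff i \<xi> \<sigma> / n ^ i)"
      have "\<bar>Z - 1/2 * g * (S + nct_coeff k \<xi> \<sigma> / n ^ k)\<bar> \<le> C * g / n ^ Suc k"
        using C[OF n(1) x] unfolding g_def[symmetric] S_def Z_def by (simp add: algebra_simps)
      then have "2 / g * n ^ k * \<bar>Z - 1/2 * g * (S + nct_coeff k \<xi> \<sigma> / n ^ k)\<bar> \<le> 2 / g * n ^ k * (C * g / n ^ Suc k)"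
        using g n by (intro mult_left_mono) auto
      also have "\<dots> = 2 * C / n" using g n by simp
      also have "2 / g * n ^ k * \<bar>Z - 1/2 * g * (S + nct_coeff k \<xi> \<sigma> / n ^ k)\<bar> = \<bar>2 / g * n ^ k * (Z - 1/2 * g * (S + nct_coeff k \<xi> \<sigma> / n ^ k))\<bar>"
        using g n by (simp add: abs_mult)
      also have "2 / g * n ^ k * (Z - 1/2 * g * (S + nct_coeff k \<xi> \<sigma> / n ^ k)) = n ^ k * (2 * (1 / g) * Z - S) - nct_coeff k \<xi> \<sigma>"
        using g n by (simp add: field_simps)
      also have "n ^ k * (2 * (1 / g) * Z - S) = F m p"
        by (simp add: F_def Let_def n_def[symmetric] \<xi>_def[symmetric] \<sigma>_def[symmetric] g_def Z_def S_def)
      finally show ?thesis by (simp add: n_def \<xi>_def \<sigma>_def)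
    qed
    have "uniform_limit U F (\<lambda>p. nct_coeff k (fst p) (snd p)) sequentially"
    proof (rule uniform_limitI)
      fix \<epsilon> :: real assume e: "\<epsilon> > 0"
      have "filterlim (\<lambda>m. M + real m) at_top sequentially"
        by (intro filterlim_tendsto_add_at_top[OF tendsto_const] filterlim_real_sequentially)
      then have "(\<lambda>m. 2 * C / (M + real m)) \<longlonglongrightarrow> 0"
        by (intro tendsto_divide_0[OF tendsto_const] filterlim_at_top_imp_at_infinity)
      then have "\<forall>\<^sub>F m in sequentially. 2 * C / (M + real m) < \<epsilon>" using e by (rule order_tendstoD)
      then show "\<forall>\<^sub>F m in sequentially. \<forall>p\<in>U. dist (F m p) (nct_coeff k (fst p) (snd p)) < \<epsilon>"
      proof (rule eventually_mono, intro ballI)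
        fix m p assume "2 * C / (M + real m) < \<epsilon>" "p \<in> U"
        then show "dist (F m p) (nct_coeff k (fst p) (snd p)) < \<epsilon>"
          unfolding dist_real_def using est[of p m] by linarith
      qed
    qed
    then have "continuous_on U (\<lambda>p. nct_coeff k (fst p) (snd p))"
      by (rule uniform_limit_theorem[rotated]) (use cF in auto)
    then have "continuous (at p0) (\<lambda>p. nct_coeff k (fst p) (snd p))"
      using U p0U continuous_on_eq_continuous_at by blast
    then show ?thesis by (rule continuous_at_imp_continuous_at_within)
  qed
  then show ?case unfolding continuous_on_eq_continuous_within by blast
qed

text \<open>Away from \<open>eta = 0\<close> one has \<open>u \<noteq> 1\<close>, so the explicit
  forms apply; the remaining link is \<open>t1 = tau * (t0 - 1)\<close>.\<close>

lemma nct_coeff_formulas: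
  assumes "0 < \<xi>" "\<sigma> \<noteq> 0" "eta \<xi> \<sigma> \<noteq> 0" shows "nct_coeff 0 \<xi> \<sigma> = c0_formula \<xi> \<sigma>" "nct_coeff 1 \<xi> \<sigma> = c1_formula \<xi> \<sigma>"
proof -
  define \<kappa> u where "\<kappa> = kappa_of (z_par \<xi> \<sigma>)" and "u = ratio_par \<xi> \<sigma>"
  note z = z_par_pos[OF assms(1,2)]
  have k: "0 < \<kappa>" "\<kappa> < 1" using kappa_of_bounds[OF z] by (simp_all add: \<kappa>_def)
  note r = ratio_par_relations[OF assms(1,2), folded \<kappa>_def u_def]
  have t0: "saddle (z_par \<xi> \<sigma>) = 1 / (1 - \<kappa>)" "saddle (z_par \<xi> \<sigma>) - 1 = \<kappa> / (1 - \<kappa>)"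
    using kappa_of_saddle[OF z] by (simp_all add: \<kappa>_def)
  have u1: "u \<noteq> 1" using assms(3) r(5) by auto
  have t1: "t1_coeff (1 / (1 - \<kappa>)) = tau \<kappa> * (1 / (1 - \<kappa>) - 1)"
  proof -
    define c d where "c = sqrt (1 - \<kappa>)" and "d = sqrt (1 + \<kappa>)"
    have cd: "c > 0" "d > 0" "c * c = 1 - \<kappa>" using k by (auto simp: c_def d_def)
    have "2 * (1 / (1 - \<kappa>)) - 1 = (1 + \<kappa>) / (1 - \<kappa>)" using k by (simp add: field_simps)
    then have "sqrt (2 * (1 / (1 - \<kappa>)) - 1) = d / c" by (simp add: real_sqrt_divide c_def d_def)
    moreover have "tau \<kappa> = sqrt 2 / (c * d)"
    proof -
      have "1 - \<kappa>\<^sup>2 = (1 - \<kappa>) * (1 + \<kappa>)" by (simp add: power2_eq_square algebra_simps)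
      then show ?thesis by (simp add: tau_def real_sqrt_divide real_sqrt_mult c_def d_def)
    qed
    moreover have "sqrt 2 * (1 / (c * c)) * x / (d / c) = sqrt 2 / (c * d) * x" for x using cd by (simp add: field_simps)
    ultimately show ?thesis unfolding t1_coeff_def cd(3)[symmetric] by simp
  qed
  have D: "sqrt ((1 - \<kappa> + \<kappa> * u) / (1 - \<kappa>) / (1 / (1 - \<kappa>))) = sqrt (1 - \<kappa> + \<kappa> * u)" using k by simp
  have e: "(1 - \<kappa> + \<kappa> * u) / (1 - \<kappa>) - 1 / (1 - \<kappa>) = (1 / (1 - \<kappa>) - 1) * (u - 1)"
    using r(3) unfolding r(2) t0(2)[symmetric] unfolding t0(1) .
  show "nct_coeff 0 \<xi> \<sigma> = c0_formula \<xi> \<sigma>"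
  proof -
    have "1 / (1 - \<kappa>) - 1 \<noteq> 0" using k by (simp add: field_simps)
    then have h: "t * s / (u - 1) = s * (t * (1 / (1 - \<kappa>) - 1) / ((1 / (1 - \<kappa>) - 1) * (u - 1)))" for t s by simp
    show ?thesis
      unfolding nct_coeff_def \<kappa>_def[symmetric] u_def[symmetric] coef_0_off_1[OF k r(1) u1] c0_formula_def Let_def t0(1) r(2) r(5) t1 D e
      unfolding h[of "tau \<kappa>" "sqrt (1 - \<kappa> + \<kappa> * u)"] ..
  qed
  show "nct_coeff 1 \<xi> \<sigma> = c1_formula \<xi> \<sigma>"
    unfolding nct_coeff_def \<kappa>_def[symmetric] u_def[symmetric] coef_1_formula[OF k r(1) u1] c1_formula_def Let_def t0(1) r(2) r(5) t1 D c1_poly_def ..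
qed

theorem theorem6p2:
  shows
    "(\<forall>n x \<delta> :: real. 0 < n \<longrightarrow> 0 < x \<longrightarrow>
        (let y = y_par (x / sqrt n); z = z_par (x / sqrt n) (\<delta> / sqrt n) in
          \<forall>\<gamma>. loop_contour (1 / y) \<gamma> \<longrightarrow>
            (\<exists>I. ((\<lambda>t. exp (of_real (n / 2) * phase z t) / ((1 - of_real y * t) * csqrt t))
                    has_contour_integral I) \<gamma> \<and>
                 complex_of_real (nct_P n x \<delta>) =
                   1 / 2 * (of_real (sqrt y * exp (- (n / 2) * phase z (1 / y)))
                            / (2 * of_real pi * \<i>)) * I)))
   \<and> (\<forall>z :: real. 0 < z \<longrightarrow>
        (\<forall>t>1. (phase z has_real_derivative (z * t\<^sup>2 - z * t - 1) / (t * (t - 1))) (at t))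
      \<and> (\<forall>t>0. z * t\<^sup>2 - z * t - 1 = 0 \<longleftrightarrow> t = saddle z)
      \<and> 1 < saddle z)
   \<and> (\<forall>\<xi> \<sigma>. 0 < \<xi> \<longrightarrow> \<sigma> \<noteq> 0 \<longrightarrow>
        phase (z_par \<xi> \<sigma>) (1 / y_par \<xi>) - phase (z_par \<xi> \<sigma>) (saddle (z_par \<xi> \<sigma>)) = (eta \<xi> \<sigma>)\<^sup>2
      \<and> sgn (eta \<xi> \<sigma>) = sgn (1 / y_par \<xi> - saddle (z_par \<xi> \<sigma>)))
   \<and> (\<exists>c :: nat \<Rightarrow> real \<Rightarrow> real \<Rightarrow> real.
        (\<forall>C z0 :: real. \<forall>K :: nat. 0 < z0 \<longrightarrow>
          (\<exists>M. \<forall>\<^sub>F n in at_top. \<forall>x \<delta>.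
             0 < x \<longrightarrow> x / n \<le> C \<longrightarrow> \<bar>\<delta>\<bar> / n \<le> C \<longrightarrow>
             (let \<xi> = x / sqrt n; \<sigma> = \<delta> / sqrt n; \<eta> = eta \<xi> \<sigma> in
               z0 \<le> z_par \<xi> \<sigma> \<longrightarrow>
               \<bar>nct_P n x \<delta>
                  - (1 / 4 * erfc (\<eta> * sqrt (n / 2))
                     + 1 / 2 * (exp (- (n / 2) * \<eta>\<^sup>2) / sqrt (2 * pi * n))
                         * (\<Sum>k<K. c k \<xi> \<sigma> / n ^ k))\<bar>
               \<le> M * (exp (- (n / 2) * \<eta>\<^sup>2) / sqrt (2 * pi * n)) / n ^ K)))
      \<and> (\<forall>\<xi> \<sigma>. 0 < \<xi> \<longrightarrow> \<sigma> \<noteq> 0 \<longrightarrow> eta \<xi> \<sigma> \<noteq> 0 \<longrightarrow>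
           c 0 \<xi> \<sigma> = c0_formula \<xi> \<sigma> \<and> c 1 \<xi> \<sigma> = c1_formula \<xi> \<sigma>)
      \<and> (\<forall>k \<xi> \<sigma>. 0 < \<xi> \<longrightarrow> \<sigma> \<noteq> 0 \<longrightarrow> eta \<xi> \<sigma> = 0 \<longrightarrow>
           ((\<lambda>(u, v). c k u v) \<longlongrightarrow> c k \<xi> \<sigma>)
             (at (\<xi>, \<sigma>) within {(u, v). 0 < u \<and> v \<noteq> 0 \<and> eta u v \<noteq> 0})))"
proof (intro conjI allI impI)
  fix n x \<delta> :: real assume "0 < n" "0 < x"
  then show "let y = y_par (x / sqrt n); z = z_par (x / sqrt n) (\<delta> / sqrt n) in
          \<forall>\<gamma>. loop_contour (1 / y) \<gamma> \<longrightarrow>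
            (\<exists>I. ((\<lambda>t. exp (of_real (n / 2) * phase z t) / ((1 - of_real y * t) * csqrt t))
                    has_contour_integral I) \<gamma> \<and>
                 complex_of_real (nct_P n x \<delta>) =
                   1 / 2 * (of_real (sqrt y * exp (- (n / 2) * phase z (1 / y)))
                            / (2 * of_real pi * \<i>)) * I)"
    unfolding Let_def by (intro allI impI nct_P_contour_integral)
next
  fix z t :: real assume "0 < z" "1 < t"
  then show "(phase z has_real_derivative (z * t\<^sup>2 - z * t - 1) / (t * (t - 1))) (at t)"
    by (intro phase_has_derivative)
next
  fix z t :: real assume "0 < z" "0 < t"
  then show "z * t\<^sup>2 - z * t - 1 = 0 \<longleftrightarrow> t = saddle z" by (rule saddle_unique)
next
  fix z :: real assume "0 < z"
  then show "1 < saddle z" by (rule saddle_root)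
next
  fix \<xi> \<sigma> :: real assume "0 < \<xi>" "\<sigma> \<noteq> 0"
  then show "phase (z_par \<xi> \<sigma>) (1 / y_par \<xi>) - phase (z_par \<xi> \<sigma>) (saddle (z_par \<xi> \<sigma>)) = (eta \<xi> \<sigma>)\<^sup>2"
    by (rule eta_properties)
next
  fix \<xi> \<sigma> :: real assume "0 < \<xi>" "\<sigma> \<noteq> 0"
  then show "sgn (eta \<xi> \<sigma>) = sgn (1 / y_par \<xi> - saddle (z_par \<xi> \<sigma>))" by (rule eta_properties)
next
  show "\<exists>c :: nat \<Rightarrow> real \<Rightarrow> real \<Rightarrow> real.
        (\<forall>C z0 :: real. \<forall>K :: nat. 0 < z0 \<longrightarrow>
          (\<exists>M. \<forall>\<^sub>F n in at_top. \<forall>x \<delta>.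
             0 < x \<longrightarrow> x / n \<le> C \<longrightarrow> \<bar>\<delta>\<bar> / n \<le> C \<longrightarrow>
             (let \<xi> = x / sqrt n; \<sigma> = \<delta> / sqrt n; \<eta> = eta \<xi> \<sigma> in
               z0 \<le> z_par \<xi> \<sigma> \<longrightarrow>
               \<bar>nct_P n x \<delta>
                  - (1 / 4 * erfc (\<eta> * sqrt (n / 2))
                     + 1 / 2 * (exp (- (n / 2) * \<eta>\<^sup>2) / sqrt (2 * pi * n))
                         * (\<Sum>k<K. c k \<xi> \<sigma> / n ^ k))\<bar>
               \<le> M * (exp (- (n / 2) * \<eta>\<^sup>2) / sqrt (2 * pi * n)) / n ^ K)))
      \<and> (\<forall>\<xi> \<sigma>. 0 < \<xi> \<longrightarrow> \<sigma> \<noteq> 0 \<longrightarrow> eta \<xi> \<sigma> \<noteq> 0 \<longrightarrow>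
           c 0 \<xi> \<sigma> = c0_formula \<xi> \<sigma> \<and> c 1 \<xi> \<sigma> = c1_formula \<xi> \<sigma>)
      \<and> (\<forall>k \<xi> \<sigma>. 0 < \<xi> \<longrightarrow> \<sigma> \<noteq> 0 \<longrightarrow> eta \<xi> \<sigma> = 0 \<longrightarrow>
           ((\<lambda>(u, v). c k u v) \<longlongrightarrow> c k \<xi> \<sigma>)
             (at (\<xi>, \<sigma>) within {(u, v). 0 < u \<and> v \<noteq> 0 \<and> eta u v \<noteq> 0}))"
  proof (rule exI[of _ nct_coeff], intro conjI allI impI)
    fix C z0 :: real and K :: nat assume z0: "0 < z0"
    show "\<exists>M. \<forall>\<^sub>F n in at_top. \<forall>x \<delta>.
             0 < x \<longrightarrow> x / n \<le> C \<longrightarrow> \<bar>\<delta>\<bar> / n \<le> C \<longrightarrow>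
             (let \<xi> = x / sqrt n; \<sigma> = \<delta> / sqrt n; \<eta> = eta \<xi> \<sigma> in
               z0 \<le> z_par \<xi> \<sigma> \<longrightarrow>
               \<bar>nct_P n x \<delta>
                  - (1 / 4 * erfc (\<eta> * sqrt (n / 2))
                     + 1 / 2 * (exp (- (n / 2) * \<eta>\<^sup>2) / sqrt (2 * pi * n))
                         * (\<Sum>k<K. nct_coeff k \<xi> \<sigma> / n ^ k))\<bar>
               \<le> M * (exp (- (n / 2) * \<eta>\<^sup>2) / sqrt (2 * pi * n)) / n ^ K)"
    proof (rule nct_P_expansion[OF z0, of K], goal_cases)
      case h: (1 B N)
      show ?case
      proof (rule exI[of _ B], rule eventually_mono[OF eventually_ge_at_top[of N]], intro allI impI, unfold Let_def, rule impI)
        fix n x \<delta> :: real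
        assume n: "N \<le> n" and x: "0 < x" and z: "z0 \<le> z_par (x / sqrt n) (\<delta> / sqrt n)"
        have n0: "n > 0" using n h(1) by simp
        have e: "x / sqrt n * sqrt n = x" "\<delta> / sqrt n * sqrt n = \<delta>" using n0 by auto
        have x': "0 < x / sqrt n" using x n0 by simp
        show "\<bar>nct_P n x \<delta>
                  - (1 / 4 * erfc (eta (x / sqrt n) (\<delta> / sqrt n) * sqrt (n / 2))
                     + 1 / 2 * (exp (- (n / 2) * (eta (x / sqrt n) (\<delta> / sqrt n))\<^sup>2) / sqrt (2 * pi * n))
                         * (\<Sum>k<K. nct_coeff k (x / sqrt n) (\<delta> / sqrt n) / n ^ k))\<bar>
               \<le> B * (exp (- (n / 2) * (eta (x / sqrt n) (\<delta> / sqrt n))\<^sup>2) / sqrt (2 * pi * n)) / n ^ K"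
          using h(2)[OF n x' z] unfolding e .
      qed
    qed
  next
    fix \<xi> \<sigma> :: real assume "0 < \<xi>" "\<sigma> \<noteq> 0" "eta \<xi> \<sigma> \<noteq> 0"
    then show "nct_coeff 0 \<xi> \<sigma> = c0_formula \<xi> \<sigma>" by (rule nct_coeff_formulas)
  next
    fix \<xi> \<sigma> :: real assume "0 < \<xi>" "\<sigma> \<noteq> 0" "eta \<xi> \<sigma> \<noteq> 0"
    then show "nct_coeff 1 \<xi> \<sigma> = c1_formula \<xi> \<sigma>" by (rule nct_coeff_formulas)
  next
    fix k and \<xi> \<sigma> :: real assume "0 < \<xi>" "\<sigma> \<noteq> 0"
    \<comment> \<open>Continuity on all admissible parameters gives in particular the limit along
      those with nonzero eta.\<close>
    then have "((\<lambda>p. nct_coeff k (fst p) (snd p)) \<longlongrightarrow> nct_coeff k (fst (\<xi>, \<sigma>)) (snd (\<xi>, \<sigma>))) (at (\<xi>, \<sigma>) within params)"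
      using continuous_on_nct_coeff[of k] unfolding continuous_on_def by blast
    then have "((\<lambda>(u, v). nct_coeff k u v) \<longlongrightarrow> nct_coeff k \<xi> \<sigma>) (at (\<xi>, \<sigma>) within params)"
      by (simp add: case_prod_unfold)
    then show "((\<lambda>(u, v). nct_coeff k u v) \<longlongrightarrow> nct_coeff k \<xi> \<sigma>) (at (\<xi>, \<sigma>) within {(u, v). 0 < u \<and> v \<noteq> 0 \<and> eta u v \<noteq> 0})"
      by (rule tendsto_within_subset) auto
  qed
qed

end
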